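(* Let $G$ be the fundamental group of the Klein bottle. Regard $G$ as a $G$-group, acting on itself by conjugation. Then $\mathsf{cd}(G\rtimes G,G)=4$ and $\mathsf{cd}_{\mathcal{G}}(G\rtimes G)=\infty$.
   Context: For a discrete group $\Gamma$, a $\Gamma$-group is a discrete group $G$ equipped with an action of $\Gamma$ by group automorphisms. $G\rtimes\Gamma$ is the associated semi-direct product, and $\Gamma$ is identified with the subgroup $\{(1,\gamma)\mid\gamma\in\Gamma\}$. Here $\Gamma=G$ acts on $G$ by ${}^{h}g=hgh^{-1}$, and in $\mathsf{cd}(G\rtimes G,G)$ the subgroup $G$ is the acting factor $\{(1,h)\mid h\in G\}$. A $K$-module means a $\mathbb{Z}K$-module. Takasu dimension of a pair $L\le K$. Let $I(K/L):=\ker(\epsilon:\mathbb{Z}(K/L)\to\mathbb{Z})$ be the kernel of the augmentation. For a $K$-module $M$, set $H^i(K,L;M):=\operatorname{Ext}^{i-1}_{\mathbb{Z}K}(I(K/L),M)$ for $i\ge1$ and $H^0(K,L;M):=0$. Then $\mathsf{cd}(K,L):=\sup\{n\mid H^n(K,L;M)\ne0\text{ for some }K\text{-module }M\}$. Bredon dimension. A family $\mathcal{F}$ of subgroups of $K$ is a non-empty collection of subgroups closed under conjugation and taking subgroups. The orbit category $\mathcal{O}_{\mathcal{F}}(K)$ has as objects the $K$-sets $K/H$ with $H\in\mathcal{F}$ and as morphisms the $K$-maps. An $\mathcal{O}_{\mathcal{F}}(K)$-module is a contravariant functor $\mathcal{O}_{\mathcal{F}}(K)\to\mathsf{Ab}$;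 these form an abelian category with enough projectives. $\underline{\mathbb{Z}}$ is the constant module with value $\mathbb{Z}$. Set $H^i_{\mathcal{F}}(K;\underline{M}):=\operatorname{Ext}^i_{\mathcal{O}_{\mathcal{F}}(K)}(\underline{\mathbb{Z}},\underline{M})$ and $\mathsf{cd}_{\mathcal{F}}(K):=\sup\{n\mid H^n_{\mathcal{F}}(K;\underline{M})\ne0\text{ for some }\underline{M}\}$. $\mathcal{G}$ denotes the family of all subgroups of $G\rtimes G$ that are contained in some $G\rtimes G$-conjugate of the acting factor $\{(1,h)\mid h\in G\}$. *)

theory Defs
  imports
    "HOL-Analysis.Analysis"
    "HOL-Algebra.Left_Coset"
    "HOL-Algebra.Elementary_Groups"
    "HOL-Algebra.Free_Abelian_Groups"
    "HOL-Library.Extended_Nat"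
begin

section \<open>The fundamental group of the Klein bottle\<close>

definition loops :: "'a::topological_space set \<Rightarrow> 'a \<Rightarrow> (real \<Rightarrow> 'a) set" where
  "loops S a = {p. path p \<and> path_image p \<subseteq> S \<and> pathstart p = a \<and> pathfinish p = a}"

definition loop_homotopy :: "'a::topological_space set \<Rightarrow> 'a \<Rightarrow> ((real \<Rightarrow> 'a) \<times> (real \<Rightarrow> 'a)) set" where
  "loop_homotopy S a = {(p, q). p \<in> loops S a \<and> q \<in> loops S a \<and> homotopic_paths S p q}"

definition fundamental_group :: "'a::topological_space set \<Rightarrow> 'a \<Rightarrow> (real \<Rightarrow> 'a) set monoid" where
  "fundamental_group S a =
     \<lparr>carrier = loops S a // loop_homotopy S a,
      monoid.mult = (\<lambda>A B. \<Union>p\<in>A. \<Union>q\<in>B. loop_homotopy S a `` {p +++ q}),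
      one = loop_homotopy S a `` {\<lambda>_. a}\<rparr>"

definition unit_square :: "(real \<times> real) set" where
  "unit_square = {0..1} \<times> {0..1}"

definition klein_glue :: "((real \<times> real) \<times> (real \<times> real)) set" where
  "klein_glue = {((s, 0), (s, 1)) | s. s \<in> {0..1}} \<union> {((0, t), (1, 1 - t)) | t. t \<in> {0..1}}"

text \<open>A space is a Klein bottle if it is a quotient of the unit square by the equivalence
  relation generated by the gluing of the edges.\<close>

definition klein_bottle :: "'a::topological_space set \<Rightarrow> bool" where
  "klein_bottle S \<longleftrightarrow>
     (\<exists>q. quotient_map (top_of_set unit_square) (top_of_set S) q \<and>
          (\<forall>a\<in>unit_square. \<forall>b\<in>unit_square.
             q a = q b \<longleftrightarrow> (a, b) \<in> (klein_glue \<union> klein_glue\<inverse>)\<^sup>*))"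


section \<open>Semi-direct products\<close>

text \<open>The argument \<open>\<phi>\<close> is the action of \<open>\<Gamma>\<close> on \<open>G\<close>.\<close>

definition semidirect ::
  "('g, 'x) monoid_scheme \<Rightarrow> ('c, 'y) monoid_scheme \<Rightarrow> ('c \<Rightarrow> 'g \<Rightarrow> 'g) \<Rightarrow> ('g \<times> 'c) monoid" where
  "semidirect G \<Gamma> \<phi> =
     \<lparr>carrier = carrier G \<times> carrier \<Gamma>,
      monoid.mult = (\<lambda>(g, c) (g', c'). (g \<otimes>\<^bsub>G\<^esub> \<phi> c g', c \<otimes>\<^bsub>\<Gamma>\<^esub> c')),
      one = (\<one>\<^bsub>G\<^esub>, \<one>\<^bsub>\<Gamma>\<^esub>)\<rparr>"

definition acting_factor :: "('g, 'x) monoid_scheme \<Rightarrow> ('c, 'y) monoid_scheme \<Rightarrow> ('g \<times> 'c) set" where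
  "acting_factor G \<Gamma> = {(\<one>\<^bsub>G\<^esub>, c) | c. c \<in> carrier \<Gamma>}"

definition conj_action :: "('g, 'x) monoid_scheme \<Rightarrow> 'g \<Rightarrow> 'g \<Rightarrow> 'g" where
  "conj_action G h g = h \<otimes>\<^bsub>G\<^esub> g \<otimes>\<^bsub>G\<^esub> inv\<^bsub>G\<^esub> h"


section \<open>Modules over a small category\<close>

text \<open>
  Both kinds of modules that occur are (covariant) functors from a small category to abelian
  groups: a \<open>\<int>K\<close>-module is a functor on \<open>K\<close> viewed as a category with one object, and an
  \<open>\<O>\<^sub>\<F>(K)\<close>-module is a functor on the opposite of the orbit category. Hom-sets are not required to
  be disjoint, so composition takes the three objects as arguments:
  \<open>Cmp C x y z g f\<close> is the composite of \<open>f : x \<rightarrow> y\<close> and \<open>g : y \<rightarrow> z\<close>.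
  Abelian groups are written multiplicatively, as \<^const>\<open>comm_group\<close>s.
\<close>

record ('o, 'h) small_cat =
  Ob :: "'o set"
  Hom :: "'o \<Rightarrow> 'o \<Rightarrow> 'h set"
  Idt :: "'o \<Rightarrow> 'h"
  Cmp :: "'o \<Rightarrow> 'o \<Rightarrow> 'o \<Rightarrow> 'h \<Rightarrow> 'h \<Rightarrow> 'h"

definition op_cat :: "('o, 'h) small_cat \<Rightarrow> ('o, 'h) small_cat" where
  "op_cat C = \<lparr>Ob = Ob C, Hom = (\<lambda>x y. Hom C y x), Idt = Idt C,
               Cmp = (\<lambda>x y z g f. Cmp C z y x f g)\<rparr>"

record ('o, 'h, 'm) cat_module =
  Val :: "'o \<Rightarrow> 'm monoid"
  Map :: "'o \<Rightarrow> 'o \<Rightarrow> 'h \<Rightarrow> 'm \<Rightarrow> 'm"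

definition cat_module :: "('o, 'h) small_cat \<Rightarrow> ('o, 'h, 'm) cat_module \<Rightarrow> bool" where
  "cat_module C M \<longleftrightarrow>
     (\<forall>x\<in>Ob C. comm_group (Val M x)) \<and>
     (\<forall>x\<in>Ob C. \<forall>y\<in>Ob C. \<forall>f\<in>Hom C x y. Map M x y f \<in> hom (Val M x) (Val M y)) \<and>
     (\<forall>x\<in>Ob C. \<forall>m\<in>carrier (Val M x). Map M x x (Idt C x) m = m) \<and>
     (\<forall>x\<in>Ob C. \<forall>y\<in>Ob C. \<forall>z\<in>Ob C. \<forall>f\<in>Hom C x y. \<forall>g\<in>Hom C y z. \<forall>m\<in>carrier (Val M x).
        Map M x z (Cmp C x y z g f) m = Map M y z g (Map M x y f m))"

text \<open>Natural transformations, normalised to be \<open>undefined\<close> outside their domain, so that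
  equality is equality of functions.\<close>

definition module_hom ::
  "('o, 'h) small_cat \<Rightarrow> ('o, 'h, 'm) cat_module \<Rightarrow> ('o, 'h, 'n) cat_module \<Rightarrow> ('o \<Rightarrow> 'm \<Rightarrow> 'n) set" where
  "module_hom C M N =
     {\<eta> \<in> (\<Pi>\<^sub>E x\<in>Ob C. hom (Val M x) (Val N x) \<inter> extensional (carrier (Val M x))).
        \<forall>x\<in>Ob C. \<forall>y\<in>Ob C. \<forall>f\<in>Hom C x y. \<forall>m\<in>carrier (Val M x).
          \<eta> y (Map M x y f m) = Map N x y f (\<eta> x m)}"

definition module_comp ::
  "('o, 'h) small_cat \<Rightarrow> ('o, 'h, 'm) cat_module \<Rightarrow> ('o \<Rightarrow> 'n \<Rightarrow> 'p) \<Rightarrow> ('o \<Rightarrow> 'm \<Rightarrow> 'n) \<Rightarrow> 'o \<Rightarrow> 'm \<Rightarrow> 'p" where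
  "module_comp C M \<theta> \<eta> = (\<lambda>x\<in>Ob C. compose (carrier (Val M x)) (\<theta> x) (\<eta> x))"

definition module_hom_group ::
  "('o, 'h) small_cat \<Rightarrow> ('o, 'h, 'm) cat_module \<Rightarrow> ('o, 'h, 'n) cat_module \<Rightarrow> ('o \<Rightarrow> 'm \<Rightarrow> 'n) monoid" where
  "module_hom_group C M N =
     \<lparr>carrier = module_hom C M N,
      monoid.mult = (\<lambda>\<eta> \<theta>. \<lambda>x\<in>Ob C. \<lambda>m\<in>carrier (Val M x). \<eta> x m \<otimes>\<^bsub>Val N x\<^esub> \<theta> x m),
      one = (\<lambda>x\<in>Ob C. \<lambda>m\<in>carrier (Val M x). \<one>\<^bsub>Val N x\<^esub>)\<rparr>"

definition module_epi ::
  "('o, 'h) small_cat \<Rightarrow> ('o, 'h, 'm) cat_module \<Rightarrow> ('o, 'h, 'n) cat_module \<Rightarrow> ('o \<Rightarrow> 'm \<Rightarrow> 'n) \<Rightarrow> bool" where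
  "module_epi C M N \<eta> \<longleftrightarrow>
     \<eta> \<in> module_hom C M N \<and> (\<forall>x\<in>Ob C. \<eta> x ` carrier (Val M x) = carrier (Val N x))"


section \<open>Projective resolutions and Ext\<close>

text \<open>
  HOL cannot quantify over all modules inside a formula, so a type \<open>'u\<close> plays the role of a
  universe: the modules under consideration are those whose values have carriers
  contained in \<open>'u\<close>. If \<open>'u\<close> is infinite and at least as large as the set of all morphisms
  of \<open>C\<close>, these modules contain a copy of every free module on generators from \<open>'u\<close> and are
  closed up to isomorphism under submodules and quotients. Hence there are enough projectives among
  them, and projectivity and Ext do not depend on the choice of \<open>'u\<close>.
\<close>

definition projective_module :: "('o, 'h) small_cat \<Rightarrow> ('o, 'h, 'u) cat_module \<Rightarrow> bool" where
  "projective_module C P \<longleftrightarrow> cat_module C P \<and>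
     (\<forall>(B :: ('o, 'h, 'u) cat_module) (D :: ('o, 'h, 'u) cat_module) \<pi> f.
        cat_module C B \<longrightarrow> cat_module C D \<longrightarrow> module_epi C B D \<pi> \<longrightarrow> f \<in> module_hom C P D \<longrightarrow>
        (\<exists>g\<in>module_hom C P B. module_comp C P \<pi> g = f))"

text \<open>The differential \<open>d n\<close> goes from \<open>P (Suc n)\<close> to \<open>P n\<close>, and \<open>e\<close> from \<open>P 0\<close> to \<open>A\<close>.\<close>

definition projective_resolution ::
  "('o, 'h) small_cat \<Rightarrow> ('o, 'h, 'a) cat_module \<Rightarrow> (nat \<Rightarrow> ('o, 'h, 'u) cat_module) \<Rightarrow>
   (nat \<Rightarrow> 'o \<Rightarrow> 'u \<Rightarrow> 'u) \<Rightarrow> ('o \<Rightarrow> 'u \<Rightarrow> 'a) \<Rightarrow> bool" where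
  "projective_resolution C A P d e \<longleftrightarrow>
     (\<forall>n. projective_module C (P n)) \<and>
     (\<forall>n. d n \<in> module_hom C (P (Suc n)) (P n)) \<and>
     module_epi C (P 0) A e \<and>
     (\<forall>x\<in>Ob C. kernel (Val (P 0) x) (Val A x) (e x) = d 0 x ` carrier (Val (P 1) x)) \<and>
     (\<forall>n. \<forall>x\<in>Ob C. kernel (Val (P (Suc n)) x) (Val (P n) x) (d n x)
        = d (Suc n) x ` carrier (Val (P (Suc (Suc n))) x))"

definition coboundary_map ::
  "('o, 'h) small_cat \<Rightarrow> (nat \<Rightarrow> ('o, 'h, 'u) cat_module) \<Rightarrow> (nat \<Rightarrow> 'o \<Rightarrow> 'u \<Rightarrow> 'u) \<Rightarrow> nat \<Rightarrow>
   ('o \<Rightarrow> 'u \<Rightarrow> 'm) \<Rightarrow> 'o \<Rightarrow> 'u \<Rightarrow> 'm" where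
  "coboundary_map C P d n \<phi> = module_comp C (P (Suc n)) \<phi> (d n)"

definition cocycles ::
  "('o, 'h) small_cat \<Rightarrow> (nat \<Rightarrow> ('o, 'h, 'u) cat_module) \<Rightarrow> (nat \<Rightarrow> 'o \<Rightarrow> 'u \<Rightarrow> 'u) \<Rightarrow>
   ('o, 'h, 'm) cat_module \<Rightarrow> nat \<Rightarrow> ('o \<Rightarrow> 'u \<Rightarrow> 'm) set" where
  "cocycles C P d M n =
     kernel (module_hom_group C (P n) M) (module_hom_group C (P (Suc n)) M) (coboundary_map C P d n)"

definition coboundaries ::
  "('o, 'h) small_cat \<Rightarrow> (nat \<Rightarrow> ('o, 'h, 'u) cat_module) \<Rightarrow> (nat \<Rightarrow> 'o \<Rightarrow> 'u \<Rightarrow> 'u) \<Rightarrow>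
   ('o, 'h, 'm) cat_module \<Rightarrow> nat \<Rightarrow> ('o \<Rightarrow> 'u \<Rightarrow> 'm) set" where
  "coboundaries C P d M n =
     (case n of 0 \<Rightarrow> {\<one>\<^bsub>module_hom_group C (P 0) M\<^esub>}
      | Suc m \<Rightarrow> coboundary_map C P d m ` module_hom C (P m) M)"

definition Hom_cohomology ::
  "('o, 'h) small_cat \<Rightarrow> (nat \<Rightarrow> ('o, 'h, 'u) cat_module) \<Rightarrow> (nat \<Rightarrow> 'o \<Rightarrow> 'u \<Rightarrow> 'u) \<Rightarrow>
   ('o, 'h, 'm) cat_module \<Rightarrow> nat \<Rightarrow> ('o \<Rightarrow> 'u \<Rightarrow> 'm) set monoid" where
  "Hom_cohomology C P d M n =
     (module_hom_group C (P n) M)\<lparr>carrier := cocycles C P d M n\<rparr> Mod coboundaries C P d M n"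

text \<open>Ext is computed from a chosen projective resolution; up to isomorphism the choice does not
  matter.\<close>

definition Ext ::
  "('o, 'h) small_cat \<Rightarrow> nat \<Rightarrow> ('o, 'h, 'a) cat_module \<Rightarrow> ('o, 'h, 'u) cat_module \<Rightarrow>
   ('o \<Rightarrow> 'u \<Rightarrow> 'u) set monoid" where
  "Ext C n A M =
     (let (P, d) = (SOME (P, d). \<exists>e. projective_resolution C A P d e) in Hom_cohomology C P d M n)"


section \<open>Takasu cohomological dimension of a pair\<close>

definition group_cat :: "('k, 'x) monoid_scheme \<Rightarrow> (unit, 'k) small_cat" where
  "group_cat K = \<lparr>Ob = {()}, Hom = (\<lambda>_ _. carrier K), Idt = (\<lambda>_. \<one>\<^bsub>K\<^esub>),
                  Cmp = (\<lambda>_ _ _ g f. g \<otimes>\<^bsub>K\<^esub> f)\<rparr>"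

definition augmentation :: "('b \<Rightarrow>\<^sub>0 int) \<Rightarrow> int" where
  "augmentation x = (\<Sum>c\<in>Poly_Mapping.keys x. Poly_Mapping.lookup x c)"

text \<open>The \<open>\<int>K\<close>-module \<open>I(K/L)\<close>, the augmentation kernel in the permutation module \<open>\<int>(K/L)\<close>.\<close>

definition augmentation_module ::
  "('k, 'x) monoid_scheme \<Rightarrow> 'k set \<Rightarrow> (unit, 'k, 'k set \<Rightarrow>\<^sub>0 int) cat_module" where
  "augmentation_module K L =
     \<lparr>Val = (\<lambda>_. (free_Abelian_group (lcosets\<^bsub>K\<^esub> L))
        \<lparr>carrier := kernel (free_Abelian_group (lcosets\<^bsub>K\<^esub> L)) integer_group augmentation\<rparr>),
      Map = (\<lambda>_ _ k. frag_extend (\<lambda>c. frag_of (k <#\<^bsub>K\<^esub> c)))\<rparr>"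

definition takasu_cohomology ::
  "('k, 'x) monoid_scheme \<Rightarrow> 'k set \<Rightarrow> (unit, 'k, 'u) cat_module \<Rightarrow> nat \<Rightarrow>
   (unit \<Rightarrow> 'u \<Rightarrow> 'u) set monoid" where
  "takasu_cohomology K L M i =
     (case i of 0 \<Rightarrow> singleton_group {}
      | Suc j \<Rightarrow> Ext (group_cat K) j (augmentation_module K L) M)"

definition takasu_cd :: "'u itself \<Rightarrow> ('k, 'x) monoid_scheme \<Rightarrow> 'k set \<Rightarrow> enat" where
  "takasu_cd U K L =
     Sup {enat n | n. \<exists>M :: (unit, 'k, 'u) cat_module.
            cat_module (group_cat K) M \<and> \<not> trivial_group (takasu_cohomology K L M n)}"


section \<open>Bredon cohomological dimension\<close>

definition orbit_cat :: "('k, 'x) monoid_scheme \<Rightarrow> 'k set set \<Rightarrow> ('k set set, 'k set \<Rightarrow> 'k set) small_cat" where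
  "orbit_cat K \<F> =
     \<lparr>Ob = {lcosets\<^bsub>K\<^esub> H | H. H \<in> \<F>},
      Hom = (\<lambda>x y. {f \<in> x \<rightarrow>\<^sub>E y. \<forall>k\<in>carrier K. \<forall>c\<in>x. f (k <#\<^bsub>K\<^esub> c) = k <#\<^bsub>K\<^esub> f c}),
      Idt = (\<lambda>x. \<lambda>c\<in>x. c),
      Cmp = (\<lambda>x y z g f. compose x g f)\<rparr>"

definition constant_Z :: "('o, 'h, int) cat_module" where
  "constant_Z = \<lparr>Val = (\<lambda>_. integer_group), Map = (\<lambda>_ _ _ m. m)\<rparr>"

definition bredon_cohomology ::
  "('k, 'x) monoid_scheme \<Rightarrow> 'k set set \<Rightarrow> ('k set set, 'k set \<Rightarrow> 'k set, 'u) cat_module \<Rightarrow> nat \<Rightarrow>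
   ('k set set \<Rightarrow> 'u \<Rightarrow> 'u) set monoid" where
  "bredon_cohomology K \<F> M i = Ext (op_cat (orbit_cat K \<F>)) i constant_Z M"

definition bredon_cd :: "'u itself \<Rightarrow> ('k, 'x) monoid_scheme \<Rightarrow> 'k set set \<Rightarrow> enat" where
  "bredon_cd U K \<F> =
     Sup {enat n | n. \<exists>M :: ('k set set, 'k set \<Rightarrow> 'k set, 'u) cat_module.
            cat_module (op_cat (orbit_cat K \<F>)) M \<and> \<not> trivial_group (bredon_cohomology K \<F> M n)}"

definition subconjugate_family :: "('k, 'x) monoid_scheme \<Rightarrow> 'k set \<Rightarrow> 'k set set" where
  "subconjugate_family K L =
     {H. subgroup H K \<and> (\<exists>k\<in>carrier K. H \<subseteq> k <#\<^bsub>K\<^esub> L #>\<^bsub>K\<^esub> inv\<^bsub>K\<^esub> k)}"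

end

theory Submission
  imports Defs
begin

text \<open>
  \<^bold>\<open>The group.\<close> Write \<open>K\<close> for the semi-direct product and \<open>L\<close> for the acting factor. The Klein bottle
  is the quotient of the plane by the group of the transformations \<open>(s, t) \<mapsto> (s, t + 1)\<close> and
  \<open>(s, t) \<mapsto> (s + 1, - t)\<close>, and lifting of loops identifies its fundamental group with this group: its
  elements are \<open>a\<^sup>m b\<^sup>n\<close>, where \<open>b a b\<inverse> = a\<inverse>\<close> (\<open>klein_group_fundamental_group\<close>). The elements of \<open>K\<close> are
  then quadruples of integers with an explicit product.

  \<^bold>\<open>Projective dimension.\<close> As the group and the orbit category are countable, every infinite type is a
  universe with enough projectives. A module of projective dimension \<open>n\<close> has projective syzygies from
  the \<open>n\<close>-th on, independently of the resolution, because syzygies preserve stable direct summands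
  (\<open>stable_retract_syzygy\<close>). A class in \<open>Ext\<^bsup>n+1\<^esup>\<close> is a map on the \<open>(n + 1)\<close>-st syzygy and vanishes
  if and only if it extends (\<open>trivial_Hom_cohomology_iff\<close>). Hence Ext vanishes above the projective
  dimension; and if \<open>Ext\<^bsup>n+1\<^esup>\<close> vanishes for all coefficients, the \<open>(n + 1)\<close>-st syzygy is a direct summand
  of the projective module that contains it (\<open>Ext_trivial_imp_syzygy_retract\<close>).

  \<^bold>\<open>Upper bound.\<close> A free action of the integers on a \<open>K\<close>-set \<open>X\<close> with quotient \<open>Y\<close> gives an exact sequence
  \<open>0 \<rightarrow> \<int>X \<rightarrow> \<int>X \<rightarrow> \<int>Y \<rightarrow> 0\<close>, so that the dimension of \<open>\<int>Y\<close> exceeds that of \<open>\<int>X\<close> by at most one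
  (\<open>permutation_pd_step\<close>). Two such steps lead from \<open>K\<close> to \<open>K/L\<close> and four to a point. Thus \<open>\<int>(K/L)\<close> has
  dimension at most \<open>2\<close>, the trivial module \<open>\<int>\<close> at most \<open>4\<close>, and \<open>I(K/L)\<close>, the kernel of
  \<open>\<int>(K/L) \<rightarrow> \<int>\<close>, at most \<open>3\<close> (\<open>pd_augmentation\<close>). The shift in the definition of Takasu cohomology
  turns \<open>3\<close> into \<open>4\<close>.

  \<^bold>\<open>Lower bound.\<close> The elements \<open>a\<close> and \<open>b\<^sup>2\<close> of the two factors generate a subgroup \<open>\<int>\<^sup>4\<close> of \<open>K\<close>. The four
  operators \<open>t - 1\<close> form a regular sequence on each projective module, the first of them is regular
  on \<open>\<int>(K/L)\<close>, and all of them vanish on \<open>\<int>\<close>. This is the situation of Koszul homology in which \<open>\<int>\<close>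
  has a class in the top degree \<open>4\<close>. The connecting homomorphisms carry it without loss through
  \<open>I(K/L)\<close> and its syzygies (\<open>connecting_class\<close>). After four steps it is an element of the third
  syzygy of \<open>I(K/L)\<close> that is zero modulo the operators in the projective module above but not in the
  syzygy itself; hence the syzygy is not a direct summand, and \<open>Ext\<^sup>3\<close> does not vanish
  (\<open>Ext_augmentation_nontrivial\<close>).

  \<^bold>\<open>Bredon dimension.\<close> The element \<open>(a, b)\<close> lies in no conjugate of \<open>L\<close>, but its square \<open>(1, b\<^sup>2)\<close> is central
  and lies in \<open>L\<close>. It defines an involution of the orbit \<open>K/\<langle>(1, b\<^sup>2)\<rangle>\<close>, which acts without fixed points on
  the maps from this orbit to any orbit of the family. The values of projective modules at this
  orbit are therefore acyclic for the Tate cohomology of \<open>\<int>/2\<close>. Were Ext of the constant module to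
  vanish in a single positive degree, acyclicity would descend from a syzygy to the constant module
  itself, where it fails because \<open>1\<close> is not divisible by \<open>2\<close> (\<open>constant_Z_Ext_nontrivial\<close>).
\<close>

section \<open>Natural maps and short exact sequences\<close>

abbreviation el :: "('o, 'h, 'm) cat_module \<Rightarrow> 'o \<Rightarrow> 'm set" where
  "el M x \<equiv> carrier (Val M x)"

text \<open>Unlike \<^const>\<open>module_hom\<close>, values outside the carriers are arbitrary here, so that composites
  and sums of maps are plain lambda terms.\<close>

definition module_map ::
  "('o, 'h) small_cat \<Rightarrow> ('o, 'h, 'm) cat_module \<Rightarrow> ('o, 'h, 'n) cat_module \<Rightarrow> ('o \<Rightarrow> 'm \<Rightarrow> 'n) \<Rightarrow> bool" where
  "module_map C M N \<eta> \<longleftrightarrow>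
     (\<forall>x\<in>Ob C. \<eta> x \<in> hom (Val M x) (Val N x)) \<and>
     (\<forall>x\<in>Ob C. \<forall>y\<in>Ob C. \<forall>f\<in>Hom C x y. \<forall>m\<in>el M x. \<eta> y (Map M x y f m) = Map N x y f (\<eta> x m))"

definition is_category :: "('o, 'h) small_cat \<Rightarrow> bool" where
  "is_category C \<longleftrightarrow>
     (\<forall>x\<in>Ob C. Idt C x \<in> Hom C x x) \<and>
     (\<forall>x\<in>Ob C. \<forall>y\<in>Ob C. \<forall>z\<in>Ob C. \<forall>f\<in>Hom C x y. \<forall>g\<in>Hom C y z. Cmp C x y z g f \<in> Hom C x z) \<and>
     (\<forall>x\<in>Ob C. \<forall>y\<in>Ob C. \<forall>f\<in>Hom C x y. Cmp C x x y f (Idt C x) = f \<and> Cmp C x y y (Idt C y) f = f) \<and>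
     (\<forall>w\<in>Ob C. \<forall>x\<in>Ob C. \<forall>y\<in>Ob C. \<forall>z\<in>Ob C. \<forall>f\<in>Hom C w x. \<forall>g\<in>Hom C x y. \<forall>h\<in>Hom C y z.
        Cmp C w y z h (Cmp C w x y g f) = Cmp C w x z (Cmp C x y z h g) f)"

lemma cat_module_comm_group: "cat_module C M \<Longrightarrow> x \<in> Ob C \<Longrightarrow> comm_group (Val M x)"
  by (simp add: cat_module_def)

lemma cat_module_group: "cat_module C M \<Longrightarrow> x \<in> Ob C \<Longrightarrow> group (Val M x)"
  by (rule comm_group.axioms(2)[OF cat_module_comm_group])

lemma Map_hom:
  "cat_module C M \<Longrightarrow> x \<in> Ob C \<Longrightarrow> y \<in> Ob C \<Longrightarrow> f \<in> Hom C x y \<Longrightarrow> Map M x y f \<in> hom (Val M x) (Val M y)"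
  by (simp add: cat_module_def)

lemma Map_closed:
  "cat_module C M \<Longrightarrow> x \<in> Ob C \<Longrightarrow> y \<in> Ob C \<Longrightarrow> f \<in> Hom C x y \<Longrightarrow> m \<in> el M x \<Longrightarrow> Map M x y f m \<in> el M y"
  using Map_hom hom_in_carrier by metis

lemma Map_mult:
  "cat_module C M \<Longrightarrow> x \<in> Ob C \<Longrightarrow> y \<in> Ob C \<Longrightarrow> f \<in> Hom C x y \<Longrightarrow> m \<in> el M x \<Longrightarrow> m' \<in> el M x \<Longrightarrow>
   Map M x y f (m \<otimes>\<^bsub>Val M x\<^esub> m') = Map M x y f m \<otimes>\<^bsub>Val M y\<^esub> Map M x y f m'"
  by (meson Map_hom hom_mult)

lemma Map_one:
  "cat_module C M \<Longrightarrow> x \<in> Ob C \<Longrightarrow> y \<in> Ob C \<Longrightarrow> f \<in> Hom C x y \<Longrightarrow> Map M x y f \<one>\<^bsub>Val M x\<^esub> = \<one>\<^bsub>Val M y\<^esub>"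
  by (meson Map_hom cat_module_group hom_one)

lemma Map_inv:
  "cat_module C M \<Longrightarrow> x \<in> Ob C \<Longrightarrow> y \<in> Ob C \<Longrightarrow> f \<in> Hom C x y \<Longrightarrow> m \<in> el M x \<Longrightarrow>
   Map M x y f (inv\<^bsub>Val M x\<^esub> m) = inv\<^bsub>Val M y\<^esub> (Map M x y f m)"
  by (rule group_hom.hom_inv) (simp_all add: group_hom_def group_hom_axioms_def Map_hom cat_module_group)

lemma Map_Idt: "cat_module C M \<Longrightarrow> x \<in> Ob C \<Longrightarrow> m \<in> el M x \<Longrightarrow> Map M x x (Idt C x) m = m"
  by (simp add: cat_module_def)

lemma Map_Cmp:
  "cat_module C M \<Longrightarrow> x \<in> Ob C \<Longrightarrow> y \<in> Ob C \<Longrightarrow> z \<in> Ob C \<Longrightarrow> f \<in> Hom C x y \<Longrightarrow> g \<in> Hom C y z \<Longrightarrow>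
   m \<in> el M x \<Longrightarrow> Map M x z (Cmp C x y z g f) m = Map M y z g (Map M x y f m)"
  by (simp add: cat_module_def)

lemma module_map_hom: "module_map C M N \<eta> \<Longrightarrow> x \<in> Ob C \<Longrightarrow> \<eta> x \<in> hom (Val M x) (Val N x)"
  by (simp add: module_map_def)

lemma module_map_nat:
  "module_map C M N \<eta> \<Longrightarrow> x \<in> Ob C \<Longrightarrow> y \<in> Ob C \<Longrightarrow> f \<in> Hom C x y \<Longrightarrow> m \<in> el M x \<Longrightarrow>
   \<eta> y (Map M x y f m) = Map N x y f (\<eta> x m)"
  by (simp add: module_map_def)

lemma module_map_closed: "module_map C M N \<eta> \<Longrightarrow> x \<in> Ob C \<Longrightarrow> m \<in> el M x \<Longrightarrow> \<eta> x m \<in> el N x"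
  using module_map_hom hom_in_carrier by metis

lemma module_map_mult:
  "module_map C M N \<eta> \<Longrightarrow> x \<in> Ob C \<Longrightarrow> m \<in> el M x \<Longrightarrow> m' \<in> el M x \<Longrightarrow>
   \<eta> x (m \<otimes>\<^bsub>Val M x\<^esub> m') = \<eta> x m \<otimes>\<^bsub>Val N x\<^esub> \<eta> x m'"
  by (meson module_map_hom hom_mult)

lemma module_map_group_hom:
  "module_map C M N \<eta> \<Longrightarrow> cat_module C M \<Longrightarrow> cat_module C N \<Longrightarrow> x \<in> Ob C \<Longrightarrow> group_hom (Val M x) (Val N x) (\<eta> x)"
  by (meson module_map_hom cat_module_group group_hom.intro group_hom_axioms.intro)

lemma module_map_one:
  "module_map C M N \<eta> \<Longrightarrow> cat_module C M \<Longrightarrow> cat_module C N \<Longrightarrow> x \<in> Ob C \<Longrightarrow> \<eta> x \<one>\<^bsub>Val M x\<^esub> = \<one>\<^bsub>Val N x\<^esub>"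
  by (rule group_hom.hom_one[OF module_map_group_hom])

lemma module_map_inv:
  "module_map C M N \<eta> \<Longrightarrow> cat_module C M \<Longrightarrow> cat_module C N \<Longrightarrow> x \<in> Ob C \<Longrightarrow> m \<in> el M x \<Longrightarrow>
   \<eta> x (inv\<^bsub>Val M x\<^esub> m) = inv\<^bsub>Val N x\<^esub> (\<eta> x m)"
  by (rule group_hom.hom_inv[OF module_map_group_hom])

lemma module_map_id: "module_map C M M (\<lambda>x m. m)"
  by (auto simp: module_map_def hom_def)

lemma module_map_comp:
  "module_map C M N \<eta> \<Longrightarrow> module_map C N P \<theta> \<Longrightarrow> module_map C M P (\<lambda>x m. \<theta> x (\<eta> x m))"
  unfolding module_map_def hom_def Pi_def by auto

lemma module_map_sum:
  assumes N: "cat_module C N" and h: "module_map C M N \<eta>" "module_map C M N \<theta>"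
  shows "module_map C M N (\<lambda>x m. \<eta> x m \<otimes>\<^bsub>Val N x\<^esub> \<theta> x m)"
  unfolding module_map_def
proof (intro conjI ballI homI)
  fix x m assume x: "x \<in> Ob C" and m: "m \<in> el M x"
  interpret comm_group "Val N x" using N x by (rule cat_module_comm_group)
  show "\<eta> x m \<otimes>\<^bsub>Val N x\<^esub> \<theta> x m \<in> el N x"
    using h x m by (simp add: module_map_closed)
  fix m' assume m': "m' \<in> el M x"
  have "\<eta> x m \<in> el N x" "\<theta> x m \<in> el N x" "\<eta> x m' \<in> el N x" "\<theta> x m' \<in> el N x"
    using h x m m' by (auto intro: module_map_closed)
  then show "\<eta> x (m \<otimes>\<^bsub>Val M x\<^esub> m') \<otimes>\<^bsub>Val N x\<^esub> \<theta> x (m \<otimes>\<^bsub>Val M x\<^esub> m') =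
     (\<eta> x m \<otimes>\<^bsub>Val N x\<^esub> \<theta> x m) \<otimes>\<^bsub>Val N x\<^esub> (\<eta> x m' \<otimes>\<^bsub>Val N x\<^esub> \<theta> x m')"
    using h x m m' by (simp add: module_map_mult m_ac)
next
  fix x y f m assume "x \<in> Ob C" "y \<in> Ob C" "f \<in> Hom C x y" "m \<in> el M x"
  then show "\<eta> y (Map M x y f m) \<otimes>\<^bsub>Val N y\<^esub> \<theta> y (Map M x y f m) = Map N x y f (\<eta> x m \<otimes>\<^bsub>Val N x\<^esub> \<theta> x m)"
    using h N by (simp add: module_map_nat Map_mult module_map_closed)
qed

lemma module_map_neg:
  assumes N: "cat_module C N" and M: "cat_module C M" and h: "module_map C M N \<eta>"
  shows "module_map C M N (\<lambda>x m. inv\<^bsub>Val N x\<^esub> (\<eta> x m))"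
  unfolding module_map_def
proof (intro conjI ballI homI)
  fix x m assume x: "x \<in> Ob C" and m: "m \<in> el M x"
  interpret comm_group "Val N x" using N x by (rule cat_module_comm_group)
  show "inv\<^bsub>Val N x\<^esub> (\<eta> x m) \<in> el N x"
    using h x m by (simp add: module_map_closed)
  fix m' assume m': "m' \<in> el M x"
  then show "inv\<^bsub>Val N x\<^esub> (\<eta> x (m \<otimes>\<^bsub>Val M x\<^esub> m')) = inv\<^bsub>Val N x\<^esub> (\<eta> x m) \<otimes>\<^bsub>Val N x\<^esub> inv\<^bsub>Val N x\<^esub> (\<eta> x m')"
    using h x m by (simp add: module_map_mult inv_mult module_map_closed)
next
  fix x y f m assume "x \<in> Ob C" "y \<in> Ob C" "f \<in> Hom C x y" "m \<in> el M x"
  then show "inv\<^bsub>Val N y\<^esub> (\<eta> y (Map M x y f m)) = Map N x y f (inv\<^bsub>Val N x\<^esub> (\<eta> x m))"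
    using h N by (simp add: module_map_nat Map_inv module_map_closed)
qed

lemma module_map_zero:
  assumes N: "cat_module C N"
  shows "module_map C M N (\<lambda>x m. \<one>\<^bsub>Val N x\<^esub>)"
  unfolding module_map_def
proof (intro conjI ballI homI)
  fix x assume x: "x \<in> Ob C"
  interpret group "Val N x" using N x by (rule cat_module_group)
  show "\<one>\<^bsub>Val N x\<^esub> \<in> el N x" "\<one>\<^bsub>Val N x\<^esub> = \<one>\<^bsub>Val N x\<^esub> \<otimes>\<^bsub>Val N x\<^esub> \<one>\<^bsub>Val N x\<^esub>"
    by simp_all
next
  fix x y f assume "x \<in> Ob C" "y \<in> Ob C" "f \<in> Hom C x y"
  then show "\<one>\<^bsub>Val N y\<^esub> = Map N x y f \<one>\<^bsub>Val N x\<^esub>"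
    using Map_one[OF N] by metis
qed

definition module_surj where
  "module_surj C M N \<pi> \<longleftrightarrow> module_map C M N \<pi> \<and> (\<forall>x\<in>Ob C. \<pi> x ` el M x = el N x)"

definition short_exact where
  "short_exact C A i B p D \<longleftrightarrow> cat_module C A \<and> cat_module C B \<and> cat_module C D \<and>
     module_map C A B i \<and> module_surj C B D p \<and>
     (\<forall>x\<in>Ob C. inj_on (i x) (el A x) \<and> i x ` el A x = kernel (Val B x) (Val D x) (p x))"

lemma short_exactD:
  assumes "short_exact C A i B p D"
  shows "cat_module C A" "cat_module C B" "cat_module C D" "module_map C A B i" "module_surj C B D p"
    "module_map C B D p"
    "x \<in> Ob C \<Longrightarrow> inj_on (i x) (el A x)"
    "x \<in> Ob C \<Longrightarrow> a \<in> el A x \<Longrightarrow> p x (i x a) = \<one>\<^bsub>Val D x\<^esub>"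
    "x \<in> Ob C \<Longrightarrow> b \<in> el B x \<Longrightarrow> p x b = \<one>\<^bsub>Val D x\<^esub> \<Longrightarrow> b \<in> i x ` el A x"
    "x \<in> Ob C \<Longrightarrow> d \<in> el D x \<Longrightarrow> \<exists>b\<in>el B x. p x b = d"
proof -
  show "cat_module C A" "cat_module C B" "cat_module C D" "module_map C A B i" "module_surj C B D p"
    "module_map C B D p" "x \<in> Ob C \<Longrightarrow> inj_on (i x) (el A x)"
    using assms by (auto simp: short_exact_def module_surj_def)
  show "x \<in> Ob C \<Longrightarrow> a \<in> el A x \<Longrightarrow> p x (i x a) = \<one>\<^bsub>Val D x\<^esub>"
    using assms unfolding short_exact_def kernel_def by blast
  show "x \<in> Ob C \<Longrightarrow> b \<in> el B x \<Longrightarrow> p x b = \<one>\<^bsub>Val D x\<^esub> \<Longrightarrow> b \<in> i x ` el A x"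
    using assms unfolding short_exact_def kernel_def by blast
  show "x \<in> Ob C \<Longrightarrow> d \<in> el D x \<Longrightarrow> \<exists>b\<in>el B x. p x b = d"
    using assms unfolding short_exact_def module_surj_def by (metis imageE)
qed

lemma short_exactI:
  assumes "cat_module C A" "cat_module C B" "cat_module C D" "module_map C A B i" "module_map C B D p"
    "\<And>x. x \<in> Ob C \<Longrightarrow> inj_on (i x) (el A x)"
    "\<And>x a. x \<in> Ob C \<Longrightarrow> a \<in> el A x \<Longrightarrow> p x (i x a) = \<one>\<^bsub>Val D x\<^esub>"
    "\<And>x b. x \<in> Ob C \<Longrightarrow> b \<in> el B x \<Longrightarrow> p x b = \<one>\<^bsub>Val D x\<^esub> \<Longrightarrow> \<exists>a\<in>el A x. i x a = b"
    "\<And>x d. x \<in> Ob C \<Longrightarrow> d \<in> el D x \<Longrightarrow> \<exists>b\<in>el B x. p x b = d"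
  shows "short_exact C A i B p D"
  unfolding short_exact_def module_surj_def
proof (intro conjI ballI assms(1-6))
  fix x assume x: "x \<in> Ob C"
  show "p x ` el B x = el D x"
    using assms(9)[OF x] module_map_closed[OF assms(5) x] by auto
  show "i x ` el A x = kernel (Val B x) (Val D x) (p x)"
    using assms(7,8)[OF x] module_map_closed[OF assms(4) x] by (auto simp: kernel_def)
qed

text \<open>The universal properties of kernels and cokernels.\<close>

lemma factor_through_injection:
  assumes j: "module_map C B P j" "\<And>x. x \<in> Ob C \<Longrightarrow> inj_on (j x) (el B x)"
    and B: "cat_module C B" and M: "cat_module C M" and h: "module_map C M P \<eta>"
    and im: "\<And>x m. x \<in> Ob C \<Longrightarrow> m \<in> el M x \<Longrightarrow> \<eta> x m \<in> j x ` el B x"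
  obtains \<eta>' where "module_map C M B \<eta>'" "\<And>x m. x \<in> Ob C \<Longrightarrow> m \<in> el M x \<Longrightarrow> j x (\<eta>' x m) = \<eta> x m"
proof -
  define g where "g = (\<lambda>x m. inv_into (el B x) (j x) (\<eta> x m))"
  have cl: "g x m \<in> el B x" and eq: "j x (g x m) = \<eta> x m" if "x \<in> Ob C" "m \<in> el M x" for x m
    using im[OF that] unfolding g_def by (auto intro: inv_into_into f_inv_into_f)
  have uniq: "a = b" if "x \<in> Ob C" "a \<in> el B x" "b \<in> el B x" "j x a = j x b" for x a b
    using j(2) that by (meson inj_onD)
  have "module_map C M B g"
    unfolding module_map_def
  proof (intro conjI ballI homI)
    fix x m assume x: "x \<in> Ob C" and m: "m \<in> el M x"
    show "g x m \<in> el B x" using cl x m .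
    fix m' assume m': "m' \<in> el M x"
    interpret MG: group "Val M x" using M x by (rule cat_module_group)
    interpret BG: group "Val B x" using B x by (rule cat_module_group)
    show "g x (m \<otimes>\<^bsub>Val M x\<^esub> m') = g x m \<otimes>\<^bsub>Val B x\<^esub> g x m'"
      by (rule uniq[OF x]) (use x m m' in \<open>simp_all add: cl eq module_map_mult[OF j(1)] module_map_mult[OF h]\<close>)
  next
    fix x y f m assume *: "x \<in> Ob C" "y \<in> Ob C" "f \<in> Hom C x y" "m \<in> el M x"
    show "g y (Map M x y f m) = Map B x y f (g x m)"
      by (rule uniq[OF \<open>y \<in> Ob C\<close>])
        (use * in \<open>simp_all add: cl eq Map_closed[OF M] Map_closed[OF B] module_map_nat[OF j(1)] module_map_nat[OF h]\<close>)
  qed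
  then show thesis using that eq by blast
qed

lemma factor_through_surjection:
  assumes p: "module_surj C P D \<pi>" and mods: "cat_module C P" "cat_module C D" "cat_module C N"
    and h: "module_map C P N \<eta>"
    and ker: "\<And>x m. x \<in> Ob C \<Longrightarrow> m \<in> el P x \<Longrightarrow> \<pi> x m = \<one>\<^bsub>Val D x\<^esub> \<Longrightarrow> \<eta> x m = \<one>\<^bsub>Val N x\<^esub>"
  obtains \<eta>' where "module_map C D N \<eta>'" "\<And>x m. x \<in> Ob C \<Longrightarrow> m \<in> el P x \<Longrightarrow> \<eta>' x (\<pi> x m) = \<eta> x m"
proof -
  have pm: "module_map C P D \<pi>" and ps: "\<And>x. x \<in> Ob C \<Longrightarrow> \<pi> x ` el P x = el D x"
    using p by (auto simp: module_surj_def)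
  define g where "g = (\<lambda>x d. \<eta> x (inv_into (el P x) (\<pi> x) d))"
  have eq: "\<eta> x a = \<eta> x b" if "x \<in> Ob C" "a \<in> el P x" "b \<in> el P x" "\<pi> x a = \<pi> x b" for x a b
  proof -
    interpret PG: group "Val P x" using mods(1) that(1) by (rule cat_module_group)
    interpret DG: group "Val D x" using mods(2) that(1) by (rule cat_module_group)
    interpret NG: group "Val N x" using mods(3) that(1) by (rule cat_module_group)
    have "\<eta> x (a \<otimes>\<^bsub>Val P x\<^esub> inv\<^bsub>Val P x\<^esub> b) = \<one>\<^bsub>Val N x\<^esub>"
      using that by (intro ker) (simp_all add: module_map_mult[OF pm] module_map_inv[OF pm mods(1,2)] module_map_closed[OF pm])
    then have "\<eta> x a \<otimes>\<^bsub>Val N x\<^esub> inv\<^bsub>Val N x\<^esub> \<eta> x b = \<one>\<^bsub>Val N x\<^esub>"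
      using that by (simp add: module_map_mult[OF h] module_map_inv[OF h mods(1,3)])
    then show ?thesis
      using that by (metis NG.inv_equality NG.inv_inv NG.inv_closed module_map_closed[OF h])
  qed
  have g: "g x (\<pi> x m) = \<eta> x m" if "x \<in> Ob C" "m \<in> el P x" for x m
  proof -
    have "\<pi> x m \<in> \<pi> x ` el P x" using that by blast
    then show ?thesis unfolding g_def
      by (intro eq that) (auto intro: inv_into_into f_inv_into_f)
  qed
  have "module_map C D N g"
    unfolding module_map_def
  proof (intro conjI ballI homI)
    fix x d assume x: "x \<in> Ob C" and d: "d \<in> el D x"
    obtain m where m: "m \<in> el P x" "d = \<pi> x m" using ps[OF x] d by blast
    show "g x d \<in> el N x" using m x by (simp add: g module_map_closed[OF h])
    fix d' assume d': "d' \<in> el D x"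
    obtain m' where m': "m' \<in> el P x" "d' = \<pi> x m'" using ps[OF x] d' by blast
    interpret PG: group "Val P x" using mods(1) x by (rule cat_module_group)
    show "g x (d \<otimes>\<^bsub>Val D x\<^esub> d') = g x d \<otimes>\<^bsub>Val N x\<^esub> g x d'"
      using x m m' g[OF x PG.m_closed[OF m(1) m'(1)]]
      by (simp add: g module_map_mult[OF pm] module_map_mult[OF h])
  next
    fix x y f d assume *: "x \<in> Ob C" "y \<in> Ob C" "f \<in> Hom C x y" "d \<in> el D x"
    obtain m where m: "m \<in> el P x" "d = \<pi> x m" using ps * by blast
    show "g y (Map D x y f d) = Map N x y f (g x d)"
      using * m g[OF *(2) Map_closed[OF mods(1) *(1-3) m(1)]]
      by (simp add: g module_map_nat[OF pm] module_map_nat[OF h])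
  qed
  then show thesis using that g by blast
qed

definition submodule where
  "submodule M S = \<lparr>Val = (\<lambda>x. (Val M x)\<lparr>carrier := S x\<rparr>), Map = Map M\<rparr>"

lemma submodule_simps [simp]:
  "carrier (Val (submodule M S) z) = S z"
  "a \<otimes>\<^bsub>Val (submodule M S) z\<^esub> b = a \<otimes>\<^bsub>Val M z\<^esub> b"
  "\<one>\<^bsub>Val (submodule M S) z\<^esub> = \<one>\<^bsub>Val M z\<^esub>"
  "Map (submodule M S) = Map M"
  by (simp_all add: submodule_def)

lemma comm_group_restrict:
  assumes "comm_group G" "subgroup H G" shows "comm_group (G\<lparr>carrier := H\<rparr>)"
proof -
  interpret comm_group G by fact
  interpret subgroup H G by fact
  show ?thesis
    by (rule group.group_comm_groupI) (auto simp: subgroup_is_group is_group intro: m_comm)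
qed

lemma cat_module_submodule:
  assumes M: "cat_module C M" and S: "\<And>x. x \<in> Ob C \<Longrightarrow> subgroup (S x) (Val M x)"
    and cl: "\<And>x y f m. x \<in> Ob C \<Longrightarrow> y \<in> Ob C \<Longrightarrow> f \<in> Hom C x y \<Longrightarrow> m \<in> S x \<Longrightarrow> Map M x y f m \<in> S y"
  shows "cat_module C (submodule M S)"
proof -
  have sub: "m \<in> S x \<Longrightarrow> m \<in> el M x" if "x \<in> Ob C" for x m
    using S[OF that] by (simp add: subgroup.mem_carrier)
  show ?thesis
    unfolding cat_module_def
  proof (intro conjI ballI)
    fix x assume x: "x \<in> Ob C"
    show "comm_group (Val (submodule M S) x)"
      using comm_group_restrict[OF cat_module_comm_group[OF M x] S[OF x]] by (simp add: submodule_def)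
  qed (use M cl sub in \<open>auto intro!: homI simp: Map_mult Map_Idt Map_Cmp\<close>)
qed

lemma submodule_map:
  assumes "\<And>x. x \<in> Ob C \<Longrightarrow> S x \<subseteq> el M x"
  shows "module_map C (submodule M S) M (\<lambda>x m. m)"
  using assms by (auto simp: module_map_def subset_iff intro!: homI)

lemma kernel_exact:
  assumes "cat_module C P" "cat_module C D" "module_surj C P D \<pi>"
  shows "short_exact C (submodule P (\<lambda>x. kernel (Val P x) (Val D x) (\<pi> x))) (\<lambda>x m. m) P \<pi> D"
proof -
  have pm: "module_map C P D \<pi>" and ps: "\<And>x. x \<in> Ob C \<Longrightarrow> \<pi> x ` el P x = el D x"
    using assms by (auto simp: module_surj_def)
  show ?thesis
  proof (rule short_exactI)
    show "cat_module C (submodule P (\<lambda>x. kernel (Val P x) (Val D x) (\<pi> x)))"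
    proof (rule cat_module_submodule[OF assms(1)])
      fix x assume "x \<in> Ob C"
      then show "subgroup (kernel (Val P x) (Val D x) (\<pi> x)) (Val P x)"
        using module_map_group_hom[OF pm assms(1,2)] group_hom.subgroup_kernel by blast
    qed (use assms in \<open>auto simp: kernel_def Map_closed module_map_nat[OF pm] Map_one\<close>)
    show "module_map C (submodule P (\<lambda>x. kernel (Val P x) (Val D x) (\<pi> x))) P (\<lambda>x m. m)"
      by (rule submodule_map) (auto simp: kernel_def)
    show "\<exists>b\<in>el P x. \<pi> x b = d" if "x \<in> Ob C" "d \<in> el D x" for x d
      using ps[OF that(1)] that(2) by (metis imageE)
  qed (use assms pm in \<open>auto simp: kernel_def\<close>)
qed

section \<open>Projective modules\<close>

text \<open>Projectivity with respect to modules in the universe \<open>'u\<close>, for a module \<open>P\<close> over an arbitrary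
  type: free modules are built over types other than \<open>'u\<close>, and only their copies in the universe
  are projective in the sense of \<^const>\<open>projective_module\<close>.\<close>

definition lifts :: "'u itself \<Rightarrow> ('o, 'h) small_cat \<Rightarrow> ('o, 'h, 'p) cat_module \<Rightarrow> bool" where
  "lifts U C P \<longleftrightarrow>
     (\<forall>(B :: ('o, 'h, 'u) cat_module) (D :: ('o, 'h, 'u) cat_module) \<pi> f.
        cat_module C B \<longrightarrow> cat_module C D \<longrightarrow> module_surj C B D \<pi> \<longrightarrow> module_map C P D f \<longrightarrow>
        (\<exists>g. module_map C P B g \<and> (\<forall>x\<in>Ob C. \<forall>p\<in>el P x. \<pi> x (g x p) = f x p)))"

lemma liftsD:
  fixes B D :: "('o, 'h, 'u) cat_module"
  assumes l: "lifts TYPE('u) C P" and mods: "cat_module C B" "cat_module C D"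
    and maps: "module_surj C B D \<pi>" "module_map C P D f"
  obtains g where "module_map C P B g" "\<And>x p. x \<in> Ob C \<Longrightarrow> p \<in> el P x \<Longrightarrow> \<pi> x (g x p) = f x p"
proof -
  have "\<exists>g. module_map C P B g \<and> (\<forall>x\<in>Ob C. \<forall>p\<in>el P x. \<pi> x (g x p) = f x p)"
    by (rule l[unfolded lifts_def, THEN spec[of _ B], THEN spec[of _ D], THEN spec[of _ \<pi>], THEN spec[of _ f],
          THEN mp[OF _ mods(1)], THEN mp[OF _ mods(2)], THEN mp[OF _ maps(1)], THEN mp[OF _ maps(2)]])
  then show thesis using that by blast
qed

definition normalise where
  "normalise C M \<eta> = (\<lambda>x\<in>Ob C. \<lambda>m\<in>el M x. \<eta> x m)"

lemma normalise_module_hom: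
  assumes "cat_module C M" "module_map C M N \<eta>" shows "normalise C M \<eta> \<in> module_hom C M N"
proof -
  have "restrict (\<eta> x) (el M x) \<in> hom (Val M x) (Val N x)" if x: "x \<in> Ob C" for x
  proof -
    interpret group "Val M x" using assms(1) x by (rule cat_module_group)
    show ?thesis using assms(2) x
      by (auto intro!: homI simp: module_map_closed[OF assms(2)] module_map_mult[OF assms(2)])
  qed
  then show ?thesis using assms
    by (auto simp: module_hom_def normalise_def Map_closed module_map_nat)
qed

lemma module_hom_map: "\<eta> \<in> module_hom C M N \<Longrightarrow> module_map C M N \<eta>"
  by (auto simp: module_hom_def module_map_def)

lemma module_hom_normalise: "\<eta> \<in> module_hom C M N \<Longrightarrow> normalise C M \<eta> = \<eta>"
  by (auto simp: module_hom_def normalise_def fun_eq_iff PiE_iff extensional_def restrict_def)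

lemma module_hom_eqI:
  assumes "\<eta> \<in> module_hom C M N" "\<theta> \<in> module_hom C M N'"
    "\<And>x m. x \<in> Ob C \<Longrightarrow> m \<in> el M x \<Longrightarrow> \<eta> x m = \<theta> x m"
  shows "\<eta> = \<theta>"
proof -
  have "normalise C M \<eta> = normalise C M \<theta>" using assms(3) by (auto simp: normalise_def fun_eq_iff)
  then show ?thesis using assms by (simp add: module_hom_normalise)
qed

lemma module_comp_apply: "x \<in> Ob C \<Longrightarrow> m \<in> el M x \<Longrightarrow> module_comp C M \<theta> \<eta> x m = \<theta> x (\<eta> x m)"
  by (simp add: module_comp_def compose_def)

lemma module_comp_normalise: "module_comp C M \<theta> \<eta> = normalise C M (\<lambda>x m. \<theta> x (\<eta> x m))"
  by (auto simp: module_comp_def normalise_def compose_def)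

lemma projective_module_iff:
  fixes P :: "('o, 'h, 'u) cat_module"
  shows "projective_module C P \<longleftrightarrow> cat_module C P \<and> lifts TYPE('u) C P"
proof (intro iffI conjI)
  assume pr: "projective_module C P"
  then show P: "cat_module C P" by (simp add: projective_module_def)
  show "lifts TYPE('u) C P"
    unfolding lifts_def
  proof (intro allI impI)
    fix B D :: "('o, 'h, 'u) cat_module" and \<pi> f
    assume B: "cat_module C B" and D: "cat_module C D" and s: "module_surj C B D \<pi>" and f: "module_map C P D f"
    have "module_epi C B D (normalise C B \<pi>)"
      using s normalise_module_hom[OF B] by (auto simp: module_epi_def module_surj_def normalise_def image_iff)
    moreover have "normalise C P f \<in> module_hom C P D" using normalise_module_hom[OF P f] .
    ultimately obtain g where g: "g \<in> module_hom C P B" "module_comp C P (normalise C B \<pi>) g = normalise C P f"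
      using pr B D unfolding projective_module_def by blast
    have "\<pi> x (g x p) = f x p" if "x \<in> Ob C" "p \<in> el P x" for x p
    proof -
      have "g x p \<in> el B x" using module_map_closed[OF module_hom_map[OF g(1)] that] .
      then show ?thesis
        using fun_cong[OF fun_cong[OF g(2), of x], of p] that by (simp add: module_comp_apply normalise_def)
    qed
    then show "\<exists>g. module_map C P B g \<and> (\<forall>x\<in>Ob C. \<forall>p\<in>el P x. \<pi> x (g x p) = f x p)"
      using module_hom_map[OF g(1)] by blast
  qed
next
  assume l: "cat_module C P \<and> lifts TYPE('u) C P"
  show "projective_module C P"
    unfolding projective_module_def
  proof (intro conjI allI impI)
    show P: "cat_module C P" using l by simp
    fix B D :: "('o, 'h, 'u) cat_module" and \<pi> f
    assume B: "cat_module C B" and D: "cat_module C D" and s: "module_epi C B D \<pi>" and f: "f \<in> module_hom C P D"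
    have "module_surj C B D \<pi>" using s module_hom_map by (auto simp: module_epi_def module_surj_def)
    then obtain g where g: "module_map C P B g" "\<forall>x\<in>Ob C. \<forall>p\<in>el P x. \<pi> x (g x p) = f x p"
      using l B D module_hom_map[OF f] unfolding lifts_def by blast
    have "module_comp C P \<pi> (normalise C P g) = normalise C P f"
      using g(2) by (auto simp: module_comp_normalise normalise_def fun_eq_iff)
    then show "\<exists>g\<in>module_hom C P B. module_comp C P \<pi> g = f"
      using normalise_module_hom[OF P g(1)] module_hom_normalise[OF f] by auto
  qed
qed

lemma projective_lift:
  fixes P B D :: "('o, 'h, 'u) cat_module"
  assumes "projective_module C P" "cat_module C B" "cat_module C D" "module_surj C B D \<pi>" "module_map C P D f"
  obtains g where "module_map C P B g" "\<And>x p. x \<in> Ob C \<Longrightarrow> p \<in> el P x \<Longrightarrow> \<pi> x (g x p) = f x p"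
  using assms liftsD[of C P B D \<pi> f thesis] by (simp add: projective_module_iff)

lemma lifts_retract:
  fixes P :: "('o, 'h, 'p) cat_module" and Q :: "('o, 'h, 'q) cat_module"
  assumes Q: "lifts TYPE('u) C Q" and i: "module_map C P Q i" and r: "module_map C Q P r"
    and ri: "\<And>x p. x \<in> Ob C \<Longrightarrow> p \<in> el P x \<Longrightarrow> r x (i x p) = p"
  shows "lifts TYPE('u) C P"
  unfolding lifts_def
proof (intro allI impI)
  fix B D :: "('o, 'h, 'u) cat_module" and \<pi> f
  assume "cat_module C B" "cat_module C D" "module_surj C B D \<pi>" and f: "module_map C P D f"
  then obtain g where g: "module_map C Q B g" "\<And>x p. x \<in> Ob C \<Longrightarrow> p \<in> el Q x \<Longrightarrow> \<pi> x (g x p) = f x (r x p)"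
    using liftsD[OF Q _ _ _ module_map_comp[OF r f]] by blast
  show "\<exists>g. module_map C P B g \<and> (\<forall>x\<in>Ob C. \<forall>p\<in>el P x. \<pi> x (g x p) = f x p)"
  proof (intro exI conjI ballI)
    show "module_map C P B (\<lambda>x p. g x (i x p))" by (rule module_map_comp[OF i g(1)])
    fix x p assume "x \<in> Ob C" "p \<in> el P x"
    then show "\<pi> x (g x (i x p)) = f x p" using g(2) module_map_closed[OF i] ri by metis
  qed
qed

section \<open>Copies of modules in the universe\<close>

definition transport :: "('o \<Rightarrow> 'm \<Rightarrow> 'n) \<Rightarrow> ('o, 'h, 'm) cat_module \<Rightarrow> ('o, 'h, 'n) cat_module" where
  "transport \<iota> M =
     \<lparr>Val = (\<lambda>x. \<lparr>carrier = \<iota> x ` el M x,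
                  monoid.mult = (\<lambda>a b. \<iota> x (inv_into (el M x) (\<iota> x) a \<otimes>\<^bsub>Val M x\<^esub> inv_into (el M x) (\<iota> x) b)),
                  one = \<iota> x \<one>\<^bsub>Val M x\<^esub>\<rparr>),
      Map = (\<lambda>x y f a. \<iota> y (Map M x y f (inv_into (el M x) (\<iota> x) a)))\<rparr>"

lemma transport_iso:
  assumes M: "cat_module C M" and inj: "\<And>x. x \<in> Ob C \<Longrightarrow> inj_on (\<iota> x) (el M x)"
  shows "cat_module C (transport \<iota> M)" (is ?mod)
    and "module_map C M (transport \<iota> M) \<iota>" (is ?to)
    and "module_map C (transport \<iota> M) M (\<lambda>x. inv_into (el M x) (\<iota> x))" (is ?from)
proof -
  let ?v = "\<lambda>x. inv_into (el M x) (\<iota> x)"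
  have inv: "?v x (\<iota> x m) = m" if "x \<in> Ob C" "m \<in> el M x" for x m
    using inv_into_f_f[OF inj[OF that(1)] that(2)] .
  have car: "el (transport \<iota> M) x = \<iota> x ` el M x" for x by (simp add: transport_def)
  have mul: "\<iota> x m \<otimes>\<^bsub>Val (transport \<iota> M) x\<^esub> \<iota> x m' = \<iota> x (m \<otimes>\<^bsub>Val M x\<^esub> m')"
    if "x \<in> Ob C" "m \<in> el M x" "m' \<in> el M x" for x m m'
    using that by (simp add: transport_def inv)
  have one: "\<one>\<^bsub>Val (transport \<iota> M) x\<^esub> = \<iota> x \<one>\<^bsub>Val M x\<^esub>" for x by (simp add: transport_def)
  have map: "Map (transport \<iota> M) x y f (\<iota> x m) = \<iota> y (Map M x y f m)" if "x \<in> Ob C" "m \<in> el M x" for x y f m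
    using that by (simp add: transport_def inv)
  have grp: "comm_group (Val (transport \<iota> M) x)" if x: "x \<in> Ob C" for x
  proof -
    interpret comm_group "Val M x" using M x by (rule cat_module_comm_group)
    show ?thesis
    proof (rule comm_groupI)
      fix a assume "a \<in> el (transport \<iota> M) x"
      then obtain m where m: "m \<in> el M x" "a = \<iota> x m" by (auto simp: car)
      show "\<exists>b\<in>el (transport \<iota> M) x. b \<otimes>\<^bsub>Val (transport \<iota> M) x\<^esub> a = \<one>\<^bsub>Val (transport \<iota> M) x\<^esub>"
        by (rule bexI[of _ "\<iota> x (inv\<^bsub>Val M x\<^esub> m)"]) (use m x in \<open>simp_all add: car mul one\<close>)
    qed (use x in \<open>auto simp: car mul one m_ac\<close>)
  qed
  show ?mod
    unfolding cat_module_def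
  proof (intro conjI ballI grp homI)
    fix x y f a b assume *: "x \<in> Ob C" "y \<in> Ob C" "f \<in> Hom C x y" "a \<in> el (transport \<iota> M) x"
    then obtain m where m: "m \<in> el M x" "a = \<iota> x m" by (auto simp: car)
    show "Map (transport \<iota> M) x y f a \<in> el (transport \<iota> M) y"
      using * m by (simp add: map car Map_closed[OF M])
    assume "b \<in> el (transport \<iota> M) x"
    then obtain m' where m': "m' \<in> el M x" "b = \<iota> x m'" by (auto simp: car)
    interpret group "Val M x" using M *(1) by (rule cat_module_group)
    show "Map (transport \<iota> M) x y f (a \<otimes>\<^bsub>Val (transport \<iota> M) x\<^esub> b) =
       Map (transport \<iota> M) x y f a \<otimes>\<^bsub>Val (transport \<iota> M) y\<^esub> Map (transport \<iota> M) x y f b"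
      using * m m' by (simp add: map mul Map_closed[OF M] Map_mult[OF M])
  next
    fix x a assume *: "x \<in> Ob C" "a \<in> el (transport \<iota> M) x"
    then show "Map (transport \<iota> M) x x (Idt C x) a = a" by (auto simp: car map Map_Idt[OF M])
  next
    fix x y z f g a assume *: "x \<in> Ob C" "y \<in> Ob C" "z \<in> Ob C" "f \<in> Hom C x y" "g \<in> Hom C y z" "a \<in> el (transport \<iota> M) x"
    then show "Map (transport \<iota> M) x z (Cmp C x y z g f) a = Map (transport \<iota> M) y z g (Map (transport \<iota> M) x y f a)"
      by (auto simp: car map Map_Cmp[OF M] Map_closed[OF M])
  qed
  show ?to by (auto simp: module_map_def car mul map intro!: homI)
  have "?v x (a \<otimes>\<^bsub>Val (transport \<iota> M) x\<^esub> b) = ?v x a \<otimes>\<^bsub>Val M x\<^esub> ?v x b"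
    if x: "x \<in> Ob C" and ab: "a \<in> el (transport \<iota> M) x" "b \<in> el (transport \<iota> M) x" for x a b
  proof -
    interpret group "Val M x" using M x by (rule cat_module_group)
    show ?thesis using ab x by (auto simp: car mul inv)
  qed
  then show ?from
    by (auto simp: module_map_def car map inv Map_closed[OF M] intro!: homI)
qed

text \<open>Resolutions live in the universe, whereas permutation modules and free modules are built over
  types of formal sums. A module is therefore replaced by an isomorphic copy whenever its values are
  small enough.\<close>

definition embeddable :: "'u itself \<Rightarrow> ('o, 'h) small_cat \<Rightarrow> ('o, 'h, 'm) cat_module \<Rightarrow> bool" where
  "embeddable U C M \<longleftrightarrow> (\<forall>x\<in>Ob C. \<exists>\<iota> :: 'm \<Rightarrow> 'u. inj_on \<iota> (el M x))"

definition embed :: "('o, 'h, 'm) cat_module \<Rightarrow> 'o \<Rightarrow> 'm \<Rightarrow> 'u" where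
  "embed M x = (SOME \<iota>. inj_on \<iota> (el M x))"

definition unembed :: "('o, 'h, 'm) cat_module \<Rightarrow> 'o \<Rightarrow> 'u \<Rightarrow> 'm" where
  "unembed M x = inv_into (el M x) (embed M x)"

definition copy :: "('o, 'h, 'm) cat_module \<Rightarrow> ('o, 'h, 'u) cat_module" where
  "copy M = transport (embed M) M"

lemma copy_iso:
  fixes M :: "('o, 'h, 'm) cat_module"
  assumes M: "cat_module C M" and e: "embeddable TYPE('u) C M"
  shows "cat_module C (copy M :: ('o, 'h, 'u) cat_module)"
    and "module_map C M (copy M :: ('o, 'h, 'u) cat_module) (embed M)"
    and "module_map C (copy M :: ('o, 'h, 'u) cat_module) M (unembed M)"
    and "x \<in> Ob C \<Longrightarrow> m \<in> el M x \<Longrightarrow> unembed M x (embed M x m :: 'u) = m"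
    and "x \<in> Ob C \<Longrightarrow> a \<in> el (copy M :: ('o, 'h, 'u) cat_module) x \<Longrightarrow> embed M x (unembed M x a) = a"
proof -
  have inj: "inj_on (embed M x :: 'm \<Rightarrow> 'u) (el M x)" if "x \<in> Ob C" for x
  proof -
    have "\<exists>\<iota> :: 'm \<Rightarrow> 'u. inj_on \<iota> (el M x)" using e that by (simp add: embeddable_def)
    then show ?thesis unfolding embed_def by (rule someI_ex)
  qed
  show "cat_module C (copy M :: ('o, 'h, 'u) cat_module)"
    "module_map C M (copy M :: ('o, 'h, 'u) cat_module) (embed M)"
    unfolding copy_def by (rule transport_iso(1)[OF M inj], assumption) (rule transport_iso(2)[OF M inj])
  have eq: "unembed M = (\<lambda>x. inv_into (el M x) (embed M x) :: 'u \<Rightarrow> 'm)" by (simp add: unembed_def fun_eq_iff)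
  show "module_map C (copy M :: ('o, 'h, 'u) cat_module) M (unembed M)"
    unfolding eq copy_def by (rule transport_iso(3)[OF M inj])
  show inv: "x \<in> Ob C \<Longrightarrow> m \<in> el M x \<Longrightarrow> unembed M x (embed M x m :: 'u) = m" for x m
    by (simp add: unembed_def inj)
  show "x \<in> Ob C \<Longrightarrow> a \<in> el (copy M :: ('o, 'h, 'u) cat_module) x \<Longrightarrow> embed M x (unembed M x a) = a"
    using inv by (auto simp: copy_def transport_def)
qed

section \<open>Linearizations of set-valued functors\<close>

text \<open>A functor to sets is given by its values \<open>X\<close> and its action \<open>act\<close> on morphisms.
  Its linearization has the free abelian groups on the values; permutation modules and free modules
  are both of this form.\<close>

definition set_functor ::
  "('o, 'h) small_cat \<Rightarrow> ('o \<Rightarrow> 's set) \<Rightarrow> ('o \<Rightarrow> 'o \<Rightarrow> 'h \<Rightarrow> 's \<Rightarrow> 's) \<Rightarrow> bool" where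
  "set_functor C X act \<longleftrightarrow>
     (\<forall>x\<in>Ob C. \<forall>y\<in>Ob C. \<forall>f\<in>Hom C x y. \<forall>s\<in>X x. act x y f s \<in> X y) \<and>
     (\<forall>x\<in>Ob C. \<forall>s\<in>X x. act x x (Idt C x) s = s) \<and>
     (\<forall>x\<in>Ob C. \<forall>y\<in>Ob C. \<forall>z\<in>Ob C. \<forall>f\<in>Hom C x y. \<forall>g\<in>Hom C y z. \<forall>s\<in>X x.
        act x z (Cmp C x y z g f) s = act y z g (act x y f s))"

definition linearization ::
  "('o \<Rightarrow> 's set) \<Rightarrow> ('o \<Rightarrow> 'o \<Rightarrow> 'h \<Rightarrow> 's \<Rightarrow> 's) \<Rightarrow> ('o, 'h, 's \<Rightarrow>\<^sub>0 int) cat_module" where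
  "linearization X act =
     \<lparr>Val = (\<lambda>x. free_Abelian_group (X x)), Map = (\<lambda>x y f. frag_extend (\<lambda>s. frag_of (act x y f s)))\<rparr>"

lemma linearization_simps [simp]:
  "Val (linearization X act) x = free_Abelian_group (X x)"
  "Map (linearization X act) x y f = frag_extend (\<lambda>s. frag_of (act x y f s))"
  by (simp_all add: linearization_def)

lemma frag_extend_hom:
  assumes "\<And>s. s \<in> S \<Longrightarrow> Poly_Mapping.keys (F s) \<subseteq> T"
  shows "frag_extend F \<in> hom (free_Abelian_group S) (free_Abelian_group T)"
proof (rule homI)
  fix u assume u: "u \<in> carrier (free_Abelian_group S)"
  then show "frag_extend F u \<in> carrier (free_Abelian_group T)"
    using keys_frag_extend[of F u] assms by (simp) blast
qed (simp add: frag_extend_add)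

lemma free_Abelian_group_hom_eq:
  fixes S :: "'a set"
  assumes h: "h \<in> hom (free_Abelian_group S) G" "k \<in> hom (free_Abelian_group S) G" and G: "group G"
    and eq: "\<And>s. s \<in> S \<Longrightarrow> h (frag_of s) = k (frag_of s)" and u: "Poly_Mapping.keys u \<subseteq> S"
  shows "h u = k u"
proof (rule free_Abelian_group_induct[OF u, where P = "\<lambda>u. h u = k u"])
  interpret h: group_hom "free_Abelian_group S" G h by (simp add: group_hom_def group_hom_axioms_def G h)
  interpret k: group_hom "free_Abelian_group S" G k by (simp add: group_hom_def group_hom_axioms_def G h)
  show "h 0 = k 0" using h.hom_one k.hom_one by simp
  fix u v :: "'a \<Rightarrow>\<^sub>0 int" assume uv: "Poly_Mapping.keys u \<subseteq> S" "Poly_Mapping.keys v \<subseteq> S" "h u = k u" "h v = k v"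
  have *: "u - v = u \<otimes>\<^bsub>free_Abelian_group S\<^esub> inv\<^bsub>free_Abelian_group S\<^esub> v" using uv by simp
  have "u \<in> carrier (free_Abelian_group S)" "v \<in> carrier (free_Abelian_group S)" using uv by simp_all
  then show "h (u - v) = k (u - v)"
    unfolding * using uv(3,4) by (simp del: inv_free_Abelian_group mult_free_Abelian_group carrier_free_Abelian_group_iff)
qed (use eq in auto)

lemma cat_module_linearization:
  assumes "set_functor C X act" shows "cat_module C (linearization X act)"
  unfolding cat_module_def
proof (intro conjI ballI)
  fix x assume x: "x \<in> Ob C"
  show "comm_group (Val (linearization X act) x)" by (simp add: abelian_free_Abelian_group)
  fix m assume "m \<in> el (linearization X act) x"
  then have m: "Poly_Mapping.keys m \<subseteq> X x" by simp
  have "frag_extend (\<lambda>s. frag_of (act x x (Idt C x) s)) m = frag_extend frag_of m"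
    by (rule frag_extend_eq) (use assms x m in \<open>auto simp: set_functor_def\<close>)
  then show "Map (linearization X act) x x (Idt C x) m = m" by (simp flip: frag_expansion)
next
  fix x y f assume "x \<in> Ob C" "y \<in> Ob C" "f \<in> Hom C x y"
  then show "Map (linearization X act) x y f \<in> hom (Val (linearization X act) x) (Val (linearization X act) y)"
    using assms by (auto simp: set_functor_def intro!: frag_extend_hom)
next
  fix x y z f g m assume *: "x \<in> Ob C" "y \<in> Ob C" "z \<in> Ob C" "f \<in> Hom C x y" "g \<in> Hom C y z" "m \<in> el (linearization X act) x"
  then have m: "Poly_Mapping.keys m \<subseteq> X x" by simp
  have "frag_extend (\<lambda>s. frag_of (act x z (Cmp C x y z g f) s)) m =
        frag_extend ((\<lambda>s. frag_of (act y z g s)) \<circ> (\<lambda>s. act x y f s)) m"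
    by (rule frag_extend_eq) (use assms * m in \<open>auto simp: set_functor_def\<close>)
  also have "\<dots> = frag_extend (\<lambda>s. frag_of (act y z g s)) (frag_extend (frag_of \<circ> (\<lambda>s. act x y f s)) m)"
    by (simp add: frag_extend_compose)
  finally show "Map (linearization X act) x z (Cmp C x y z g f) m =
      Map (linearization X act) y z g (Map (linearization X act) x y f m)"
    by (simp add: comp_def)
qed

lemma linearization_universal:
  assumes X: "set_functor C X act" and N: "cat_module C N"
    and cl: "\<And>x s. x \<in> Ob C \<Longrightarrow> s \<in> X x \<Longrightarrow> \<phi> x s \<in> el N x"
    and nat: "\<And>x y f s. x \<in> Ob C \<Longrightarrow> y \<in> Ob C \<Longrightarrow> f \<in> Hom C x y \<Longrightarrow> s \<in> X x \<Longrightarrow> \<phi> y (act x y f s) = Map N x y f (\<phi> x s)"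
  obtains \<eta> where "module_map C (linearization X act) N \<eta>"
    "\<And>x s. x \<in> Ob C \<Longrightarrow> s \<in> X x \<Longrightarrow> \<eta> x (frag_of s) = \<phi> x s"
proof -
  have "\<exists>h. h \<in> hom (free_Abelian_group (X x)) (Val N x) \<and> (\<forall>s\<in>X x. h (frag_of s) = \<phi> x s)" if x: "x \<in> Ob C" for x
  proof -
    interpret comm_group "Val N x" using N x by (rule cat_module_comm_group)
    have "\<phi> x ` X x \<subseteq> el N x" using cl x by blast
    from free_Abelian_group_universal[OF this] show ?thesis by metis
  qed
  then obtain \<eta> where \<eta>: "\<And>x. x \<in> Ob C \<Longrightarrow> \<eta> x \<in> hom (free_Abelian_group (X x)) (Val N x)"
      "\<And>x s. x \<in> Ob C \<Longrightarrow> s \<in> X x \<Longrightarrow> \<eta> x (frag_of s) = \<phi> x s"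
    by metis
  have "\<eta> y (Map (linearization X act) x y f m) = Map N x y f (\<eta> x m)"
    if *: "x \<in> Ob C" "y \<in> Ob C" "f \<in> Hom C x y" "m \<in> el (linearization X act) x" for x y f m
  proof (rule free_Abelian_group_hom_eq[where G = "Val N y" and S = "X x"])
    have M: "Map (linearization X act) x y f \<in> hom (free_Abelian_group (X x)) (free_Abelian_group (X y))"
      using Map_hom[OF cat_module_linearization[OF X] *(1-3)] by simp
    show "(\<lambda>m. \<eta> y (Map (linearization X act) x y f m)) \<in> hom (free_Abelian_group (X x)) (Val N y)"
      using hom_compose[OF M \<eta>(1)[OF *(2)]] by (simp add: comp_def)
    show "(\<lambda>m. Map N x y f (\<eta> x m)) \<in> hom (free_Abelian_group (X x)) (Val N y)"
      using hom_compose[OF \<eta>(1)[OF *(1)] Map_hom[OF N *(1-3)]] by (simp add: comp_def)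
    show "group (Val N y)" using N *(2) by (rule cat_module_group)
    show "\<eta> y (Map (linearization X act) x y f (frag_of s)) = Map N x y f (\<eta> x (frag_of s))" if "s \<in> X x" for s
    proof -
      have "act x y f s \<in> X y" using X * that by (simp add: set_functor_def)
      then show ?thesis using * that by (simp add: \<eta> nat)
    qed
  qed (use * in simp)
  then show thesis using that[of \<eta>] \<eta> by (simp add: module_map_def)
qed

lemma frag_extend_onto:
  assumes "Poly_Mapping.keys v \<subseteq> p ` X"
  obtains b where "Poly_Mapping.keys b \<subseteq> X" "frag_extend (frag_of \<circ> p) b = v"
proof -
  define q where "q = inv_into X p"
  have pq: "q t \<in> X" "p (q t) = t" if "t \<in> Poly_Mapping.keys v" for t
    using assms that by (auto simp: q_def inv_into_into f_inv_into_f subset_iff)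
  have "Poly_Mapping.keys (frag_extend (frag_of \<circ> q) v) \<subseteq> X"
    using keys_frag_extend[of "frag_of \<circ> q" v] pq(1) by auto
  moreover have "frag_extend (frag_of \<circ> p) (frag_extend (frag_of \<circ> q) v) = frag_extend frag_of v"
    unfolding frag_extend_compose by (rule frag_extend_eq) (simp add: pq(2))
  ultimately show thesis using that frag_expansion[of v] by simp
qed

lemma linearization_map:
  assumes X: "set_functor C X act" and Y: "set_functor C Y act'"
    and cl: "\<And>x s. x \<in> Ob C \<Longrightarrow> s \<in> X x \<Longrightarrow> p x s \<in> Y x"
    and nat: "\<And>x y f s. x \<in> Ob C \<Longrightarrow> y \<in> Ob C \<Longrightarrow> f \<in> Hom C x y \<Longrightarrow> s \<in> X x \<Longrightarrow> p y (act x y f s) = act' x y f (p x s)"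
  shows "module_map C (linearization X act) (linearization Y act') (\<lambda>x. frag_extend (frag_of \<circ> p x))"
  unfolding module_map_def
proof (intro conjI ballI)
  fix x assume "x \<in> Ob C"
  then show "frag_extend (frag_of \<circ> p x) \<in> hom (Val (linearization X act) x) (Val (linearization Y act') x)"
    using cl by (auto intro!: frag_extend_hom)
next
  fix x y f m assume *: "x \<in> Ob C" "y \<in> Ob C" "f \<in> Hom C x y" "m \<in> el (linearization X act) x"
  have "frag_extend (frag_of \<circ> p y) (frag_extend (frag_of \<circ> act x y f) m) = frag_extend (frag_of \<circ> act' x y f) (frag_extend (frag_of \<circ> p x) m)"
    unfolding frag_extend_compose by (rule frag_extend_eq) (use * nat in auto)
  then show "frag_extend (frag_of \<circ> p y) (Map (linearization X act) x y f m) =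
      Map (linearization Y act') x y f (frag_extend (frag_of \<circ> p x) m)"
    by (simp add: comp_def)
qed

text \<open>The free module with one generator over the object \<open>ob \<tau>\<close> for every \<open>\<tau> \<in> T\<close>.\<close>

definition generated_elements where
  "generated_elements C T ob x = {(\<tau>, f). \<tau> \<in> T \<and> f \<in> Hom C (ob \<tau>) x}"

definition postcompose where
  "postcompose C ob x y g = (\<lambda>(\<tau>, f). (\<tau>, Cmp C (ob \<tau>) x y g f))"

definition free_module where
  "free_module C T ob = linearization (generated_elements C T ob) (postcompose C ob)"

lemma set_functor_free:
  assumes "is_category C" "ob ` T \<subseteq> Ob C"
  shows "set_functor C (generated_elements C T ob) (postcompose C ob)"
proof -
  have ob: "\<And>\<tau>. \<tau> \<in> T \<Longrightarrow> ob \<tau> \<in> Ob C" using assms(2) by blast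
  show ?thesis
    using assms(1) ob unfolding set_functor_def generated_elements_def postcompose_def is_category_def
    by simp
qed

lemma free_module_universal:
  assumes C: "is_category C" "ob ` T \<subseteq> Ob C" and N: "cat_module C N"
    and n: "\<And>\<tau>. \<tau> \<in> T \<Longrightarrow> n \<tau> \<in> el N (ob \<tau>)"
  obtains \<eta> where "module_map C (free_module C T ob) N \<eta>"
    "\<And>x \<tau> f. x \<in> Ob C \<Longrightarrow> \<tau> \<in> T \<Longrightarrow> f \<in> Hom C (ob \<tau>) x \<Longrightarrow> \<eta> x (frag_of (\<tau>, f)) = Map N (ob \<tau>) x f (n \<tau>)"
proof -
  have ob: "\<And>\<tau>. \<tau> \<in> T \<Longrightarrow> ob \<tau> \<in> Ob C" using C(2) by blast
  define \<phi> where "\<phi> x = (\<lambda>(\<tau>, f). Map N (ob \<tau>) x f (n \<tau>))" for x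
  obtain \<eta> where \<eta>: "module_map C (free_module C T ob) N \<eta>"
     "\<And>x s. x \<in> Ob C \<Longrightarrow> s \<in> generated_elements C T ob x \<Longrightarrow> \<eta> x (frag_of s) = \<phi> x s"
    unfolding free_module_def
  proof (rule linearization_universal[OF set_functor_free[OF C] N])
    show "\<phi> x s \<in> el N x" if "x \<in> Ob C" "s \<in> generated_elements C T ob x" for x s
      using that ob n by (auto simp: \<phi>_def generated_elements_def intro!: Map_closed[OF N])
    show "\<phi> y (postcompose C ob x y f s) = Map N x y f (\<phi> x s)"
      if "x \<in> Ob C" "y \<in> Ob C" "f \<in> Hom C x y" "s \<in> generated_elements C T ob x" for x y f s
      using that ob n by (auto simp: \<phi>_def generated_elements_def postcompose_def Map_Cmp[OF N])
  qed (use that in auto)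
  then show thesis using that[of \<eta>] by (simp add: generated_elements_def \<phi>_def)
qed

lemma cat_module_free: "is_category C \<Longrightarrow> ob ` T \<subseteq> Ob C \<Longrightarrow> cat_module C (free_module C T ob)"
  unfolding free_module_def by (intro cat_module_linearization set_functor_free)

lemma lifts_free:
  assumes C: "is_category C" "ob ` T \<subseteq> Ob C"
  shows "lifts TYPE('u) C (free_module C T ob)"
  unfolding lifts_def
proof (intro allI impI)
  let ?F = "free_module C T ob"
  fix B D :: "('a, 'b, 'u) cat_module" and \<pi> f
  assume B: "cat_module C B" and D: "cat_module C D" and s: "module_surj C B D \<pi>" and f: "module_map C ?F D f"
  have pm: "module_map C B D \<pi>" and ps: "\<And>x. x \<in> Ob C \<Longrightarrow> \<pi> x ` el B x = el D x"
    using s by (auto simp: module_surj_def)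
  have ob: "\<And>\<tau>. \<tau> \<in> T \<Longrightarrow> ob \<tau> \<in> Ob C" using C(2) by blast
  have F: "cat_module C ?F" using C by (rule cat_module_free)
  have idt: "Idt C (ob \<tau>) \<in> Hom C (ob \<tau>) (ob \<tau>)" if "\<tau> \<in> T" for \<tau>
    using C(1) ob[OF that] by (simp add: is_category_def)
  have gen: "frag_of (\<tau>, h) \<in> el ?F x" if "\<tau> \<in> T" "h \<in> Hom C (ob \<tau>) x" for \<tau> h x
    using that by (simp add: free_module_def generated_elements_def)
  have "\<exists>b. b \<in> el B (ob \<tau>) \<and> \<pi> (ob \<tau>) b = f (ob \<tau>) (frag_of (\<tau>, Idt C (ob \<tau>)))" if t: "\<tau> \<in> T" for \<tau>
  proof -
    have "f (ob \<tau>) (frag_of (\<tau>, Idt C (ob \<tau>))) \<in> el D (ob \<tau>)"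
      using module_map_closed[OF f ob[OF t] gen[OF t idt[OF t]]] .
    then show ?thesis using ps[OF ob[OF t]] by (metis imageE)
  qed
  then obtain n where n: "\<And>\<tau>. \<tau> \<in> T \<Longrightarrow> n \<tau> \<in> el B (ob \<tau>)"
     "\<And>\<tau>. \<tau> \<in> T \<Longrightarrow> \<pi> (ob \<tau>) (n \<tau>) = f (ob \<tau>) (frag_of (\<tau>, Idt C (ob \<tau>)))"
    by metis
  obtain g where g: "module_map C ?F B g"
    "\<And>x \<tau> h. x \<in> Ob C \<Longrightarrow> \<tau> \<in> T \<Longrightarrow> h \<in> Hom C (ob \<tau>) x \<Longrightarrow> g x (frag_of (\<tau>, h)) = Map B (ob \<tau>) x h (n \<tau>)"
    using free_module_universal[OF C B n(1)] by metis
  have "\<pi> x (g x u) = f x u" if x: "x \<in> Ob C" and u: "u \<in> el ?F x" for x u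
  proof (rule free_Abelian_group_hom_eq[where G = "Val D x" and S = "generated_elements C T ob x"])
    have eq: "free_Abelian_group (generated_elements C T ob x) = Val ?F x" by (simp add: free_module_def)
    show "(\<lambda>u. \<pi> x (g x u)) \<in> hom (free_Abelian_group (generated_elements C T ob x)) (Val D x)"
      unfolding eq using module_map_hom[OF module_map_comp[OF g(1) pm] x] .
    show "f x \<in> hom (free_Abelian_group (generated_elements C T ob x)) (Val D x)"
      unfolding eq using module_map_hom[OF f x] by simp
    show "group (Val D x)" using D x by (rule cat_module_group)
    fix s assume "s \<in> generated_elements C T ob x"
    then obtain \<tau> h where s: "s = (\<tau>, h)" "\<tau> \<in> T" "h \<in> Hom C (ob \<tau>) x" by (auto simp: generated_elements_def)
    have "\<pi> x (g x (frag_of s)) = Map D (ob \<tau>) x h (\<pi> (ob \<tau>) (n \<tau>))"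
      using s x ob n by (simp add: g module_map_nat[OF pm])
    also have "\<dots> = f x (Map ?F (ob \<tau>) x h (frag_of (\<tau>, Idt C (ob \<tau>))))"
      using s x ob n gen idt by (simp add: module_map_nat[OF f])
    also have "Map ?F (ob \<tau>) x h (frag_of (\<tau>, Idt C (ob \<tau>))) = frag_of s"
      using C(1) ob s x by (simp add: free_module_def postcompose_def is_category_def)
    finally show "\<pi> x (g x (frag_of s)) = f x (frag_of s)" .

  qed (use u in \<open>simp add: free_module_def\<close>)
  then show "\<exists>g. module_map C ?F B g \<and> (\<forall>x\<in>Ob C. \<forall>p\<in>el ?F x. \<pi> x (g x p) = f x p)" using g(1) by blast
qed

section \<open>Enough projectives\<close>

text \<open>For countable categories every infinite type is a large enough universe: the free cover of a
  module in the universe has generators indexed by countably many objects and morphisms and by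
  elements of \<open>'u\<close>, and infinite cardinals absorb products with countable sets and the formation of
  free abelian groups.\<close>

definition countable_category :: "('o, 'h) small_cat \<Rightarrow> bool" where
  "countable_category C \<longleftrightarrow> is_category C \<and> countable (Ob C) \<and> (\<forall>x\<in>Ob C. \<forall>y\<in>Ob C. countable (Hom C x y))"

abbreviation all_elements where
  "all_elements C A \<equiv> {(z, a). z \<in> Ob C \<and> a \<in> el A z}"

definition free_cover where
  "free_cover C A = free_module C (all_elements C A) fst"

lemma free_cover_surj:
  assumes C: "is_category C" and A: "cat_module C A"
  obtains r where "module_surj C (free_cover C A) A r"
proof -
  have ob: "fst ` all_elements C A \<subseteq> Ob C" by auto
  obtain r where r: "module_map C (free_cover C A) A r"
    "\<And>x \<tau> f. x \<in> Ob C \<Longrightarrow> \<tau> \<in> all_elements C A \<Longrightarrow> f \<in> Hom C (fst \<tau>) x \<Longrightarrow> r x (frag_of (\<tau>, f)) = Map A (fst \<tau>) x f (snd \<tau>)"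
    unfolding free_cover_def by (rule free_module_universal[OF C ob A, of snd]) auto
  have "r x ` el (free_cover C A) x = el A x" if x: "x \<in> Ob C" for x
  proof
    show "r x ` el (free_cover C A) x \<subseteq> el A x" using module_map_closed[OF r(1) x] by blast
    show "el A x \<subseteq> r x ` el (free_cover C A) x"
    proof
      fix a assume a: "a \<in> el A x"
      have idt: "Idt C x \<in> Hom C x x" using C x by (simp add: is_category_def)
      have "r x (frag_of ((x, a), Idt C x)) = a" using r(2)[OF x, of "(x, a)"] a x idt by (simp add: Map_Idt[OF A])
      moreover have "frag_of ((x, a), Idt C x) \<in> el (free_cover C A) x"
        using a x idt by (simp add: free_cover_def free_module_def generated_elements_def)
      ultimately show "a \<in> r x ` el (free_cover C A) x" by (metis imageI)
    qed
  qed
  then have "module_surj C (free_cover C A) A r" using r(1) by (simp add: module_surj_def)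
  then show thesis by (rule that)
qed

lemma embed_free_Abelian_group:
  assumes inf: "infinite (UNIV :: 'u set)" and e: "inj_on (e :: 's \<Rightarrow> 'u) S"
  shows "\<exists>\<iota> :: ('s \<Rightarrow>\<^sub>0 int) \<Rightarrow> 'u. inj_on \<iota> (carrier (free_Abelian_group S))"
proof -
  obtain \<beta> where \<beta>: "bij_betw \<beta> (carrier (free_Abelian_group (UNIV :: 'u set))) (UNIV :: 'u set)"
    using eqpoll_free_Abelian_group_infinite[OF inf] by (auto simp: eqpoll_def)
  have "inj_on (frag_extend (frag_of \<circ> e)) (carrier (free_Abelian_group S))"
  proof (rule inj_on_inverseI[where g = "frag_extend (frag_of \<circ> inv_into S e)"])
    fix u :: "'s \<Rightarrow>\<^sub>0 int" assume "u \<in> carrier (free_Abelian_group S)"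
    then have u: "Poly_Mapping.keys u \<subseteq> S" by simp
    have "frag_extend (frag_of \<circ> inv_into S e \<circ> e) u = frag_extend frag_of u"
      by (rule frag_extend_eq) (use e u in auto)
    then show "frag_extend (frag_of \<circ> inv_into S e) (frag_extend (frag_of \<circ> e) u) = u"
      by (simp add: frag_extend_compose flip: frag_expansion)
  qed
  then have "inj_on (\<beta> \<circ> frag_extend (frag_of \<circ> e)) (carrier (free_Abelian_group S))"
    using \<beta> by (intro comp_inj_on) (auto simp: bij_betw_def intro: inj_on_subset)
  then show ?thesis by blast
qed

lemma embed_countable:
  assumes inf: "infinite (UNIV :: 'u set)" and "countable S"
  shows "\<exists>e :: 's \<Rightarrow> 'u. inj_on e S"
proof -
  obtain f :: "nat \<Rightarrow> 'u" where "inj f" using inf infinite_countable_subset by blast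
  moreover obtain g :: "'s \<Rightarrow> nat" where "inj_on g S" using assms(2) by (auto simp: countable_def)
  ultimately have "inj_on (f \<circ> g) S" by (auto intro: comp_inj_on inj_on_subset)
  then show ?thesis by blast
qed

lemma embeddable_linearization:
  fixes X :: "'o \<Rightarrow> 's set"
  assumes "infinite (UNIV :: 'u set)" "\<And>x. x \<in> Ob C \<Longrightarrow> countable (X x)"
  shows "embeddable TYPE('u) C (linearization X act)"
  unfolding embeddable_def
proof
  fix x assume x: "x \<in> Ob C"
  obtain e :: "'s \<Rightarrow> 'u" where "inj_on e (X x)" using embed_countable[OF assms(1) assms(2)[OF x]] by blast
  from embed_free_Abelian_group[OF assms(1) this]
  show "\<exists>\<iota> :: ('s \<Rightarrow>\<^sub>0 int) \<Rightarrow> 'u. inj_on \<iota> (el (linearization X act) x)" by simp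
qed

lemma embeddable_free_cover:
  fixes C :: "('o, 'h) small_cat" and A :: "('o, 'h, 'u) cat_module"
  assumes inf: "infinite (UNIV :: 'u set)" and C: "countable_category C"
  shows "embeddable TYPE('u) C (free_cover C A)"
  unfolding embeddable_def
proof
  fix x assume x: "x \<in> Ob C"
  have "countable (Ob C)" using C by (simp add: countable_category_def)
  then obtain e1 :: "'o \<Rightarrow> 'u" where e1: "inj_on e1 (Ob C)"
    using embed_countable[OF inf] by blast
  have "countable (\<Union>z\<in>Ob C. Hom C z x)" using C x by (auto simp: countable_category_def)
  then obtain e2 :: "'h \<Rightarrow> 'u" where e2: "inj_on e2 (\<Union>z\<in>Ob C. Hom C z x)"
    using embed_countable[OF inf] by blast
  obtain p :: "'u \<times> 'u \<Rightarrow> 'u" where p: "inj p"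
    using Times_same_infinite_bij_betw_types[OF inf] by (auto simp: bij_def)
  have "inj_on (\<lambda>((z, a), f). p (p (e1 z, a), e2 f)) (generated_elements C (all_elements C A) fst x)"
  proof (rule inj_onI)
    fix s t assume st: "s \<in> generated_elements C (all_elements C A) fst x" "t \<in> generated_elements C (all_elements C A) fst x"
      and eq': "(\<lambda>((z, a), f). p (p (e1 z, a), e2 f)) s = (\<lambda>((z, a), f). p (p (e1 z, a), e2 f)) t"
    obtain z a f z' a' f' where s: "s = ((z, a), f)" "t = ((z', a'), f')" by (metis surj_pair)
    have eq: "p (p (e1 z, a), e2 f) = p (p (e1 z', a'), e2 f')" using eq' s by simp
    from st s have *: "z \<in> Ob C" "z' \<in> Ob C" "f \<in> (\<Union>z\<in>Ob C. Hom C z x)" "f' \<in> (\<Union>z\<in>Ob C. Hom C z x)"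
      by (auto simp: generated_elements_def)
    have "p (e1 z, a) = p (e1 z', a')" "e2 f = e2 f'" using injD[OF p eq] by simp_all
    moreover from this have "e1 z = e1 z'" "a = a'" using injD[OF p, of "(e1 z, a)" "(e1 z', a')"] by simp_all
    ultimately show "s = t"
      using s inj_onD[OF e1 _ *(1,2)] inj_onD[OF e2 _ *(3,4)] by simp
  qed
  from embed_free_Abelian_group[OF inf this]
  show "\<exists>\<iota> :: (('o \<times> 'u) \<times> 'h \<Rightarrow>\<^sub>0 int) \<Rightarrow> 'u. inj_on \<iota> (el (free_cover C A) x)"
    by (simp add: free_cover_def free_module_def)
qed

lemma module_surj_comp_iso:
  assumes "module_surj C P A r" and i: "module_map C Q P i" and j: "module_map C P Q j"
    and "\<And>x p. x \<in> Ob C \<Longrightarrow> p \<in> el P x \<Longrightarrow> i x (j x p) = p"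
  shows "module_surj C Q A (\<lambda>x q. r x (i x q))"
  unfolding module_surj_def
proof (intro conjI ballI)
  have r: "module_map C P A r" "\<And>x. x \<in> Ob C \<Longrightarrow> r x ` el P x = el A x" using assms(1) by (auto simp: module_surj_def)
  show "module_map C Q A (\<lambda>x q. r x (i x q))" using i r(1) by (rule module_map_comp)
  fix x assume x: "x \<in> Ob C"
  have "i x ` el Q x = el P x"
    using module_map_closed[OF i x] module_map_closed[OF j x] assms(4)[OF x] by (metis (no_types, lifting) image_eqI image_subset_iff subsetI subset_antisym)
  then show "(\<lambda>q. r x (i x q)) ` el Q x = el A x" using r(2)[OF x] by (metis image_image)
qed

lemma enough_projectives:
  fixes A :: "('o, 'h, 'u) cat_module"
  assumes inf: "infinite (UNIV :: 'u set)" and C: "countable_category C" and A: "cat_module C A"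
  obtains P :: "('o, 'h, 'u) cat_module" and \<pi> where "projective_module C P" "module_surj C P A \<pi>"
proof -
  let ?F = "free_cover C A"
  have cat: "is_category C" using C by (simp add: countable_category_def)
  have ob: "fst ` all_elements C A \<subseteq> Ob C" by auto
  have F: "cat_module C ?F" unfolding free_cover_def by (rule cat_module_free[OF cat ob])
  note iso = copy_iso[OF F embeddable_free_cover[OF inf C]]
  have "projective_module C (copy ?F :: ('o, 'h, 'u) cat_module)"
    unfolding projective_module_iff
    using lifts_retract[OF lifts_free[OF cat ob, folded free_cover_def] iso(3,2)] iso(1,5) by blast
  moreover obtain r where "module_surj C ?F A r" using free_cover_surj[OF cat A] .
  ultimately show thesis using that module_surj_comp_iso[OF _ iso(3,2)] iso(4) by blast
qed

text \<open>Every property of free modules that passes to direct summands therefore holds for projective modules.\<close>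

lemma projective_retract_of_free:
  fixes P :: "('o, 'h, 'u) cat_module"
  assumes inf: "infinite (UNIV :: 'u set)" and C: "countable_category C" and P: "projective_module C P"
  obtains i r where "module_map C P (free_cover C P) i" "module_map C (free_cover C P) P r"
    "\<And>x p. x \<in> Ob C \<Longrightarrow> p \<in> el P x \<Longrightarrow> r x (i x p) = p"
proof -
  let ?F = "free_cover C P"
  have P': "cat_module C P" using P by (simp add: projective_module_iff)
  have cat: "is_category C" using C by (simp add: countable_category_def)
  have ob: "fst ` all_elements C P \<subseteq> Ob C" by auto
  have F: "cat_module C ?F" unfolding free_cover_def by (rule cat_module_free[OF cat ob])
  note iso = copy_iso[OF F embeddable_free_cover[OF inf C]]
  obtain r where r: "module_surj C ?F P r" using free_cover_surj[OF cat P'] .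
  obtain g where g: "module_map C P (copy ?F :: ('o, 'h, 'u) cat_module) g"
    "\<And>x p. x \<in> Ob C \<Longrightarrow> p \<in> el P x \<Longrightarrow> r x (unembed ?F x (g x p)) = p"
    using projective_lift[OF P iso(1) P' module_surj_comp_iso[OF r iso(3,2)] module_map_id] iso(4) by metis
  have "module_map C P ?F (\<lambda>x p. unembed ?F x (g x p))" by (rule module_map_comp[OF g(1) iso(3)])
  then show thesis using that r g(2) unfolding module_surj_def by blast
qed

section \<open>Projective dimension\<close>

primrec pd_le :: "('o, 'h) small_cat \<Rightarrow> nat \<Rightarrow> ('o, 'h, 'u) cat_module \<Rightarrow> bool" where
  "pd_le C 0 = projective_module C"
| "pd_le C (Suc n) = (\<lambda>A. \<exists>(P :: ('o, 'h, 'u) cat_module) (B :: ('o, 'h, 'u) cat_module) j \<pi>. projective_module C P \<and> short_exact C B j P \<pi> A \<and> pd_le C n B)"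

text \<open>The identity of \<open>B\<close> factors through \<open>A \<oplus> Q\<close> for a projective \<open>Q\<close>; in other words, \<open>B\<close> is
  stably a direct summand of \<open>A\<close>. This relation passes to syzygies of arbitrary projective covers,
  so that it does the work of Schanuel's lemma, and writing out the factorization avoids the
  construction of direct sums.\<close>

definition stable_retract :: "('o, 'h) small_cat \<Rightarrow> ('o, 'h, 'u) cat_module \<Rightarrow> ('o, 'h, 'u) cat_module \<Rightarrow> bool" where
  "stable_retract C B A \<longleftrightarrow> (\<exists>(Q :: ('o, 'h, 'u) cat_module) f g \<alpha> \<beta>. projective_module C Q \<and>
     module_map C B A f \<and> module_map C A B g \<and> module_map C B Q \<alpha> \<and> module_map C Q B \<beta> \<and>
     (\<forall>x\<in>Ob C. \<forall>b\<in>el B x. b = g x (f x b) \<otimes>\<^bsub>Val B x\<^esub> \<beta> x (\<alpha> x b)))"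

lemma stable_retract_intro:
  fixes A B Q :: "('o, 'h, 'u) cat_module"
  assumes "projective_module C Q" "module_map C B A f" "module_map C A B g" "module_map C B Q \<alpha>" "module_map C Q B \<beta>"
    "\<And>x b. x \<in> Ob C \<Longrightarrow> b \<in> el B x \<Longrightarrow> b = g x (f x b) \<otimes>\<^bsub>Val B x\<^esub> \<beta> x (\<alpha> x b)"
  shows "stable_retract C B A"
  unfolding stable_retract_def
  by (rule exI[of _ Q], rule exI[of _ f], rule exI[of _ g], rule exI[of _ \<alpha>], rule exI[of _ \<beta>]) (simp add: assms)

lemma stable_retract_elim:
  fixes A B :: "('o, 'h, 'u) cat_module"
  assumes "stable_retract C B A"
  obtains Q :: "('o, 'h, 'u) cat_module" and f g \<alpha> \<beta> where "projective_module C Q" "module_map C B A f"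
    "module_map C A B g" "module_map C B Q \<alpha>" "module_map C Q B \<beta>"
    "\<And>x b. x \<in> Ob C \<Longrightarrow> b \<in> el B x \<Longrightarrow> g x (f x b) \<otimes>\<^bsub>Val B x\<^esub> \<beta> x (\<alpha> x b) = b"
proof -
  from assms obtain Q :: "('o, 'h, 'u) cat_module" and f g \<alpha> \<beta> where *: "projective_module C Q \<and>
     module_map C B A f \<and> module_map C A B g \<and> module_map C B Q \<alpha> \<and> module_map C Q B \<beta> \<and>
     (\<forall>x\<in>Ob C. \<forall>b\<in>el B x. b = g x (f x b) \<otimes>\<^bsub>Val B x\<^esub> \<beta> x (\<alpha> x b))"
    unfolding stable_retract_def by (elim exE) (rule that)
  show thesis
    by (rule that[of Q f g \<alpha> \<beta>]) (use * in simp_all)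
qed

lemma projective_cat_module: "projective_module C P \<Longrightarrow> cat_module C P"
  by (simp add: projective_module_def)

text \<open>Lift the two factors of the identity of \<open>B\<close> to the projective covers. The composite \<open>u\<close> of the
  lifts covers the identity of \<open>B\<close>, hence \<open>id - u\<close> maps \<open>P\<close> into the syzygy \<open>B'\<close>. On \<open>B'\<close> the part of
  \<open>u\<close> through \<open>Q\<close> vanishes, and what remains expresses the identity of \<open>B'\<close> by a map through \<open>A'\<close> and
  a map through the projective module \<open>P\<close>.\<close>

lemma stable_retract_syzygy:
  fixes A A' B B' P P' :: "('o, 'h, 'u) cat_module"
  assumes B': "short_exact C B' j P \<pi> B" and P: "projective_module C P"
    and A': "short_exact C A' j' P' \<pi>' A" and P': "projective_module C P'"
    and st: "stable_retract C B A"
  shows "stable_retract C B' A'"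
proof -
  obtain Q :: "('o, 'h, 'u) cat_module" and f g \<alpha> \<beta> where Q: "projective_module C Q"
    and f: "module_map C B A f" and g: "module_map C A B g"
    and \<alpha>: "module_map C B Q \<alpha>" and \<beta>: "module_map C Q B \<beta>"
    and eq: "\<And>x b. x \<in> Ob C \<Longrightarrow> b \<in> el B x \<Longrightarrow> g x (f x b) \<otimes>\<^bsub>Val B x\<^esub> \<beta> x (\<alpha> x b) = b"
    by (rule stable_retract_elim[OF st]) (rule that)
  note b = short_exactD[OF B'] and a = short_exactD[OF A']
  have Qm: "cat_module C Q" using Q by (rule projective_cat_module)
  obtain f1 where f1: "module_map C P P' f1" "\<And>x p. x \<in> Ob C \<Longrightarrow> p \<in> el P x \<Longrightarrow> \<pi>' x (f1 x p) = f x (\<pi> x p)"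
    by (rule projective_lift[OF P a(2,3,5) module_map_comp[OF b(6) f]]) (rule that)
  obtain g1 where g1: "module_map C P' P g1" "\<And>x p. x \<in> Ob C \<Longrightarrow> p \<in> el P' x \<Longrightarrow> \<pi> x (g1 x p) = g x (\<pi>' x p)"
    by (rule projective_lift[OF P' b(2,3,5) module_map_comp[OF a(6) g]]) (rule that)
  obtain b1 where b1: "module_map C Q P b1" "\<And>x q. x \<in> Ob C \<Longrightarrow> q \<in> el Q x \<Longrightarrow> \<pi> x (b1 x q) = \<beta> x q"
    by (rule projective_lift[OF Q b(2,3,5) \<beta>]) (rule that)
  define u where "u x p = g1 x (f1 x p) \<otimes>\<^bsub>Val P x\<^esub> b1 x (\<alpha> x (\<pi> x p))" for x p
  define s where "s x p = p \<otimes>\<^bsub>Val P x\<^esub> inv\<^bsub>Val P x\<^esub> (u x p)" for x p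
  have u: "module_map C P P u"
    unfolding u_def
    by (rule module_map_sum[OF b(2) module_map_comp[OF f1(1) g1(1)]
          module_map_comp[OF module_map_comp[OF b(6) \<alpha>] b1(1)]])
  have s: "module_map C P P s"
    unfolding s_def by (rule module_map_sum[OF b(2) module_map_id module_map_neg[OF b(2,2) u]])
  have \<pi>u: "\<pi> x (u x p) = \<pi> x p" if "x \<in> Ob C" "p \<in> el P x" for x p
  proof -
    have cl: "g1 x (f1 x p) \<in> el P x" "b1 x (\<alpha> x (\<pi> x p)) \<in> el P x" "f1 x p \<in> el P' x"
        "\<pi> x p \<in> el B x" "\<alpha> x (\<pi> x p) \<in> el Q x"
      using that by (simp_all add: module_map_closed[OF f1(1)] module_map_closed[OF g1(1)] module_map_closed[OF b1(1)] module_map_closed[OF \<alpha>] module_map_closed[OF b(6)])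
    have "\<pi> x (u x p) = g x (f x (\<pi> x p)) \<otimes>\<^bsub>Val B x\<^esub> \<beta> x (\<alpha> x (\<pi> x p))"
      unfolding u_def module_map_mult[OF b(6) that(1) cl(1,2)] using that cl by (simp add: g1(2) f1(2) b1(2))
    then show ?thesis using eq[OF that(1) cl(4)] by simp
  qed
  have im_s: "s x p \<in> j x ` el B' x" if x: "x \<in> Ob C" and p: "p \<in> el P x" for x p
  proof (rule b(9)[OF x])
    interpret PG: group "Val P x" using b(2) x by (rule cat_module_group)
    interpret BG: group "Val B x" using b(3) x by (rule cat_module_group)
    show "s x p \<in> el P x" using s x p by (rule module_map_closed)
    have up: "u x p \<in> el P x" using u x p by (rule module_map_closed)
    have "\<pi> x (s x p) = \<pi> x p \<otimes>\<^bsub>Val B x\<^esub> inv\<^bsub>Val B x\<^esub> (\<pi> x (u x p))"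
      unfolding s_def using x p up by (simp add: module_map_mult[OF b(6)] module_map_inv[OF b(6,2,3)])
    then show "\<pi> x (s x p) = \<one>\<^bsub>Val B x\<^esub>"
      using \<pi>u[OF x p] module_map_closed[OF b(6) x p] by simp
  qed
  obtain f' where f': "module_map C B' A' f'" "\<And>x m. x \<in> Ob C \<Longrightarrow> m \<in> el B' x \<Longrightarrow> j' x (f' x m) = f1 x (j x m)"
  proof (rule factor_through_injection[OF a(4) a(7) a(1) b(1) module_map_comp[OF b(4) f1(1)]])
    fix x m assume x: "x \<in> Ob C" and m: "m \<in> el B' x"
    have jm: "j x m \<in> el P x" using b(4) x m by (rule module_map_closed)
    show "f1 x (j x m) \<in> j' x ` el A' x"
      by (rule a(9)[OF x module_map_closed[OF f1(1) x jm]])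
        (use x m jm in \<open>simp add: f1(2) b(8) module_map_one[OF f b(3) a(3)]\<close>)
  qed auto
  obtain g' where g': "module_map C A' B' g'" "\<And>x m. x \<in> Ob C \<Longrightarrow> m \<in> el A' x \<Longrightarrow> j x (g' x m) = g1 x (j' x m)"
  proof (rule factor_through_injection[OF b(4) b(7) b(1) a(1) module_map_comp[OF a(4) g1(1)]])
    fix x m assume x: "x \<in> Ob C" and m: "m \<in> el A' x"
    have jm: "j' x m \<in> el P' x" using a(4) x m by (rule module_map_closed)
    show "g1 x (j' x m) \<in> j x ` el B' x"
      by (rule b(9)[OF x module_map_closed[OF g1(1) x jm]])
        (use x m jm in \<open>simp add: g1(2) a(8) module_map_one[OF g a(3) b(3)]\<close>)
  qed auto
  obtain t where t: "module_map C P B' t" "\<And>x p. x \<in> Ob C \<Longrightarrow> p \<in> el P x \<Longrightarrow> j x (t x p) = s x p"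
    by (rule factor_through_injection[OF b(4,7,1,2) s im_s]) (assumption | rule that)+
  have "m = g' x (f' x m) \<otimes>\<^bsub>Val B' x\<^esub> t x (j x m)" if x: "x \<in> Ob C" and m: "m \<in> el B' x" for x m
  proof (rule inj_onD[OF b(7)[OF x]])
    interpret B'G: group "Val B' x" using b(1) x by (rule cat_module_group)
    interpret PG: comm_group "Val P x" using b(2) x by (rule cat_module_comm_group)
    have cl: "j x m \<in> el P x" "f' x m \<in> el A' x" "g' x (f' x m) \<in> el B' x" "t x (j x m) \<in> el B' x"
      "g1 x (f1 x (j x m)) \<in> el P x"
      using x m by (simp_all add: module_map_closed[OF b(4)] module_map_closed[OF f'(1)] module_map_closed[OF g'(1)] module_map_closed[OF t(1)] module_map_closed[OF f1(1)] module_map_closed[OF g1(1)])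
    show "m \<in> el B' x" "g' x (f' x m) \<otimes>\<^bsub>Val B' x\<^esub> t x (j x m) \<in> el B' x" using m cl by simp_all
    have "u x (j x m) = g1 x (f1 x (j x m))"
      using x m cl unfolding u_def
      by (simp add: b(8) module_map_one[OF \<alpha> b(3) Qm] module_map_one[OF b1(1) Qm b(2)])
    then have "s x (j x m) = j x m \<otimes>\<^bsub>Val P x\<^esub> inv\<^bsub>Val P x\<^esub> (g1 x (f1 x (j x m)))" by (simp add: s_def)
    then show "j x m = j x (g' x (f' x m) \<otimes>\<^bsub>Val B' x\<^esub> t x (j x m))"
      using x m cl by (simp add: module_map_mult[OF b(4)] g'(2) f'(2) t(2) PG.m_lcomm[of "g1 x (f1 x (j x m))" "j x m"])
  qed
  then show ?thesis by (rule stable_retract_intro[OF P f'(1) g'(1) b(4) t(1)])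
qed

locale module_universe =
  fixes C :: "('o, 'h) small_cat" and U :: "'u itself"
  assumes infinite_universe: "infinite (UNIV :: 'u set)"
    and countable: "countable_category C"
begin

lemma enough_projectives':
  fixes A :: "('o, 'h, 'u) cat_module"
  assumes A: "cat_module C A"
  obtains P B :: "('o, 'h, 'u) cat_module" and j \<pi> where "projective_module C P" "short_exact C B j P \<pi> A"
proof -
  obtain P :: "('o, 'h, 'u) cat_module" and \<pi> where P: "projective_module C P" "module_surj C P A \<pi>"
    using enough_projectives[OF infinite_universe countable A] .
  show thesis by (rule that[OF P(1) kernel_exact[OF projective_cat_module[OF P(1)] A P(2)]])
qed

lemma stable_retractI:
  fixes A B :: "('o, 'h, 'u) cat_module"
  assumes A: "cat_module C A" and B: "cat_module C B" and f: "module_map C B A f" and g: "module_map C A B g"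
    and gf: "\<And>x b. x \<in> Ob C \<Longrightarrow> b \<in> el B x \<Longrightarrow> g x (f x b) = b"
  shows "stable_retract C B A"
proof -
  obtain Q :: "('o, 'h, 'u) cat_module" and \<pi> where Q: "projective_module C Q" "module_surj C Q A \<pi>"
    using enough_projectives[OF infinite_universe countable A] .
  have Qm: "cat_module C Q" using Q(1) by (rule projective_cat_module)
  have "b = g x (f x b) \<otimes>\<^bsub>Val B x\<^esub> \<one>\<^bsub>Val B x\<^esub>" if "x \<in> Ob C" "b \<in> el B x" for x b
  proof -
    interpret group "Val B x" using B that(1) by (rule cat_module_group)
    show ?thesis using gf that by simp
  qed
  then show ?thesis
    by (rule stable_retract_intro[OF Q(1) f g module_map_zero[OF Qm] module_map_zero[OF B]])
qed

lemma pd_le_stable_retract: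
  fixes A B :: "('o, 'h, 'u) cat_module"
  assumes "pd_le C n A" "stable_retract C B A" "cat_module C B"
  shows "pd_le C n B"
  using assms
proof (induction n arbitrary: A B)
  case (0 A B)
  obtain Q :: "('o, 'h, 'u) cat_module" and f g \<alpha> \<beta> where Q: "projective_module C Q"
    and f: "module_map C B A f" and g: "module_map C A B g"
    and \<alpha>: "module_map C B Q \<alpha>" and \<beta>: "module_map C Q B \<beta>"
    and eq: "\<And>x b. x \<in> Ob C \<Longrightarrow> b \<in> el B x \<Longrightarrow> g x (f x b) \<otimes>\<^bsub>Val B x\<^esub> \<beta> x (\<alpha> x b) = b"
    by (rule stable_retract_elim[OF 0(2)]) (rule that)
  have A: "projective_module C A" using 0(1) by simp
  have "lifts TYPE('u) C B"
    unfolding lifts_def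
  proof (intro allI impI)
    fix E D :: "('o, 'h, 'u) cat_module" and \<pi> h
    assume E: "cat_module C E" and D: "cat_module C D" and \<pi>: "module_surj C E D \<pi>" and h: "module_map C B D h"
    have \<pi>m: "module_map C E D \<pi>" using \<pi> by (simp add: module_surj_def)
    obtain k1 where k1: "module_map C A E k1" "\<And>x a. x \<in> Ob C \<Longrightarrow> a \<in> el A x \<Longrightarrow> \<pi> x (k1 x a) = h x (g x a)"
      using projective_lift[OF A E D \<pi> module_map_comp[OF g h]] by metis
    obtain k2 where k2: "module_map C Q E k2" "\<And>x a. x \<in> Ob C \<Longrightarrow> a \<in> el Q x \<Longrightarrow> \<pi> x (k2 x a) = h x (\<beta> x a)"
      using projective_lift[OF Q E D \<pi> module_map_comp[OF \<beta> h]] by metis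
    have "module_map C B E (\<lambda>x b. k1 x (f x b) \<otimes>\<^bsub>Val E x\<^esub> k2 x (\<alpha> x b))"
      by (rule module_map_sum[OF E module_map_comp[OF f k1(1)] module_map_comp[OF \<alpha> k2(1)]])
    moreover have "\<pi> x (k1 x (f x b) \<otimes>\<^bsub>Val E x\<^esub> k2 x (\<alpha> x b)) = h x b" if x: "x \<in> Ob C" and b: "b \<in> el B x" for x b
    proof -
      have cl: "f x b \<in> el A x" "\<alpha> x b \<in> el Q x" "k1 x (f x b) \<in> el E x" "k2 x (\<alpha> x b) \<in> el E x"
        "g x (f x b) \<in> el B x" "\<beta> x (\<alpha> x b) \<in> el B x"
        using x b by (simp_all add: module_map_closed[OF f] module_map_closed[OF g] module_map_closed[OF \<alpha>] module_map_closed[OF \<beta>] module_map_closed[OF k1(1)] module_map_closed[OF k2(1)])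
      have "\<pi> x (k1 x (f x b) \<otimes>\<^bsub>Val E x\<^esub> k2 x (\<alpha> x b)) = h x (g x (f x b)) \<otimes>\<^bsub>Val D x\<^esub> h x (\<beta> x (\<alpha> x b))"
        unfolding module_map_mult[OF \<pi>m x cl(3,4)] using x cl by (simp add: k1(2) k2(2))
      also have "\<dots> = h x b" unfolding module_map_mult[OF h x cl(5,6), symmetric] using eq x b by simp
      finally show ?thesis .
    qed
    ultimately show "\<exists>g. module_map C B E g \<and> (\<forall>x\<in>Ob C. \<forall>p\<in>el B x. \<pi> x (g x p) = h x p)" by blast
  qed
  then show ?case using 0(3) by (simp add: projective_module_iff)
next
  case (Suc n A B)
  obtain P A' :: "('o, 'h, 'u) cat_module" and j \<pi> where
    P: "projective_module C P" "short_exact C A' j P \<pi> A" "pd_le C n A'" using Suc(2) by auto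
  obtain P' B' :: "('o, 'h, 'u) cat_module" and j' \<pi>' where
    P': "projective_module C P'" "short_exact C B' j' P' \<pi>' B" using enough_projectives'[OF Suc(4)] .
  have "stable_retract C B' A'" using stable_retract_syzygy[OF P'(2,1) P(2,1) Suc(3)] .
  then have "pd_le C n B'" using Suc(1)[OF P(3)] short_exactD(1)[OF P'(2)] by simp
  then show ?case using P' by auto
qed

text \<open>Two covers of the same module have stably equivalent syzygies, so that the cover in the definition
  of \<open>pd_le\<close> may be replaced by any other.\<close>

lemma pd_le_syzygy:
  fixes A B P :: "('o, 'h, 'u) cat_module"
  assumes A: "pd_le C (Suc n) A" and P: "projective_module C P" and B: "short_exact C B j P \<pi> A"
  shows "pd_le C n B"
proof -
  obtain P' A' :: "('o, 'h, 'u) cat_module" and j' \<pi>' where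
    P': "projective_module C P'" "short_exact C A' j' P' \<pi>' A" "pd_le C n A'" using A by auto
  have Am: "cat_module C A" using B by (rule short_exactD)
  have "stable_retract C A A" by (rule stable_retractI[OF Am Am module_map_id module_map_id]) simp
  then have "stable_retract C B A'" using stable_retract_syzygy[OF B P P'(2,1)] by simp
  then show ?thesis using pd_le_stable_retract[OF P'(3)] short_exactD(1)[OF B] by simp
qed

text \<open>A projective module covers itself, and the syzygy of this cover is zero.\<close>

lemma pd_le_mono:
  fixes A :: "('o, 'h, 'u) cat_module"
  assumes "pd_le C n A" shows "pd_le C (Suc n) A"
  using assms
proof (induction n arbitrary: A)
  case (0 A)
  then have pr: "projective_module C A" and A: "cat_module C A" by (auto simp: projective_cat_module)
  have "module_surj C A A (\<lambda>x m. m)" by (simp add: module_surj_def module_map_id)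
  from kernel_exact[OF A A this]
  have ex: "short_exact C (submodule A (\<lambda>x. kernel (Val A x) (Val A x) (\<lambda>m. m))) (\<lambda>x m. m) A (\<lambda>x m. m) A" (is "short_exact C ?Z _ _ _ _") .
  have Z: "cat_module C ?Z" using ex by (rule short_exactD)
  have one: "m = \<one>\<^bsub>Val ?Z x\<^esub>" if "m \<in> el ?Z x" for m x using that by (simp add: kernel_def)
  have "lifts TYPE('u) C ?Z"
    unfolding lifts_def
  proof (intro allI impI)
    fix E D :: "('o, 'h, 'u) cat_module" and \<pi> h
    assume E: "cat_module C E" and D: "cat_module C D" and \<pi>: "module_surj C E D \<pi>" and h: "module_map C ?Z D h"
    have "\<pi> x \<one>\<^bsub>Val E x\<^esub> = h x m" if "x \<in> Ob C" "m \<in> el ?Z x" for x m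
      using module_map_one[OF _ E D that(1)] module_map_one[OF h Z D that(1)] \<pi> one[OF that(2)]
      by (metis module_surj_def)
    then show "\<exists>g. module_map C ?Z E g \<and> (\<forall>x\<in>Ob C. \<forall>p\<in>el ?Z x. \<pi> x (g x p) = h x p)"
      by (intro exI[of _ "\<lambda>x m. \<one>\<^bsub>Val E x\<^esub>"]) (simp add: module_map_zero[OF E])
  qed
  then have "projective_module C ?Z" using Z by (simp add: projective_module_iff)
  then show ?case using pr ex by auto
next
  case (Suc n A)
  then obtain P B :: "('o, 'h, 'u) cat_module" and j \<pi> where
    "projective_module C P" "short_exact C B j P \<pi> A" "pd_le C n B" by auto
  then show ?case using Suc(1)[of B] unfolding pd_le.simps(2)[of C "Suc n"] by blast
qed

text \<open>A cover of the middle term of a short exact sequence covers the quotient too, and the two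
  syzygies differ by the submodule. This rotation reduces the dimension by one.\<close>

lemma rotate_short_exact:
  fixes A B B' D P :: "('o, 'h, 'u) cat_module"
  assumes A: "short_exact C A i B p D" and B': "short_exact C B' j P \<pi> B"
  obtains E :: "('o, 'h, 'u) cat_module" and k l q where
    "short_exact C E k P (\<lambda>x m. p x (\<pi> x m)) D" "short_exact C B' l E q A"
proof -
  note a = short_exactD[OF A] and b = short_exactD[OF B']
  have surj: "module_surj C P D (\<lambda>x m. p x (\<pi> x m))"
    unfolding module_surj_def
  proof (intro conjI ballI)
    show "module_map C P D (\<lambda>x m. p x (\<pi> x m))" using b(6) a(6) by (rule module_map_comp)
    fix x assume x: "x \<in> Ob C"
    have "\<pi> x ` el P x = el B x" "p x ` el B x = el D x" using a(5) b(5) x by (auto simp: module_surj_def)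
    then show "(\<lambda>m. p x (\<pi> x m)) ` el P x = el D x" by (metis image_image)
  qed
  obtain E where E: "short_exact C E (\<lambda>x m. m) P (\<lambda>x m. p x (\<pi> x m)) D"
    using kernel_exact[OF b(2) a(3) surj] by blast
  note e = short_exactD[OF E]
  have eP: "m \<in> el E x \<Longrightarrow> m \<in> el P x" if "x \<in> Ob C" for x m using module_map_closed[OF e(4) that] .
  obtain l where l: "module_map C B' E l" "\<And>x m. x \<in> Ob C \<Longrightarrow> m \<in> el B' x \<Longrightarrow> l x m = j x m"
  proof (rule factor_through_injection[OF e(4,7,1) b(1) b(4)])
    fix x m assume x: "x \<in> Ob C" and m: "m \<in> el B' x"
    show "j x m \<in> (\<lambda>m. m) ` el E x"
      by (rule e(9)[OF x module_map_closed[OF b(4) x m]]) (use x m in \<open>simp add: b(8) module_map_one[OF a(6,2,3)]\<close>)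
  qed auto
  obtain q where q: "module_map C E A q" "\<And>x m. x \<in> Ob C \<Longrightarrow> m \<in> el E x \<Longrightarrow> i x (q x m) = \<pi> x m"
  proof (rule factor_through_injection[OF a(4) a(7) a(1) e(1) module_map_comp[OF e(4) b(6)]])
    fix x m assume x: "x \<in> Ob C" and m: "m \<in> el E x"
    show "\<pi> x m \<in> i x ` el A x"
      by (rule a(9)[OF x module_map_closed[OF b(6) x eP[OF x m]]]) (use e(8)[OF x m] in simp)
  qed auto
  have i1: "i x \<one>\<^bsub>Val A x\<^esub> = \<one>\<^bsub>Val B x\<^esub>" if "x \<in> Ob C" for x using module_map_one[OF a(4,1,2) that] .
  have one: "\<one>\<^bsub>Val A x\<^esub> \<in> el A x" if "x \<in> Ob C" for x
    using cat_module_group[OF a(1) that] by (simp add: group.is_monoid monoid.one_closed)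
  have "short_exact C B' l E q A"
  proof (rule short_exactI[OF b(1) e(1) a(1) l(1) q(1)])
    fix x assume x: "x \<in> Ob C"
    show "inj_on (l x) (el B' x)" using b(7)[OF x] l(2)[OF x] by (simp cong: inj_on_cong)
    show "q x (l x m) = \<one>\<^bsub>Val A x\<^esub>" if m: "m \<in> el B' x" for m
    proof (rule inj_onD[OF a(7)[OF x]])
      have lm: "l x m \<in> el E x" using l(1) x m by (rule module_map_closed)
      then show "q x (l x m) \<in> el A x" by (rule module_map_closed[OF q(1) x])
      show "i x (q x (l x m)) = i x \<one>\<^bsub>Val A x\<^esub>" using q(2)[OF x lm] l(2)[OF x m] b(8)[OF x m] i1[OF x] by simp
    qed (rule one[OF x])
    show "\<exists>m\<in>el B' x. l x m = c" if c: "c \<in> el E x" "q x c = \<one>\<^bsub>Val A x\<^esub>" for c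
    proof -
      have "\<pi> x c = \<one>\<^bsub>Val B x\<^esub>" using q(2)[OF x c(1)] c(2) i1[OF x] by simp
      then have "c \<in> j x ` el B' x" by (rule b(9)[OF x eP[OF x c(1)]])
      then show ?thesis using l(2)[OF x] by auto
    qed
    show "\<exists>c\<in>el E x. q x c = a" if aa: "a \<in> el A x" for a
    proof -
      have ia: "i x a \<in> el B x" using a(4) x aa by (rule module_map_closed)
      obtain m where m: "m \<in> el P x" "\<pi> x m = i x a" using b(10)[OF x ia] by blast
      have "p x (\<pi> x m) = \<one>\<^bsub>Val D x\<^esub>" using m(2) a(8)[OF x aa] by simp
      then have mE: "m \<in> el E x" using e(9)[OF x m(1)] by simp
      have "q x m = a"
        by (rule inj_onD[OF a(7)[OF x]]) (use q(2)[OF x mE] m(2) module_map_closed[OF q(1) x mE] aa in auto)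
      then show ?thesis using mE by blast
    qed
  qed
  from that[OF E this] show thesis .
qed

lemma short_exact_splits:
  fixes A B D :: "('o, 'h, 'u) cat_module"
  assumes ex: "short_exact C A i B p D" and D: "projective_module C D"
  obtains r s where "module_map C B A r" "module_map C D B s"
    "\<And>x b. x \<in> Ob C \<Longrightarrow> b \<in> el B x \<Longrightarrow> b = i x (r x b) \<otimes>\<^bsub>Val B x\<^esub> s x (p x b)"
    "\<And>x c. x \<in> Ob C \<Longrightarrow> c \<in> el A x \<Longrightarrow> r x (i x c) = c"
proof -
  note a = short_exactD[OF ex]
  obtain s where s: "module_map C D B s" "\<And>x d. x \<in> Ob C \<Longrightarrow> d \<in> el D x \<Longrightarrow> p x (s x d) = d"
    by (rule projective_lift[OF D a(2,3,5) module_map_id]) (rule that)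
  \<comment> \<open>the projection of \<open>B\<close> to \<open>A\<close> along the section \<open>s\<close>\<close>
  define t where "t x b = b \<otimes>\<^bsub>Val B x\<^esub> inv\<^bsub>Val B x\<^esub> (s x (p x b))" for x b
  have t: "module_map C B B t"
    unfolding t_def by (rule module_map_sum[OF a(2) module_map_id module_map_neg[OF a(2,2) module_map_comp[OF a(6) s(1)]]])
  obtain r where r: "module_map C B A r" "\<And>x b. x \<in> Ob C \<Longrightarrow> b \<in> el B x \<Longrightarrow> i x (r x b) = t x b"
  proof (rule factor_through_injection[OF a(4) a(7) a(1) a(2) t])
    fix x b assume x: "x \<in> Ob C" and b: "b \<in> el B x"
    interpret BG: group "Val B x" using a(2) x by (rule cat_module_group)
    interpret DG: group "Val D x" using a(3) x by (rule cat_module_group)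
    have cl: "p x b \<in> el D x" "s x (p x b) \<in> el B x" using x b by (simp_all add: module_map_closed[OF a(6)] module_map_closed[OF s(1)])
    have "p x (t x b) = \<one>\<^bsub>Val D x\<^esub>"
      unfolding t_def using x b cl by (simp add: module_map_mult[OF a(6)] module_map_inv[OF a(6,2,3)] s(2))
    then show "t x b \<in> i x ` el A x" by (rule a(9)[OF x module_map_closed[OF t x b]])
  qed auto
  moreover have "b = i x (r x b) \<otimes>\<^bsub>Val B x\<^esub> s x (p x b)" if x: "x \<in> Ob C" and b: "b \<in> el B x" for x b
  proof -
    interpret BG: group "Val B x" using a(2) x by (rule cat_module_group)
    have cl: "p x b \<in> el D x" "s x (p x b) \<in> el B x" using x b by (simp_all add: module_map_closed[OF a(6)] module_map_closed[OF s(1)])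
    show ?thesis using x b cl by (simp add: r(2) t_def BG.m_assoc)
  qed
  moreover have "r x (i x c) = c" if x: "x \<in> Ob C" and c: "c \<in> el A x" for x c
  proof (rule inj_onD[OF a(7)[OF x]])
    interpret BG: group "Val B x" using a(2) x by (rule cat_module_group)
    have ic: "i x c \<in> el B x" using a(4) x c by (rule module_map_closed)
    then show "r x (i x c) \<in> el A x" by (rule module_map_closed[OF r(1) x])
    show "i x (r x (i x c)) = i x c"
      using x c ic by (simp add: r(2) t_def a(8) module_map_one[OF s(1) a(3,2)])
  qed fact
  ultimately show thesis by (intro that[OF r(1) s(1)])
qed

lemma projective_extension:
  fixes A B D :: "('o, 'h, 'u) cat_module"
  assumes ex: "short_exact C A i B p D" and A: "projective_module C A" and D: "projective_module C D"
  shows "projective_module C B"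
proof -
  obtain r s where rs: "module_map C B A r" "module_map C D B s"
    "\<And>x b. x \<in> Ob C \<Longrightarrow> b \<in> el B x \<Longrightarrow> b = i x (r x b) \<otimes>\<^bsub>Val B x\<^esub> s x (p x b)"
    by (rule short_exact_splits[OF ex D]) (rule that)
  have "stable_retract C B A" by (rule stable_retract_intro[OF D rs(1) short_exactD(4,6)[OF ex] rs(2,3)])
  then show ?thesis using pd_le_stable_retract[of 0 A B] A short_exactD(2)[OF ex] by simp
qed

lemma pd_le_quotient_of_extension:
  fixes A B D :: "('o, 'h, 'u) cat_module"
  assumes ext: "\<And>(A :: ('o, 'h, 'u) cat_module) i (B :: ('o, 'h, 'u) cat_module) p (D :: ('o, 'h, 'u) cat_module).
      short_exact C A i B p D \<Longrightarrow> pd_le C n A \<Longrightarrow> pd_le C n D \<Longrightarrow> pd_le C n B"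
    and ex: "short_exact C A i B p D" and A: "pd_le C n A" and B: "pd_le C (Suc n) B"
  shows "pd_le C (Suc n) D"
proof -
  obtain P B' :: "('o, 'h, 'u) cat_module" and j \<pi> where
    P: "projective_module C P" "short_exact C B' j P \<pi> B" "pd_le C n B'" using B by auto
  obtain E :: "('o, 'h, 'u) cat_module" and k l q where
    E: "short_exact C E k P (\<lambda>x m. p x (\<pi> x m)) D" "short_exact C B' l E q A"
    using rotate_short_exact[OF ex P(2)] .
  have "pd_le C n E" using ext[OF E(2) P(3) A] .
  then show ?thesis using P(1) E(1) by auto
qed

text \<open>The two bounds need each other: after rotation, the bound for an extension follows from the
  bound for a submodule one dimension lower, and the bound for a submodule from the bound for a
  quotient, which in turn comes from an extension one dimension lower.\<close>

lemma pd_le_extension_and_submodule: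
  fixes A B D :: "('o, 'h, 'u) cat_module"
  shows "short_exact C A i B p D \<Longrightarrow> pd_le C n A \<Longrightarrow> pd_le C n D \<Longrightarrow> pd_le C n B"
    and "short_exact C A i B p D \<Longrightarrow> pd_le C n B \<Longrightarrow> pd_le C (Suc n) D \<Longrightarrow> pd_le C n A"
proof (induction n arbitrary: A i B p D and A i B p D)
  case 0
  { case 1 then show ?case using projective_extension by simp
  next
    case 2 then show ?case using pd_le_syzygy[of 0 D B A i p] by simp }
next
  case (Suc n)
  { case (1 A i B p D)
    have Bm: "cat_module C B" using 1(1) by (rule short_exactD)
    obtain P B' :: "('o, 'h, 'u) cat_module" and j \<pi> where
      P: "projective_module C P" "short_exact C B' j P \<pi> B" using enough_projectives'[OF Bm] .
    obtain E :: "('o, 'h, 'u) cat_module" and k l q where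
      E: "short_exact C E k P (\<lambda>x m. p x (\<pi> x m)) D" "short_exact C B' l E q A"
      using rotate_short_exact[OF 1(1) P(2)] .
    have "pd_le C n E" using pd_le_syzygy[OF 1(3) P(1) E(1)] .
    then have "pd_le C n B'" using Suc(2)[OF E(2)] 1(2) by simp
    then show ?case using P by auto
  next
    case (2 A i B p D)
    obtain P B' :: "('o, 'h, 'u) cat_module" and j \<pi> where
      P: "projective_module C P" "short_exact C B' j P \<pi> B" "pd_le C n B'" using 2(2) by auto
    obtain E :: "('o, 'h, 'u) cat_module" and k l q where
      E: "short_exact C E k P (\<lambda>x m. p x (\<pi> x m)) D" "short_exact C B' l E q A"
      using rotate_short_exact[OF 2(1) P(2)] .
    have "pd_le C (Suc n) E" using pd_le_syzygy[OF 2(3) P(1) E(1)] .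
    show ?case by (rule pd_le_quotient_of_extension[OF _ E(2) P(3) \<open>pd_le C (Suc n) E\<close>]) (rule Suc(1)) }
qed

lemmas pd_le_extension = pd_le_extension_and_submodule(1)
  and pd_le_submodule = pd_le_extension_and_submodule(2)

lemma pd_le_quotient:
  fixes A B D :: "('o, 'h, 'u) cat_module"
  assumes "short_exact C A i B p D" "pd_le C n A" "pd_le C (Suc n) B"
  shows "pd_le C (Suc n) D"
  by (rule pd_le_quotient_of_extension[OF _ assms]) (rule pd_le_extension)

end

lemma short_exact_copy:
  fixes A :: "('o, 'h, 'a) cat_module" and B :: "('o, 'h, 'b) cat_module" and D :: "('o, 'h, 'd) cat_module"
  assumes ex: "short_exact C A i B p D"
    and e: "embeddable TYPE('u) C A" "embeddable TYPE('u) C B" "embeddable TYPE('u) C D"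
  shows "short_exact C (copy A :: ('o, 'h, 'u) cat_module) (\<lambda>x a. embed B x (i x (unembed A x a)))
           (copy B :: ('o, 'h, 'u) cat_module) (\<lambda>x b. embed D x (p x (unembed B x b)))
           (copy D :: ('o, 'h, 'u) cat_module)"
proof -
  note a = short_exactD[OF ex]
  note cA = copy_iso[OF a(1) e(1)] and cB = copy_iso[OF a(2) e(2)] and cD = copy_iso[OF a(3) e(3)]
  have i1: "embed M x \<one>\<^bsub>Val M x\<^esub> = \<one>\<^bsub>Val (copy M :: ('o, 'h, 'u) cat_module) x\<^esub>" for M :: "('o, 'h, 'm) cat_module" and x
    by (simp add: copy_def transport_def)
  show ?thesis
  proof (rule short_exactI[OF cA(1) cB(1) cD(1)])
    show "module_map C (copy A :: ('o, 'h, 'u) cat_module) (copy B :: ('o, 'h, 'u) cat_module) (\<lambda>x a. embed B x (i x (unembed A x a)))"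
      by (rule module_map_comp[OF module_map_comp[OF cA(3) a(4)] cB(2)])
    show "module_map C (copy B :: ('o, 'h, 'u) cat_module) (copy D :: ('o, 'h, 'u) cat_module) (\<lambda>x b. embed D x (p x (unembed B x b)))"
      by (rule module_map_comp[OF module_map_comp[OF cB(3) a(6)] cD(2)])
    fix x assume x: "x \<in> Ob C"
    have uA: "unembed A x c \<in> el A x" if "c \<in> el (copy A :: ('o, 'h, 'u) cat_module) x" for c
      using cA(3) x that by (rule module_map_closed)
    have uB: "unembed B x c \<in> el B x" if "c \<in> el (copy B :: ('o, 'h, 'u) cat_module) x" for c
      using cB(3) x that by (rule module_map_closed)
    have uD: "unembed D x c \<in> el D x" if "c \<in> el (copy D :: ('o, 'h, 'u) cat_module) x" for c
      using cD(3) x that by (rule module_map_closed)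
    have ia: "i x b \<in> el B x" if "b \<in> el A x" for b using a(4) x that by (rule module_map_closed)
    show "inj_on (\<lambda>a. embed B x (i x (unembed A x a)) :: 'u) (el (copy A :: ('o, 'h, 'u) cat_module) x)"
    proof (rule inj_onI)
      fix c d assume c: "c \<in> el (copy A :: ('o, 'h, 'u) cat_module) x" and d: "d \<in> el (copy A :: ('o, 'h, 'u) cat_module) x"
        and eq: "embed B x (i x (unembed A x c)) = (embed B x (i x (unembed A x d)) :: 'u)"
      have "i x (unembed A x c) = i x (unembed A x d)"
        using arg_cong[OF eq, of "unembed B x"] by (simp add: cB(4)[OF x] ia uA c d)
      then have "unembed A x c = unembed A x d"
        by (rule inj_onD[OF a(7)[OF x]]) (simp_all add: uA c d)
      then have "embed A x (unembed A x c) = (embed A x (unembed A x d) :: 'u)" by simp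
      then show "c = d" unfolding cA(5)[OF x c] cA(5)[OF x d] .
    qed
    show "embed D x (p x (unembed B x (embed B x (i x (unembed A x c)) :: 'u))) = \<one>\<^bsub>Val (copy D :: ('o, 'h, 'u) cat_module) x\<^esub>"
      if "c \<in> el (copy A :: ('o, 'h, 'u) cat_module) x" for c
      using that by (simp add: cB(4)[OF x] ia uA a(8)[OF x] i1)
    show "\<exists>c\<in>el (copy A :: ('o, 'h, 'u) cat_module) x. embed B x (i x (unembed A x c)) = b"
      if b: "b \<in> el (copy B :: ('o, 'h, 'u) cat_module) x"
        and z: "embed D x (p x (unembed B x b)) = \<one>\<^bsub>Val (copy D :: ('o, 'h, 'u) cat_module) x\<^esub>" for b
    proof -
      have "p x (unembed B x b) = \<one>\<^bsub>Val D x\<^esub>"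
      proof -
        have "\<one>\<^bsub>Val D x\<^esub> \<in> el D x" using cat_module_group[OF a(3) x] by (simp add: group.is_monoid monoid.one_closed)
        moreover have "embed D x (p x (unembed B x b)) = (embed D x \<one>\<^bsub>Val D x\<^esub> :: 'u)" using z by (simp add: i1)
        ultimately show ?thesis
          using arg_cong[of "embed D x (p x (unembed B x b)) :: 'u" _ "unembed D x"] module_map_closed[OF a(6) x uB[OF b]]
          by (metis cD(4)[OF x])
      qed
      from a(9)[OF x uB[OF b] this] obtain c where c: "c \<in> el A x" "unembed B x b = i x c" by blast
      have "embed A x c \<in> el (copy A :: ('o, 'h, 'u) cat_module) x" using cA(2) x c(1) by (rule module_map_closed)
      moreover have "embed B x (i x (unembed A x (embed A x c :: 'u))) = b"
        using c cA(4)[OF x c(1)] cB(5)[OF x b] by simp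
      ultimately show ?thesis by blast
    qed
    show "\<exists>b\<in>el (copy B :: ('o, 'h, 'u) cat_module) x. embed D x (p x (unembed B x b)) = d"
      if d: "d \<in> el (copy D :: ('o, 'h, 'u) cat_module) x" for d
    proof -
      obtain b where b: "b \<in> el B x" "p x b = unembed D x d" using a(10)[OF x uD[OF d]] by blast
      have "embed B x b \<in> el (copy B :: ('o, 'h, 'u) cat_module) x" using cB(2) x b(1) by (rule module_map_closed)
      moreover have "embed D x (p x (unembed B x (embed B x b :: 'u))) = d"
        using b cB(4)[OF x b(1)] cD(5)[OF x d] by simp
      ultimately show ?thesis by blast
    qed
  qed
qed

section \<open>Projective resolutions and Ext\<close>

context module_universe
begin

lemma projective_resolution_exists:
  fixes A :: "('o, 'h, 'a) cat_module"
  assumes A: "cat_module C A" and emb: "embeddable TYPE('u) C A"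
  shows "\<exists>(P :: nat \<Rightarrow> ('o, 'h, 'u) cat_module) d e. projective_resolution C A P d e"
proof -
  have "\<exists>(P :: ('o, 'h, 'u) cat_module) \<pi>. cat_module C B \<longrightarrow> projective_module C P \<and> module_surj C P B \<pi>"
    for B :: "('o, 'h, 'u) cat_module"
  proof (cases "cat_module C B")
    case True
    obtain P :: "('o, 'h, 'u) cat_module" and \<pi> where "projective_module C P" "module_surj C P B \<pi>"
      using enough_projectives[OF infinite_universe countable True] .
    then show ?thesis by blast
  qed simp
  then obtain cov :: "('o, 'h, 'u) cat_module \<Rightarrow> ('o, 'h, 'u) cat_module" and pr where
    cov: "\<And>B. cat_module C B \<Longrightarrow> projective_module C (cov B)" "\<And>B. cat_module C B \<Longrightarrow> module_surj C (cov B) B (pr B)"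
    by metis
  define ker where "ker B = submodule (cov B) (\<lambda>x. kernel (Val (cov B) x) (Val B x) (pr B x))" for B
  have ker: "short_exact C (ker B) (\<lambda>x m. m) (cov B) (pr B) B" if "cat_module C B" for B
    unfolding ker_def using kernel_exact[OF projective_cat_module[OF cov(1)[OF that]] that cov(2)[OF that]] .
  define \<Omega> where "\<Omega> n = (ker ^^ n) (copy A)" for n
  note cA = copy_iso[OF A emb]
  have \<Omega>: "cat_module C (\<Omega> n)" for n
    by (induction n) (use cA(1) short_exactD(1)[OF ker] in \<open>auto simp: \<Omega>_def\<close>)
  define P where "P n = cov (\<Omega> n)" for n
  define d where "d n = normalise C (P (Suc n)) (pr (\<Omega> (Suc n)))" for n
  define e where "e = normalise C (P 0) (\<lambda>x m. unembed A x (pr (copy A) x m))"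
  have Pm: "cat_module C (P n)" for n unfolding P_def using cov(1)[OF \<Omega>] by (rule projective_cat_module)
  have ex: "short_exact C (\<Omega> (Suc n)) (\<lambda>x m. m) (P n) (pr (\<Omega> n)) (\<Omega> n)" for n
    using ker[OF \<Omega>[of n]] by (simp add: \<Omega>_def P_def)
  have sj: "pr (\<Omega> n) x ` el (P n) x = el (\<Omega> n) x" if "x \<in> Ob C" for n x
    using short_exactD(5)[OF ex[of n]] that by (simp add: module_surj_def)
  have pm: "module_map C (P n) (\<Omega> n) (pr (\<Omega> n))" for n by (rule short_exactD(6)[OF ex])
  have im: "d n x ` el (P (Suc n)) x = el (\<Omega> (Suc n)) x" if "x \<in> Ob C" for n x
    using sj[OF that, of "Suc n"] that by (simp add: d_def normalise_def)
  have kr: "el (\<Omega> (Suc n)) x = {m \<in> el (P n) x. pr (\<Omega> n) x m = \<one>\<^bsub>Val (\<Omega> n) x\<^esub>}" if "x \<in> Ob C" for n x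
    using ex[of n] that by (simp add: short_exact_def kernel_def)
  have "projective_resolution C A P d e"
    unfolding projective_resolution_def
  proof (intro conjI allI ballI)
    fix n show "projective_module C (P n)" unfolding P_def by (rule cov(1)[OF \<Omega>])
    show "d n \<in> module_hom C (P (Suc n)) (P n)"
      unfolding d_def
      by (rule normalise_module_hom[OF Pm module_map_comp[OF pm short_exactD(4)[OF ex]]])
    fix x assume x: "x \<in> Ob C"
    have "\<one>\<^bsub>Val (\<Omega> (Suc n)) x\<^esub> = \<one>\<^bsub>Val (P n) x\<^esub>" by (simp add: \<Omega>_def ker_def P_def)
    then show "kernel (Val (P (Suc n)) x) (Val (P n) x) (d n x) = d (Suc n) x ` el (P (Suc (Suc n))) x"
      unfolding im[OF x] kr[OF x] using x by (auto simp: kernel_def d_def normalise_def)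
  next
    have em: "module_map C (P 0) A (\<lambda>x m. unembed A x (pr (copy A) x m))"
      using module_map_comp[OF pm[of 0]] cA(3) by (simp add: \<Omega>_def)
    have ue: "unembed A x ` el (copy A :: ('o, 'h, 'u) cat_module) x = el A x" if "x \<in> Ob C" for x
      using module_map_closed[OF cA(3) that] module_map_closed[OF cA(2) that] cA(4)[OF that]
      by (metis (no_types, lifting) image_eqI image_subset_iff subsetI subset_antisym)
    show "module_epi C (P 0) A e"
      unfolding module_epi_def
    proof (intro conjI ballI)
      show "e \<in> module_hom C (P 0) A" unfolding e_def by (rule normalise_module_hom[OF Pm em])
      fix x assume x: "x \<in> Ob C"
      have "e x ` el (P 0) x = unembed A x ` (pr (\<Omega> 0) x ` el (P 0) x)"
        using x by (simp add: e_def normalise_def image_image \<Omega>_def)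
      then show "e x ` el (P 0) x = el A x" using sj[OF x, of 0] ue[OF x] by (simp add: \<Omega>_def)
    qed
    fix x assume x: "x \<in> Ob C"
    have one: "unembed A x c = \<one>\<^bsub>Val A x\<^esub> \<longleftrightarrow> c = \<one>\<^bsub>Val (copy A) x\<^esub>" if c: "c \<in> el (copy A :: ('o, 'h, 'u) cat_module) x" for c
      using module_map_one[OF cA(3) cA(1) A x] module_map_one[OF cA(2) A cA(1) x] cA(5)[OF x c] by metis
    have "pr (copy A) x m \<in> el (copy A :: ('o, 'h, 'u) cat_module) x" if "m \<in> el (P 0) x" for m
      using module_map_closed[OF pm[of 0] x that] by (simp add: \<Omega>_def)
    then have "kernel (Val (P 0) x) (Val A x) (e x) = {m \<in> el (P 0) x. pr (\<Omega> 0) x m = \<one>\<^bsub>Val (\<Omega> 0) x\<^esub>}"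
      using x one by (auto simp: kernel_def e_def normalise_def \<Omega>_def)
    then show "kernel (Val (P 0) x) (Val A x) (e x) = d 0 x ` el (P 1) x"
      using im[OF x, of 0] kr[OF x, of 0] by simp
  qed
  then show ?thesis by blast
qed

end

text \<open>The numbering starts with the kernel of the augmentation: \<open>syzygy P d n\<close> is the \<open>(n + 1)\<close>-st
  syzygy of the resolved module and sits in \<open>P n\<close>.\<close>

definition syzygy where
  "syzygy P d n = submodule (P n) (\<lambda>x. d n x ` el (P (Suc n)) x)"

lemma syzygy_exact:
  assumes res: "projective_resolution C A P d e" and A: "cat_module C A"
  shows "short_exact C (syzygy P d 0) (\<lambda>x m. m) (P 0) e A"
    and "short_exact C (syzygy P d (Suc n)) (\<lambda>x m. m) (P (Suc n)) (d n) (syzygy P d n)"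
proof -
  have Pm: "cat_module C (P n)" for n using res by (simp add: projective_resolution_def projective_cat_module)
  have dm: "module_map C (P (Suc n)) (P n) (d n)" for n
    by (rule module_hom_map) (use res in \<open>simp add: projective_resolution_def\<close>)
  have surj: "module_surj C (P 0) A e"
  proof -
    have "e \<in> module_hom C (P 0) A" "\<forall>x\<in>Ob C. e x ` el (P 0) x = el A x"
      using res by (simp_all add: projective_resolution_def module_epi_def)
    then show ?thesis using module_hom_map[of e C "P 0" A] by (simp add: module_surj_def)
  qed
  have cat: "cat_module C (syzygy P d n)" for n
    unfolding syzygy_def
  proof (rule cat_module_submodule[OF Pm])
    fix x assume x: "x \<in> Ob C"
    show "subgroup (d n x ` el (P (Suc n)) x) (Val (P n) x)"
      by (rule group_hom.img_is_subgroup[OF module_map_group_hom[OF dm Pm Pm x]])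
    fix y f m assume *: "y \<in> Ob C" "f \<in> Hom C x y" "m \<in> d n x ` el (P (Suc n)) x"
    then obtain m' where m': "m' \<in> el (P (Suc n)) x" "m = d n x m'" by blast
    have "Map (P n) x y f m = d n y (Map (P (Suc n)) x y f m')"
      using module_map_nat[OF dm x *(1,2) m'(1)] m'(2) by simp
    then show "Map (P n) x y f m \<in> d n y ` el (P (Suc n)) y"
      using Map_closed[OF Pm x *(1,2) m'(1)] by blast
  qed
  have incl: "module_map C (syzygy P d n) (P n) (\<lambda>x m. m)" for n
    unfolding syzygy_def by (rule submodule_map) (use module_map_closed[OF dm] in blast)
  show "short_exact C (syzygy P d 0) (\<lambda>x m. m) (P 0) e A"
    unfolding short_exact_def
    using cat[of 0] Pm A incl surj res by (simp add: projective_resolution_def syzygy_def)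
  have dm': "module_map C (P (Suc n)) (syzygy P d n) (d n)" for n
    using dm[of n] unfolding module_map_def syzygy_def hom_def by auto
  then have "module_surj C (P (Suc n)) (syzygy P d n) (d n)"
    by (simp add: module_surj_def syzygy_def)
  moreover have "kernel (Val (P (Suc n)) x) (Val (syzygy P d n) x) (d n x) = kernel (Val (P (Suc n)) x) (Val (P n) x) (d n x)" for x
    by (simp add: kernel_def syzygy_def)
  ultimately show "short_exact C (syzygy P d (Suc n)) (\<lambda>x m. m) (P (Suc n)) (d n) (syzygy P d n)"
    unfolding short_exact_def
    using cat Pm incl[of "Suc n"] res by (simp add: projective_resolution_def syzygy_def)
qed

lemma comm_group_module_hom_group:
  assumes M: "cat_module C M" and N: "cat_module C N"
  shows "comm_group (module_hom_group C M N)"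
proof -
  let ?G = "module_hom_group C M N"
  have mul: "\<eta> \<otimes>\<^bsub>?G\<^esub> \<theta> = normalise C M (\<lambda>x m. \<eta> x m \<otimes>\<^bsub>Val N x\<^esub> \<theta> x m)" for \<eta> \<theta>
    by (simp add: module_hom_group_def normalise_def)
  have one: "\<one>\<^bsub>?G\<^esub> = normalise C M (\<lambda>x m. \<one>\<^bsub>Val N x\<^esub>)" by (simp add: module_hom_group_def normalise_def)
  have car: "carrier ?G = module_hom C M N" by (simp add: module_hom_group_def)
  have mc: "\<eta> \<otimes>\<^bsub>?G\<^esub> \<theta> \<in> module_hom C M N" if "\<eta> \<in> module_hom C M N" "\<theta> \<in> module_hom C M N" for \<eta> \<theta>
    unfolding mul using that by (intro normalise_module_hom[OF M] module_map_sum[OF N] module_hom_map)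
  have oc: "\<one>\<^bsub>?G\<^esub> \<in> module_hom C M N"
    unfolding one by (rule normalise_module_hom[OF M module_map_zero[OF N]])
  have ap: "(\<eta> \<otimes>\<^bsub>?G\<^esub> \<theta>) x m = \<eta> x m \<otimes>\<^bsub>Val N x\<^esub> \<theta> x m" "\<one>\<^bsub>?G\<^esub> x m = \<one>\<^bsub>Val N x\<^esub>"
    if "x \<in> Ob C" "m \<in> el M x" for \<eta> \<theta> x m
    using that by (simp_all add: mul one normalise_def)
  have cl: "\<eta> x m \<in> el N x" if "\<eta> \<in> module_hom C M N" "x \<in> Ob C" "m \<in> el M x" for \<eta> x m
    using module_map_closed[OF module_hom_map[OF that(1)] that(2,3)] .
  have eqI: "\<eta> = \<theta>" if "\<eta> \<in> module_hom C M N" "\<theta> \<in> module_hom C M N"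
      "\<And>x m. x \<in> Ob C \<Longrightarrow> m \<in> el M x \<Longrightarrow> comm_group (Val N x) \<Longrightarrow> \<eta> x m = \<theta> x m" for \<eta> \<theta>
    using module_hom_eqI[OF that(1,2)] that(3) cat_module_comm_group[OF N] by blast
  show ?thesis
  proof (rule comm_groupI)
    show "\<one>\<^bsub>?G\<^esub> \<in> carrier ?G" by (simp add: car oc)
    fix \<eta> assume "\<eta> \<in> carrier ?G"
    then have \<eta>: "\<eta> \<in> module_hom C M N" by (simp add: car)
    show "\<one>\<^bsub>?G\<^esub> \<otimes>\<^bsub>?G\<^esub> \<eta> = \<eta>"
    proof (rule eqI[OF mc[OF oc \<eta>] \<eta>])
      fix x m assume *: "x \<in> Ob C" "m \<in> el M x" "comm_group (Val N x)"
      interpret comm_group "Val N x" by fact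
      show "(\<one>\<^bsub>?G\<^esub> \<otimes>\<^bsub>?G\<^esub> \<eta>) x m = \<eta> x m" using * by (simp add: ap cl[OF \<eta>])
    qed
    have ic: "normalise C M (\<lambda>x m. inv\<^bsub>Val N x\<^esub> (\<eta> x m)) \<in> module_hom C M N"
      by (rule normalise_module_hom[OF M module_map_neg[OF N M module_hom_map[OF \<eta>]]])
    have "normalise C M (\<lambda>x m. inv\<^bsub>Val N x\<^esub> (\<eta> x m)) \<otimes>\<^bsub>?G\<^esub> \<eta> = \<one>\<^bsub>?G\<^esub>"
    proof (rule eqI[OF mc[OF ic \<eta>] oc])
      fix x m assume *: "x \<in> Ob C" "m \<in> el M x" "comm_group (Val N x)"
      interpret comm_group "Val N x" by fact
      show "(normalise C M (\<lambda>x m. inv\<^bsub>Val N x\<^esub> (\<eta> x m)) \<otimes>\<^bsub>?G\<^esub> \<eta>) x m = \<one>\<^bsub>?G\<^esub> x m"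
        using * cl[OF \<eta> *(1,2)] by (simp add: ap) (simp add: normalise_def)
    qed
    then show "\<exists>\<theta>\<in>carrier ?G. \<theta> \<otimes>\<^bsub>?G\<^esub> \<eta> = \<one>\<^bsub>?G\<^esub>" using ic by (auto simp: car)
    fix \<theta> assume "\<theta> \<in> carrier ?G"
    then have \<theta>: "\<theta> \<in> module_hom C M N" by (simp add: car)
    show "\<eta> \<otimes>\<^bsub>?G\<^esub> \<theta> \<in> carrier ?G" using mc[OF \<eta> \<theta>] by (simp add: car)
    show "\<eta> \<otimes>\<^bsub>?G\<^esub> \<theta> = \<theta> \<otimes>\<^bsub>?G\<^esub> \<eta>"
    proof (rule eqI[OF mc[OF \<eta> \<theta>] mc[OF \<theta> \<eta>]])
      fix x m assume *: "x \<in> Ob C" "m \<in> el M x" "comm_group (Val N x)"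
      interpret comm_group "Val N x" by fact
      show "(\<eta> \<otimes>\<^bsub>?G\<^esub> \<theta>) x m = (\<theta> \<otimes>\<^bsub>?G\<^esub> \<eta>) x m"
        using * cl[OF \<eta> *(1,2)] cl[OF \<theta> *(1,2)] by (simp add: ap m_comm)
    qed
    fix \<zeta> assume "\<zeta> \<in> carrier ?G"
    then have \<zeta>: "\<zeta> \<in> module_hom C M N" by (simp add: car)
    show "\<eta> \<otimes>\<^bsub>?G\<^esub> \<theta> \<otimes>\<^bsub>?G\<^esub> \<zeta> = \<eta> \<otimes>\<^bsub>?G\<^esub> (\<theta> \<otimes>\<^bsub>?G\<^esub> \<zeta>)"
    proof (rule eqI[OF mc[OF mc[OF \<eta> \<theta>] \<zeta>] mc[OF \<eta> mc[OF \<theta> \<zeta>]]])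
      fix x m assume *: "x \<in> Ob C" "m \<in> el M x" "comm_group (Val N x)"
      interpret comm_group "Val N x" by fact
      show "(\<eta> \<otimes>\<^bsub>?G\<^esub> \<theta> \<otimes>\<^bsub>?G\<^esub> \<zeta>) x m = (\<eta> \<otimes>\<^bsub>?G\<^esub> (\<theta> \<otimes>\<^bsub>?G\<^esub> \<zeta>)) x m"
        using * cl[OF \<eta> *(1,2)] cl[OF \<theta> *(1,2)] cl[OF \<zeta> *(1,2)] by (simp add: ap m_assoc)
    qed
  qed
qed

lemma trivial_quotient_iff:
  assumes G: "comm_group G" and B: "subgroup B G"
  shows "trivial_group (G Mod B) \<longleftrightarrow> carrier G \<subseteq> B"
proof -
  interpret comm_group G by fact
  have N: "B \<lhd> G" using B by (rule subgroup_imp_normal)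
  interpret Q: group "G Mod B" using N by (rule normal.factorgroup_is_group)
  have "carrier (G Mod B) \<subseteq> {B} \<longleftrightarrow> (\<forall>g\<in>carrier G. B #>\<^bsub>G\<^esub> g = B)"
    by (auto simp: FactGroup_def RCOSETS_def)
  also have "\<dots> \<longleftrightarrow> carrier G \<subseteq> B"
    using coset_join1[OF _ _ B] coset_join2[OF _ B] by blast
  finally show ?thesis using Q.trivial_group_subset by (simp add: FactGroup_def)
qed

text \<open>Dimension shifting: a class in degree \<open>n + 1\<close> is a map on the \<open>n\<close>-th syzygy, and it vanishes
  exactly when the map extends.\<close>

lemma trivial_Hom_cohomology_iff:
  assumes res: "projective_resolution C A P d e" and A: "cat_module C A" and M: "cat_module C M"
  shows "trivial_group (Hom_cohomology C P d M (Suc n)) \<longleftrightarrow>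
    (\<forall>\<phi>. module_map C (syzygy P d n) M \<phi> \<longrightarrow>
       (\<exists>\<psi>. module_map C (P n) M \<psi> \<and> (\<forall>x\<in>Ob C. \<forall>m\<in>el (syzygy P d n) x. \<psi> x m = \<phi> x m)))"
proof -
  have Pm: "cat_module C (P n)" for n using res by (simp add: projective_resolution_def projective_cat_module)
  have dh: "d n \<in> module_hom C (P (Suc n)) (P n)" for n using res by (simp add: projective_resolution_def)
  note dm = module_hom_map[OF dh]
  let ?G = "\<lambda>n. module_hom_group C (P n) M"
  have G: "comm_group (?G n)" for n by (rule comm_group_module_hom_group[OF Pm M])
  note Gg = comm_group.axioms(2)[OF G]
  have ch: "coboundary_map C P d n \<in> hom (?G n) (?G (Suc n))" for n
  proof (rule homI)
    fix \<phi> assume \<phi>: "\<phi> \<in> carrier (?G n)"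
    then have \<phi>m: "\<phi> \<in> module_hom C (P n) M" by (simp add: module_hom_group_def)
    show "coboundary_map C P d n \<phi> \<in> carrier (?G (Suc n))"
      unfolding coboundary_map_def module_comp_normalise
      using normalise_module_hom[OF Pm module_map_comp[OF dm module_hom_map[OF \<phi>m]]] by (simp add: module_hom_group_def)
    fix \<psi> assume "\<psi> \<in> carrier (?G n)"
    show "coboundary_map C P d n (\<phi> \<otimes>\<^bsub>?G n\<^esub> \<psi>) = coboundary_map C P d n \<phi> \<otimes>\<^bsub>?G (Suc n)\<^esub> coboundary_map C P d n \<psi>"
      unfolding coboundary_map_def module_comp_normalise
      by (auto simp: module_hom_group_def normalise_def fun_eq_iff module_map_closed[OF dm])
  qed
  have gh: "group_hom (?G n) (?G (Suc n)) (coboundary_map C P d n)" for n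
    by (simp add: group_hom_def group_hom_axioms_def Gg ch)
  let ?Z = "cocycles C P d M (Suc n)" and ?B = "coboundaries C P d M (Suc n)"
  have Z: "subgroup ?Z (?G (Suc n))" unfolding cocycles_def by (rule group_hom.subgroup_kernel[OF gh])
  have car: "carrier (?G n) = module_hom C (P n) M" for n by (simp add: module_hom_group_def)
  have B: "subgroup ?B (?G (Suc n))"
    using group_hom.img_is_subgroup[OF gh[of n]] by (simp add: coboundaries_def car)
  have syz: "short_exact C (syzygy P d (Suc n)) (\<lambda>x m. m) (P (Suc n)) (d n) (syzygy P d n)"
    by (rule syzygy_exact(2)[OF res A])
  note sz = short_exactD[OF syz]
  have elz: "el (syzygy P d k) x = d k x ` el (P (Suc k)) x" for k x by (simp add: syzygy_def)
  have Zi: "\<phi> \<in> ?Z \<longleftrightarrow> \<phi> \<in> module_hom C (P (Suc n)) M \<and> (\<forall>x\<in>Ob C. \<forall>m\<in>el (syzygy P d (Suc n)) x. \<phi> x m = \<one>\<^bsub>Val M x\<^esub>)" for \<phi>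
  proof -
    have "coboundary_map C P d (Suc n) \<phi> = \<one>\<^bsub>?G (Suc (Suc n))\<^esub> \<longleftrightarrow>
       (\<forall>x\<in>Ob C. \<forall>m\<in>el (P (Suc (Suc n))) x. \<phi> x (d (Suc n) x m) = \<one>\<^bsub>Val M x\<^esub>)"
      unfolding coboundary_map_def module_comp_normalise module_hom_group_def normalise_def
      by (auto simp: fun_eq_iff restrict_def split: if_splits)
    then show ?thesis by (auto simp: cocycles_def kernel_def car elz)
  qed
  have Bi: "\<phi> \<in> ?B \<longleftrightarrow> (\<exists>\<psi>\<in>module_hom C (P n) M. \<phi> = coboundary_map C P d n \<psi>)" for \<phi>
    by (auto simp: coboundaries_def)
  have BZ: "?B \<subseteq> ?Z"
  proof
    fix \<phi> assume b: "\<phi> \<in> ?B"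
    then obtain \<psi> where \<psi>: "\<psi> \<in> module_hom C (P n) M" "\<phi> = coboundary_map C P d n \<psi>" unfolding Bi by blast
    have \<phi>: "\<phi> \<in> module_hom C (P (Suc n)) M" using subgroup.mem_carrier[OF B b] by (simp add: car)
    have "\<phi> x m = \<one>\<^bsub>Val M x\<^esub>" if x: "x \<in> Ob C" and m: "m \<in> el (syzygy P d (Suc n)) x" for x m
    proof -
      have "m \<in> el (P (Suc n)) x" using module_map_closed[OF sz(4) x m] .
      then have "\<phi> x m = \<psi> x (d n x m)" using \<psi>(2) x by (simp add: coboundary_map_def module_comp_apply)
      also have "d n x m = \<one>\<^bsub>Val (P n) x\<^esub>" using sz(8)[OF x m] by (simp add: syzygy_def)
      finally show ?thesis using module_map_one[OF module_hom_map[OF \<psi>(1)] Pm M x] by simp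
    qed
    then show "\<phi> \<in> ?Z" using \<phi> by (simp add: Zi)
  qed
  have ZG: "comm_group (?G (Suc n)\<lparr>carrier := ?Z\<rparr>)" by (rule comm_group_restrict[OF G Z])
  have BZs: "subgroup ?B (?G (Suc n)\<lparr>carrier := ?Z\<rparr>)"
    using group.subgroup_incl[OF Gg B Z BZ] .
  have "trivial_group (Hom_cohomology C P d M (Suc n)) \<longleftrightarrow> ?Z \<subseteq> ?B"
    unfolding Hom_cohomology_def using trivial_quotient_iff[OF ZG BZs] by simp
  also have "\<dots> \<longleftrightarrow> (\<forall>\<phi>. module_map C (syzygy P d n) M \<phi> \<longrightarrow>
       (\<exists>\<psi>. module_map C (P n) M \<psi> \<and> (\<forall>x\<in>Ob C. \<forall>m\<in>el (syzygy P d n) x. \<psi> x m = \<phi> x m)))" (is "_ \<longleftrightarrow> ?ext")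
  proof
    assume sub: "?Z \<subseteq> ?B"
    show ?ext
    proof (intro allI impI)
      fix \<phi> assume \<phi>: "module_map C (syzygy P d n) M \<phi>"
      let ?c = "normalise C (P (Suc n)) (\<lambda>x m. \<phi> x (d n x m))"
      have ch: "?c \<in> module_hom C (P (Suc n)) M"
        by (rule normalise_module_hom[OF Pm module_map_comp[OF sz(6) \<phi>]])
      have "?c x m = \<one>\<^bsub>Val M x\<^esub>" if x: "x \<in> Ob C" and m: "m \<in> el (syzygy P d (Suc n)) x" for x m
        using module_map_closed[OF sz(4) x m] x sz(8)[OF x m] module_map_one[OF \<phi> sz(3) M x] by (simp add: normalise_def)
      then have "?c \<in> ?Z" using ch by (simp add: Zi)
      then obtain \<psi> where \<psi>: "\<psi> \<in> module_hom C (P n) M" "?c = coboundary_map C P d n \<psi>" using sub Bi by blast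
      have "\<psi> x m = \<phi> x m" if x: "x \<in> Ob C" and m: "m \<in> el (syzygy P d n) x" for x m
      proof -
        obtain m' where m': "m' \<in> el (P (Suc n)) x" "m = d n x m'" using m by (auto simp: elz)
        then show ?thesis
          using fun_cong[OF fun_cong[OF \<psi>(2)], of x m'] x by (simp add: coboundary_map_def module_comp_apply normalise_def)
      qed
      then show "\<exists>\<psi>. module_map C (P n) M \<psi> \<and> (\<forall>x\<in>Ob C. \<forall>m\<in>el (syzygy P d n) x. \<psi> x m = \<phi> x m)"
        using module_hom_map[OF \<psi>(1)] by blast
    qed
  next
    assume ext: ?ext
    show "?Z \<subseteq> ?B"
    proof
      fix c assume "c \<in> ?Z"
      then have c: "c \<in> module_hom C (P (Suc n)) M"
        and c0: "\<And>x m. x \<in> Ob C \<Longrightarrow> m \<in> el (syzygy P d (Suc n)) x \<Longrightarrow> c x m = \<one>\<^bsub>Val M x\<^esub>"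
        by (auto simp: Zi)
      have ker: "c x m = \<one>\<^bsub>Val M x\<^esub>" if "x \<in> Ob C" "m \<in> el (P (Suc n)) x" "d n x m = \<one>\<^bsub>Val (syzygy P d n) x\<^esub>" for x m
        using sz(9)[OF that] c0[OF that(1)] by auto
      obtain \<phi> where \<phi>: "module_map C (syzygy P d n) M \<phi>" "\<And>x m. x \<in> Ob C \<Longrightarrow> m \<in> el (P (Suc n)) x \<Longrightarrow> \<phi> x (d n x m) = c x m"
        by (rule factor_through_surjection[OF sz(5) sz(2,3) M module_hom_map[OF c] ker]) (assumption | rule that)+
      obtain \<psi> where \<psi>: "module_map C (P n) M \<psi>" "\<And>x m. x \<in> Ob C \<Longrightarrow> m \<in> el (syzygy P d n) x \<Longrightarrow> \<psi> x m = \<phi> x m"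
        using ext \<phi>(1) by blast
      have nh: "normalise C (P n) \<psi> \<in> module_hom C (P n) M" by (rule normalise_module_hom[OF Pm \<psi>(1)])
      have "c = coboundary_map C P d n (normalise C (P n) \<psi>)"
      proof (rule module_hom_eqI[OF c])
        show "coboundary_map C P d n (normalise C (P n) \<psi>) \<in> module_hom C (P (Suc n)) M"
          unfolding coboundary_map_def module_comp_normalise
          by (rule normalise_module_hom[OF Pm module_map_comp[OF dm module_hom_map[OF nh]]])
        fix x m assume *: "x \<in> Ob C" "m \<in> el (P (Suc n)) x"
        then have "d n x m \<in> el (P n) x" "d n x m \<in> el (syzygy P d n) x"
          using module_map_closed[OF dm *] by (auto simp: elz)
        then show "c x m = coboundary_map C P d n (normalise C (P n) \<psi>) x m"
          using * \<psi>(2) \<phi>(2) by (simp add: coboundary_map_def module_comp_apply normalise_def)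
      qed
      then show "c \<in> ?B" using nh by (auto simp: Bi)
    qed
  qed
  finally show ?thesis .
qed

text \<open>Ext is defined with a choice operator, which yields a resolution because there is one.\<close>

lemma (in module_universe) Ext_resolution:
  fixes A :: "('o, 'h, 'a) cat_module"
  assumes "cat_module C A" "embeddable TYPE('u) C A"
  obtains P :: "nat \<Rightarrow> ('o, 'h, 'u) cat_module" and d e where "projective_resolution C A P d e"
    "\<And>n M. Ext C n A M = Hom_cohomology C P d M n"
proof -
  let ?R = "\<lambda>(P :: nat \<Rightarrow> ('o, 'h, 'u) cat_module, d). \<exists>e. projective_resolution C A P d e"
  have "\<exists>Pd. ?R Pd" using projective_resolution_exists[OF assms] by auto
  then have "?R (SOME Pd. ?R Pd)" by (rule someI_ex)
  moreover obtain P d where Pd: "(SOME Pd. ?R Pd) = (P, d)" by (metis surj_pair)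
  ultimately obtain e where e: "projective_resolution C A P d e" by auto
  have "Ext C n A M = Hom_cohomology C P d M n" for n M
    unfolding Ext_def Pd by simp
  then show thesis using that e by blast
qed

context module_universe
begin

text \<open>Each syzygy lowers the dimension by one. The offset \<open>Suc n\<close> is due to the numbering of
  \<open>syzygy\<close>.\<close>

lemma pd_le_syzygy_resolution:
  fixes A :: "('o, 'h, 'a) cat_module" and P :: "nat \<Rightarrow> ('o, 'h, 'u) cat_module"
  assumes A: "cat_module C A" and emb: "embeddable TYPE('u) C A" and res: "projective_resolution C A P d e"
    and pd: "pd_le C (Suc n) (copy A :: ('o, 'h, 'u) cat_module)"
  shows "projective_module C (syzygy P d (n + k))"
proof -
  note cA = copy_iso[OF A emb]
  have pr: "projective_module C (P k)" for k using res by (simp add: projective_resolution_def)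
  note s0 = syzygy_exact(1)[OF res A] and sS = syzygy_exact(2)[OF res A]
  note s = short_exactD[OF s0]
  have one: "embed A x c = \<one>\<^bsub>Val (copy A :: ('o, 'h, 'u) cat_module) x\<^esub> \<longleftrightarrow> c = \<one>\<^bsub>Val A x\<^esub>"
    if x: "x \<in> Ob C" and c: "c \<in> el A x" for x c
    using module_map_one[OF cA(3) cA(1) A x] module_map_one[OF cA(2) A cA(1) x] cA(4)[OF x c] by metis
  have ex: "short_exact C (syzygy P d 0) (\<lambda>x m. m) (P 0) (\<lambda>x m. embed A x (e x m)) (copy A :: ('o, 'h, 'u) cat_module)"
  proof (rule short_exactI[OF s(1,2) cA(1) s(4) module_map_comp[OF s(6) cA(2)]])
    fix x assume x: "x \<in> Ob C"
    show "inj_on (\<lambda>m. m) (el (syzygy P d 0) x)" by simp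
    show "embed A x (e x m) = \<one>\<^bsub>Val (copy A :: ('o, 'h, 'u) cat_module) x\<^esub>" if "m \<in> el (syzygy P d 0) x" for m
      using s(8)[OF x that] module_map_one[OF cA(2) A cA(1) x] by simp
    show "\<exists>a\<in>el (syzygy P d 0) x. a = b" if "b \<in> el (P 0) x" "embed A x (e x b) = \<one>\<^bsub>Val (copy A :: ('o, 'h, 'u) cat_module) x\<^esub>" for b
    proof -
      have "e x b = \<one>\<^bsub>Val A x\<^esub>" using one[OF x module_map_closed[OF s(6) x that(1)]] that(2) by simp
      from s(9)[OF x that(1) this] show ?thesis by simp
    qed
    show "\<exists>b\<in>el (P 0) x. embed A x (e x b) = c" if c: "c \<in> el (copy A :: ('o, 'h, 'u) cat_module) x" for c
    proof -
      obtain b where "b \<in> el (P 0) x" "e x b = unembed A x c"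
        using s(10)[OF x module_map_closed[OF cA(3) x c]] by blast
      then show ?thesis using cA(5)[OF x c] by (intro bexI[of _ b]) simp_all
    qed
  qed
  have step: "pd_le C m (syzygy P d (Suc k))" if "pd_le C (Suc m) (syzygy P d k)" for m k
    using pd_le_syzygy[OF that pr sS] .
  have "pd_le C n (syzygy P d 0)" using pd_le_syzygy[OF pd pr ex] .
  then have "pd_le C (n - j) (syzygy P d j)" if "j \<le> n" for j
    using that
  proof (induction j)
    case (Suc j)
    then have "pd_le C (Suc (n - Suc j)) (syzygy P d j)" by (simp add: Suc_diff_Suc)
    then show ?case by (rule step)
  qed simp
  from this[of n] have "pd_le C 0 (syzygy P d n)" by simp
  then have "pd_le C 0 (syzygy P d (n + k))"
  proof (induction k)
    case (Suc k)
    then have "pd_le C (Suc 0) (syzygy P d (n + k))" using pd_le_mono[of 0] by blast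
    from step[OF this] show ?case by simp
  qed simp
  then show ?thesis by simp
qed

text \<open>Once a syzygy is projective, the inclusion of the next one splits, and all maps on it extend.\<close>

lemma Ext_trivial_above_pd:
  fixes A :: "('o, 'h, 'a) cat_module" and M :: "('o, 'h, 'u) cat_module"
  assumes A: "cat_module C A" and emb: "embeddable TYPE('u) C A" and M: "cat_module C M"
    and pd: "pd_le C (Suc n) (copy A :: ('o, 'h, 'u) cat_module)" and k: "Suc n < k"
  shows "trivial_group (Ext C k A M)"
proof -
  obtain P :: "nat \<Rightarrow> ('o, 'h, 'u) cat_module" and d e where res: "projective_resolution C A P d e"
    and Ext: "\<And>n M. Ext C n A M = Hom_cohomology C P d M n"
    by (rule Ext_resolution[OF A emb]) (rule that)
  obtain j where k: "k = Suc (Suc (n + j))" using less_imp_Suc_add[OF k] by auto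
  have "projective_module C (syzygy P d (n + j))" by (rule pd_le_syzygy_resolution[OF A emb res pd])
  then obtain r where r: "module_map C (P (Suc (n + j))) (syzygy P d (Suc (n + j))) r"
     "\<And>x a. x \<in> Ob C \<Longrightarrow> a \<in> el (syzygy P d (Suc (n + j))) x \<Longrightarrow> r x a = a"
    by (rule short_exact_splits[OF syzygy_exact(2)[OF res A]]) (assumption | rule that)+
  show ?thesis
    unfolding Ext k trivial_Hom_cohomology_iff[OF res A M]
  proof (intro allI impI)
    fix \<phi> assume "module_map C (syzygy P d (Suc (n + j))) M \<phi>"
    from module_map_comp[OF r(1) this]
    show "\<exists>\<psi>. module_map C (P (Suc (n + j))) M \<psi> \<and> (\<forall>x\<in>Ob C. \<forall>m\<in>el (syzygy P d (Suc (n + j))) x. \<psi> x m = \<phi> x m)"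
      using r(2) by (intro exI[of _ "\<lambda>x m. \<phi> x (r x m)"]) simp
  qed
qed

text \<open>The syzygy itself is a universal test module.\<close>

lemma Ext_trivial_imp_syzygy_retract:
  fixes A :: "('o, 'h, 'a) cat_module"
  assumes A: "cat_module C A" and emb: "embeddable TYPE('u) C A"
    and triv: "\<And>M :: ('o, 'h, 'u) cat_module. cat_module C M \<Longrightarrow> trivial_group (Ext C (Suc n) A M)"
  obtains P :: "nat \<Rightarrow> ('o, 'h, 'u) cat_module" and d e r where "projective_resolution C A P d e"
    "module_map C (P n) (syzygy P d n) r" "\<And>x a. x \<in> Ob C \<Longrightarrow> a \<in> el (syzygy P d n) x \<Longrightarrow> r x a = a"
proof -
  obtain P :: "nat \<Rightarrow> ('o, 'h, 'u) cat_module" and d e where res: "projective_resolution C A P d e"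
    and Ext: "\<And>n M. Ext C n A M = Hom_cohomology C P d M n"
    by (rule Ext_resolution[OF A emb]) (rule that)
  have M: "cat_module C (syzygy P d n)"
    using short_exactD(3)[OF syzygy_exact(2)[OF res A]] .
  have "trivial_group (Hom_cohomology C P d (syzygy P d n) (Suc n))" using triv[OF M] by (simp add: Ext)
  then obtain r where "module_map C (P n) (syzygy P d n) r" "\<forall>x\<in>Ob C. \<forall>m\<in>el (syzygy P d n) x. r x m = m"
    unfolding trivial_Hom_cohomology_iff[OF res A M] using module_map_id by blast
  with res that show thesis by blast
qed

end

section \<open>Involutions acting freely\<close>

text \<open>For an endomorphism \<open>w\<close> of \<open>x\<close> with square the identity, this is the vanishing of the Tate
  cohomology of \<open>\<int>/2\<close> with values in \<open>M x\<close>: invariants are norms, anti-invariants are differences.\<close>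

definition Tate_acyclic where
  "Tate_acyclic M x w \<longleftrightarrow>
     (\<forall>m\<in>el M x. Map M x x w m = m \<longrightarrow> (\<exists>m'\<in>el M x. m = m' \<otimes>\<^bsub>Val M x\<^esub> Map M x x w m')) \<and>
     (\<forall>m\<in>el M x. Map M x x w m = inv\<^bsub>Val M x\<^esub> m \<longrightarrow> (\<exists>m'\<in>el M x. m = m' \<otimes>\<^bsub>Val M x\<^esub> inv\<^bsub>Val M x\<^esub> (Map M x x w m')))"

lemma Tate_acyclic_retract:
  assumes Q: "Tate_acyclic Q x w" and mods: "cat_module C P" "cat_module C Q"
    and i: "module_map C P Q i" and r: "module_map C Q P r" and ri: "\<And>p. p \<in> el P x \<Longrightarrow> r x (i x p) = p"
    and x: "x \<in> Ob C" and w: "w \<in> Hom C x x"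
  shows "Tate_acyclic P x w"
  unfolding Tate_acyclic_def
proof (intro conjI ballI impI)
  fix m assume m: "m \<in> el P x"
  interpret QG: group "Val Q x" using mods(2) x by (rule cat_module_group)
  have im: "i x m \<in> el Q x" using i x m by (rule module_map_closed)
  note ni = module_map_nat[OF i x x w m]
  { assume "Map P x x w m = m"
    then have "Map Q x x w (i x m) = i x m" using ni by simp
    then obtain q where q: "q \<in> el Q x" "i x m = q \<otimes>\<^bsub>Val Q x\<^esub> Map Q x x w q" using Q im unfolding Tate_acyclic_def by blast
    have "m = r x q \<otimes>\<^bsub>Val P x\<^esub> Map P x x w (r x q)"
      using ri[OF m] q module_map_mult[OF r x q(1) Map_closed[OF mods(2) x x w q(1)]] module_map_nat[OF r x x w q(1)] by simp
    then show "\<exists>m'\<in>el P x. m = m' \<otimes>\<^bsub>Val P x\<^esub> Map P x x w m'" using module_map_closed[OF r x q(1)] by blast }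
  { assume "Map P x x w m = inv\<^bsub>Val P x\<^esub> m"
    then have "Map Q x x w (i x m) = inv\<^bsub>Val Q x\<^esub> (i x m)" using ni module_map_inv[OF i mods x m] by simp
    then obtain q where q: "q \<in> el Q x" "i x m = q \<otimes>\<^bsub>Val Q x\<^esub> inv\<^bsub>Val Q x\<^esub> (Map Q x x w q)" using Q im unfolding Tate_acyclic_def by blast
    have wq: "Map Q x x w q \<in> el Q x" using Map_closed[OF mods(2) x x w q(1)] .
    have "m = r x q \<otimes>\<^bsub>Val P x\<^esub> inv\<^bsub>Val P x\<^esub> (Map P x x w (r x q))"
      using ri[OF m] q wq module_map_mult[OF r x q(1) QG.inv_closed[OF wq]] module_map_nat[OF r x x w q(1)]
        module_map_inv[OF r mods(2,1) x wq] by simp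
    then show "\<exists>m'\<in>el P x. m = m' \<otimes>\<^bsub>Val P x\<^esub> inv\<^bsub>Val P x\<^esub> (Map P x x w m')" using module_map_closed[OF r x q(1)] by blast }
qed

text \<open>This is the long exact Tate sequence with its connecting maps made explicit: the obstruction to
  an invariant lift of an invariant element of \<open>D\<close> is an anti-invariant element of \<open>A\<close>, and the
  other way round.\<close>

lemma Tate_acyclic_quotient:
  assumes ex: "short_exact C A i P p D" and A: "Tate_acyclic A x w" and P: "Tate_acyclic P x w"
    and x: "x \<in> Ob C" and w: "w \<in> Hom C x x" and ww: "Cmp C x x x w w = Idt C x"
  shows "Tate_acyclic D x w"
proof -
  note a = short_exactD[OF ex]
  interpret AG: comm_group "Val A x" using a(1) x by (rule cat_module_comm_group)
  interpret PG: comm_group "Val P x" using a(2) x by (rule cat_module_comm_group)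
  interpret DG: comm_group "Val D x" using a(3) x by (rule cat_module_comm_group)
  let ?wA = "Map A x x w" and ?wP = "Map P x x w" and ?wD = "Map D x x w"
  have wA: "?wA c \<in> el A x" if "c \<in> el A x" for c using Map_closed[OF a(1) x x w that] .
  have wP: "?wP c \<in> el P x" if "c \<in> el P x" for c using Map_closed[OF a(2) x x w that] .
  have wwP: "?wP (?wP c) = c" if "c \<in> el P x" for c
    using Map_Cmp[OF a(2) x x x w w that] Map_Idt[OF a(2) x that] ww by simp
  have ic: "i x c \<in> el P x" if "c \<in> el A x" for c using module_map_closed[OF a(4) x that] .
  have pc: "p x c \<in> el D x" if "c \<in> el P x" for c using module_map_closed[OF a(6) x that] .
  note simps = module_map_mult[OF a(4) x] module_map_mult[OF a(6) x] module_map_inv[OF a(4,1,2) x] module_map_inv[OF a(6,2,3) x]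
     Map_mult[OF a(2) x x w] Map_inv[OF a(2) x x w] Map_mult[OF a(1) x x w] Map_inv[OF a(1) x x w] a(8)[OF x]
  have inat: "i x (?wA c) = ?wP (i x c)" if "c \<in> el A x" for c using module_map_nat[OF a(4) x x w that] .
  have pnat: "p x (?wP c) = ?wD (p x c)" if "c \<in> el P x" for c using module_map_nat[OF a(6) x x w that] .
  have iinj: "c = c'" if "i x c = i x c'" "c \<in> el A x" "c' \<in> el A x" for c c' using inj_onD[OF a(7)[OF x] that] .
  have A0: "\<exists>c'\<in>el A x. c = c' \<otimes>\<^bsub>Val A x\<^esub> ?wA c'" if "c \<in> el A x" "?wA c = c" for c
    using A that unfolding Tate_acyclic_def by blast
  have A1: "\<exists>c'\<in>el A x. c = c' \<otimes>\<^bsub>Val A x\<^esub> inv\<^bsub>Val A x\<^esub> (?wA c')" if "c \<in> el A x" "?wA c = inv\<^bsub>Val A x\<^esub> c" for c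
    using A that unfolding Tate_acyclic_def by blast
  have P0: "\<exists>c'\<in>el P x. c = c' \<otimes>\<^bsub>Val P x\<^esub> ?wP c'" if "c \<in> el P x" "?wP c = c" for c
    using P that unfolding Tate_acyclic_def by blast
  have P1: "\<exists>c'\<in>el P x. c = c' \<otimes>\<^bsub>Val P x\<^esub> inv\<^bsub>Val P x\<^esub> (?wP c')" if "c \<in> el P x" "?wP c = inv\<^bsub>Val P x\<^esub> c" for c
    using P that unfolding Tate_acyclic_def by blast
  show ?thesis
    unfolding Tate_acyclic_def
  proof (intro conjI ballI impI)
    fix d assume d: "d \<in> el D x"
    obtain q where q: "q \<in> el P x" "p x q = d" using a(10)[OF x d] by blast
    { assume inva: "?wD d = d"
      \<comment> \<open>\<open>w q - q\<close> is anti-invariant in \<open>A\<close>, hence a difference, which corrects \<open>q\<close> to an invariant lift\<close>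
      have "p x (?wP q \<otimes>\<^bsub>Val P x\<^esub> inv\<^bsub>Val P x\<^esub> q) = \<one>\<^bsub>Val D x\<^esub>"
        using q d inva by (simp add: simps pnat wP)
      then obtain c where c: "c \<in> el A x" "?wP q \<otimes>\<^bsub>Val P x\<^esub> inv\<^bsub>Val P x\<^esub> q = i x c"
        using a(9)[OF x] wP q(1) by (metis PG.inv_closed PG.m_closed imageE)
      have "?wA c = inv\<^bsub>Val A x\<^esub> c"
      proof (rule iinj)
        have "?wP (i x c) = q \<otimes>\<^bsub>Val P x\<^esub> inv\<^bsub>Val P x\<^esub> ?wP q" unfolding c(2)[symmetric] using q by (simp add: simps wP wwP)
        also have "\<dots> = inv\<^bsub>Val P x\<^esub> (i x c)" unfolding c(2)[symmetric] using q by (simp add: wP PG.inv_mult_group)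
        finally show "i x (?wA c) = i x (inv\<^bsub>Val A x\<^esub> c)" using c by (simp add: inat simps)
      qed (use c wA in auto)
      then obtain c' where c': "c' \<in> el A x" "c = c' \<otimes>\<^bsub>Val A x\<^esub> inv\<^bsub>Val A x\<^esub> (?wA c')" using A1 c(1) by blast
      let ?q = "q \<otimes>\<^bsub>Val P x\<^esub> i x c'"
      have qw: "?wP q = q \<otimes>\<^bsub>Val P x\<^esub> (i x c' \<otimes>\<^bsub>Val P x\<^esub> inv\<^bsub>Val P x\<^esub> ?wP (i x c'))"
      proof -
        have "?wP q = ?wP q \<otimes>\<^bsub>Val P x\<^esub> inv\<^bsub>Val P x\<^esub> q \<otimes>\<^bsub>Val P x\<^esub> q" using q by (simp add: wP PG.m_assoc)
        also have "\<dots> = i x c \<otimes>\<^bsub>Val P x\<^esub> q" unfolding c(2) ..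
        also have "i x c = i x c' \<otimes>\<^bsub>Val P x\<^esub> inv\<^bsub>Val P x\<^esub> ?wP (i x c')"
          using c' by (simp add: simps wA inat)
        finally show ?thesis using q c' by (simp add: ic wP PG.m_comm)
      qed
      have "?wP ?q = ?q"
        using q c' by (simp add: simps ic qw wP PG.m_assoc)
      then obtain q' where q': "q' \<in> el P x" "?q = q' \<otimes>\<^bsub>Val P x\<^esub> ?wP q'" using P0 q c' by (metis PG.m_closed ic)
      have "d = p x ?q" using q c' d by (simp add: simps ic)
      also have "\<dots> = p x q' \<otimes>\<^bsub>Val D x\<^esub> ?wD (p x q')" unfolding q'(2) using q' by (simp add: simps wP pnat)
      finally show "\<exists>d'\<in>el D x. d = d' \<otimes>\<^bsub>Val D x\<^esub> ?wD d'" using pc[OF q'(1)] by blast }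
    { assume anti: "?wD d = inv\<^bsub>Val D x\<^esub> d"
      have "p x (?wP q \<otimes>\<^bsub>Val P x\<^esub> q) = \<one>\<^bsub>Val D x\<^esub>"
        using q d anti by (simp add: simps pnat wP)
      then obtain c where c: "c \<in> el A x" "?wP q \<otimes>\<^bsub>Val P x\<^esub> q = i x c"
        using a(9)[OF x] wP q(1) by (metis PG.m_closed imageE)
      have "?wA c = c"
      proof (rule iinj)
        have "?wP (i x c) = i x c" unfolding c(2)[symmetric] using q by (simp add: simps wP wwP PG.m_comm)
        then show "i x (?wA c) = i x c" using c by (simp add: inat)
      qed (use c wA in auto)
      then obtain c' where c': "c' \<in> el A x" "c = c' \<otimes>\<^bsub>Val A x\<^esub> ?wA c'" using A0 c(1) by blast
      let ?q = "q \<otimes>\<^bsub>Val P x\<^esub> inv\<^bsub>Val P x\<^esub> (i x c')"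
      have qw: "?wP q = inv\<^bsub>Val P x\<^esub> q \<otimes>\<^bsub>Val P x\<^esub> (i x c' \<otimes>\<^bsub>Val P x\<^esub> ?wP (i x c'))"
      proof -
        have "?wP q = inv\<^bsub>Val P x\<^esub> q \<otimes>\<^bsub>Val P x\<^esub> (?wP q \<otimes>\<^bsub>Val P x\<^esub> q)" using q PG.m_lcomm[of "inv\<^bsub>Val P x\<^esub> q" "?wP q" q] by (simp add: wP)
        also have "\<dots> = inv\<^bsub>Val P x\<^esub> q \<otimes>\<^bsub>Val P x\<^esub> i x c" unfolding c(2) ..
        also have "i x c = i x c' \<otimes>\<^bsub>Val P x\<^esub> ?wP (i x c')" using c' by (simp add: simps wA inat)
        finally show ?thesis .
      qed
      have "?wP ?q = inv\<^bsub>Val P x\<^esub> ?q"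
        using q c' by (simp add: simps ic qw wP PG.m_assoc PG.inv_mult)
      then obtain q' where q': "q' \<in> el P x" "?q = q' \<otimes>\<^bsub>Val P x\<^esub> inv\<^bsub>Val P x\<^esub> (?wP q')" using P1 q c' by (metis PG.inv_closed PG.m_closed ic)
      have "d = p x ?q" using q c' d by (simp add: simps ic)
      also have "\<dots> = p x q' \<otimes>\<^bsub>Val D x\<^esub> inv\<^bsub>Val D x\<^esub> ?wD (p x q')" unfolding q'(2) using q' by (simp add: simps wP pnat)
      finally show "\<exists>d'\<in>el D x. d = d' \<otimes>\<^bsub>Val D x\<^esub> inv\<^bsub>Val D x\<^esub> ?wD d'" using pc[OF q'(1)] by blast }
  qed
qed

lemma lookup_frag_extend_inj:
  assumes \<tau>: "inj_on \<tau> X" and u: "Poly_Mapping.keys u \<subseteq> X" and s: "s \<in> X"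
  shows "Poly_Mapping.lookup (frag_extend (\<lambda>s. frag_of (\<tau> s)) u) (\<tau> s) = Poly_Mapping.lookup u s"
  using u
proof (induction rule: frag_induction)
  case (one t)
  then show ?case using inj_onD[OF \<tau> _ one s] by (auto simp: lookup_single when_def)
qed (simp_all add: frag_extend_diff lookup_minus)

text \<open>An invariant or anti-invariant sum is determined by its restriction to a set of representatives
  of the orbits, all of which have two elements.\<close>

lemma Tate_acyclic_linearization:
  fixes X :: "'o \<Rightarrow> 's set"
  assumes X: "\<And>s. s \<in> X x \<Longrightarrow> act x x w s \<in> X x" "\<And>s. s \<in> X x \<Longrightarrow> act x x w (act x x w s) = s"
    and free: "\<And>s. s \<in> X x \<Longrightarrow> act x x w s \<noteq> s"
  shows "Tate_acyclic (linearization X act) x w"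
proof -
  let ?t = "act x x w"
  let ?W = "frag_extend (\<lambda>s. frag_of (?t s))"
  have inj: "inj_on ?t (X x)" by (metis X(2) inj_onI)
  \<comment> \<open>a set of representatives of the orbits\<close>
  define R where "R = {s \<in> X x. s = (SOME t. t \<in> {s, ?t s})}"
  have R: "s \<in> R \<longleftrightarrow> ?t s \<notin> R" if s: "s \<in> X x" for s
  proof -
    define c where "c = (SOME t. t \<in> {s, ?t s})"
    have "c \<in> {s, ?t s}" unfolding c_def by (rule someI[of _ s]) simp
    moreover have "s \<in> R \<longleftrightarrow> s = c" using s by (simp add: R_def c_def)
    moreover have "?t s \<in> R \<longleftrightarrow> ?t s = c"
    proof -
      have "{?t s, ?t (?t s)} = {s, ?t s}" unfolding X(2)[OF s] by (rule insert_commute)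
      then have "(SOME t. t \<in> {?t s, ?t (?t s)}) = c" by (simp only: c_def)
      then show ?thesis using X(1)[OF s] by (simp only: R_def mem_Collect_eq) simp
    qed
    ultimately show ?thesis using free[OF s] by auto
  qed
  define cut where "cut = frag_extend (\<lambda>s. if s \<in> R then frag_of s else 0)"
  have cut: "Poly_Mapping.lookup (cut u) s = (if s \<in> R then Poly_Mapping.lookup u s else 0)" for u s
    unfolding cut_def using subset_UNIV
    by (induction u rule: frag_induction) (auto simp: frag_extend_diff lookup_minus lookup_single when_def)
  have cutk: "Poly_Mapping.keys (cut u) \<subseteq> X x" for u
    by (auto simp: in_keys_iff cut R_def split: if_splits)
  have W: "Poly_Mapping.lookup (?W u) s = Poly_Mapping.lookup u (?t s)" if "Poly_Mapping.keys u \<subseteq> X x" "s \<in> X x" for u s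
    using lookup_frag_extend_inj[OF inj that(1) X(1)[OF that(2)]] X(2)[OF that(2)] by simp
  have Wk: "Poly_Mapping.keys (?W u) \<subseteq> X x" if "Poly_Mapping.keys u \<subseteq> X x" for u
    using keys_frag_extend[of "\<lambda>s. frag_of (?t s)" u] X(1) that by auto
  have out: "Poly_Mapping.lookup u s = 0" if "Poly_Mapping.keys u \<subseteq> X x" "s \<notin> X x" for u :: "'s \<Rightarrow>\<^sub>0 int" and s
    using that by (metis in_keys_iff subsetD)
  show ?thesis
    unfolding Tate_acyclic_def
  proof (intro conjI ballI impI)
    fix u assume "u \<in> el (linearization X act) x"
    then have u: "Poly_Mapping.keys u \<subseteq> X x" by simp
    { assume "Map (linearization X act) x x w u = u"
      then have inv: "?W u = u" by simp
      have "u = cut u + ?W (cut u)"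
      proof (rule poly_mapping_eqI)
        fix s show "Poly_Mapping.lookup u s = Poly_Mapping.lookup (cut u + ?W (cut u)) s"
          using W[OF u, of s] W[OF cutk, of s u] R[of s] inv out[OF u, of s] out[OF cutk, of s u] out[OF Wk[OF cutk], of s u]
          by (cases "s \<in> X x") (auto simp: lookup_add cut)
      qed
      then show "\<exists>m'\<in>el (linearization X act) x. u = m' \<otimes>\<^bsub>Val (linearization X act) x\<^esub> Map (linearization X act) x x w m'"
        using cutk by (intro bexI[of _ "cut u"]) auto }
    { assume "Map (linearization X act) x x w u = inv\<^bsub>Val (linearization X act) x\<^esub> u"
      then have inv: "?W u = - u" using u by simp
      have "u = cut u - ?W (cut u)"
      proof (rule poly_mapping_eqI)
        fix s show "Poly_Mapping.lookup u s = Poly_Mapping.lookup (cut u - ?W (cut u)) s"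
          using W[OF u, of s] W[OF cutk, of s u] R[of s] inv out[OF u, of s] out[OF cutk, of s u] out[OF Wk[OF cutk], of s u]
          by (cases "s \<in> X x") (auto simp: lookup_minus cut)
      qed
      then show "\<exists>m'\<in>el (linearization X act) x. u = m' \<otimes>\<^bsub>Val (linearization X act) x\<^esub>
          inv\<^bsub>Val (linearization X act) x\<^esub> (Map (linearization X act) x x w m')"
        using cutk Wk[OF cutk] by (intro bexI[of _ "cut u"]) auto }
  qed
qed

context module_universe
begin

text \<open>At the object \<open>x\<close> a free module is free abelian on morphisms to \<open>x\<close>, where composition with \<open>w\<close> has
  no fixed points.\<close>

lemma Tate_acyclic_projective:
  fixes P :: "('o, 'h, 'u) cat_module"
  assumes P: "projective_module C P" and x: "x \<in> Ob C" and w: "w \<in> Hom C x x" and ww: "Cmp C x x x w w = Idt C x"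
    and free: "\<And>z f. z \<in> Ob C \<Longrightarrow> f \<in> Hom C z x \<Longrightarrow> Cmp C z x x w f \<noteq> f"
  shows "Tate_acyclic P x w"
proof -
  have cat: "is_category C" using countable by (simp add: countable_category_def)
  let ?T = "all_elements C P"
  have F: "cat_module C (free_cover C P)" unfolding free_cover_def by (rule cat_module_free[OF cat]) auto
  have "Tate_acyclic (free_cover C P) x w"
    unfolding free_cover_def free_module_def
  proof (rule Tate_acyclic_linearization)
    fix s assume "s \<in> generated_elements C ?T fst x"
    then obtain \<tau> f where s: "s = (\<tau>, f)" "\<tau> \<in> ?T" "fst \<tau> \<in> Ob C" "f \<in> Hom C (fst \<tau>) x" by (auto simp: generated_elements_def)
    show "postcompose C fst x x w s \<in> generated_elements C ?T fst x"
      using s cat x w by (simp add: generated_elements_def postcompose_def is_category_def)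
    have "Cmp C (fst \<tau>) x x w (Cmp C (fst \<tau>) x x w f) = Cmp C (fst \<tau>) x x (Cmp C x x x w w) f"
      using cat s x w unfolding is_category_def by blast
    also have "\<dots> = f" unfolding ww using cat s x unfolding is_category_def by blast
    finally show "postcompose C fst x x w (postcompose C fst x x w s) = s" using s by (simp add: postcompose_def)
    show "postcompose C fst x x w s \<noteq> s" using s free by (simp add: postcompose_def)
  qed
  moreover obtain i r where "module_map C P (free_cover C P) i" "module_map C (free_cover C P) P r"
    "\<And>x p. x \<in> Ob C \<Longrightarrow> p \<in> el P x \<Longrightarrow> r x (i x p) = p"
    by (rule projective_retract_of_free[OF infinite_universe countable P]) (rule that)
  ultimately show ?thesis using Tate_acyclic_retract[OF _ projective_cat_module[OF P] F _ _ _ x w] x by blast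
qed

text \<open>The constant module is not Tate acyclic, because \<open>1\<close> is invariant but not of the form \<open>m + m\<close>.
  If Ext in some positive degree vanished for all coefficients, a syzygy would be a summand of a projective module
  and acyclicity would descend along the resolution.\<close>

lemma constant_Z_Ext_nontrivial:
  assumes x: "x \<in> Ob C" and w: "w \<in> Hom C x x" and ww: "Cmp C x x x w w = Idt C x"
    and free: "\<And>z f. z \<in> Ob C \<Longrightarrow> f \<in> Hom C z x \<Longrightarrow> Cmp C z x x w f \<noteq> f"
  shows "\<exists>M :: ('o, 'h, 'u) cat_module. cat_module C M \<and> \<not> trivial_group (Ext C (Suc n) constant_Z M)"
proof (rule ccontr)
  assume "\<not> ?thesis"
  then have triv: "\<And>M :: ('o, 'h, 'u) cat_module. cat_module C M \<Longrightarrow> trivial_group (Ext C (Suc n) constant_Z M)" by blast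
  have Z: "cat_module C constant_Z"
    by (auto simp: cat_module_def constant_Z_def abelian_integer_group hom_def)
  have "embeddable TYPE('u) C constant_Z"
    unfolding embeddable_def using embed_countable[OF infinite_universe, of "UNIV :: int set"]
    by (auto simp: constant_Z_def)
  note emb = this
  obtain P :: "nat \<Rightarrow> ('o, 'h, 'u) cat_module" and d e r where res: "projective_resolution C constant_Z P d e"
    and r: "module_map C (P n) (syzygy P d n) r" "\<And>x a. x \<in> Ob C \<Longrightarrow> a \<in> el (syzygy P d n) x \<Longrightarrow> r x a = a"
    by (rule Ext_trivial_imp_syzygy_retract[OF Z emb triv]) (assumption | rule that)+
  note s0 = syzygy_exact(1)[OF res Z] and sS = syzygy_exact(2)[OF res Z]
  have P: "Tate_acyclic (P k) x w" for k
    by (rule Tate_acyclic_projective[OF _ x w ww free]) (use res in \<open>auto simp: projective_resolution_def\<close>)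
  have i: "cat_module C (syzygy P d k)" "cat_module C (P k)" "module_map C (syzygy P d k) (P k) (\<lambda>x m. m)" for k
    using short_exactD(3)[OF sS[of k]] short_exactD(2,4)[OF s0] short_exactD(2,4)[OF sS] by (cases k; blast)+
  have "Tate_acyclic (syzygy P d n) x w"
    by (rule Tate_acyclic_retract[OF P i(1,2) i(3) r(1) _ x w]) (use r(2) x in blast)
  then have "Tate_acyclic (syzygy P d (n - k)) x w" if "k \<le> n" for k
    using that
  proof (induction k)
    case (Suc k)
    then have "Tate_acyclic (syzygy P d (Suc (n - Suc k))) x w" by (simp add: Suc_diff_Suc)
    from Tate_acyclic_quotient[OF sS this P x w ww] show ?case .
  qed simp
  from this[of n] have "Tate_acyclic (syzygy P d 0) x w" by simp
  from Tate_acyclic_quotient[OF s0 this P x w ww]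
  have "\<forall>k :: int. \<exists>m. k = m + m" by (simp add: Tate_acyclic_def constant_Z_def)
  then obtain m :: int where "1 = m + m" by blast
  then show False by presburger
qed

end

section \<open>Regular sequences\<close>

text \<open>\<open>partial_sum x M i\<close> is the subgroup \<open>x 0 M + \<dots> + x (i - 1) M\<close>.\<close>

primrec partial_sum :: "(nat \<Rightarrow> 'm \<Rightarrow> 'm) \<Rightarrow> 'm monoid \<Rightarrow> nat \<Rightarrow> 'm set" where
  "partial_sum x M 0 = {\<one>\<^bsub>M\<^esub>}"
| "partial_sum x M (Suc i) = {u \<otimes>\<^bsub>M\<^esub> x i m | u m. u \<in> partial_sum x M i \<and> m \<in> carrier M}"

lemma partial_sum_SucI: "u \<in> partial_sum x M i \<Longrightarrow> m \<in> carrier M \<Longrightarrow> u \<otimes>\<^bsub>M\<^esub> x i m \<in> partial_sum x M (Suc i)"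
  by auto

definition regular_sequence :: "(nat \<Rightarrow> 'm \<Rightarrow> 'm) \<Rightarrow> 'm monoid \<Rightarrow> nat \<Rightarrow> bool" where
  "regular_sequence x M i \<longleftrightarrow>
     (\<forall>j<i. \<forall>m\<in>carrier M. x j m \<in> partial_sum x M j \<longrightarrow> m \<in> partial_sum x M j)"

lemma regular_le: "regular_sequence x M n \<Longrightarrow> i \<le> n \<Longrightarrow> regular_sequence x M i"
  by (simp add: regular_sequence_def)

locale commuting_endomorphisms =
  fixes M :: "'m monoid" and x :: "nat \<Rightarrow> 'm \<Rightarrow> 'm" and n :: nat
  assumes comm: "comm_group M"
    and endo: "j < n \<Longrightarrow> x j \<in> hom M M"
    and commute: "j < n \<Longrightarrow> k < n \<Longrightarrow> m \<in> carrier M \<Longrightarrow> x j (x k m) = x k (x j m)"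
begin

sublocale comm_group M by (rule comm)

lemma x_closed [simp]: "j < n \<Longrightarrow> m \<in> carrier M \<Longrightarrow> x j m \<in> carrier M"
  using endo hom_in_carrier by metis

lemma x_mult: "j < n \<Longrightarrow> m \<in> carrier M \<Longrightarrow> m' \<in> carrier M \<Longrightarrow> x j (m \<otimes>\<^bsub>M\<^esub> m') = x j m \<otimes>\<^bsub>M\<^esub> x j m'"
  using endo hom_mult by metis

lemma x_one: "j < n \<Longrightarrow> x j \<one>\<^bsub>M\<^esub> = \<one>\<^bsub>M\<^esub>"
  using hom_one[OF endo is_group is_group] .

lemma x_inv: "j < n \<Longrightarrow> m \<in> carrier M \<Longrightarrow> x j (inv\<^bsub>M\<^esub> m) = inv\<^bsub>M\<^esub> (x j m)"
  by (rule group_hom.hom_inv) (simp_all add: group_hom_def group_hom_axioms_def endo is_group)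

abbreviation J where "J i \<equiv> partial_sum x M i"

lemma J_closed: "i \<le> n \<Longrightarrow> u \<in> J i \<Longrightarrow> u \<in> carrier M"
  by (induction i arbitrary: u) auto

lemma J_one: "i \<le> n \<Longrightarrow> \<one>\<^bsub>M\<^esub> \<in> J i"
proof (induction i)
  case (Suc i)
  then show ?case using x_one[of i] partial_sum_SucI[of "\<one>\<^bsub>M\<^esub>" x M i "\<one>\<^bsub>M\<^esub>"] by simp
qed simp

lemma J_mult: "i \<le> n \<Longrightarrow> u \<in> J i \<Longrightarrow> v \<in> J i \<Longrightarrow> u \<otimes>\<^bsub>M\<^esub> v \<in> J i"
proof (induction i arbitrary: u v)
  case (Suc i)
  obtain u' m where u: "u = u' \<otimes>\<^bsub>M\<^esub> x i m" "u' \<in> J i" "m \<in> carrier M" using Suc(3) by auto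
  obtain v' k where v: "v = v' \<otimes>\<^bsub>M\<^esub> x i k" "v' \<in> J i" "k \<in> carrier M" using Suc(4) by auto
  have i: "i < n" using Suc(2) by simp
  have cl: "u' \<in> carrier M" "v' \<in> carrier M" using u v i J_closed[of i] by auto
  have "u \<otimes>\<^bsub>M\<^esub> v = (u' \<otimes>\<^bsub>M\<^esub> v') \<otimes>\<^bsub>M\<^esub> x i (m \<otimes>\<^bsub>M\<^esub> k)"
    using u v i cl by (simp add: x_mult m_ac)
  moreover have "u' \<otimes>\<^bsub>M\<^esub> v' \<in> J i" using Suc u v by simp
  ultimately show ?case using u(3) v(3) by auto
qed simp

lemma J_inv: "i \<le> n \<Longrightarrow> u \<in> J i \<Longrightarrow> inv\<^bsub>M\<^esub> u \<in> J i"
proof (induction i arbitrary: u)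
  case (Suc i)
  obtain u' m where u: "u = u' \<otimes>\<^bsub>M\<^esub> x i m" "u' \<in> J i" "m \<in> carrier M" using Suc(3) by auto
  have i: "i < n" using Suc(2) by simp
  have cl: "u' \<in> carrier M" using u i J_closed[of i] by auto
  have "inv\<^bsub>M\<^esub> u = inv\<^bsub>M\<^esub> u' \<otimes>\<^bsub>M\<^esub> x i (inv\<^bsub>M\<^esub> m)" using u i cl by (simp add: x_inv inv_mult)
  moreover have "inv\<^bsub>M\<^esub> u' \<in> J i" using Suc u by simp
  ultimately show ?case using u(3) by auto
qed simp

lemma J_Suc: "Suc i \<le> n \<Longrightarrow> u \<in> J i \<Longrightarrow> u \<in> J (Suc i)"
  using x_one[of i] J_closed[of i u] partial_sum_SucI[of u x M i "\<one>\<^bsub>M\<^esub>"] by (simp del: partial_sum.simps)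

lemma x_in_J: "j < i \<Longrightarrow> i \<le> n \<Longrightarrow> m \<in> carrier M \<Longrightarrow> x j m \<in> J i"
proof (induction i)
  case (Suc i)
  show ?case
  proof (cases "j = i")
    case True
    then show ?thesis using Suc J_one[of i] partial_sum_SucI[of "\<one>\<^bsub>M\<^esub>" x M i m] by (simp del: partial_sum.simps)
  next
    case False
    then show ?thesis using Suc by (intro J_Suc) auto
  qed
qed simp

lemma x_J: "j < n \<Longrightarrow> i \<le> n \<Longrightarrow> u \<in> J i \<Longrightarrow> x j u \<in> J i"
proof (induction i arbitrary: u)
  case (Suc i)
  obtain u' m where u: "u = u' \<otimes>\<^bsub>M\<^esub> x i m" "u' \<in> J i" "m \<in> carrier M" using Suc(4) by auto
  have i: "i < n" using Suc(3) by simp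
  have cl: "u' \<in> carrier M" using u i J_closed[of i] by auto
  have "x j u = x j u' \<otimes>\<^bsub>M\<^esub> x i (x j m)" using u i cl Suc(2) by (simp add: x_mult commute)
  moreover have "x j u' \<in> J i" using Suc u by simp
  ultimately show ?case using partial_sum_SucI[of "x j u'" x M i "x j m"] u(3) Suc(2) by (simp del: partial_sum.simps)
qed (simp add: x_one)

lemma J_map:
  assumes h: "h \<in> hom M N" and y: "\<And>j m. j < n \<Longrightarrow> m \<in> carrier M \<Longrightarrow> h (x j m) = y j (h m)" and N: "group N"
  shows "i \<le> n \<Longrightarrow> u \<in> J i \<Longrightarrow> h u \<in> partial_sum y N i"
proof (induction i arbitrary: u)
  case 0
  then show ?case using hom_one[OF h is_group N] by simp
next
  case (Suc i)
  then obtain v m where v: "u = v \<otimes>\<^bsub>M\<^esub> x i m" "v \<in> J i" "m \<in> carrier M" by auto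
  have "h u = h v \<otimes>\<^bsub>N\<^esub> y i (h m)"
    using v Suc(2) J_closed[of i v] hom_mult[OF h] y[of i m] by simp
  then show ?case using Suc v hom_in_carrier[OF h v(3)] partial_sum_SucI[of "h v" y N i "h m"]
    by (simp del: partial_sum.simps)
qed

end

text \<open>A short exact sequence \<open>0 \<rightarrow> A \<rightarrow> P \<rightarrow> D \<rightarrow> 0\<close> of modules with commuting operators.\<close>

locale operator_extension =
  P: commuting_endomorphisms P x n + D: commuting_endomorphisms D y n
  for P :: "'p monoid" and x and D :: "'d monoid" and y and n +
  fixes \<pi> :: "'p \<Rightarrow> 'd" and A :: "'p set"
  assumes \<pi>: "\<pi> \<in> hom P D" and surj: "\<And>d. d \<in> carrier D \<Longrightarrow> \<exists>p\<in>carrier P. \<pi> p = d"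
    and nat: "\<And>j p. j < n \<Longrightarrow> p \<in> carrier P \<Longrightarrow> \<pi> (x j p) = y j (\<pi> p)"
    and ker: "\<And>p. p \<in> A \<longleftrightarrow> p \<in> carrier P \<and> \<pi> p = \<one>\<^bsub>D\<^esub>"
begin

sublocale \<pi>: group_hom P D \<pi>
  by (simp add: group_hom_def group_hom_axioms_def P.is_group D.is_group \<pi>)

lemma subgroup_A: "subgroup A P"
proof -
  have "A = kernel P D \<pi>" using ker by (auto simp: kernel_def)
  then show ?thesis using \<pi>.subgroup_kernel by simp
qed

sublocale A: commuting_endomorphisms "P\<lparr>carrier := A\<rparr>" x n
proof (rule commuting_endomorphisms.intro)
  show "comm_group (P\<lparr>carrier := A\<rparr>)" using comm_group_restrict[OF P.comm subgroup_A] .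
  fix j assume j: "j < n"
  show "x j \<in> hom (P\<lparr>carrier := A\<rparr>) (P\<lparr>carrier := A\<rparr>)"
    using j by (intro homI) (auto simp: ker nat P.x_mult D.x_one)
  fix k m assume "k < n" "m \<in> carrier (P\<lparr>carrier := A\<rparr>)"
  then show "x j (x k m) = x k (x j m)" using j P.commute by (simp add: ker)
qed

lemma A_P: "a \<in> A \<Longrightarrow> a \<in> carrier P" by (simp add: ker)

lemma J_A_P: "u \<in> A.J i \<Longrightarrow> i \<le> n \<Longrightarrow> u \<in> P.J i"
  by (induction i arbitrary: u) (auto dest: A_P)

lemma J_image: "i \<le> n \<Longrightarrow> v \<in> P.J i \<Longrightarrow> \<pi> v \<in> D.J i"
proof (induction i arbitrary: v)
  case (Suc i)
  then obtain u p where "v = u \<otimes>\<^bsub>P\<^esub> x i p" "u \<in> P.J i" "p \<in> carrier P" by auto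
  then show ?case using Suc P.J_closed[of i u] partial_sum_SucI[of "\<pi> u" y D i "\<pi> p"]
    by (simp add: nat del: partial_sum.simps)
qed simp

lemma J_lift: "i \<le> n \<Longrightarrow> c \<in> D.J i \<Longrightarrow> \<exists>v\<in>P.J i. \<pi> v = c"
proof (induction i arbitrary: c)
  case (Suc i)
  then obtain u d where u: "c = u \<otimes>\<^bsub>D\<^esub> y i d" "u \<in> D.J i" "d \<in> carrier D" by auto
  obtain v where v: "v \<in> P.J i" "\<pi> v = u" using Suc u by auto
  obtain p where p: "p \<in> carrier P" "\<pi> p = d" using surj u by blast
  have "\<pi> (v \<otimes>\<^bsub>P\<^esub> x i p) = c" using v p u Suc(2) P.J_closed[of i v] by (simp add: nat)
  moreover have "v \<otimes>\<^bsub>P\<^esub> x i p \<in> P.J (Suc i)" using v p by auto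
  ultimately show ?case by blast
qed simp

text \<open>This is the injectivity of \<open>A / J A \<rightarrow> P / J P\<close>, that is, the vanishing of the first Koszul homology
  of \<open>D\<close> for the first \<open>i\<close> operators.\<close>

lemma J_inter:
  assumes "i \<le> n" "regular_sequence y D i" "v \<in> P.J i" "v \<in> A"
  shows "v \<in> A.J i"
  using assms
proof (induction i arbitrary: v)
  case (Suc i)
  have i: "i < n" using Suc by simp
  obtain u p where u: "v = u \<otimes>\<^bsub>P\<^esub> x i p" "u \<in> P.J i" "p \<in> carrier P" using Suc by auto
  have uP: "u \<in> carrier P" using P.J_closed[of i] u i by simp
  have "\<pi> u \<otimes>\<^bsub>D\<^esub> y i (\<pi> p) = \<one>\<^bsub>D\<^esub>" using Suc(5) u uP i by (simp add: ker nat)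
  then have "y i (\<pi> p) = inv\<^bsub>D\<^esub> (\<pi> u)"
    using uP u(3) i by (metis D.inv_unique' D.x_closed \<pi>.hom_closed D.inv_equality D.m_comm)
  then have "y i (\<pi> p) \<in> D.J i" using D.J_inv J_image u(2) i by simp
  then have "\<pi> p \<in> D.J i" using Suc(3) u(3) by (simp add: regular_sequence_def)
  then obtain w where w: "w \<in> P.J i" "\<pi> w = \<pi> p" using J_lift[of i "\<pi> p"] i by auto
  have wP: "w \<in> carrier P" using P.J_closed[of i] w i by simp
  define a where "a = p \<otimes>\<^bsub>P\<^esub> inv\<^bsub>P\<^esub> w"
  have a: "a \<in> A" using w wP u(3) by (simp add: a_def ker)
  have aP: "a \<in> carrier P" using a by (rule A_P)
  have p: "p = a \<otimes>\<^bsub>P\<^esub> w" using wP u(3) by (simp add: a_def P.m_assoc)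
  define v' where "v' = u \<otimes>\<^bsub>P\<^esub> x i w"
  have v': "v = v' \<otimes>\<^bsub>P\<^esub> x i a" using u(1) uP wP aP i by (simp add: v'_def p P.x_mult P.m_ac)
  have v'J: "v' \<in> P.J i" unfolding v'_def using u(2) w(1) i by (intro P.J_mult P.x_J) auto
  have v'P: "v' \<in> carrier P" using uP wP i by (simp add: v'_def)
  have xa: "x i a \<in> A" using A.x_closed[OF i] a by simp
  have "v' = v \<otimes>\<^bsub>P\<^esub> inv\<^bsub>P\<^esub> (x i a)" using v' v'P aP i by (simp add: P.m_assoc)
  then have "v' \<in> A" using Suc(5) xa by (simp add: ker)
  then have "v' \<in> A.J i" using Suc v'J by (simp add: regular_sequence_def)
  then show ?case using v' a by auto
qed simp

text \<open>Since \<open>A / J A\<close> embeds into \<open>P / J P\<close>, regularity on \<open>A\<close> reaches one operator further than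
  regularity on \<open>D\<close>.\<close>

lemma regular_A:
  assumes "Suc i \<le> n" "regular_sequence y D i" "regular_sequence x P (Suc i)"
  shows "regular_sequence x (P\<lparr>carrier := A\<rparr>) (Suc i)"
  unfolding regular_sequence_def
proof (intro allI impI ballI)
  fix j m assume j: "j < Suc i" and m: "m \<in> carrier (P\<lparr>carrier := A\<rparr>)" and xm: "x j m \<in> A.J j"
  have mA: "m \<in> A" using m by simp
  have "x j m \<in> P.J j" using J_A_P xm j assms(1) by simp
  then have "m \<in> P.J j" using assms(3) j A_P[OF mA] by (simp add: regular_sequence_def)
  moreover have "regular_sequence y D j" using assms(2) j by (simp add: regular_sequence_def)
  ultimately show "m \<in> A.J j" using J_inter[of j m] mA j assms(1) by simp
qed

text \<open>A class of \<open>D / J D\<close> killed by all operators gives, by the connecting homomorphism of \<open>x i\<close>,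
  such a class in \<open>A\<close>, and this class becomes zero in \<open>P\<close>.\<close>

lemma connecting_class:
  assumes i: "Suc i \<le> n" and rD: "regular_sequence y D i" and rP: "regular_sequence x P (Suc i)"
    and c: "c \<in> carrier D" "c \<notin> D.J i" "\<And>j. j < n \<Longrightarrow> y j c \<in> D.J i"
  shows "\<exists>a\<in>A. a \<in> P.J (Suc i) \<and> a \<notin> A.J (Suc i) \<and> (\<forall>j<n. x j a \<in> A.J (Suc i))"
proof -
  have i': "i < n" using i by simp
  obtain p where p: "p \<in> carrier P" "\<pi> p = c" using surj c(1) by blast
  obtain u where u: "u \<in> P.J i" "\<pi> u = y i c" using J_lift[of i "y i c"] c(3)[OF i'] i by auto
  have uP: "u \<in> carrier P" using P.J_closed[of i u] u i by simp
  define a where "a = x i p \<otimes>\<^bsub>P\<^esub> inv\<^bsub>P\<^esub> u"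
  have a: "a \<in> A" using p u uP i' c(1) by (simp add: a_def ker nat)
  have aP: "a \<in> carrier P" using a by (rule A_P)
  have aJ: "a \<in> P.J (Suc i)"
    unfolding a_def using p(1) u(1) i i' by (intro P.J_mult P.x_in_J P.J_inv P.J_Suc) auto
  have "a \<notin> A.J (Suc i)"
  proof
    assume "a \<in> A.J (Suc i)"
    then obtain v b where v: "a = v \<otimes>\<^bsub>P\<^esub> x i b" "v \<in> A.J i" "b \<in> A" by auto
    have bP: "b \<in> carrier P" using v(3) by (rule A_P)
    have vJ: "v \<in> P.J i" using J_A_P v(2) i by simp
    have vP: "v \<in> carrier P" using P.J_closed[of i] vJ i by simp
    have "x i (p \<otimes>\<^bsub>P\<^esub> inv\<^bsub>P\<^esub> b) = x i p \<otimes>\<^bsub>P\<^esub> inv\<^bsub>P\<^esub> (x i b)" using p bP i' by (simp add: P.x_mult P.x_inv)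
    also have "x i p = v \<otimes>\<^bsub>P\<^esub> x i b \<otimes>\<^bsub>P\<^esub> u"
    proof -
      have "x i p = a \<otimes>\<^bsub>P\<^esub> u" using p uP i' by (simp add: a_def P.m_assoc)
      then show ?thesis using v(1) by simp
    qed
    also have "v \<otimes>\<^bsub>P\<^esub> x i b \<otimes>\<^bsub>P\<^esub> u \<otimes>\<^bsub>P\<^esub> inv\<^bsub>P\<^esub> (x i b) = v \<otimes>\<^bsub>P\<^esub> u"
    proof -
      have "v \<otimes>\<^bsub>P\<^esub> x i b \<otimes>\<^bsub>P\<^esub> u \<otimes>\<^bsub>P\<^esub> inv\<^bsub>P\<^esub> (x i b) = v \<otimes>\<^bsub>P\<^esub> (u \<otimes>\<^bsub>P\<^esub> (x i b \<otimes>\<^bsub>P\<^esub> inv\<^bsub>P\<^esub> (x i b)))"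
        using vP uP bP i' by (simp add: P.m_ac del: P.r_inv)
      then show ?thesis using vP uP bP i' by simp
    qed
    finally have "x i (p \<otimes>\<^bsub>P\<^esub> inv\<^bsub>P\<^esub> b) \<in> P.J i" using P.J_mult[of i v u] vJ u(1) i by simp
    then have "p \<otimes>\<^bsub>P\<^esub> inv\<^bsub>P\<^esub> b \<in> P.J i" using rP p(1) bP by (simp add: regular_sequence_def)
    then have "\<pi> (p \<otimes>\<^bsub>P\<^esub> inv\<^bsub>P\<^esub> b) \<in> D.J i" using J_image i by simp
    moreover have "\<pi> (p \<otimes>\<^bsub>P\<^esub> inv\<^bsub>P\<^esub> b) = c" using p v(3) bP c(1) by (simp add: ker)
    ultimately show False using c(2) by simp
  qed
  moreover have "x j a \<in> A.J (Suc i)" if j: "j < n" for j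
  proof -
    obtain v where v: "v \<in> P.J i" "\<pi> v = y j c" using J_lift[of i "y j c"] c(3)[OF j] i by auto
    have vP: "v \<in> carrier P" using P.J_closed[of i v] v i by simp
    define b where "b = x j p \<otimes>\<^bsub>P\<^esub> inv\<^bsub>P\<^esub> v"
    have b: "b \<in> A" using p v vP j c(1) by (simp add: b_def ker nat)
    have bP: "b \<in> carrier P" using b by (rule A_P)
    have xjp: "x j p = v \<otimes>\<^bsub>P\<^esub> b" using p vP j by (simp add: b_def P.m_lcomm[of v])
    define z where "z = x i v \<otimes>\<^bsub>P\<^esub> inv\<^bsub>P\<^esub> (x j u)"
    have zJ: "z \<in> P.J i" unfolding z_def using u(1) v(1) i i' j by (intro P.J_mult P.J_inv P.x_J) auto
    have zP: "z \<in> carrier P" using P.J_closed[of i z] zJ i by simp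
    have "x j a = x i (x j p) \<otimes>\<^bsub>P\<^esub> inv\<^bsub>P\<^esub> (x j u)"
      using p uP i' j by (simp add: a_def P.x_mult P.x_inv P.commute[of j i])
    also have "\<dots> = z \<otimes>\<^bsub>P\<^esub> x i b" using vP uP bP i' j by (simp add: xjp P.x_mult z_def P.m_ac)
    finally have eq: "x j a = z \<otimes>\<^bsub>P\<^esub> x i b" .
    have xja: "x j a \<in> A" "x i b \<in> A" using A.x_closed a b i' j by auto
    have "z = x j a \<otimes>\<^bsub>P\<^esub> inv\<^bsub>P\<^esub> (x i b)" using eq zP bP i' by (simp add: P.m_assoc)
    then have "z \<in> A" using xja by (simp add: ker)
    then have "z \<in> A.J i" using J_inter[of i z] rD zJ i by simp
    then show ?thesis using eq b by auto
  qed
  ultimately show ?thesis using a aJ by blast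
qed

end

section \<open>Permutations without invariants\<close>

text \<open>A height that grows along \<open>\<tau>\<close> excludes finite orbits.\<close>

lemma no_invariant_frag:
  fixes ht :: "'s \<Rightarrow> int"
  assumes \<tau>: "inj_on \<tau> X" "\<And>s. s \<in> X \<Longrightarrow> \<tau> s \<in> X" and ht: "\<And>s. s \<in> X \<Longrightarrow> ht s < ht (\<tau> s)"
    and u: "Poly_Mapping.keys u \<subseteq> X" and inv: "frag_extend (\<lambda>s. frag_of (\<tau> s)) u = u"
  shows "u = 0"
proof (rule ccontr)
  assume "u \<noteq> 0"
  then have ne: "Poly_Mapping.keys u \<noteq> {}" by simp
  let ?m = "Max (ht ` Poly_Mapping.keys u)"
  have "?m \<in> ht ` Poly_Mapping.keys u" using ne by (intro Max_in) auto
  then obtain s where s: "s \<in> Poly_Mapping.keys u" "ht s = ?m" by auto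
  then have sX: "s \<in> X" using u by blast
  have "Poly_Mapping.lookup u (\<tau> s) = Poly_Mapping.lookup u s"
    using lookup_frag_extend_inj[OF \<tau>(1) u sX] inv by simp
  then have "\<tau> s \<in> Poly_Mapping.keys u" using s by (simp add: in_keys_iff)
  then have "ht (\<tau> s) \<le> ?m" by (intro Max_ge) auto
  then show False using ht[OF sX] s(2) by simp
qed

text \<open>Choose a point \<open>q t\<close> in each fibre: modulo \<open>J\<close> every \<open>u\<close> is congruent to its image under \<open>q \<circ> p\<close>,
  and this image vanishes together with \<open>p u\<close>.\<close>

lemma frag_kernel:
  fixes p :: "'s \<Rightarrow> 't"
  assumes J: "0 \<in> J" "\<And>a b. a \<in> J \<Longrightarrow> b \<in> J \<Longrightarrow> a - b \<in> J"
    and fib: "\<And>s s'. s \<in> X \<Longrightarrow> s' \<in> X \<Longrightarrow> p s = p s' \<Longrightarrow> frag_of s - frag_of s' \<in> J"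
    and u: "Poly_Mapping.keys u \<subseteq> X" and z: "frag_extend (frag_of \<circ> p) u = 0"
  shows "u \<in> J"
proof -
  define q where "q = (\<lambda>t. SOME s. s \<in> X \<and> p s = t)"
  have q: "q (p s) \<in> X \<and> p (q (p s)) = p s" if "s \<in> X" for s
    unfolding q_def by (rule someI[of _ s]) (use that in simp)
  have "u - frag_extend (frag_of \<circ> q) (frag_extend (frag_of \<circ> p) u) \<in> J"
    using u
  proof (induction rule: frag_induction)
    case zero then show ?case using J(1) by simp
  next
    case (one s) then show ?case using fib[OF one] q[OF one] by simp
  next
    case (diff a b)
    have "a - b - frag_extend (frag_of \<circ> q) (frag_extend (frag_of \<circ> p) (a - b)) =
       (a - frag_extend (frag_of \<circ> q) (frag_extend (frag_of \<circ> p) a)) - (b - frag_extend (frag_of \<circ> q) (frag_extend (frag_of \<circ> p) b))"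
      by (simp add: frag_extend_diff)
    then show ?case using J(2)[OF diff] by (simp only:)
  qed
  then show ?thesis using z by simp
qed

text \<open>If \<open>\<sigma>\<close> generates a free action of the integers on \<open>X\<close> with quotient \<open>Y\<close>, then
  \<open>0 \<rightarrow> \<int>X \<rightarrow> \<int>X \<rightarrow> \<int>Y \<rightarrow> 0\<close> with the first map \<open>1 - \<sigma>\<close> is exact.\<close>

lemma permutation_short_exact:
  fixes X :: "'o \<Rightarrow> 's set" and Y :: "'o \<Rightarrow> 't set" and ht :: "'s \<Rightarrow> int"
  assumes X: "set_functor C X act" and Y: "set_functor C Y act'"
    and \<sigma>: "\<And>x s. x \<in> Ob C \<Longrightarrow> s \<in> X x \<Longrightarrow> \<sigma> s \<in> X x" "\<And>x. x \<in> Ob C \<Longrightarrow> inj_on \<sigma> (X x)"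
    and \<sigma>nat: "\<And>x y f s. x \<in> Ob C \<Longrightarrow> y \<in> Ob C \<Longrightarrow> f \<in> Hom C x y \<Longrightarrow> s \<in> X x \<Longrightarrow> \<sigma> (act x y f s) = act x y f (\<sigma> s)"
    and ht: "\<And>x s. x \<in> Ob C \<Longrightarrow> s \<in> X x \<Longrightarrow> ht s < ht (\<sigma> s)"
    and p: "\<And>x. x \<in> Ob C \<Longrightarrow> p ` X x = Y x"
    and pnat: "\<And>x y f s. x \<in> Ob C \<Longrightarrow> y \<in> Ob C \<Longrightarrow> f \<in> Hom C x y \<Longrightarrow> s \<in> X x \<Longrightarrow> p (act x y f s) = act' x y f (p s)"
    and p\<sigma>: "\<And>x s. x \<in> Ob C \<Longrightarrow> s \<in> X x \<Longrightarrow> p (\<sigma> s) = p s"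
    and fib: "\<And>x s s'. x \<in> Ob C \<Longrightarrow> s \<in> X x \<Longrightarrow> s' \<in> X x \<Longrightarrow> p s = p s' \<Longrightarrow> \<exists>k. s' = (\<sigma> ^^ k) s \<or> s = (\<sigma> ^^ k) s'"
  shows "short_exact C (linearization X act) (\<lambda>x. frag_extend (\<lambda>s. frag_of s - frag_of (\<sigma> s)))
     (linearization X act) (\<lambda>x. frag_extend (frag_of \<circ> p)) (linearization Y act')"
proof -
  let ?i = "frag_extend (\<lambda>s. frag_of s - frag_of (\<sigma> s)) :: ('s \<Rightarrow>\<^sub>0 int) \<Rightarrow> _"
  have i_eq: "?i u = u - frag_extend (\<lambda>s. frag_of (\<sigma> s)) u" for u
    using subset_UNIV by (induction u rule: frag_induction) (auto simp: frag_extend_diff)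
  have i_keys: "Poly_Mapping.keys (?i u) \<subseteq> X x" if "x \<in> Ob C" "Poly_Mapping.keys u \<subseteq> X x" for u x
  proof -
    have "Poly_Mapping.keys (frag_of s - frag_of (\<sigma> s)) \<subseteq> X x" if s: "s \<in> Poly_Mapping.keys u" for s
    proof -
      have "Poly_Mapping.keys (frag_of s - frag_of (\<sigma> s)) \<subseteq> {s, \<sigma> s}"
        using keys_diff[of "frag_of s" "frag_of (\<sigma> s)"] by auto
      also have "\<dots> \<subseteq> X x" using \<sigma>(1)[OF \<open>x \<in> Ob C\<close>] s \<open>Poly_Mapping.keys u \<subseteq> X x\<close> by auto
      finally show ?thesis .
    qed
    then show ?thesis using keys_frag_extend[of "\<lambda>s. frag_of s - frag_of (\<sigma> s)" u] by blast
  qed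
  note mX = cat_module_linearization[OF X] and mY = cat_module_linearization[OF Y]
  show ?thesis
  proof (rule short_exactI[OF mX mX mY])
    show "module_map C (linearization X act) (linearization X act) (\<lambda>x. ?i)"
      unfolding module_map_def
    proof (intro conjI ballI)
      fix x assume x: "x \<in> Ob C"
      show "?i \<in> hom (Val (linearization X act) x) (Val (linearization X act) x)"
        using i_keys[OF x] by (auto intro!: homI simp: frag_extend_add)
    next
      fix x y f m assume *: "x \<in> Ob C" "y \<in> Ob C" "f \<in> Hom C x y" "m \<in> el (linearization X act) x"
      then have "Poly_Mapping.keys m \<subseteq> X x" by simp
      then show "?i (Map (linearization X act) x y f m) = Map (linearization X act) x y f (?i m)"
        by (induction rule: frag_induction) (use * \<sigma>nat in \<open>auto simp: frag_extend_diff\<close>)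
    qed
    show "module_map C (linearization X act) (linearization Y act') (\<lambda>x. frag_extend (frag_of \<circ> p))"
      by (rule linearization_map[OF X Y]) (use p pnat in auto)
    fix x assume x: "x \<in> Ob C"
    show "inj_on ?i (el (linearization X act) x)"
    proof (rule inj_onI)
      fix u v assume "u \<in> el (linearization X act) x" "v \<in> el (linearization X act) x" and eq: "?i u = ?i v"
      then have k: "Poly_Mapping.keys (u - v) \<subseteq> X x" using keys_diff[of u v] by auto
      have "?i (u - v) = 0" using eq by (simp add: frag_extend_diff)
      then have "frag_extend (\<lambda>s. frag_of (\<sigma> s)) (u - v) = u - v" by (simp add: i_eq)
      from no_invariant_frag[of \<sigma> "X x" ht, OF \<sigma>(2)[OF x] \<sigma>(1)[OF x] ht[OF x] k this] show "u = v" by simp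
    qed
    show "frag_extend (frag_of \<circ> p) (?i u) = \<one>\<^bsub>Val (linearization Y act') x\<^esub>" if "u \<in> el (linearization X act) x" for u
    proof -
      have "Poly_Mapping.keys u \<subseteq> X x" using that by simp
      then have "frag_extend (frag_of \<circ> p) (?i u) = 0"
        by (induction rule: frag_induction) (use p\<sigma>[OF x] in \<open>auto simp: frag_extend_diff\<close>)
      then show ?thesis by simp
    qed
    show "\<exists>a\<in>el (linearization X act) x. ?i a = u"
      if u: "u \<in> el (linearization X act) x" "frag_extend (frag_of \<circ> p) u = \<one>\<^bsub>Val (linearization Y act') x\<^esub>" for u
    proof -
      define J where "J = ?i ` {a. Poly_Mapping.keys a \<subseteq> X x}"
      have J0: "0 \<in> J" unfolding J_def by (rule image_eqI[of _ _ 0]) auto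
      have Jd: "a - b \<in> J" if ab: "a \<in> J" "b \<in> J" for a b
      proof -
        obtain a' b' where "a = ?i a'" "b = ?i b'" "Poly_Mapping.keys a' \<subseteq> X x" "Poly_Mapping.keys b' \<subseteq> X x" using ab unfolding J_def by blast
        then show ?thesis using keys_diff[of a' b'] unfolding J_def by (intro image_eqI[of _ _ "a' - b'"]) (auto simp: frag_extend_diff)
      qed
      have Jm: "- a \<in> J" if "a \<in> J" for a using Jd[OF J0 that] by simp
      have pow: "(\<sigma> ^^ k) s \<in> X x \<and> frag_of s - frag_of ((\<sigma> ^^ k) s) \<in> J" if s: "s \<in> X x" for k s
      proof (induction k)
        case 0 then show ?case using s J0 by simp
      next
        case (Suc k)
        let ?t = "(\<sigma> ^^ k) s"
        have d: "frag_of ?t - frag_of (\<sigma> ?t) \<in> J" unfolding J_def using Suc by (intro image_eqI[of _ _ "frag_of ?t"]) auto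
        have "(frag_of s - frag_of ?t) - - (frag_of ?t - frag_of (\<sigma> ?t)) \<in> J" by (rule Jd[OF conjunct2[OF Suc] Jm[OF d]])
        then show ?case using Suc \<sigma>(1)[OF x] by simp
      qed
      have "u \<in> J"
      proof (rule frag_kernel[of J "X x" p u, OF J0 Jd])
        fix s s' assume s: "s \<in> X x" "s' \<in> X x" "p s = p s'"
        obtain k where "s' = (\<sigma> ^^ k) s \<or> s = (\<sigma> ^^ k) s'" using fib[OF x s] by (elim exE) (rule that)
        then show "frag_of s - frag_of s' \<in> J"
        proof
          assume e: "s' = (\<sigma> ^^ k) s"
          show ?thesis unfolding e by (rule conjunct2[OF pow[OF s(1)]])
        next
          assume e: "s = (\<sigma> ^^ k) s'"
          have "- (frag_of s' - frag_of ((\<sigma> ^^ k) s')) \<in> J" by (rule Jm[OF conjunct2[OF pow[OF s(2)]]])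
          then show ?thesis unfolding e minus_diff_eq .
        qed
      qed (use u in auto)
      then show ?thesis unfolding J_def by auto
    qed
    show "\<exists>b\<in>el (linearization X act) x. frag_extend (frag_of \<circ> p) b = v" if "v \<in> el (linearization Y act') x" for v
    proof -
      have "Poly_Mapping.keys v \<subseteq> p ` X x" using that unfolding p[OF x] by simp
      then obtain b where "Poly_Mapping.keys b \<subseteq> X x" "frag_extend (frag_of \<circ> p) b = v" by (rule frag_extend_onto)
      then show ?thesis by auto
    qed
  qed
qed

lemma (in module_universe) pd_le_permutation_quotient:
  fixes X :: "'o \<Rightarrow> 's set" and Y :: "'o \<Rightarrow> 't set"
  assumes ex: "short_exact C (linearization X act) i (linearization X act) p (linearization Y act')"
    and cnt: "\<And>x. x \<in> Ob C \<Longrightarrow> countable (X x)" "\<And>x. x \<in> Ob C \<Longrightarrow> countable (Y x)"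
    and pd: "pd_le C n (copy (linearization X act) :: ('o, 'h, 'u) cat_module)"
  shows "pd_le C (Suc n) (copy (linearization Y act') :: ('o, 'h, 'u) cat_module)"
proof -
  have "embeddable TYPE('u) C (linearization X act)" "embeddable TYPE('u) C (linearization Y act')"
    by (rule embeddable_linearization[OF infinite_universe], erule cnt)+
  from pd_le_quotient[OF short_exact_copy[OF ex this(1,1,2)] pd pd_le_mono[OF pd]] show ?thesis .
qed

section \<open>The Klein bottle group and its semi-direct product\<close>

text \<open>The sign by which \<open>b\<^sup>n\<close> acts on \<open>\<langle>a\<rangle>\<close>.\<close>

definition sg :: "int \<Rightarrow> int" where
  "sg n = (if even n then 1 else - 1)"

lemma sg_simps [simp]: "sg 0 = 1" "sg 1 = - 1" "sg 2 = 1" "sg (- n) = sg n" "sg n * sg n = 1" "sg n * (sg n * m) = m"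
  by (auto simp: sg_def)

lemma sg_add: "sg (m + n) = sg m * sg n"
  by (auto simp: sg_def)

text \<open>The pair \<open>(m, n)\<close> stands for \<open>a\<^sup>m b\<^sup>n\<close>, where \<open>b a b\<inverse> = a\<inverse>\<close>.\<close>

locale klein_group = group G for G :: "'g monoid" (structure) +
  fixes \<psi> :: "int \<times> int \<Rightarrow> 'g"
  assumes bij: "bij_betw \<psi> UNIV (carrier G)"
    and mult: "\<psi> (m, n) \<otimes> \<psi> (m', n') = \<psi> (m + sg n * m', n + n')"
begin

lemma \<psi>_closed [simp]: "\<psi> v \<in> carrier G"
  using bij by (auto simp: bij_betw_def)

lemma \<psi>_eq_iff [simp]: "\<psi> v = \<psi> w \<longleftrightarrow> v = w"
  using bij by (metis bij_betw_imp_inj_on inj_eq)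

lemma \<psi>_cases: assumes "g \<in> carrier G" obtains m n where "g = \<psi> (m, n)"
  using assms bij by (metis bij_betw_def imageE surj_pair)

lemma one_\<psi>: "\<one> = \<psi> (0, 0)"
proof -
  have "\<psi> (0, 0) \<otimes> \<psi> (0, 0) = \<psi> (0, 0)" by (simp add: mult)
  then show ?thesis by (metis \<psi>_closed l_cancel_one)
qed

lemma inv_\<psi>: "inv (\<psi> (m, n)) = \<psi> (- (sg n * m), - n)"
  by (rule inv_equality) (simp_all add: mult one_\<psi>)

lemma conj_\<psi>: "conj_action G (\<psi> (m, n)) (\<psi> (m', n')) = \<psi> (m + sg n * m' - sg n' * m, n')"
  by (simp add: conj_action_def mult inv_\<psi> sg_add algebra_simps)

abbreviation K where "K \<equiv> semidirect G G (conj_action G)"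
abbreviation L where "L \<equiv> acting_factor G G"

lemma K_simps [simp]:
  "carrier K = carrier G \<times> carrier G"
  "(g, h) \<otimes>\<^bsub>K\<^esub> (g', h') = (g \<otimes> conj_action G h g', h \<otimes> h')"
  "\<one>\<^bsub>K\<^esub> = (\<one>, \<one>)"
  by (simp_all add: semidirect_def)

lemma conj_action_closed [simp]: "h \<in> carrier G \<Longrightarrow> g \<in> carrier G \<Longrightarrow> conj_action G h g \<in> carrier G"
  by (simp add: conj_action_def)

lemma conj_action_one [simp]: "h \<in> carrier G \<Longrightarrow> conj_action G h \<one> = \<one>"
  by (simp add: conj_action_def)

text \<open>The element of the semi-direct product with coordinates \<open>m, n, p, q\<close> is \<open>(a\<^sup>m b\<^sup>n, a\<^sup>p b\<^sup>q)\<close>.\<close>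

definition \<kappa> :: "int \<times> int \<times> int \<times> int \<Rightarrow> 'g \<times> 'g" where
  "\<kappa> = (\<lambda>(m, n, p, q). (\<psi> (m, n), \<psi> (p, q)))"

lemma \<kappa>_mult: "\<kappa> (m, n, p, q) \<otimes>\<^bsub>K\<^esub> \<kappa> (m', n', p', q') =
    \<kappa> (m + sg n * (p + sg q * m' - sg n' * p), n + n', p + sg q * p', q + q')"
  by (simp add: \<kappa>_def mult conj_\<psi>)

lemma \<kappa>_closed [simp]: "\<kappa> v \<in> carrier K"
  by (simp add: \<kappa>_def split: prod.splits)

lemma \<kappa>_eq_iff [simp]: "\<kappa> v = \<kappa> w \<longleftrightarrow> v = w"
  by (auto simp: \<kappa>_def split: prod.splits)

lemma \<kappa>_cases: assumes "k \<in> carrier K" obtains m n p q where "k = \<kappa> (m, n, p, q)"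
  using assms by (cases k) (auto simp: \<kappa>_def elim!: \<psi>_cases)

lemma one_\<kappa>: "\<one>\<^bsub>K\<^esub> = \<kappa> (0, 0, 0, 0)"
  by (simp add: \<kappa>_def one_\<psi>)

lemma group_K: "group K"
proof (rule groupI)
  fix x assume "x \<in> carrier K"
  then obtain m n p q where x: "x = \<kappa> (m, n, p, q)" by (rule \<kappa>_cases)
  show "\<one>\<^bsub>K\<^esub> \<otimes>\<^bsub>K\<^esub> x = x" unfolding x one_\<kappa> \<kappa>_mult by simp
  have "\<kappa> (- sg n * (sg q * m - sg q * p + sg n * sg q * p), - n, - (sg q * p), - q) \<otimes>\<^bsub>K\<^esub> x = \<one>\<^bsub>K\<^esub>"
    unfolding x one_\<kappa> \<kappa>_mult by (auto simp: sg_def algebra_simps)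
  then show "\<exists>y\<in>carrier K. y \<otimes>\<^bsub>K\<^esub> x = \<one>\<^bsub>K\<^esub>" using \<kappa>_closed by blast
  fix y z assume "y \<in> carrier K" "z \<in> carrier K"
  then obtain m' n' p' q' m'' n'' p'' q'' where yz: "y = \<kappa> (m', n', p', q')" "z = \<kappa> (m'', n'', p'', q'')"
    by (metis \<kappa>_cases)
  show "x \<otimes>\<^bsub>K\<^esub> y \<in> carrier K" unfolding x yz \<kappa>_mult by (rule \<kappa>_closed)
  show "x \<otimes>\<^bsub>K\<^esub> y \<otimes>\<^bsub>K\<^esub> z = x \<otimes>\<^bsub>K\<^esub> (y \<otimes>\<^bsub>K\<^esub> z)"
    unfolding x yz \<kappa>_mult by (simp add: sg_add algebra_simps)
qed (simp add: one_closed)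

sublocale K: group K by (rule group_K)

lemma countable_G: "countable (carrier G)"
  using bij by (metis bij_betw_def countable_image countableI_type)

lemma countable_K: "countable (carrier K)"
  using countable_G by simp

lemma L_eq: "L = {\<one>} \<times> carrier G"
  by (auto simp: acting_factor_def)

lemma subgroup_L: "subgroup L K"
proof (rule K.subgroupI)
  show "L \<subseteq> carrier K" "L \<noteq> {}" by (auto simp: L_eq)
  show "inv\<^bsub>K\<^esub> k \<in> L" if kL: "k \<in> L" for k
  proof -
    obtain h where h: "k = (\<one>, h)" "h \<in> carrier G" using kL by (auto simp: L_eq)
    have "inv\<^bsub>K\<^esub> k = (\<one>, inv h)" by (rule K.inv_equality) (use h in auto)
    then show ?thesis using h by (simp add: L_eq)
  qed
  show "k \<otimes>\<^bsub>K\<^esub> k' \<in> L" if "k \<in> L" "k' \<in> L" for k k'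
    using that by (auto simp: L_eq)
qed

text \<open>The left cosets of the acting factor are the fibres of the first projection.\<close>

lemma coset_L: "g \<in> carrier G \<Longrightarrow> h \<in> carrier G \<Longrightarrow> (g, h) <#\<^bsub>K\<^esub> L = {g} \<times> carrier G"
proof -
  assume gh: "g \<in> carrier G" "h \<in> carrier G"
  have "(g, h) <#\<^bsub>K\<^esub> L = {g} \<times> ((\<lambda>y. h \<otimes> y) ` carrier G)"
  proof -
    have "(g, h) <#\<^bsub>K\<^esub> L = (\<lambda>y. (g, h) \<otimes>\<^bsub>K\<^esub> (\<one>, y)) ` carrier G"
      unfolding l_coset_def L_eq by (auto simp only: mem_Sigma_iff UN_iff singleton_iff image_iff)
    also have "\<dots> = (\<lambda>y. (g, h \<otimes> y)) ` carrier G" by (rule image_cong) (use gh in simp_all)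
    finally show ?thesis by (auto simp: image_iff)
  qed
  also have "(\<lambda>y. h \<otimes> y) ` carrier G = carrier G"
    using gh by (metis surj_const_mult)
  finally show ?thesis .
qed

lemma lcosets_L: "lcosets\<^bsub>K\<^esub> L = (\<lambda>g. {g} \<times> carrier G) ` carrier G"
proof -
  have "lcosets\<^bsub>K\<^esub> L = (\<lambda>k. k <#\<^bsub>K\<^esub> L) ` (carrier G \<times> carrier G)" by (auto simp: LCOSETS_def)
  also have "\<dots> = (\<lambda>(g, h). {g} \<times> carrier G) ` (carrier G \<times> carrier G)"
    by (rule image_cong) (auto simp: coset_L)
  also have "\<dots> = (\<lambda>g. {g} \<times> carrier G) ` carrier G" using one_closed by force
  finally show ?thesis .
qed

lemma act_coset_L:
  assumes "g \<in> carrier G" "h \<in> carrier G" "x \<in> carrier G"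
  shows "(g, h) <#\<^bsub>K\<^esub> ({x} \<times> carrier G) = {g \<otimes> conj_action G h x} \<times> carrier G"
proof -
  have "(g, h) <#\<^bsub>K\<^esub> ((x, \<one>) <#\<^bsub>K\<^esub> L) = ((g, h) \<otimes>\<^bsub>K\<^esub> (x, \<one>)) <#\<^bsub>K\<^esub> L"
    by (rule K.lcos_m_assoc) (use assms subgroup.subset[OF subgroup_L] in auto)
  then show ?thesis using assms by (simp add: coset_L)
qed

end

section \<open>Permutation modules\<close>

definition permutation_module :: "'s set \<Rightarrow> ('k \<Rightarrow> 's \<Rightarrow> 's) \<Rightarrow> (unit, 'k, 's \<Rightarrow>\<^sub>0 int) cat_module" where
  "permutation_module X act = linearization (\<lambda>_. X) (\<lambda>_ _. act)"

definition group_set :: "('k, 'x) monoid_scheme \<Rightarrow> 's set \<Rightarrow> ('k \<Rightarrow> 's \<Rightarrow> 's) \<Rightarrow> bool" where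
  "group_set K X act \<longleftrightarrow> (\<forall>k\<in>carrier K. \<forall>s\<in>X. act k s \<in> X) \<and> (\<forall>s\<in>X. act \<one>\<^bsub>K\<^esub> s = s) \<and>
     (\<forall>k\<in>carrier K. \<forall>k'\<in>carrier K. \<forall>s\<in>X. act (k \<otimes>\<^bsub>K\<^esub> k') s = act k (act k' s))"

lemma group_cat_simps [simp]:
  "Ob (group_cat K) = {()}" "Hom (group_cat K) x y = carrier K" "Idt (group_cat K) x = \<one>\<^bsub>K\<^esub>"
  "Cmp (group_cat K) x y z g f = g \<otimes>\<^bsub>K\<^esub> f"
  by (simp_all add: group_cat_def)

lemma is_category_group_cat: assumes "group K" shows "is_category (group_cat K)"
proof -
  interpret group K by fact
  show ?thesis by (auto simp: is_category_def m_assoc)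
qed

lemma group_set_functor: "group_set K X act \<Longrightarrow> set_functor (group_cat K) (\<lambda>_. X) (\<lambda>_ _. act)"
  by (auto simp: group_set_def set_functor_def)

lemma group_set_quotient:
  assumes X: "group_set K X act" and p: "p ` X = Y" "\<And>k s. k \<in> carrier K \<Longrightarrow> s \<in> X \<Longrightarrow> p (act k s) = act' k (p s)"
    and K: "group K"
  shows "group_set K Y act'"
proof -
  interpret group K by fact
  have c: "act k s \<in> X" if "k \<in> carrier K" "s \<in> X" for k s using X that by (simp add: group_set_def)
  show ?thesis
    unfolding group_set_def p(1)[symmetric]
  proof (intro conjI ballI; elim imageE)
    fix k y s assume *: "k \<in> carrier K" "y = p s" "s \<in> X"
    show "act' k y \<in> p ` X" unfolding *(2) p(2)[OF *(1,3), symmetric] using c[OF *(1,3)] by (rule imageI)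
  next
    fix y s assume *: "y = p s" "s \<in> X"
    have "act \<one>\<^bsub>K\<^esub> s = s" using X *(2) by (simp add: group_set_def)
    then show "act' \<one>\<^bsub>K\<^esub> y = y" using p(2)[OF one_closed *(2)] *(1) by simp
  next
    fix k k' y s assume *: "k \<in> carrier K" "k' \<in> carrier K" "y = p s" "s \<in> X"
    have "act (k \<otimes>\<^bsub>K\<^esub> k') s = act k (act k' s)" using X * by (simp add: group_set_def)
    then show "act' (k \<otimes>\<^bsub>K\<^esub> k') y = act' k (act' k' y)"
      using p(2)[OF m_closed[OF *(1,2)] *(4)] p(2)[OF *(1) c[OF *(2,4)]] p(2)[OF *(2,4)] *(3) by simp
  qed
qed

locale countable_group = group K for K :: "'k monoid" + fixes U :: "'u itself"
  assumes infU: "infinite (UNIV :: 'u set)" and cntK: "countable (carrier K)"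
begin

sublocale module_universe "group_cat K" U
  by unfold_locales (use infU cntK is_category_group_cat is_group in \<open>auto simp: countable_category_def\<close>)

text \<open>Passing from a \<open>K\<close>-set to its quotient by a free action of the integers raises the projective
  dimension by at most one. The height, which \<open>\<sigma>\<close> increases, is a certificate for freeness.\<close>

lemma permutation_pd_step:
  fixes ht :: "'s \<Rightarrow> int" and X :: "'s set" and Y :: "'t set"
  assumes pd: "pd_le (group_cat K) n (copy (permutation_module X act) :: (unit, 'k, 'u) cat_module)"
    and X: "group_set K X act" "countable X"
    and \<sigma>: "\<And>s. s \<in> X \<Longrightarrow> \<sigma> s \<in> X" "inj_on \<sigma> X" "\<And>k s. k \<in> carrier K \<Longrightarrow> s \<in> X \<Longrightarrow> \<sigma> (act k s) = act k (\<sigma> s)"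
    and ht: "\<And>s. s \<in> X \<Longrightarrow> ht s < ht (\<sigma> s)"
    and p: "p ` X = Y" "\<And>k s. k \<in> carrier K \<Longrightarrow> s \<in> X \<Longrightarrow> p (act k s) = act' k (p s)"
      "\<And>s. s \<in> X \<Longrightarrow> p (\<sigma> s) = p s"
    and fib: "\<And>s s'. s \<in> X \<Longrightarrow> s' \<in> X \<Longrightarrow> p s = p s' \<Longrightarrow> \<exists>k. s' = (\<sigma> ^^ k) s \<or> s = (\<sigma> ^^ k) s'"
  shows "pd_le (group_cat K) (Suc n) (copy (permutation_module Y act') :: (unit, 'k, 'u) cat_module)"
proof -
  have Y: "group_set K Y act'" by (rule group_set_quotient[where p = p and act = act, OF X(1) p(1,2) is_group])
  have cY: "countable Y" unfolding p(1)[symmetric] using X(2) by (rule countable_image)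
  have ex: "short_exact (group_cat K) (linearization (\<lambda>_. X) (\<lambda>_ _. act)) (\<lambda>_. frag_extend (\<lambda>s. frag_of s - frag_of (\<sigma> s)))
      (linearization (\<lambda>_. X) (\<lambda>_ _. act)) (\<lambda>_. frag_extend (frag_of \<circ> p)) (linearization (\<lambda>_. Y) (\<lambda>_ _. act'))"
  proof (rule permutation_short_exact[where ht = ht, OF group_set_functor[OF X(1)] group_set_functor[OF Y]])
    show "p ` X = Y" by (rule p(1))
    show "\<exists>k. s' = (\<sigma> ^^ k) s \<or> s = (\<sigma> ^^ k) s'" if "s \<in> X" "s' \<in> X" "p s = p s'" for s s'
      using that by (rule fib)
  qed (simp_all add: \<sigma> ht p(2,3))
  show ?thesis
    using pd_le_permutation_quotient[OF ex X(2) cY pd[unfolded permutation_module_def]]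
    unfolding permutation_module_def .
qed

text \<open>The regular module is free on one generator.\<close>

lemma projective_regular_module:
  "pd_le (group_cat K) 0 (copy (permutation_module (carrier K) (\<lambda>k k'. k \<otimes>\<^bsub>K\<^esub> k')) :: (unit, 'k, 'u) cat_module)"
proof -
  let ?C = "group_cat K"
  let ?F = "free_module ?C {()} (\<lambda>_. ())" and ?R = "permutation_module (carrier K) (\<lambda>k k'. k \<otimes>\<^bsub>K\<^esub> k')"
  have cat: "is_category ?C" by (rule is_category_group_cat[OF is_group])
  have gs: "group_set K (carrier K) (\<lambda>k k'. k \<otimes>\<^bsub>K\<^esub> k')" by (auto simp: group_set_def m_assoc)
  have R: "cat_module ?C ?R" unfolding permutation_module_def by (rule cat_module_linearization[OF group_set_functor[OF gs]])
  have Fl: "lifts TYPE('u) ?C ?F" by (rule lifts_free[OF cat]) simp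
  have Ff: "set_functor ?C (generated_elements ?C {()} (\<lambda>_. ())) (postcompose ?C (\<lambda>_. ()))"
    by (rule set_functor_free[OF cat]) simp
  have i: "module_map ?C ?R ?F (\<lambda>x. frag_extend (frag_of \<circ> (\<lambda>k. ((), k))))"
    unfolding permutation_module_def free_module_def
    by (rule linearization_map[OF group_set_functor[OF gs] Ff, of "\<lambda>_ k. ((), k)"])
      (auto simp: generated_elements_def postcompose_def)
  have r: "module_map ?C ?F ?R (\<lambda>x. frag_extend (frag_of \<circ> snd))"
    unfolding permutation_module_def free_module_def
    by (rule linearization_map[OF Ff group_set_functor[OF gs], of "\<lambda>_. snd"])
      (auto simp: generated_elements_def postcompose_def)
  have "lifts TYPE('u) ?C ?R"
  proof (rule lifts_retract[OF Fl i r])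
    fix x u show "frag_extend (frag_of \<circ> snd) (frag_extend (frag_of \<circ> (\<lambda>k. ((), k))) u) = u"
      unfolding frag_extend_compose using frag_expansion[of u] by (simp add: comp_def)
  qed
  note l = this
  have emb: "embeddable TYPE('u) ?C ?R"
    unfolding permutation_module_def by (rule embeddable_linearization[OF infU]) (rule cntK)
  note iso = copy_iso[OF R emb]
  have "lifts TYPE('u) ?C (copy ?R :: (unit, 'k, 'u) cat_module)"
    by (rule lifts_retract[OF l iso(3) iso(2) iso(5)])
  then show ?thesis using iso(1) by (simp add: projective_module_iff)
qed

end

section \<open>The upper bound for the Takasu dimension\<close>

lemma funpow_int_path:
  fixes f :: "int \<Rightarrow> 's"
  assumes "\<And>k. \<sigma> (f k) = f (k + 1)"
  shows "\<exists>k. f b = (\<sigma> ^^ k) (f a) \<or> f a = (\<sigma> ^^ k) (f b)"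
proof -
  have pw: "(\<sigma> ^^ k) (f c) = f (c + int k)" for k c
    by (induction k) (simp_all add: assms algebra_simps)
  show ?thesis
  proof (cases "a \<le> b")
    case True
    then show ?thesis using pw[of "nat (b - a)" a] by (intro exI[of _ "nat (b - a)"]) simp
  next
    case False
    then show ?thesis using pw[of "nat (a - b)" b] by (intro exI[of _ "nat (a - b)"]) simp
  qed
qed

locale klein_universe = klein_group G \<psi> for G :: "'g monoid" (structure) and \<psi> +
  fixes U :: "'u itself"
  assumes infinite_U: "infinite (UNIV :: 'u set)"
begin

sublocale C: countable_group K U
  by unfold_locales (use infinite_U countable_K in auto)

abbreviation "C \<equiv> group_cat K"

definition coords :: "'g \<times> 'g \<Rightarrow> int \<times> int \<times> int \<times> int" where
  "coords = inv_into UNIV \<kappa>"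

lemma coords [simp]: "coords (\<kappa> v) = v"
  unfolding coords_def by (rule inv_into_f_f) (simp_all add: inj_on_def)

lemma group_set_K: "group_set K (carrier K) (\<lambda>k k'. k \<otimes>\<^bsub>K\<^esub> k')"
  unfolding group_set_def by (intro conjI ballI K.m_closed K.l_one K.m_assoc)

lemma range_\<kappa>: "range \<kappa> = carrier K"
proof
  show "range \<kappa> \<subseteq> carrier K" using \<kappa>_closed by blast
  show "carrier K \<subseteq> range \<kappa>" by (metis \<kappa>_cases rangeI subsetI)
qed

lemma image_K: "f ` carrier K = range (\<lambda>v. f (\<kappa> v))"
  unfolding range_\<kappa>[symmetric] image_image ..

text \<open>The \<open>K\<close>-sets \<open>K/H\<close> below are given by integer coordinates on the cosets, and the action laws are
  inherited from \<open>K\<close>.\<close>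

lemma group_set_coords:
  assumes eq: "\<And>m n p q m' n' p' q'. f (\<kappa> (m, n, p, q) \<otimes>\<^bsub>K\<^esub> \<kappa> (m', n', p', q')) = act (\<kappa> (m, n, p, q)) (f (\<kappa> (m', n', p', q')))"
    and sj: "range (\<lambda>v. f (\<kappa> v)) = Y"
  shows "group_set K Y act"
proof (rule group_set_quotient[where p = f, OF group_set_K _ _ group_K])
  show "f ` carrier K = Y" unfolding image_K by (rule sj)
  fix k s assume ks: "k \<in> carrier K" "s \<in> carrier K"
  obtain m n p q where k: "k = \<kappa> (m, n, p, q)" using ks(1) by (rule \<kappa>_cases)
  obtain m' n' p' q' where s: "s = \<kappa> (m', n', p', q')" using ks(2) by (rule \<kappa>_cases)
  show "f (k \<otimes>\<^bsub>K\<^esub> s) = act k (f s)" unfolding k s by (rule eq)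
qed

text \<open>Two quotients by the integers lead from \<open>K\<close> to \<open>K/L\<close>: right multiplication by \<open>(1, a)\<close> removes
  the coordinate \<open>p\<close>, and right multiplication by \<open>(1, b)\<close> then removes \<open>q\<close>. The action \<open>act3\<close> is that
  on \<open>K/\<langle>(1, a)\<rangle>\<close>. Right multiplication by \<open>(1, a)\<close> changes \<open>p\<close> by \<open>sg q\<close>, whence the height
  \<open>sg q * p\<close>.\<close>

definition act3 where
  "act3 k = (case coords k of (m, n, p, q) \<Rightarrow> \<lambda>(m', n', q'). (m + sg n * (p + sg q * m' - sg n' * p), n + n', q + q'))"

lemma pd_L1: "pd_le C 1 (copy (permutation_module (UNIV :: (int \<times> int \<times> int) set) act3) :: (unit, 'g \<times> 'g, 'u) cat_module)"
proof -
  define \<sigma> where "\<sigma> k = k \<otimes>\<^bsub>K\<^esub> \<kappa> (0, 0, 1, 0)" for k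
  have \<sigma>: "\<sigma> (\<kappa> (m, n, p, q)) = \<kappa> (m, n, p + sg q, q)" for m n p q
    unfolding \<sigma>_def \<kappa>_mult by simp
  define ht where "ht k = (case coords k of (m, n, p, q) \<Rightarrow> sg q * p)" for k
  define pr where "pr k = (case coords k of (m, n, p, q) \<Rightarrow> (m, n, q))" for k
  have "pd_le C (Suc 0) (copy (permutation_module (UNIV :: (int \<times> int \<times> int) set) act3) :: (unit, 'g \<times> 'g, 'u) cat_module)"
  proof (rule C.permutation_pd_step[where \<sigma> = \<sigma> and ht = ht and p = pr, OF C.projective_regular_module group_set_K countable_K])
    fix k s assume ks: "k \<in> carrier K" "s \<in> carrier K"
    show "\<sigma> (k \<otimes>\<^bsub>K\<^esub> s) = k \<otimes>\<^bsub>K\<^esub> \<sigma> s" unfolding \<sigma>_def by (rule K.m_assoc[OF ks \<kappa>_closed])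
    obtain m n p q m' n' p' q' where "k = \<kappa> (m, n, p, q)" "s = \<kappa> (m', n', p', q')" using ks by (metis \<kappa>_cases)
    then show "pr (k \<otimes>\<^bsub>K\<^esub> s) = act3 k (pr s)" by (simp only: \<kappa>_mult pr_def act3_def coords prod.case)
  next
    fix s assume s: "s \<in> carrier K"
    show "\<sigma> s \<in> carrier K" unfolding \<sigma>_def by (rule K.m_closed[OF s \<kappa>_closed])
    obtain m n p q where s': "s = \<kappa> (m, n, p, q)" using s by (rule \<kappa>_cases)
    show "ht s < ht (\<sigma> s)" "pr (\<sigma> s) = pr s" by (simp_all add: s' \<sigma> ht_def pr_def distrib_left)
  next
    show "inj_on \<sigma> (carrier K)" unfolding \<sigma>_def by (rule inj_onI) (metis K.right_cancel \<kappa>_closed)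
    show "pr ` carrier K = UNIV" unfolding image_K by (auto simp: pr_def image_iff split: prod.splits)
  next
    fix s s' assume s: "s \<in> carrier K" "s' \<in> carrier K" "pr s = pr s'"
    obtain m n p q where k1: "s = \<kappa> (m, n, p, q)" using s(1) by (rule \<kappa>_cases)
    obtain m' n' p' q' where k2: "s' = \<kappa> (m', n', p', q')" using s(2) by (rule \<kappa>_cases)
    have k: "s = \<kappa> (m, n, p, q)" "s' = \<kappa> (m, n, p', q)" using s(3) k1 k2 by (simp_all add: pr_def)
    have st: "\<sigma> (\<kappa> (m, n, sg q * j, q)) = \<kappa> (m, n, sg q * (j + 1), q)" for j by (simp add: \<sigma> distrib_left)
    show "\<exists>j. s' = (\<sigma> ^^ j) s \<or> s = (\<sigma> ^^ j) s'"
      using funpow_int_path[where f = "\<lambda>j. \<kappa> (m, n, sg q * j, q)" and a = "sg q * p" and b = "sg q * p'", OF st] by (simp add: k)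
  qed
  then show ?thesis by simp
qed

lemma pd_L2: "pd_le C 2 (copy (permutation_module (lcosets\<^bsub>K\<^esub> L) (\<lambda>k c. k <#\<^bsub>K\<^esub> c)) :: (unit, 'g \<times> 'g, 'u) cat_module)"
proof -
  define \<sigma> where "\<sigma> = (\<lambda>(m :: int, n :: int, q :: int). (m, n, q + 1))"
  define pr where "pr = (\<lambda>(m, n, q :: int). {\<psi> (m, n)} \<times> carrier G)"
  have gs: "group_set K UNIV act3"
    by (rule group_set_coords[where f = "\<lambda>k. (case coords k of (m, n, p, q) \<Rightarrow> (m, n, q))"])
      (auto simp: \<kappa>_mult act3_def image_iff simp del: K_simps)
  have "pd_le C (Suc 1) (copy (permutation_module (lcosets\<^bsub>K\<^esub> L) (\<lambda>k c. k <#\<^bsub>K\<^esub> c)) :: (unit, 'g \<times> 'g, 'u) cat_module)"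
  proof (rule C.permutation_pd_step[where \<sigma> = \<sigma> and ht = "\<lambda>(m, n, q). q" and p = pr, OF pd_L1 gs])
    fix k :: "'g \<times> 'g" and s :: "int \<times> int \<times> int" assume ks: "k \<in> carrier K" "s \<in> UNIV"
    obtain m n p q where k: "k = \<kappa> (m, n, p, q)" using ks(1) by (rule \<kappa>_cases)
    obtain m' n' q' where s: "s = (m', n', q')" by (cases s) auto
    show "\<sigma> (act3 k s) = act3 k (\<sigma> s)" by (simp add: \<sigma>_def k s act3_def)
    have "k <#\<^bsub>K\<^esub> ({\<psi> (m', n')} \<times> carrier G) = {\<psi> (m, n) \<otimes> conj_action G (\<psi> (p, q)) (\<psi> (m', n'))} \<times> carrier G"
      unfolding k \<kappa>_def prod.case by (rule act_coset_L) simp_all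
    then show "pr (act3 k s) = k <#\<^bsub>K\<^esub> pr s" by (simp add: k s pr_def act3_def conj_\<psi> mult)
  next
    show "inj_on \<sigma> UNIV" by (auto simp: inj_on_def \<sigma>_def)
    show "pr ` UNIV = lcosets\<^bsub>K\<^esub> L"
      unfolding lcosets_L using one_closed by (auto simp: pr_def image_iff elim!: \<psi>_cases)
  next
    fix s s' :: "int \<times> int \<times> int" assume "pr s = pr s'"
    moreover obtain m n q m' n' q' where s: "s = (m, n, q)" "s' = (m', n', q')" by (metis surj_pair)
    ultimately have "{\<psi> (m, n)} \<times> carrier G = {\<psi> (m', n')} \<times> carrier G" by (simp add: pr_def)
    then have "(\<psi> (m, n), \<one>) \<in> {\<psi> (m', n')} \<times> carrier G" by (metis SigmaI one_closed singletonI)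
    then have "m = m'" "n = n'" by simp_all
    then show "\<exists>j. s' = (\<sigma> ^^ j) s \<or> s = (\<sigma> ^^ j) s'"
      using funpow_int_path[where f = "\<lambda>j. (m, n, j)" and \<sigma> = \<sigma> and a = q and b = q'] by (simp add: s \<sigma>_def)
  qed (auto simp: \<sigma>_def pr_def)
  then show ?thesis by (simp add: numeral_2_eq_2)
qed

text \<open>Four quotients by the integers lead from \<open>K\<close> to a point: the coordinates \<open>m, n, p, q\<close> are removed
  one after the other, along the chain of subgroups generated by \<open>(a, 1)\<close>, then also by \<open>(b, 1)\<close>,
  \<open>(1, a)\<close> and \<open>(1, b)\<close>.\<close>

definition act3' where
  "act3' k = (case coords k of (m :: int, n, p, q) \<Rightarrow> \<lambda>(n', p', q'). (n + n', p + sg q * p', q + q'))"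

definition act2 where
  "act2 k = (case coords k of (m :: int, n :: int, p, q) \<Rightarrow> \<lambda>(p', q'). (p + sg q * p', q + q'))"

definition act1 where
  "act1 k = (case coords k of (m :: int, n :: int, p :: int, q) \<Rightarrow> \<lambda>q'. q + q')"

lemma group_set_acts:
  "group_set K UNIV act3'" "group_set K UNIV act2" "group_set K UNIV act1"
proof -
  show "group_set K UNIV act3'"
    by (rule group_set_coords[where f = "\<lambda>k. (case coords k of (m, n, p, q) \<Rightarrow> (n, p, q))"])
      (auto simp: \<kappa>_mult act3'_def image_iff simp del: K_simps)
  show "group_set K UNIV act2"
    by (rule group_set_coords[where f = "\<lambda>k. (case coords k of (m, n, p, q) \<Rightarrow> (p, q))"])
      (auto simp: \<kappa>_mult act2_def image_iff simp del: K_simps)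
  show "group_set K UNIV act1"
    by (rule group_set_coords[where f = "\<lambda>k. (case coords k of (m, n, p, q) \<Rightarrow> q)"])
      (auto simp: \<kappa>_mult act1_def image_iff simp del: K_simps)
qed

lemma pd_K1: "pd_le C 1 (copy (permutation_module UNIV act3') :: (unit, 'g \<times> 'g, 'u) cat_module)"
proof -
  define \<sigma> where "\<sigma> k = k \<otimes>\<^bsub>K\<^esub> \<kappa> (1, 0, 0, 0)" for k
  have \<sigma>: "\<sigma> (\<kappa> (m, n, p, q)) = \<kappa> (m + sg n * sg q, n, p, q)" for m n p q
    unfolding \<sigma>_def \<kappa>_mult by simp
  define ht where "ht k = (case coords k of (m, n, p, q) \<Rightarrow> sg n * (sg q * m))" for k
  define pr where "pr k = (case coords k of (m, n, p, q) \<Rightarrow> (n, p, q))" for k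
  have s1: "sg n * (sg q * (m + sg n * sg q)) = sg n * (sg q * m) + 1" for n q m
    by (auto simp: sg_def)
  have "pd_le C (Suc 0) (copy (permutation_module UNIV act3') :: (unit, 'g \<times> 'g, 'u) cat_module)"
  proof (rule C.permutation_pd_step[where \<sigma> = \<sigma> and ht = ht and p = pr, OF C.projective_regular_module group_set_K countable_K])
    fix k s assume ks: "k \<in> carrier K" "s \<in> carrier K"
    show "\<sigma> (k \<otimes>\<^bsub>K\<^esub> s) = k \<otimes>\<^bsub>K\<^esub> \<sigma> s" unfolding \<sigma>_def by (rule K.m_assoc[OF ks \<kappa>_closed])
    obtain m n p q m' n' p' q' where "k = \<kappa> (m, n, p, q)" "s = \<kappa> (m', n', p', q')" using ks by (metis \<kappa>_cases)
    then show "pr (k \<otimes>\<^bsub>K\<^esub> s) = act3' k (pr s)" by (simp only: \<kappa>_mult pr_def act3'_def coords prod.case)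
  next
    fix s assume s: "s \<in> carrier K"
    show "\<sigma> s \<in> carrier K" unfolding \<sigma>_def by (rule K.m_closed[OF s \<kappa>_closed])
    obtain m n p q where s': "s = \<kappa> (m, n, p, q)" using s by (rule \<kappa>_cases)
    show "ht s < ht (\<sigma> s)" "pr (\<sigma> s) = pr s" by (simp_all add: s' \<sigma> ht_def pr_def s1)
  next
    show "inj_on \<sigma> (carrier K)" unfolding \<sigma>_def by (rule inj_onI) (metis K.right_cancel \<kappa>_closed)
    show "pr ` carrier K = UNIV" unfolding image_K by (auto simp: pr_def image_iff split: prod.splits)
  next
    fix s s' assume s: "s \<in> carrier K" "s' \<in> carrier K" "pr s = pr s'"
    obtain m n p q where k1: "s = \<kappa> (m, n, p, q)" using s(1) by (rule \<kappa>_cases)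
    obtain m' n' p' q' where k2: "s' = \<kappa> (m', n', p', q')" using s(2) by (rule \<kappa>_cases)
    have k: "s = \<kappa> (m, n, p, q)" "s' = \<kappa> (m', n, p, q)" using s(3) k1 k2 by (simp_all add: pr_def)
    have st: "\<sigma> (\<kappa> (sg n * (sg q * j), n, p, q)) = \<kappa> (sg n * (sg q * (j + 1)), n, p, q)" for j by (simp add: \<sigma> distrib_left)
    have inv: "sg n * (sg q * (sg n * (sg q * j))) = j" for j by (auto simp: sg_def)
    show "\<exists>j. s' = (\<sigma> ^^ j) s \<or> s = (\<sigma> ^^ j) s'"
      using funpow_int_path[where f = "\<lambda>j. \<kappa> (sg n * (sg q * j), n, p, q)" and a = "sg n * (sg q * m)" and b = "sg n * (sg q * m')", OF st]
      by (simp add: k inv)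
  qed
  then show ?thesis by simp
qed

lemma pd_K2: "pd_le C 2 (copy (permutation_module UNIV act2) :: (unit, 'g \<times> 'g, 'u) cat_module)"
proof -
  define \<sigma> where "\<sigma> = (\<lambda>(n :: int, p :: int, q :: int). (n + 1, p, q))"
  define pr where "pr = (\<lambda>(n :: int, p :: int, q :: int). (p, q))"
  have "pd_le C (Suc 1) (copy (permutation_module UNIV act2) :: (unit, 'g \<times> 'g, 'u) cat_module)"
  proof (rule C.permutation_pd_step[where \<sigma> = \<sigma> and ht = "\<lambda>(n, p, q). n" and p = pr, OF pd_K1 group_set_acts(1)])
    show "pr ` UNIV = UNIV" by (auto simp: pr_def image_iff)
    fix s s' :: "int \<times> int \<times> int" assume "pr s = pr s'"
    then obtain n n' p q where s: "s = (n, p, q)" "s' = (n', p, q)" by (cases s, cases s') (auto simp: pr_def)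
    then show "\<exists>j. s' = (\<sigma> ^^ j) s \<or> s = (\<sigma> ^^ j) s'"
      using funpow_int_path[where f = "\<lambda>j. (j, p, q)" and \<sigma> = \<sigma> and a = n and b = n'] by (simp add: \<sigma>_def)
  qed (auto simp: \<sigma>_def pr_def inj_on_def act3'_def act2_def split: prod.splits)
  then show ?thesis by (simp add: numeral_2_eq_2)
qed

lemma pd_K3: "pd_le C 3 (copy (permutation_module UNIV act1) :: (unit, 'g \<times> 'g, 'u) cat_module)"
proof -
  define \<sigma> where "\<sigma> = (\<lambda>(p :: int, q :: int). (p + sg q, q))"
  have "pd_le C (Suc 2) (copy (permutation_module UNIV act1) :: (unit, 'g \<times> 'g, 'u) cat_module)"
  proof (rule C.permutation_pd_step[where \<sigma> = \<sigma> and ht = "\<lambda>(p, q). sg q * p" and p = snd, OF pd_K2 group_set_acts(2)])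
    fix s s' :: "int \<times> int" assume "snd s = snd s'"
    then obtain p p' q where s: "s = (p, q)" "s' = (p', q)" by (cases s, cases s') auto
    then show "\<exists>j. s' = (\<sigma> ^^ j) s \<or> s = (\<sigma> ^^ j) s'"
      using funpow_int_path[where f = "\<lambda>j. (sg q * j, q)" and \<sigma> = \<sigma> and a = "sg q * p" and b = "sg q * p'"]
      by (simp add: \<sigma>_def distrib_left)
  qed (auto simp: \<sigma>_def inj_on_def act2_def act1_def distrib_left sg_add split: prod.splits)
  then show ?thesis by (simp add: numeral_3_eq_3)
qed

abbreviation trivial_module :: "(unit, 'g \<times> 'g, unit \<Rightarrow>\<^sub>0 int) cat_module" where
  "trivial_module \<equiv> permutation_module {()} (\<lambda>_ _. ())"

lemma pd_K4: "pd_le C 4 (copy trivial_module :: (unit, 'g \<times> 'g, 'u) cat_module)"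
proof -
  have "pd_le C (Suc 3) (copy trivial_module :: (unit, 'g \<times> 'g, 'u) cat_module)"
  proof (rule C.permutation_pd_step[where \<sigma> = "\<lambda>q. q + 1" and ht = "\<lambda>q. q" and p = "\<lambda>_. ()", OF pd_K3 group_set_acts(3)])
    fix s s' :: int
    show "\<exists>j. s' = ((\<lambda>q. q + 1) ^^ j) s \<or> s = ((\<lambda>q. q + 1) ^^ j) s'"
      using funpow_int_path[where f = "\<lambda>j. j" and \<sigma> = "\<lambda>q. q + 1" and a = s and b = s'] by simp
  qed (auto simp: act1_def split: prod.splits)
  then show ?thesis by simp
qed

abbreviation coset_module where
  "coset_module \<equiv> permutation_module (lcosets\<^bsub>K\<^esub> L) (\<lambda>k c. k <#\<^bsub>K\<^esub> c)"

lemma group_set_cosets: "group_set K (lcosets\<^bsub>K\<^esub> L) (\<lambda>k c. k <#\<^bsub>K\<^esub> c)"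
  unfolding group_set_def
proof (intro conjI ballI)
  have sub: "c \<subseteq> carrier K" if "c \<in> lcosets\<^bsub>K\<^esub> L" for c
    using subgroup.lcosets_carrier[OF subgroup_L group_K that] .
  fix k c assume k: "k \<in> carrier K" and c: "c \<in> lcosets\<^bsub>K\<^esub> L"
  then obtain x where x: "x \<in> carrier K" "c = x <#\<^bsub>K\<^esub> L" by (auto simp: LCOSETS_def)
  have "k <#\<^bsub>K\<^esub> c = (k \<otimes>\<^bsub>K\<^esub> x) <#\<^bsub>K\<^esub> L"
    unfolding x(2) by (rule K.lcos_m_assoc[OF subgroup.subset[OF subgroup_L] k x(1)])
  then show "k <#\<^bsub>K\<^esub> c \<in> lcosets\<^bsub>K\<^esub> L" using K.m_closed[OF k x(1)] unfolding LCOSETS_def by blast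
  fix k' assume k': "k' \<in> carrier K"
  show "(k \<otimes>\<^bsub>K\<^esub> k') <#\<^bsub>K\<^esub> c = k <#\<^bsub>K\<^esub> (k' <#\<^bsub>K\<^esub> c)"
    using K.lcos_m_assoc[OF sub[OF c] k k'] by simp
next
  fix c assume "c \<in> lcosets\<^bsub>K\<^esub> L"
  then show "\<one>\<^bsub>K\<^esub> <#\<^bsub>K\<^esub> c = c"
    using subgroup.lcosets_carrier[OF subgroup_L group_K] K.lcos_mult_one by blast
qed

lemma augmentation_eq: "augmentation u = Poly_Mapping.lookup (frag_extend (frag_of \<circ> (\<lambda>_. ())) u) ()"
  by (simp add: augmentation_def frag_extend_def lookup_sum)

lemma augmentation_exact:
  "short_exact C (augmentation_module K L) (\<lambda>x m. m) coset_module (\<lambda>x. frag_extend (frag_of \<circ> (\<lambda>_. ())))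
     trivial_module"
proof -
  let ?e = "\<lambda>x :: unit. frag_extend (frag_of \<circ> (\<lambda>_ :: ('g \<times> 'g) set. ()))"
  have gt: "group_set K {()} (\<lambda>_ _. ())" by (simp add: group_set_def)
  have P: "cat_module C coset_module" and D: "cat_module C trivial_module"
    unfolding permutation_module_def by (rule cat_module_linearization[OF group_set_functor] group_set_cosets gt)+
  have m: "module_map C coset_module trivial_module ?e"
    unfolding permutation_module_def
    by (rule linearization_map[OF group_set_functor[OF group_set_cosets] group_set_functor[OF gt], of "\<lambda>_ _. ()"]) auto
  have ne: "L \<in> lcosets\<^bsub>K\<^esub> L"
    using K.lcos_mult_one[OF subgroup.subset[OF subgroup_L]] K.one_closed unfolding LCOSETS_def by blast
  have "?e x ` el coset_module x = el trivial_module x" for x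
  proof
    show "?e x ` el coset_module x \<subseteq> el trivial_module x"
      using module_map_closed[OF m, of x] by (intro image_subsetI) simp
    show "el trivial_module x \<subseteq> ?e x ` el coset_module x"
    proof
      fix d :: "unit \<Rightarrow>\<^sub>0 int"
      have "Poly_Mapping.keys d \<subseteq> (\<lambda>_. ()) ` (lcosets\<^bsub>K\<^esub> L)" using ne by auto
      then obtain b where b: "Poly_Mapping.keys b \<subseteq> lcosets\<^bsub>K\<^esub> L" "?e () b = d" by (rule frag_extend_onto)
      have "b \<in> el coset_module x" using b(1) by (simp add: permutation_module_def)
      then show "d \<in> ?e x ` el coset_module x" unfolding b(2)[symmetric] by (rule imageI)
    qed
  qed
  then have surj: "module_surj C coset_module trivial_module ?e"
    unfolding module_surj_def using m by simp
  have "kernel (free_Abelian_group (lcosets\<^bsub>K\<^esub> L)) integer_group augmentation =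
     kernel (Val coset_module x) (Val trivial_module x) (?e x)" for x
  proof -
    have "augmentation u = 0 \<longleftrightarrow> ?e x u = 0" for u
      unfolding augmentation_eq by (auto intro!: poly_mapping_eqI)
    then show ?thesis by (simp add: kernel_def permutation_module_def)
  qed
  then have eq: "augmentation_module K L = submodule coset_module
     (\<lambda>x. kernel (Val coset_module x) (Val trivial_module x) (?e x))"
    by (simp add: augmentation_module_def submodule_def permutation_module_def linearization_def)
  show ?thesis unfolding eq by (rule kernel_exact[OF P D surj])
qed

lemma countable_cosets: "countable (lcosets\<^bsub>K\<^esub> L)"
  unfolding lcosets_L using countable_G by simp

lemma embeddable_cosets: "embeddable TYPE('u) C coset_module"
  unfolding permutation_module_def by (rule embeddable_linearization[OF infinite_U countable_cosets])

lemma embeddable_augmentation: "embeddable TYPE('u) C (augmentation_module K L)"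
proof -
  have "el (augmentation_module K L) x \<subseteq> el coset_module x" for x
    by (auto simp: augmentation_module_def permutation_module_def kernel_def)
  then show ?thesis using embeddable_cosets unfolding embeddable_def by (meson inj_on_subset)
qed

text \<open>As \<open>\<int>(K/L)\<close> has dimension at most \<open>2\<close>, the sequence \<open>0 \<rightarrow> I(K/L) \<rightarrow> \<int>(K/L) \<rightarrow> \<int> \<rightarrow> 0\<close> makes \<open>I(K/L)\<close> a
  syzygy of \<open>\<int>\<close> as far as the dimension is concerned.\<close>

lemma pd_augmentation: "pd_le C 3 (copy (augmentation_module K L) :: (unit, 'g \<times> 'g, 'u) cat_module)"
proof -
  have "embeddable TYPE('u) C trivial_module"
    unfolding permutation_module_def by (rule embeddable_linearization[OF infinite_U]) simp
  note ex = short_exact_copy[OF augmentation_exact embeddable_augmentation embeddable_cosets this]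
  have B: "pd_le C 3 (copy coset_module :: (unit, 'g \<times> 'g, 'u) cat_module)"
    using C.pd_le_mono[OF pd_L2] by (simp add: numeral_3_eq_3 numeral_2_eq_2)
  have D: "pd_le C (Suc 3) (copy trivial_module :: (unit, 'g \<times> 'g, 'u) cat_module)"
    using pd_K4 by (simp del: pd_le.simps)
  show ?thesis by (rule C.pd_le_submodule[OF ex B D])
qed

end

section \<open>The lower bound for the Takasu dimension\<close>

text \<open>Regularity on a permutation module: the quotient by the first \<open>j\<close> operators is the permutation
  module on the values of \<open>p j\<close>, where the next operator still moves every point upwards.\<close>

lemma regular_sequence_permutation:
  fixes X :: "'s set" and \<tau> :: "nat \<Rightarrow> 's \<Rightarrow> 's" and p :: "nat \<Rightarrow> 's \<Rightarrow> 'y" and ht :: "nat \<Rightarrow> 'y \<Rightarrow> int"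
  assumes ce: "commuting_endomorphisms (free_Abelian_group X) x n"
    and x: "\<And>j u. j < n \<Longrightarrow> Poly_Mapping.keys u \<subseteq> X \<Longrightarrow> x j u = frag_extend (\<lambda>s. frag_of (\<tau> j s)) u - u"
    and p: "\<And>k j s. k < j \<Longrightarrow> j < n \<Longrightarrow> s \<in> X \<Longrightarrow> p j (\<tau> k s) = p j s"
    and fib: "\<And>j s s'. j < n \<Longrightarrow> s \<in> X \<Longrightarrow> s' \<in> X \<Longrightarrow> p j s = p j s' \<Longrightarrow>
        frag_of s - frag_of s' \<in> partial_sum x (free_Abelian_group X) j"
    and \<rho>: "\<And>j s. j < n \<Longrightarrow> s \<in> X \<Longrightarrow> p j (\<tau> j s) = \<rho> j (p j s)" "\<And>j. j < n \<Longrightarrow> inj (\<rho> j)"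
      "\<And>j s. j < n \<Longrightarrow> s \<in> X \<Longrightarrow> \<tau> j s \<in> X"
    and ht: "\<And>j s. j < n \<Longrightarrow> s \<in> X \<Longrightarrow> ht j (p j s) < ht j (\<rho> j (p j s))"
  shows "regular_sequence x (free_Abelian_group X) n"
  unfolding regular_sequence_def
proof (intro allI impI ballI)
  interpret commuting_endomorphisms "free_Abelian_group X" x n by (rule ce)
  fix j u assume j: "j < n" and u: "u \<in> carrier (free_Abelian_group X)" and xu: "x j u \<in> J j"
  have uX: "Poly_Mapping.keys u \<subseteq> X" using u by simp
  let ?P = "frag_extend (frag_of \<circ> p j)"
  have Px: "?P (x k v) = 0" if k: "k < j" and v: "Poly_Mapping.keys v \<subseteq> X" for k v
  proof -
    have kn: "k < n" using k j by simp
    have "?P (frag_extend (frag_of \<circ> \<tau> k) v) = ?P v"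
      unfolding frag_extend_compose by (rule frag_extend_eq) (use p[OF k j] v in auto)
    then show ?thesis unfolding x[OF kn v] frag_extend_diff by (simp add: comp_def)
  qed
  have PJ: "?P v = 0" if "i \<le> j" "v \<in> J i" for i v
    using that
  proof (induction i arbitrary: v)
    case (Suc i)
    then obtain w m where w: "v = w \<otimes>\<^bsub>free_Abelian_group X\<^esub> x i m" "w \<in> J i" "m \<in> carrier (free_Abelian_group X)" by auto
    have "?P v = ?P w + ?P (x i m)" unfolding w(1) mult_free_Abelian_group frag_extend_add ..
    moreover have "?P w = 0" by (rule Suc.IH[OF _ w(2)]) (use Suc.prems(1) in simp)
    moreover have "?P (x i m) = 0" by (rule Px) (use Suc.prems(1) w(3) in simp_all)
    ultimately show ?case by (simp only: add_0)
  qed simp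
  have Pinv: "frag_extend (\<lambda>y. frag_of (\<rho> j y)) (?P u) = ?P u"
  proof -
    have "0 = ?P (x j u)" using PJ[OF order_refl xu] by simp
    also have "\<dots> = ?P (frag_extend (frag_of \<circ> \<tau> j) u) - ?P u" unfolding x[OF j uX] frag_extend_diff by (simp add: comp_def)
    also have "?P (frag_extend (frag_of \<circ> \<tau> j) u) = frag_extend ((\<lambda>y. frag_of (\<rho> j y)) \<circ> p j) u"
      unfolding frag_extend_compose by (rule frag_extend_eq) (use \<rho>(1)[OF j] uX in auto)
    also have "\<dots> = frag_extend (\<lambda>y. frag_of (\<rho> j y)) (?P u)" by (simp only: frag_extend_compose)
    finally show ?thesis by (metis right_minus_eq)
  qed
  have "?P u = 0"
  proof (rule no_invariant_frag[where \<tau> = "\<rho> j" and X = "p j ` X" and ht = "ht j", OF _ _ _ _ Pinv])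
    show "inj_on (\<rho> j) (p j ` X)" by (rule inj_on_subset[OF \<rho>(2)[OF j] subset_UNIV])
    fix y assume "y \<in> p j ` X"
    then obtain s where s: "s \<in> X" "y = p j s" by (elim imageE)
    show "\<rho> j y \<in> p j ` X" unfolding s(2) \<rho>(1)[OF j s(1), symmetric] by (rule imageI[OF \<rho>(3)[OF j s(1)]])
    show "ht j y < ht j (\<rho> j y)" unfolding s(2) by (rule ht[OF j s(1)])
  next
    show "Poly_Mapping.keys (?P u) \<subseteq> p j ` X" using keys_frag_extend[of "frag_of \<circ> p j" u] uX by auto
  qed
  then show "u \<in> J j"
  proof (rule frag_kernel[rotated -1])
    show "0 \<in> J j" using J_one[of j] j by simp
    show "a - b \<in> J j" if ab: "a \<in> J j" "b \<in> J j" for a b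
    proof -
      have "Poly_Mapping.keys b \<subseteq> X" using J_closed[of j b] ab j by simp
      then have "inv\<^bsub>free_Abelian_group X\<^esub> b = - b" by simp
      then have "a + - b \<in> J j" using J_mult[of j a "- b"] J_inv[of j b] ab j by simp
      then show ?thesis by simp
    qed
  qed (use fib[OF j] uX in auto)
qed

lemma int_chain:
  assumes refl: "\<And>s. E s s" and sym: "\<And>s t. E s t \<Longrightarrow> E t s" and trans: "\<And>s t u. E s t \<Longrightarrow> E t u \<Longrightarrow> E s u"
    and step: "\<And>k :: int. E (f k) (f (k + 1))"
  shows "E (f a) (f b)"
proof -
  have up: "E (f c) (f (c + int k))" for c k
  proof (induction k)
    case (Suc k)
    have "E (f (c + int k)) (f (c + int (Suc k)))" using step[of "c + int k"] by (simp add: algebra_simps)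
    then show ?case using Suc trans by blast
  qed (simp add: refl)
  show ?thesis
  proof (cases "a \<le> b")
    case True
    then show ?thesis using up[of a "nat (b - a)"] by simp
  next
    case False
    then show ?thesis using up[of b "nat (a - b)"] sym by simp
  qed
qed

context klein_universe
begin

(* Elements of K are handled through the coordinates \<kappa>; membership in a product of carriers would
   break them into pairs. *)
declare K_simps(1) [simp del]

text \<open>The commuting elements \<open>a\<close>, \<open>b\<^sup>2\<close> of both factors generate a subgroup isomorphic to \<open>\<int>\<^sup>4\<close>.\<close>

definition tor :: "nat \<Rightarrow> 'g \<times> 'g" where
  "tor j = \<kappa> (if j = 0 then 1 else 0, if j = 1 then 2 else 0, if j = 2 then 1 else 0, if j = 3 then 2 else 0)"

lemma tor_closed [simp]: "tor j \<in> carrier K"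
  unfolding tor_def by (rule \<kappa>_closed)

lemma tor_mult: "tor j \<otimes>\<^bsub>K\<^esub> \<kappa> (m, n, p, q) =
   \<kappa> (if j = 0 then 1 + m else if j = 2 then 1 + m - sg n else m, if j = 1 then n + 2 else n,
      if j = 2 then p + 1 else p, if j = 3 then q + 2 else q)"
  unfolding tor_def \<kappa>_mult by simp

lemma tor_commute: "tor j \<otimes>\<^bsub>K\<^esub> tor k = tor k \<otimes>\<^bsub>K\<^esub> tor j"
  unfolding tor_def[of j] tor_def[of k] \<kappa>_mult by simp

definition tor_op where
  "tor_op M j m = Map M () () (tor j) m \<otimes>\<^bsub>Val M ()\<^esub> inv\<^bsub>Val M ()\<^esub> m"

lemma tor_op_commuting:
  assumes M: "cat_module C M" shows "commuting_endomorphisms (Val M ()) (tor_op M) n"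
proof (rule commuting_endomorphisms.intro)
  interpret comm_group "Val M ()" using M by (rule cat_module_comm_group) simp
  show "comm_group (Val M ())" by unfold_locales
  have cl: "Map M () () (tor j) m \<in> el M ()" if "m \<in> el M ()" for j m by (rule Map_closed[OF M]) (use that in simp_all)
  have mu: "Map M () () (tor j) (m \<otimes>\<^bsub>Val M ()\<^esub> m') = Map M () () (tor j) m \<otimes>\<^bsub>Val M ()\<^esub> Map M () () (tor j) m'"
    if "m \<in> el M ()" "m' \<in> el M ()" for j m m' by (rule Map_mult[OF M]) (use that in simp_all)
  have iv: "Map M () () (tor j) (inv\<^bsub>Val M ()\<^esub> m) = inv\<^bsub>Val M ()\<^esub> (Map M () () (tor j) m)"
    if "m \<in> el M ()" for j m by (rule Map_inv[OF M]) (use that in simp_all)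
  have co: "Map M () () (tor j) (Map M () () (tor k) m) = Map M () () (tor k) (Map M () () (tor j) m)"
    if m: "m \<in> el M ()" for j k m
  proof -
    have "Map M () () (tor j \<otimes>\<^bsub>K\<^esub> tor k) m = Map M () () (tor j) (Map M () () (tor k) m)" for j k
      using Map_Cmp[OF M, of "()" "()" "()" "tor k" "tor j" m] m by simp
    then show ?thesis using tor_commute[of j k] by metis
  qed
  fix j k show "tor_op M j \<in> hom (Val M ()) (Val M ())"
    by (rule homI) (auto simp: tor_op_def cl mu inv_mult m_ac)
  fix m assume m: "m \<in> el M ()"
  show "tor_op M j (tor_op M k m) = tor_op M k (tor_op M j m)"
    using m cl[OF m] cl[OF cl[OF m]] co[OF m, of j k] by (simp add: tor_op_def mu iv inv_mult m_ac)
qed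

lemma tor_op_nat:
  assumes M: "cat_module C M" and N: "cat_module C N" and h: "module_map C M N \<eta>" and m: "m \<in> el M ()"
  shows "\<eta> () (tor_op M j m) = tor_op N j (\<eta> () m)"
proof -
  interpret group "Val M ()" using M by (rule cat_module_group) simp
  have "Map M () () (tor j) m \<in> el M ()" by (rule Map_closed[OF M]) (use m in simp_all)
  moreover have "\<eta> () (Map M () () (tor j) m) = Map N () () (tor j) (\<eta> () m)"
    by (rule module_map_nat[OF h]) (use m in simp_all)
  ultimately show ?thesis using m by (simp add: tor_op_def module_map_mult[OF h] module_map_inv[OF h M N])
qed

lemma regular_retract:
  assumes mods: "cat_module C P" "cat_module C F" and maps: "module_map C P F i" "module_map C F P r"
    and ri: "\<And>m. m \<in> el P () \<Longrightarrow> r () (i () m) = m"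
    and F: "regular_sequence (tor_op F) (Val F ()) n"
  shows "regular_sequence (tor_op P) (Val P ()) n"
  unfolding regular_sequence_def
proof (intro allI impI ballI)
  interpret P: commuting_endomorphisms "Val P ()" "tor_op P" n by (rule tor_op_commuting[OF mods(1)])
  interpret F: commuting_endomorphisms "Val F ()" "tor_op F" n by (rule tor_op_commuting[OF mods(2)])
  have hi: "i () \<in> hom (Val P ()) (Val F ())" "r () \<in> hom (Val F ()) (Val P ())"
    using maps by (auto simp: module_map_def)
  fix j m assume j: "j < n" and m: "m \<in> el P ()" and xm: "tor_op P j m \<in> P.J j"
  have "i () (tor_op P j m) \<in> F.J j"
    by (rule P.J_map[OF hi(1) _ F.is_group _ xm]) (use tor_op_nat[OF mods maps(1)] j in auto)
  then have "tor_op F j (i () m) \<in> F.J j" using tor_op_nat[OF mods maps(1) m] by simp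
  then have "i () m \<in> F.J j" using F j hom_in_carrier[OF hi(1) m] by (simp add: regular_sequence_def)
  then have "r () (i () m) \<in> P.J j"
    by (rule F.J_map[OF hi(2) _ P.is_group, rotated 2]) (use tor_op_nat[OF mods(2,1) maps(2)] j in auto)
  then show "m \<in> P.J j" using ri[OF m] by simp
qed

lemma tor_op_linearization:
  assumes "Poly_Mapping.keys u \<subseteq> X ()" "\<And>s. s \<in> X () \<Longrightarrow> act () () (tor j) s \<in> X ()"
  shows "tor_op (linearization X act) j u = frag_extend (\<lambda>s. frag_of (act () () (tor j) s)) u - u"
  using assms by (simp add: tor_op_def)

text \<open>The operators are taken in an order in which each of them still acts freely on the set of orbits
  of the preceding ones: \<open>(1, a)\<close> comes after \<open>(a, 1)\<close> because it also moves the coordinate \<open>m\<close>.\<close>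

lemma regular_free:
  fixes ob :: "'t \<Rightarrow> unit"
  shows "regular_sequence (tor_op (free_module C T ob)) (Val (free_module C T ob) ()) 4"
proof -
  let ?X = "generated_elements C T ob" and ?act = "postcompose C ob"
  let ?F = "linearization ?X ?act"
  have F: "free_module C T ob = ?F" by (simp add: free_module_def)
  have cat: "is_category C" by (rule is_category_group_cat[OF group_K])
  have Fm: "cat_module C ?F" unfolding F[symmetric] by (rule cat_module_free[OF cat]) auto
  interpret F: commuting_endomorphisms "free_Abelian_group (?X ())" "tor_op ?F" 4
    using tor_op_commuting[OF Fm] by simp
  define \<tau> where "\<tau> j = ?act () () (tor j)" for j
  have \<tau>: "\<tau> j (\<theta>, \<kappa> (m, n, p, q)) = (\<theta>, \<kappa> (if j = 0 then 1 + m else if j = 2 then 1 + m - sg n else m, if j = 1 then n + 2 else n,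
      if j = 2 then p + 1 else p, if j = 3 then q + 2 else q))" for j \<theta> m n p q
    by (simp add: \<tau>_def postcompose_def tor_mult del: K_simps)
  have X: "s \<in> ?X () \<longleftrightarrow> fst s \<in> T \<and> snd s \<in> carrier K" for s
    by (auto simp: generated_elements_def mem_Times_iff)
  have \<tau>X: "\<tau> j s \<in> ?X ()" if "s \<in> ?X ()" for j s
    using that K.m_closed[OF tor_closed, of "snd s" j] by (cases s) (simp add: X \<tau>_def postcompose_def del: K_simps)
  have Xc: "\<exists>\<theta> m n p q. s = (\<theta>, \<kappa> (m, n, p, q)) \<and> \<theta> \<in> T" if "s \<in> ?X ()" for s
    using that by (cases s) (metis X \<kappa>_cases fst_conv snd_conv)
  have op: "tor_op ?F j u = frag_extend (\<lambda>s. frag_of (\<tau> j s)) u - u" if "Poly_Mapping.keys u \<subseteq> ?X ()" for j u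
    unfolding \<tau>_def by (rule tor_op_linearization[where X = ?X and act = ?act, OF that \<tau>X[unfolded \<tau>_def]])
  \<comment> \<open>the orbits of the first \<open>j\<close> operators: \<open>m\<close> is forgotten, then \<open>n\<close> is reduced to its parity, then
    \<open>p\<close> is forgotten; the next operator shifts the coordinate in position \<open>j\<close>\<close>
  define p where "p j s = (case coords (snd s) of (m, n, p, q) \<Rightarrow>
    (fst s, if j = 0 then m else 0, if j \<le> 1 then n else n mod 2, if j \<le> 2 then p else 0, q))" for j :: nat and s :: "'t \<times> 'g \<times> 'g"
  define \<rho> where "\<rho> j = (\<lambda>(\<theta> :: 't, m :: int, n :: int, p :: int, q :: int).
    (\<theta>, if j = 0 then m + 1 else m, if j = 1 then n + 2 else n, if j = 2 then p + 1 else p, if j = 3 then q + 2 else q))" for j :: nat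
  define ht where "ht j = (\<lambda>(\<theta> :: 't, m :: int, n :: int, p :: int, q :: int). if j = 0 then m else if j = 1 then n else if j = 2 then p else q)" for j :: nat
  have "regular_sequence (tor_op ?F) (free_Abelian_group (?X ())) 4"
  proof (rule regular_sequence_permutation[where \<tau> = \<tau> and p = p and \<rho> = \<rho> and ht = ht, OF F.commuting_endomorphisms_axioms op])
    fix j k :: nat and s assume "k < j" "j < 4" "s \<in> ?X ()"
    then show "p j (\<tau> k s) = p j s" using Xc[of s] by (auto simp: \<tau> p_def)
  next
    fix j :: nat and s assume j: "j < 4" and "s \<in> ?X ()"
    then obtain \<theta> m n pp q where s: "s = (\<theta>, \<kappa> (m, n, pp, q))" using Xc[of s] by blast
    have "j = 0 \<or> j = 1 \<or> j = 2 \<or> j = 3" using j by auto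
    then show "p j (\<tau> j s) = \<rho> j (p j s)" "ht j (p j s) < ht j (\<rho> j (p j s))"
      by (auto simp: s \<tau> p_def \<rho>_def ht_def)
  next
    fix j :: nat show "inj (\<rho> j)" by (auto simp: inj_def \<rho>_def split: if_splits)
  next
    fix j :: nat and s s' assume j: "j < 4" and s: "s \<in> ?X ()" "s' \<in> ?X ()" and eq: "p j s = p j s'"
    define E where "E s s' \<longleftrightarrow> frag_of s - frag_of s' \<in> F.J j" for s s'
    have jn: "j \<le> 4" using j by simp
    have zero: "0 \<in> F.J j" using F.J_one[OF jn] by simp
    have neg: "- u \<in> F.J j" if "u \<in> F.J j" for u
      using F.J_inv[OF jn that] F.J_closed[OF jn that] by simp
    have add: "u + v \<in> F.J j" if "u \<in> F.J j" "v \<in> F.J j" for u v using F.J_mult[OF jn that] by simp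
    have E: "E s s" "E s t \<Longrightarrow> E t s" "E s t \<Longrightarrow> E t u \<Longrightarrow> E s u" for s t u
    proof -
      show "E s s" using zero by (simp add: E_def)
      show "E s t \<Longrightarrow> E t s" using neg[of "frag_of s - frag_of t"] by (simp add: E_def)
      show "E s t \<Longrightarrow> E t u \<Longrightarrow> E s u" using add[of "frag_of s - frag_of t" "frag_of t - frag_of u"] by (simp add: E_def)
    qed
    have step: "E t (\<tau> k t)" if "k < j" "t \<in> ?X ()" for k t
    proof -
      have "tor_op ?F k (frag_of t) \<in> F.J j" by (rule F.x_in_J) (use that j in auto)
      then have "frag_of (\<tau> k t) - frag_of t \<in> F.J j" using op[of "frag_of t" k] that by simp
      then show ?thesis using E(2) by (simp add: E_def)
    qed
    obtain \<theta> m n pp q where s1: "s = (\<theta>, \<kappa> (m, n, pp, q))" and \<theta>: "\<theta> \<in> T" using Xc[OF s(1)] by blast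
    obtain \<theta>' m' n' pp' q' where s2: "s' = (\<theta>', \<kappa> (m', n', pp', q'))" using Xc[OF s(2)] by blast
    have inX: "(\<theta>, \<kappa> v) \<in> ?X ()" for v unfolding X using \<theta> \<kappa>_closed by simp
    have e: "\<theta>' = \<theta>" "q' = q" "j = 0 \<longrightarrow> m' = m" "j \<le> 1 \<longrightarrow> n' = n" "j > 1 \<longrightarrow> n mod 2 = n' mod 2" "j \<le> 2 \<longrightarrow> pp' = pp"
      using eq by (auto simp: s1 s2 p_def)
    have E0: "E (\<theta>, \<kappa> (a, n, pp, q)) (\<theta>, \<kappa> (b, n, pp, q))" if "0 < j" for a b n pp
    proof (rule int_chain[where f = "\<lambda>m. (\<theta>, \<kappa> (m, n, pp, q))", OF E])
      fix k show "E (\<theta>, \<kappa> (k, n, pp, q)) (\<theta>, \<kappa> (k + 1, n, pp, q))"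
        using step[OF that inX[of "(k, n, pp, q)"]] by (simp add: \<tau> add.commute)
    qed
    have E1: "E (\<theta>, \<kappa> (a, n, pp, q)) (\<theta>, \<kappa> (b, n', pp, q))" if "1 < j" "n mod 2 = n' mod 2" for a b pp
    proof -
      have eqn: "n' = n + 2 * ((n' - n) div 2)" using that(2) by presburger
      have "E (\<theta>, \<kappa> (a, n + 2 * 0, pp, q)) (\<theta>, \<kappa> (a, n + 2 * ((n' - n) div 2), pp, q))"
      proof (rule int_chain[where f = "\<lambda>k. (\<theta>, \<kappa> (a, n + 2 * k, pp, q))", OF E])
        fix k show "E (\<theta>, \<kappa> (a, n + 2 * k, pp, q)) (\<theta>, \<kappa> (a, n + 2 * (k + 1), pp, q))"
          using step[OF that(1) inX[of "(a, n + 2 * k, pp, q)"]] by (simp add: \<tau> algebra_simps)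
      qed
      then have "E (\<theta>, \<kappa> (a, n, pp, q)) (\<theta>, \<kappa> (a, n', pp, q))" using eqn by simp
      then show ?thesis using E(3) E0[of a n' pp b] that(1) by simp
    qed
    have E2: "E (\<theta>, \<kappa> (a, n, c, q)) (\<theta>, \<kappa> (a, n, c', q))" if "2 < j" for a c c'
    proof (rule int_chain[where f = "\<lambda>k. (\<theta>, \<kappa> (a, n, k, q))", OF E])
      fix k
      have "E (\<theta>, \<kappa> (a, n, k, q)) (\<theta>, \<kappa> (1 + a - sg n, n, k + 1, q))" using step[OF that inX[of "(a, n, k, q)"]] by (simp add: \<tau>)
      then show "E (\<theta>, \<kappa> (a, n, k, q)) (\<theta>, \<kappa> (a, n, k + 1, q))" using E(3) E0[of "1 + a - sg n" n "k + 1" a] that by simp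
    qed
    have "E s s'"
    proof -
      consider "j = 0" | "j = 1" | "j = 2" | "j = 3" using j by linarith
      then show ?thesis
      proof cases
        case 1 then show ?thesis using e E(1) by (simp add: s1 s2)
      next
        case 2 then show ?thesis using e E0 by (simp add: s1 s2)
      next
        case 3 then show ?thesis using e E1 by (simp add: s1 s2)
      next
        case 4
        then have "E s (\<theta>, \<kappa> (m, n, pp', q))" using E2 by (simp add: s1)
        moreover have "E (\<theta>, \<kappa> (m, n, pp', q)) s'" using 4 e E1 by (simp add: s2)
        ultimately show ?thesis using E(3) by blast
      qed
    qed
    then show "frag_of s - frag_of s' \<in> F.J j" by (simp add: E_def)
  qed (use \<tau>X in auto)
  then show ?thesis by (simp add: F)
qed

lemma regular_projective:
  fixes P :: "(unit, 'g \<times> 'g, 'u) cat_module"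
  assumes P: "projective_module C P"
  shows "regular_sequence (tor_op P) (Val P ()) 4"
proof -
  have cat: "is_category C" by (rule is_category_group_cat[OF group_K])
  have F: "cat_module C (free_cover C P)" unfolding free_cover_def by (rule cat_module_free[OF cat]) auto
  obtain i r where ir: "module_map C P (free_cover C P) i" "module_map C (free_cover C P) P r"
    "\<And>x p. x \<in> Ob C \<Longrightarrow> p \<in> el P x \<Longrightarrow> r x (i x p) = p"
    by (rule projective_retract_of_free[OF C.infinite_universe C.countable P]) (rule that)
  have "regular_sequence (tor_op (free_cover C P)) (Val (free_cover C P) ()) 4"
    unfolding free_cover_def by (rule regular_free)
  then show ?thesis
    by (rule regular_retract[OF projective_cat_module[OF P] F ir(1,2), rotated]) (use ir(3) in simp)
qed

text \<open>Only the first operator is needed on \<open>\<int>(K/L)\<close>. It maps the coset of \<open>a\<^sup>m b\<^sup>n\<close> to that of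
  \<open>a\<^bsup>m+1\<^esup> b\<^sup>n\<close>, so that \<open>m\<close> is a height.\<close>

lemma regular_cosets: "regular_sequence (tor_op coset_module) (Val coset_module ()) 1"
proof -
  have "regular_sequence (tor_op coset_module) (Val coset_module ()) (Suc 0)"
    unfolding regular_sequence_def
  proof (intro allI impI ballI)
    fix j u assume "j < Suc 0" and u: "u \<in> el coset_module ()" and z: "tor_op coset_module j u \<in> partial_sum (tor_op coset_module) (Val coset_module ()) j"
    then have j: "j = 0" by simp
    have uX: "Poly_Mapping.keys u \<subseteq> lcosets\<^bsub>K\<^esub> L" using u by (simp add: permutation_module_def)
    let ?t = "\<lambda>c. tor 0 <#\<^bsub>K\<^esub> c"
    have t: "?t ({\<psi> (m, n)} \<times> carrier G) = {\<psi> (m + 1, n)} \<times> carrier G" for m n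
    proof -
      have "?t ({\<psi> (m, n)} \<times> carrier G) = {\<psi> (1, 0) \<otimes> conj_action G (\<psi> (0, 0)) (\<psi> (m, n))} \<times> carrier G"
        unfolding tor_def \<kappa>_def by (simp add: act_coset_L)
      then show ?thesis by (simp add: conj_\<psi> mult add.commute)
    qed
    have cos: "\<exists>m n. c = {\<psi> (m, n)} \<times> carrier G" if c: "c \<in> lcosets\<^bsub>K\<^esub> L" for c
    proof -
      obtain g where g: "g \<in> carrier G" "c = {g} \<times> carrier G" using c unfolding lcosets_L by auto
      obtain m n where "g = \<psi> (m, n)" using g(1) by (rule \<psi>_cases)
      then show ?thesis using g(2) by blast
    qed
    have tX: "?t c \<in> lcosets\<^bsub>K\<^esub> L" if c: "c \<in> lcosets\<^bsub>K\<^esub> L" for c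
    proof -
      obtain m n where "c = {\<psi> (m, n)} \<times> carrier G" using cos[OF c] by (elim exE)
      then have "?t c = {\<psi> (m + 1, n)} \<times> carrier G" by (simp only: t)
      then show ?thesis unfolding lcosets_L by (rule image_eqI) simp
    qed
    have "tor_op coset_module 0 u = frag_extend (\<lambda>c. frag_of (?t c)) u - u"
      unfolding permutation_module_def by (rule tor_op_linearization[where X = "\<lambda>_. lcosets\<^bsub>K\<^esub> L" and act = "\<lambda>_ _ k c. k <#\<^bsub>K\<^esub> c", OF uX tX])
    then have inv: "frag_extend (\<lambda>c. frag_of (?t c)) u = u" using z j by (simp add: permutation_module_def)
    define ht where "ht c = fst (inv_into UNIV \<psi> (fst (SOME x. x \<in> c)))" for c :: "('g \<times> 'g) set"
    have ht: "ht ({\<psi> (m, n)} \<times> carrier G) = m" for m n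
    proof -
      have "(SOME x. x \<in> {\<psi> (m, n)} \<times> carrier G) \<in> {\<psi> (m, n)} \<times> carrier G"
        by (rule someI[of _ "(\<psi> (m, n), \<one>)"]) simp
      then have "fst (SOME x. x \<in> {\<psi> (m, n)} \<times> carrier G) = \<psi> (m, n)" by (metis mem_Times_iff singletonD)
      moreover have "inv_into UNIV \<psi> (\<psi> (m, n)) = (m, n)" by (rule inv_into_f_f) (auto simp: inj_on_def)
      ultimately show ?thesis by (simp add: ht_def)
    qed
    have "u = 0"
    proof (rule no_invariant_frag[where \<tau> = ?t and X = "lcosets\<^bsub>K\<^esub> L" and ht = ht, OF _ tX _ uX inv])
      show "inj_on ?t (lcosets\<^bsub>K\<^esub> L)"
      proof (rule inj_onI)
        fix c d assume cd: "c \<in> lcosets\<^bsub>K\<^esub> L" "d \<in> lcosets\<^bsub>K\<^esub> L" "?t c = ?t d"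
        obtain m n where e1: "c = {\<psi> (m, n)} \<times> carrier G" using cos[OF cd(1)] by (elim exE)
        obtain m' n' where e2: "d = {\<psi> (m', n')} \<times> carrier G" using cos[OF cd(2)] by (elim exE)
        note e = e1 e2
        have "{\<psi> (m + 1, n)} \<times> carrier G = {\<psi> (m' + 1, n')} \<times> carrier G" using cd(3) by (simp add: e t)
        then have "(\<psi> (m + 1, n), \<one>) \<in> {\<psi> (m' + 1, n')} \<times> carrier G" by (metis SigmaI one_closed singletonI)
        then show "c = d" by (simp add: e)
      qed
      show "ht c < ht (?t c)" if "c \<in> lcosets\<^bsub>K\<^esub> L" for c
        using cos[OF that] by (auto simp: t ht)
    qed
    then show "u \<in> partial_sum (tor_op coset_module) (Val coset_module ()) j" using j by (simp add: permutation_module_def)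
  qed
  then show ?thesis by simp
qed

text \<open>A non-zero element of the socle of \<open>D / J D\<close>, where \<open>J\<close> belongs to the first \<open>i\<close> of the four
  operators. It stands for a non-zero class of degree \<open>4 - i\<close> in Koszul homology.\<close>

definition socle_class :: "(nat \<Rightarrow> 'm \<Rightarrow> 'm) \<Rightarrow> 'm monoid \<Rightarrow> nat \<Rightarrow> bool" where
  "socle_class y D i \<longleftrightarrow> commuting_endomorphisms D y 4 \<and> regular_sequence y D i \<and>
     (\<exists>c\<in>carrier D. c \<notin> partial_sum y D i \<and> (\<forall>j<4. y j c \<in> partial_sum y D i))"

text \<open>One step of the descent along \<open>0 \<rightarrow> A \<rightarrow> P \<rightarrow> D \<rightarrow> 0\<close>. The operators \<open>y\<close> on \<open>D\<close> are given separately
  because \<open>D\<close> will be the syzygy of the step before, with the operators of the module that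
  contains it.\<close>

lemma socle_class_step:
  assumes D: "socle_class y D i" and P: "cat_module C P" "regular_sequence (tor_op P) (Val P ()) (Suc i)" and i: "Suc i \<le> 4"
    and \<pi>: "\<pi> \<in> hom (Val P ()) D" "\<pi> ` el P () = carrier D" "\<And>j m. j < 4 \<Longrightarrow> m \<in> el P () \<Longrightarrow> \<pi> (tor_op P j m) = y j (\<pi> m)"
    and A: "A = kernel (Val P ()) D \<pi>"
  shows "socle_class (tor_op P) ((Val P ())\<lparr>carrier := A\<rparr>) (Suc i)"
    and "\<exists>a\<in>A. a \<in> partial_sum (tor_op P) (Val P ()) (Suc i) \<and> a \<notin> partial_sum (tor_op P) ((Val P ())\<lparr>carrier := A\<rparr>) (Suc i)"
proof -
  have "operator_extension (Val P ()) (tor_op P) D y 4 \<pi> A"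
  proof (rule operator_extension.intro[OF tor_op_commuting[OF P(1)] _ operator_extension_axioms.intro])
    show "commuting_endomorphisms D y 4" using D by (simp add: socle_class_def)
    show "\<exists>p\<in>el P (). \<pi> p = d" if "d \<in> carrier D" for d using that unfolding \<pi>(2)[symmetric] by blast
    show "\<pi> \<in> hom (Val P ()) D" by (rule \<pi>(1))
    show "\<pi> (tor_op P j p) = y j (\<pi> p)" if "j < 4" "p \<in> el P ()" for j p using that by (rule \<pi>(3))
    show "p \<in> A \<longleftrightarrow> p \<in> el P () \<and> \<pi> p = \<one>\<^bsub>D\<^esub>" for p by (simp add: A kernel_def)
  qed
  then interpret operator_extension "Val P ()" "tor_op P" D y 4 \<pi> A .
  obtain c where c: "c \<in> carrier D" "c \<notin> D.J i" "\<And>j. j < 4 \<Longrightarrow> y j c \<in> D.J i" and r: "regular_sequence y D i"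
    using D by (auto simp: socle_class_def)
  obtain a where a: "a \<in> A" "a \<in> P.J (Suc i)" "a \<notin> A.J (Suc i)" "\<And>j. j < 4 \<Longrightarrow> tor_op P j a \<in> A.J (Suc i)"
    using connecting_class[OF i r P(2) c] by blast
  then show "\<exists>a\<in>A. a \<in> P.J (Suc i) \<and> a \<notin> A.J (Suc i)" by blast
  show "socle_class (tor_op P) ((Val P ())\<lparr>carrier := A\<rparr>) (Suc i)"
    unfolding socle_class_def using A.commuting_endomorphisms_axioms regular_A[OF i r P(2)] a by auto
qed

text \<open>Four steps of the descent start from \<open>1 \<in> \<int>\<close> and pass through \<open>I(K/L)\<close> to its third syzygy
  \<open>A \<subseteq> P\<close>, where they produce an element of \<open>A\<close> that lies in \<open>J P\<close> but not in \<open>J A\<close>. If \<open>Ext\<^sup>3\<close> vanished,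
  there would be a retraction \<open>P \<rightarrow> A\<close>; it commutes with the operators and carries \<open>J P\<close> into
  \<open>J A\<close>.\<close>

lemma Ext_augmentation_nontrivial:
  "\<exists>M :: (unit, 'g \<times> 'g, 'u) cat_module. cat_module C M \<and> \<not> trivial_group (Ext C 3 (augmentation_module K L) M)"
proof (rule ccontr)
  assume "\<not> ?thesis"
  then have triv: "\<And>M :: (unit, 'g \<times> 'g, 'u) cat_module. cat_module C M \<Longrightarrow> trivial_group (Ext C (Suc 2) (augmentation_module K L) M)"
    by (simp add: numeral_3_eq_3 numeral_2_eq_2)
  note ex = short_exactD[OF augmentation_exact]
  obtain P :: "nat \<Rightarrow> (unit, 'g \<times> 'g, 'u) cat_module" and d e r where res: "projective_resolution C (augmentation_module K L) P d e"
    and r: "module_map C (P 2) (syzygy P d 2) r" "\<And>x a. x \<in> Ob C \<Longrightarrow> a \<in> el (syzygy P d 2) x \<Longrightarrow> r x a = a"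
    by (rule C.Ext_trivial_imp_syzygy_retract[OF ex(1) embeddable_augmentation triv]) (assumption | rule that)+
  note s0 = syzygy_exact(1)[OF res ex(1)] and sS = syzygy_exact(2)[OF res ex(1)]
  have pr: "projective_module C (P k)" for k using res by (simp add: projective_resolution_def)
  note Pm = projective_cat_module[OF pr]
  have reg: "regular_sequence (tor_op (P k)) (Val (P k) ()) i" if "i \<le> 4" for k i
    using regular_le[OF regular_projective[OF pr] that] .
  have kerP: "el (syzygy P d (Suc k)) () = kernel (Val (P (Suc k)) ()) (Val (syzygy P d k) ()) (d (Suc k - 1) ())" for k
    using sS[of k] by (simp add: short_exact_def)
  have val: "Val (syzygy P d k) () = (Val (P k) ())\<lparr>carrier := el (syzygy P d k) ()\<rparr>" for k
    by (simp add: syzygy_def submodule_def)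
  have zero: "socle_class (\<lambda>_ _. 0) integer_group 0"
    unfolding socle_class_def regular_sequence_def
    by (auto simp: hom_def abelian_integer_group intro!: commuting_endomorphisms.intro exI[of _ "1 :: int"])
  have aug_val: "Val (augmentation_module K L) () = (Val coset_module ())\<lparr>carrier := kernel (Val coset_module ()) integer_group augmentation\<rparr>"
    by (simp add: augmentation_module_def permutation_module_def)
  have aug_map: "module_map C coset_module trivial_module (\<lambda>x. frag_extend (frag_of \<circ> (\<lambda>_. ())))" by (rule ex(6))
  have "socle_class (tor_op coset_module) (Val (augmentation_module K L) ()) (Suc 0)"
    unfolding aug_val
  proof (rule socle_class_step(1)[OF zero ex(2)])
    show "regular_sequence (tor_op coset_module) (Val coset_module ()) (Suc 0)" using regular_cosets by simp
    show "augmentation \<in> hom (Val coset_module ()) integer_group"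
      by (rule homI) (simp_all add: augmentation_eq permutation_module_def frag_extend_add lookup_add)
    have ne: "L \<in> lcosets\<^bsub>K\<^esub> L"
      using K.lcos_mult_one[OF subgroup.subset[OF subgroup_L]] K.one_closed unfolding LCOSETS_def by blast
    have "k \<in> augmentation ` el coset_module ()" for k
      by (rule image_eqI[of _ _ "frag_cmul k (frag_of L)"])
        (use ne in \<open>auto simp: augmentation_eq frag_extend_cmul permutation_module_def\<close>)
    then show "augmentation ` el coset_module () = carrier integer_group" by auto
    fix j m assume m: "m \<in> el coset_module ()"
    have "frag_extend (frag_of \<circ> (\<lambda>_. ())) (tor_op coset_module j m) = tor_op trivial_module j (frag_extend (frag_of \<circ> (\<lambda>_. ())) m)"
      using tor_op_nat[OF ex(2,3) aug_map m] by simp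
    also have "\<dots> = 0"
    proof -
      have "frag_extend (\<lambda>_. frag_of ()) v = v" for v :: "unit \<Rightarrow>\<^sub>0 int"
        using frag_expansion[of v] by (simp add: frag_extend_def)
      moreover have "inv\<^bsub>free_Abelian_group {()}\<^esub> v = - v" for v :: "unit \<Rightarrow>\<^sub>0 int"
        by (rule inv_free_Abelian_group) auto
      ultimately show ?thesis by (simp add: tor_op_def permutation_module_def)
    qed
    finally show "augmentation (tor_op coset_module j m) = 0" by (simp add: augmentation_eq)
  qed simp_all
  then have "socle_class (tor_op (P 0)) ((Val (P 0) ())\<lparr>carrier := el (syzygy P d 0) ()\<rparr>) (Suc (Suc 0))"
  proof (rule socle_class_step(1)[OF _ Pm reg])
    note z = short_exactD[OF s0]
    show "e () \<in> hom (Val (P 0) ()) (Val (augmentation_module K L) ())" using module_map_hom[OF z(6)] by simp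
    show "e () ` el (P 0) () = el (augmentation_module K L) ()" using z(5) by (simp add: module_surj_def)
    show "el (syzygy P d 0) () = kernel (Val (P 0) ()) (Val (augmentation_module K L) ()) (e ())"
      using s0 by (simp add: short_exact_def)
    fix j m assume m: "m \<in> el (P 0) ()"
    have em: "e () m \<in> el (augmentation_module K L) ()" using module_map_closed[OF z(6) _ m] by simp
    have "e () (tor_op (P 0) j m) = tor_op (augmentation_module K L) j (e () m)" using tor_op_nat[OF z(2,3,6) m] .
    also have "\<dots> = tor_op coset_module j (e () m)" using tor_op_nat[OF ex(1,2,4) em] by simp
    finally show "e () (tor_op (P 0) j m) = tor_op coset_module j (e () m)" .
  qed simp_all
  moreover have step: "socle_class (tor_op (P (Suc k))) ((Val (P (Suc k)) ())\<lparr>carrier := el (syzygy P d (Suc k)) ()\<rparr>) (Suc i)"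
     "\<exists>a\<in>el (syzygy P d (Suc k)) (). a \<in> partial_sum (tor_op (P (Suc k))) (Val (P (Suc k)) ()) (Suc i) \<and>
         a \<notin> partial_sum (tor_op (P (Suc k))) ((Val (P (Suc k)) ())\<lparr>carrier := el (syzygy P d (Suc k)) ()\<rparr>) (Suc i)"
    if sc: "socle_class (tor_op (P k)) ((Val (P k) ())\<lparr>carrier := el (syzygy P d k) ()\<rparr>) i" and i: "Suc i \<le> 4" for k i
  proof -
    note z = short_exactD[OF sS[of k]] and inc = short_exactD(4)[OF s0] short_exactD(4)[OF sS]
    have iz: "module_map C (syzygy P d k) (P k) (\<lambda>x m. m)" using inc by (cases k) auto
    have h: "d k () \<in> hom (Val (P (Suc k)) ()) ((Val (P k) ())\<lparr>carrier := el (syzygy P d k) ()\<rparr>)"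
      unfolding val[symmetric] using module_map_hom[OF z(6)] by simp
    have im: "d k () ` el (P (Suc k)) () = carrier ((Val (P k) ())\<lparr>carrier := el (syzygy P d k) ()\<rparr>)"
      by (simp add: syzygy_def)
    have nat: "d k () (tor_op (P (Suc k)) j m) = tor_op (P k) j (d k () m)" if m: "m \<in> el (P (Suc k)) ()" for j m
    proof -
      have dm: "d k () m \<in> el (syzygy P d k) ()" using module_map_closed[OF z(6) _ m] by simp
      show ?thesis using tor_op_nat[OF z(2,3,6) m] tor_op_nat[OF z(3) Pm iz dm] by simp
    qed
    have ker: "el (syzygy P d (Suc k)) () = kernel (Val (P (Suc k)) ()) ((Val (P k) ())\<lparr>carrier := el (syzygy P d k) ()\<rparr>) (d k ())"
      unfolding val[symmetric] using kerP[of k] by simp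
    show "socle_class (tor_op (P (Suc k))) ((Val (P (Suc k)) ())\<lparr>carrier := el (syzygy P d (Suc k)) ()\<rparr>) (Suc i)"
     "\<exists>a\<in>el (syzygy P d (Suc k)) (). a \<in> partial_sum (tor_op (P (Suc k))) (Val (P (Suc k)) ()) (Suc i) \<and>
         a \<notin> partial_sum (tor_op (P (Suc k))) ((Val (P (Suc k)) ())\<lparr>carrier := el (syzygy P d (Suc k)) ()\<rparr>) (Suc i)"
      by (rule socle_class_step[OF sc Pm reg[OF i] i h im nat ker], assumption)+
  qed
  ultimately have "socle_class (tor_op (P 1)) ((Val (P 1) ())\<lparr>carrier := el (syzygy P d 1) ()\<rparr>) 3"
    using step(1)[of 0 2] by (simp add: numeral_2_eq_2 numeral_3_eq_3)
  note sc = this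
  have e: "Suc 1 = (2 :: nat)" "Suc 3 = (4 :: nat)" "Suc 3 \<le> (4 :: nat)" by simp_all
  obtain a where a: "a \<in> el (syzygy P d 2) ()" "a \<in> partial_sum (tor_op (P 2)) (Val (P 2) ()) 4"
      "a \<notin> partial_sum (tor_op (P 2)) ((Val (P 2) ())\<lparr>carrier := el (syzygy P d 2) ()\<rparr>) 4"
    using step(2)[OF sc e(3)] unfolding e(1,2) by (elim bexE conjE) (rule that)
  interpret P2: commuting_endomorphisms "Val (P 2) ()" "tor_op (P 2)" 4 by (rule tor_op_commuting[OF Pm])
  have s2: "cat_module C (syzygy P d 2)" "module_map C (syzygy P d 2) (P 2) (\<lambda>x m. m)"
    using short_exactD(1,4)[OF sS[of 1]] by (simp_all add: numeral_2_eq_2)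
  have "r () a \<in> partial_sum (tor_op (P 2)) (Val (syzygy P d 2) ()) 4"
  proof (rule P2.J_map[OF _ _ _ _ a(2)])
    show "r () \<in> hom (Val (P 2) ()) (Val (syzygy P d 2) ())" using module_map_hom[OF r(1)] by simp
    show "group (Val (syzygy P d 2) ())" by (rule cat_module_group[OF s2(1)]) simp
    fix j m assume m: "m \<in> el (P 2) ()"
    have rm: "r () m \<in> el (syzygy P d 2) ()" using module_map_closed[OF r(1) _ m] by simp
    show "r () (tor_op (P 2) j m) = tor_op (P 2) j (r () m)"
      using tor_op_nat[OF Pm s2(1) r(1) m] tor_op_nat[OF s2(1) Pm s2(2) rm] by simp
  qed simp
  then show False using r(2) a(1,3) val[of 2] by simp
qed

theorem takasu_cd_klein: "takasu_cd TYPE('u) K L = 4"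
proof -
  let ?S = "{enat n | n. \<exists>M :: (unit, 'g \<times> 'g, 'u) cat_module. cat_module C M \<and> \<not> trivial_group (takasu_cohomology K L M n)}"
  have "takasu_cohomology K L M 4 = Ext C 3 (augmentation_module K L) M" for M :: "(unit, 'g \<times> 'g, 'u) cat_module"
    by (simp add: takasu_cohomology_def eval_nat_numeral)
  then have "enat 4 \<in> ?S" using Ext_augmentation_nontrivial by auto
  then have lower: "enat 4 \<le> Sup ?S" by (rule Sup_upper)
  have "x \<le> enat 4" if x: "x \<in> ?S" for x
  proof (rule ccontr)
    assume nle: "\<not> x \<le> enat 4"
    obtain n and M :: "(unit, 'g \<times> 'g, 'u) cat_module" where n: "x = enat n" and M: "cat_module C M" "\<not> trivial_group (takasu_cohomology K L M n)"
      using x by auto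
    have n4: "4 < n" using nle n by simp
    then obtain j where j: "n = Suc j" by (cases n) auto
    have "trivial_group (Ext C j (augmentation_module K L) M)"
      by (rule C.Ext_trivial_above_pd[OF short_exactD(1)[OF augmentation_exact] embeddable_augmentation M(1), of 2])
        (use pd_augmentation n4 j in \<open>simp_all add: numeral_3_eq_3 numeral_2_eq_2 del: pd_le.simps\<close>)
    then show False using M(2) by (simp add: takasu_cohomology_def j)
  qed
  then have "Sup ?S \<le> enat 4" by (rule Sup_least)
  with lower show ?thesis unfolding takasu_cd_def by (simp add: numeral_eq_enat)
qed

end

section \<open>The orbit category\<close>

lemma op_cat_simps [simp]:
  "Ob (op_cat C) = Ob C" "Hom (op_cat C) x y = Hom C y x" "Idt (op_cat C) = Idt C"
  "Cmp (op_cat C) x y z g f = Cmp C z y x f g"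
  by (simp_all add: op_cat_def)

lemma is_category_op:
  assumes "is_category C" shows "is_category (op_cat C)"
  using assms unfolding is_category_def by simp

lemma orbit_cat_simps:
  "Ob (orbit_cat K \<F>) = {lcosets\<^bsub>K\<^esub> H | H. H \<in> \<F>}"
  "Hom (orbit_cat K \<F>) x y = {f \<in> x \<rightarrow>\<^sub>E y. \<forall>k\<in>carrier K. \<forall>c\<in>x. f (k <#\<^bsub>K\<^esub> c) = k <#\<^bsub>K\<^esub> f c}"
  "Idt (orbit_cat K \<F>) x = (\<lambda>c\<in>x. c)"
  "Cmp (orbit_cat K \<F>) x y z g f = compose x g f"
  by (simp_all add: orbit_cat_def)

lemma (in group) lcosets_translate:
  assumes H: "subgroup H G" and k: "k \<in> carrier G" and c: "c \<in> lcosets H"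
  shows "k <# c \<in> lcosets H"
proof -
  obtain x where x: "x \<in> carrier G" "c = x <# H" using c by (auto simp: LCOSETS_def)
  have "k <# c = (k \<otimes> x) <# H" unfolding x(2) by (rule lcos_m_assoc[OF subgroup.subset[OF H] k x(1)])
  then show ?thesis using m_closed[OF k x(1)] unfolding LCOSETS_def by blast
qed

lemma is_category_orbit_cat:
  assumes "group K" and F: "\<And>H. H \<in> \<F> \<Longrightarrow> subgroup H K"
  shows "is_category (orbit_cat K \<F>)"
proof -
  interpret group K by fact
  have tr: "k <#\<^bsub>K\<^esub> c \<in> x" if "x \<in> Ob (orbit_cat K \<F>)" "k \<in> carrier K" "c \<in> x" for x k c
    using that lcosets_translate[OF F] by (auto simp: orbit_cat_simps)
  show ?thesis
    unfolding is_category_def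
  proof (intro conjI ballI)
    fix x assume x: "x \<in> Ob (orbit_cat K \<F>)"
    show "Idt (orbit_cat K \<F>) x \<in> Hom (orbit_cat K \<F>) x x"
      using tr[OF x] by (simp add: orbit_cat_simps)
    fix y assume y: "y \<in> Ob (orbit_cat K \<F>)"
    { fix f assume f: "f \<in> Hom (orbit_cat K \<F>) x y"
      show "Cmp (orbit_cat K \<F>) x x y f (Idt (orbit_cat K \<F>) x) = f" "Cmp (orbit_cat K \<F>) x y y (Idt (orbit_cat K \<F>) y) f = f"
        using f by (auto simp: orbit_cat_simps compose_def fun_eq_iff PiE_iff extensional_def restrict_def) }
    fix z assume z: "z \<in> Ob (orbit_cat K \<F>)"
    { fix f g assume f: "f \<in> Hom (orbit_cat K \<F>) x y" and g: "g \<in> Hom (orbit_cat K \<F>) y z"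
      have "compose x g f \<in> x \<rightarrow>\<^sub>E z" using f g by (auto simp: orbit_cat_simps compose_def)
      moreover have "compose x g f (k <#\<^bsub>K\<^esub> c) = k <#\<^bsub>K\<^esub> compose x g f c" if "k \<in> carrier K" "c \<in> x" for k c
      proof -
        have "f c \<in> y" using f that by (auto simp: orbit_cat_simps)
        then show ?thesis using f g that tr[OF x that] by (simp add: orbit_cat_simps compose_def)
      qed
      ultimately show "Cmp (orbit_cat K \<F>) x y z g f \<in> Hom (orbit_cat K \<F>) x z" by (simp add: orbit_cat_simps) }
    fix v f g h assume "f \<in> Hom (orbit_cat K \<F>) x y" "g \<in> Hom (orbit_cat K \<F>) y z" "h \<in> Hom (orbit_cat K \<F>) z v"
    then show "Cmp (orbit_cat K \<F>) x z v h (Cmp (orbit_cat K \<F>) x y z g f) = Cmp (orbit_cat K \<F>) x y v (Cmp (orbit_cat K \<F>) y z v h g) f"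
      by (auto simp: orbit_cat_simps compose_def fun_eq_iff)
  qed
qed

text \<open>A map out of \<open>K/H\<close> is determined by the image of \<open>H\<close>.\<close>

lemma countable_orbit_cat_Hom:
  assumes "group K" and cnt: "countable (carrier K)" and H: "subgroup H K" and y: "y \<in> Ob (orbit_cat K \<F>)"
  shows "countable (Hom (orbit_cat K \<F>) (lcosets\<^bsub>K\<^esub> H) y)"
proof -
  interpret group K by fact
  have HH: "H \<in> lcosets\<^bsub>K\<^esub> H"
    using lcos_mult_one[OF subgroup.subset[OF H]] one_closed unfolding LCOSETS_def by blast
  have "countable y" using y cnt by (auto simp: orbit_cat_simps LCOSETS_def)
  moreover have "(\<lambda>f. f H) ` Hom (orbit_cat K \<F>) (lcosets\<^bsub>K\<^esub> H) y \<subseteq> y"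
    using HH by (auto simp: orbit_cat_simps)
  moreover have "inj_on (\<lambda>f. f H) (Hom (orbit_cat K \<F>) (lcosets\<^bsub>K\<^esub> H) y)"
  proof (rule inj_onI)
    fix f g assume f: "f \<in> Hom (orbit_cat K \<F>) (lcosets\<^bsub>K\<^esub> H) y" and g: "g \<in> Hom (orbit_cat K \<F>) (lcosets\<^bsub>K\<^esub> H) y"
      and eq: "f H = g H"
    have fe: "f \<in> lcosets\<^bsub>K\<^esub> H \<rightarrow>\<^sub>E y" "g \<in> lcosets\<^bsub>K\<^esub> H \<rightarrow>\<^sub>E y" using f g by (auto simp: orbit_cat_simps)
    show "f = g"
    proof (rule PiE_ext[OF fe])
      fix c assume "c \<in> lcosets\<^bsub>K\<^esub> H"
      then obtain k where "k \<in> carrier K" "c = k <#\<^bsub>K\<^esub> H" by (auto simp: LCOSETS_def)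
      then show "f c = g c" using f g HH eq by (simp add: orbit_cat_simps)
    qed
  qed
  ultimately show ?thesis by (metis countable_image_inj_on countable_subset)
qed

section \<open>The Bredon dimension\<close>

lemma int_subgroup_cyclic:
  fixes A :: "int set"
  assumes z: "0 \<in> A" and d: "\<And>a b. a \<in> A \<Longrightarrow> b \<in> A \<Longrightarrow> a - b \<in> A"
  shows "\<exists>d. A = range (\<lambda>k. d * k)"
proof (cases "A = {0}")
  case True
  then show ?thesis by (intro exI[of _ 0]) auto
next
  case False
  have neg: "- a \<in> A" if "a \<in> A" for a using d[OF z that] by simp
  have add: "a + b \<in> A" if "a \<in> A" "b \<in> A" for a b using d[OF that(1) neg[OF that(2)]] by simp
  obtain a where a: "a \<in> A" "a \<noteq> 0" using False z by blast
  define n where "n = (LEAST n. 0 < n \<and> int n \<in> A)"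
  have "\<exists>n. 0 < n \<and> int n \<in> A"
    using a neg[OF a(1)] by (intro exI[of _ "nat \<bar>a\<bar>"]) (auto simp: abs_if)
  from LeastI_ex[OF this] have n: "0 < n" "int n \<in> A" unfolding n_def by auto
  have mult: "int n * k \<in> A" for k
  proof (induction k rule: int_induct[where k = 0])
    case base then show ?case using z by simp
  next
    case (step1 i) then show ?case using add[OF _ n(2)] by (simp add: distrib_left)
  next
    case (step2 i) then show ?case using d[OF _ n(2)] by (simp add: right_diff_distrib)
  qed
  have "b \<in> range (\<lambda>k. int n * k)" if b: "b \<in> A" for b
  proof -
    have "b mod int n = b - int n * (b div int n)" by (simp add: minus_mult_div_eq_mod)
    then have r: "b mod int n \<in> A" using d[OF b mult] by simp
    have "b mod int n = 0"
    proof (rule ccontr)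
      assume "b mod int n \<noteq> 0"
      then have pos: "0 < b mod int n" using pos_mod_sign[of "int n" b] n(1) by linarith
      then have "0 < nat (b mod int n)" by simp
      moreover have "int (nat (b mod int n)) \<in> A" using pos r by simp
      ultimately have "n \<le> nat (b mod int n)" unfolding n_def by (intro Least_le) auto
      then show False using n(1) pos_mod_bound[of "int n" b] by linarith
    qed
    then have "b = int n * (b div int n)" using mult_div_mod_eq[of "int n" b] by simp
    then show ?thesis by blast
  qed
  then show ?thesis using mult by blast
qed

context klein_group
begin

lemma int_pow_\<psi>: "\<exists>m'. \<psi> (m, n) [^] (k :: int) = \<psi> (m', n * k)"
proof (induction k rule: int_induct[where k = 0])
  case base then show ?case by (simp add: one_\<psi>)
next
  case (step1 i)
  then obtain m' where "\<psi> (m, n) [^] i = \<psi> (m', n * i)" by blast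
  then show ?case by (simp add: int_pow_mult mult distrib_left)
next
  case (step2 i)
  then obtain m' where "\<psi> (m, n) [^] i = \<psi> (m', n * i)" by blast
  then have "\<psi> (m, n) [^] (i - 1) = \<psi> (m', n * i) \<otimes> inv (\<psi> (m, n))"
    by (simp add: int_pow_diff)
  then show ?case by (simp add: inv_\<psi> mult right_diff_distrib)
qed

text \<open>A subgroup is determined by its intersection with \<open>\<langle>a\<rangle>\<close>, its image in \<open>\<langle>b\<rangle>\<close> and one element
  over a generator of this image.\<close>

lemma countable_subgroups: "countable {H. subgroup H G}"
proof -
  define A where "A H = {m. \<psi> (m, 0) \<in> H}" for H
  define B where "B H = {n. \<exists>m. \<psi> (m, n) \<in> H}" for H
  have ex: "\<exists>t. A H = range (\<lambda>k. fst t * k) \<and> B H = range (\<lambda>k. fst (snd t) * k) \<and> \<psi> (snd (snd t), fst (snd t)) \<in> H"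
    if H: "subgroup H G" for H
  proof -
    have one: "\<psi> (0, 0) \<in> H" using subgroup.one_closed[OF H] by (simp add: one_\<psi>)
    have dv: "g \<otimes> inv h \<in> H" if "g \<in> H" "h \<in> H" for g h
      using subgroup.m_closed[OF H that(1) subgroup.m_inv_closed[OF H that(2)]] .
    have "m - m' \<in> A H" if "m \<in> A H" "m' \<in> A H" for m m'
      using dv[of "\<psi> (m, 0)" "\<psi> (m', 0)"] that by (simp add: A_def inv_\<psi> mult)
    then obtain d where d: "A H = range (\<lambda>k. d * k)" using int_subgroup_cyclic[of "A H"] one by (auto simp: A_def)
    have "n - n' \<in> B H" if n: "n \<in> B H" "n' \<in> B H" for n n'
    proof -
      obtain m m' where "\<psi> (m, n) \<in> H" "\<psi> (m', n') \<in> H" using n by (auto simp: B_def)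
      from dv[OF this] show ?thesis by (auto simp: B_def inv_\<psi> mult)
    qed
    then obtain e where e: "B H = range (\<lambda>k. e * k)" using int_subgroup_cyclic[of "B H"] one by (auto simp: B_def)
    have "e \<in> B H" unfolding e by (rule range_eqI[of _ _ 1]) simp
    then obtain m where "\<psi> (m, e) \<in> H" by (auto simp: B_def)
    then show ?thesis using d e by (intro exI[of _ "(d, e, m)"]) simp
  qed
  define t where "t H = (SOME t. A H = range (\<lambda>k. fst t * k) \<and> B H = range (\<lambda>k. fst (snd t) * k) \<and> \<psi> (snd (snd t), fst (snd t)) \<in> H)" for H
  have t: "A H = range (\<lambda>k. fst (t H) * k)" "B H = range (\<lambda>k. fst (snd (t H)) * k)" "\<psi> (snd (snd (t H)), fst (snd (t H))) \<in> H"
    if "subgroup H G" for H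
    using someI_ex[OF ex[OF that]] unfolding t_def by auto
  have le: "H \<subseteq> H'" if H: "subgroup H G" and H': "subgroup H' G" and eq: "t H = t H'" for H H'
  proof
    fix h assume h: "h \<in> H"
    obtain d e m0 where tH: "t H = (d, e, m0)" by (metis surj_pair)
    obtain m n where hmn: "h = \<psi> (m, n)" using subgroup.mem_carrier[OF H h] by (rule \<psi>_cases)
    have "n \<in> B H" using h hmn by (auto simp: B_def)
    then obtain k where k: "n = e * k" using t(2)[OF H] by (auto simp: tH)
    let ?g = "\<psi> (m0, e) [^] k"
    have gH: "?g \<in> H" "?g \<in> H'" using t(3)[OF H] t(3)[OF H'] eq
      by (simp_all add: tH eq[symmetric] subgroup_int_pow_closed H H')
    obtain m' where g: "?g = \<psi> (m', n)" using int_pow_\<psi>[of m0 e k] by (auto simp: k)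
    have a: "h \<otimes> inv ?g = \<psi> (m - m', 0)" unfolding hmn g inv_\<psi> mult by simp
    have "h \<otimes> inv ?g \<in> H" using subgroup.m_closed[OF H h subgroup.m_inv_closed[OF H gH(1)]] .
    then have "m - m' \<in> A H" by (simp add: a A_def)
    then have "m - m' \<in> A H'" using t(1)[OF H] t(1)[OF H'] eq by simp
    then have "h \<otimes> inv ?g \<in> H'" by (simp add: a A_def)
    then have "h \<otimes> inv ?g \<otimes> ?g \<in> H'" using subgroup.m_closed[OF H' _ gH(2)] by blast
    then show "h \<in> H'" using subgroup.mem_carrier[OF H h] by (simp add: m_assoc)
  qed
  have "inj_on t {H. subgroup H G}"
  proof (rule inj_onI)
    fix H H' assume "H \<in> {H. subgroup H G}" "H' \<in> {H. subgroup H G}" and eq: "t H = t H'"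
    then have "subgroup H G" "subgroup H' G" by simp_all
    then show "H = H'" by (intro equalityI le eq eq[symmetric])
  qed
  then show ?thesis by (rule countableI')
qed

end

context klein_universe
begin

abbreviation \<F> where "\<F> \<equiv> subconjugate_family K L"

lemma subgroup_family: "H \<in> \<F> \<Longrightarrow> subgroup H K"
  by (simp add: subconjugate_family_def)

text \<open>A member of the family is the conjugate by some \<open>k\<close> of a subgroup of the acting factor, and there
  are countably many of either.\<close>

lemma countable_family: "countable \<F>"
proof -
  let ?f = "\<lambda>(k, H). (\<lambda>h. k \<otimes>\<^bsub>K\<^esub> (\<one>, h) \<otimes>\<^bsub>K\<^esub> inv\<^bsub>K\<^esub> k) ` H"
  have "\<F> \<subseteq> ?f ` (carrier K \<times> {H. subgroup H G})"
  proof
    fix H assume "H \<in> \<F>"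
    then obtain k where H: "subgroup H K" and k: "k \<in> carrier K" and sub: "H \<subseteq> k <#\<^bsub>K\<^esub> L #>\<^bsub>K\<^esub> inv\<^bsub>K\<^esub> k"
      by (auto simp: subconjugate_family_def)
    let ?i = "\<lambda>h. k \<otimes>\<^bsub>K\<^esub> (\<one>, h) \<otimes>\<^bsub>K\<^esub> inv\<^bsub>K\<^esub> k"
    have hom: "?i h \<otimes>\<^bsub>K\<^esub> ?i h' = ?i (h \<otimes> h')" if hh: "h \<in> carrier G" "h' \<in> carrier G" for h h'
    proof -
      have c: "(\<one>, h) \<in> carrier K" "(\<one>, h') \<in> carrier K" using hh by (simp_all add: K_simps)
      have "?i h \<otimes>\<^bsub>K\<^esub> ?i h' = k \<otimes>\<^bsub>K\<^esub> ((\<one>, h) \<otimes>\<^bsub>K\<^esub> (\<one>, h')) \<otimes>\<^bsub>K\<^esub> inv\<^bsub>K\<^esub> k"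
        using k c by (simp add: K.m_assoc K.inv_solve_left' del: K_simps)
      then show ?thesis using hh by simp
    qed
    have ig: "?i h \<in> carrier K" if "h \<in> carrier G" for h
      using k that by (intro K.m_closed K.inv_closed) (simp_all add: K_simps)
    have i1: "?i \<one> = \<one>\<^bsub>K\<^esub>" using k K.r_inv[OF k] by (simp flip: K_simps(3))
    define H0 where "H0 = {h \<in> carrier G. ?i h \<in> H}"
    have "subgroup H0 G"
    proof (rule subgroupI)
      show "H0 \<subseteq> carrier G" by (auto simp: H0_def)
      show "H0 \<noteq> {}" using subgroup.one_closed[OF H] i1 one_closed by (auto simp: H0_def)
      show "a \<otimes> b \<in> H0" if "a \<in> H0" "b \<in> H0" for a b
        using that subgroup.m_closed[OF H, of "?i a" "?i b"] hom[of a b] by (auto simp: H0_def)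
      show "inv a \<in> H0" if a: "a \<in> H0" for a
      proof -
        have ac: "a \<in> carrier G" "?i a \<in> H" using a by (auto simp: H0_def)
        have "?i (inv a) \<otimes>\<^bsub>K\<^esub> ?i a = \<one>\<^bsub>K\<^esub>" using hom[OF inv_closed[OF ac(1)] ac(1)] i1 ac by simp
        then have "?i (inv a) = inv\<^bsub>K\<^esub> (?i a)" using K.inv_equality ig ac inv_closed by metis
        then show ?thesis using subgroup.m_inv_closed[OF H ac(2)] ac by (simp add: H0_def)
      qed
    qed
    moreover have "H = ?i ` H0"
    proof
      show "?i ` H0 \<subseteq> H" by (auto simp: H0_def)
      show "H \<subseteq> ?i ` H0"
      proof
        fix x assume x: "x \<in> H"
        then have "x \<in> k <#\<^bsub>K\<^esub> L #>\<^bsub>K\<^esub> inv\<^bsub>K\<^esub> k" using sub by blast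
        then obtain l where l: "l \<in> L" "x = k \<otimes>\<^bsub>K\<^esub> l \<otimes>\<^bsub>K\<^esub> inv\<^bsub>K\<^esub> k" by (auto simp: l_coset_def r_coset_def)
        then obtain h where h: "h \<in> carrier G" "l = (\<one>, h)" by (auto simp: L_eq)
        then have "x = ?i h" using l by simp
        then show "x \<in> ?i ` H0" using h x by (auto simp: H0_def)
      qed
    qed
    ultimately show "H \<in> ?f ` (carrier K \<times> {H. subgroup H G})" using k by (intro image_eqI[of _ _ "(k, H0)"]) auto
  qed
  moreover have "countable (carrier K \<times> {H. subgroup H G})" using countable_K countable_subgroups by blast
  ultimately show ?thesis by (rule countable_subset[OF _ countable_image])
qed

abbreviation O_cat where "O_cat \<equiv> op_cat (orbit_cat K \<F>)"

lemma countable_category_orbit: "countable_category O_cat"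
  unfolding countable_category_def
proof (intro conjI ballI)
  show "is_category O_cat" by (rule is_category_op[OF is_category_orbit_cat[OF group_K subgroup_family]])
  have "Ob (orbit_cat K \<F>) = (\<lambda>H. lcosets\<^bsub>K\<^esub> H) ` \<F>" by (auto simp: orbit_cat_simps)
  then show "countable (Ob O_cat)" using countable_family by simp
  fix x y assume "x \<in> Ob O_cat" "y \<in> Ob O_cat"
  then have x: "x \<in> Ob (orbit_cat K \<F>)" and y: "y \<in> Ob (orbit_cat K \<F>)" by simp_all
  obtain H where H: "y = lcosets\<^bsub>K\<^esub> H" "H \<in> \<F>" using y by (auto simp: orbit_cat_simps)
  show "countable (Hom O_cat x y)"
    unfolding op_cat_simps H(1) by (rule countable_orbit_cat_Hom[OF group_K countable_K subgroup_family[OF H(2)] x])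
qed

sublocale O: module_universe O_cat U
  by unfold_locales (use infinite_U countable_category_orbit in auto)

text \<open>The element \<open>(a, b)\<close> lies in no conjugate of the acting factor, but its square \<open>(1, b\<^sup>2)\<close> is
  central and lies in the acting factor. Right multiplication by it is therefore an involution of
  \<open>K/\<langle>(1, b\<^sup>2)\<rangle>\<close>, an object of the orbit category.\<close>

definition Z0 where "Z0 = range (\<lambda>j. \<kappa> (0, 0, 0, 2 * j))"

definition w0 where "w0 = \<kappa> (1, 0, 0, 1)"

lemma w0_closed: "w0 \<in> carrier K" unfolding w0_def by (rule \<kappa>_closed)

lemma subgroup_Z0: "subgroup Z0 K"
proof (rule K.subgroupI)
  show "Z0 \<subseteq> carrier K" using \<kappa>_closed by (auto simp: Z0_def)
  show "Z0 \<noteq> {}" by (simp add: Z0_def)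
  have mu: "\<kappa> (0, 0, 0, 2 * i) \<otimes>\<^bsub>K\<^esub> \<kappa> (0, 0, 0, 2 * j) = \<kappa> (0, 0, 0, 2 * (i + j))" for i j
    unfolding \<kappa>_mult by simp
  show "inv\<^bsub>K\<^esub> z \<in> Z0" if z: "z \<in> Z0" for z
  proof -
    obtain j where j: "z = \<kappa> (0, 0, 0, 2 * j)" using z by (auto simp: Z0_def)
    have "inv\<^bsub>K\<^esub> z = \<kappa> (0, 0, 0, 2 * (- j))"
      by (rule K.inv_equality) (unfold j mu one_\<kappa>, simp_all only: \<kappa>_closed, simp)
    then show ?thesis by (auto simp: Z0_def)
  qed
  show "z \<otimes>\<^bsub>K\<^esub> z' \<in> Z0" if z: "z \<in> Z0" "z' \<in> Z0" for z z'
  proof -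
    obtain i j where ij: "z = \<kappa> (0, 0, 0, 2 * i)" "z' = \<kappa> (0, 0, 0, 2 * j)" using z by (auto simp: Z0_def)
    show ?thesis unfolding ij mu unfolding Z0_def by (rule rangeI)
  qed
qed

lemma Z0_central: "k \<in> carrier K \<Longrightarrow> z \<in> Z0 \<Longrightarrow> k \<otimes>\<^bsub>K\<^esub> z = z \<otimes>\<^bsub>K\<^esub> k"
proof -
  assume k: "k \<in> carrier K" and z: "z \<in> Z0"
  obtain m n p q where "k = \<kappa> (m, n, p, q)" using k by (rule \<kappa>_cases)
  moreover obtain j where "z = \<kappa> (0, 0, 0, 2 * j)" using z unfolding Z0_def by (rule rangeE)
  moreover have "sg (2 * j) = 1" by (simp add: sg_def)
  ultimately show ?thesis by (simp only: \<kappa>_mult) simp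
qed

lemma Z0_family: "Z0 \<in> \<F>"
proof -
  have "Z0 \<subseteq> L" by (auto simp: Z0_def L_eq \<kappa>_def one_\<psi>)
  moreover have "\<one>\<^bsub>K\<^esub> <#\<^bsub>K\<^esub> L #>\<^bsub>K\<^esub> inv\<^bsub>K\<^esub> \<one>\<^bsub>K\<^esub> = L"
    using subgroup.subset[OF subgroup_L] by (simp only: K.lcos_mult_one K.inv_one K.coset_mult_one)
  ultimately show ?thesis using subgroup_Z0 K.one_closed unfolding subconjugate_family_def by auto
qed

lemma w0_square: "w0 \<otimes>\<^bsub>K\<^esub> w0 \<in> Z0"
proof -
  have "w0 \<otimes>\<^bsub>K\<^esub> w0 = \<kappa> (0, 0, 0, 2 * 1)" unfolding w0_def \<kappa>_mult by simp
  then show ?thesis unfolding Z0_def by blast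
qed

lemma w0_not_conjugate:
  assumes u: "u \<in> carrier K" and l: "l \<in> L" shows "w0 \<otimes>\<^bsub>K\<^esub> u \<noteq> u \<otimes>\<^bsub>K\<^esub> l"
proof
  assume eq: "w0 \<otimes>\<^bsub>K\<^esub> u = u \<otimes>\<^bsub>K\<^esub> l"
  obtain m n p q where u': "u = \<kappa> (m, n, p, q)" using u by (rule \<kappa>_cases)
  obtain h where "h \<in> carrier G" "l = (\<one>, h)" using l by (auto simp: L_eq)
  then obtain p' q' where l': "l = \<kappa> (0, 0, p', q')" by (auto simp: \<kappa>_def one_\<psi> elim!: \<psi>_cases)
  have "\<kappa> (1 - m, n, sg 1 * p, 1 + q) = \<kappa> (m, n, p + sg q * p', q + q')"
    using eq unfolding u' l' w0_def \<kappa>_mult by simp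
  then have "1 - m = m" by simp
  then show False by presburger
qed

definition X0 where "X0 = lcosets\<^bsub>K\<^esub> Z0"

definition W where "W = (\<lambda>c\<in>X0. c #>\<^bsub>K\<^esub> w0)"

lemma W_apply: "c \<in> X0 \<Longrightarrow> W c = c #>\<^bsub>K\<^esub> w0"
  by (simp add: W_def)

lemma X0_sub: "c \<in> X0 \<Longrightarrow> c \<subseteq> carrier K"
  unfolding X0_def using subgroup.lcosets_carrier[OF subgroup_Z0 group_K] .

lemma coset_w0: "k \<in> carrier K \<Longrightarrow> (k <#\<^bsub>K\<^esub> Z0) #>\<^bsub>K\<^esub> w0 = (k \<otimes>\<^bsub>K\<^esub> w0) <#\<^bsub>K\<^esub> Z0"
proof -
  assume k: "k \<in> carrier K"
  have "k \<otimes>\<^bsub>K\<^esub> z \<otimes>\<^bsub>K\<^esub> w0 = k \<otimes>\<^bsub>K\<^esub> w0 \<otimes>\<^bsub>K\<^esub> z" if z: "z \<in> Z0" for z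
    using Z0_central[OF w0_closed z] K.m_assoc[OF k subgroup.mem_carrier[OF subgroup_Z0 z] w0_closed]
      K.m_assoc[OF k w0_closed subgroup.mem_carrier[OF subgroup_Z0 z]] by simp
  then show ?thesis unfolding l_coset_def r_coset_def by auto
qed

lemma W_Hom: "W \<in> Hom O_cat X0 X0"
  unfolding op_cat_simps orbit_cat_simps
proof (intro CollectI conjI ballI)
  have cl: "c #>\<^bsub>K\<^esub> w0 \<in> X0" if c: "c \<in> X0" for c
  proof -
    obtain k where k: "k \<in> carrier K" "c = k <#\<^bsub>K\<^esub> Z0" using c by (auto simp: X0_def LCOSETS_def)
    show ?thesis unfolding k(2) coset_w0[OF k(1)] X0_def LCOSETS_def using K.m_closed[OF k(1) w0_closed] by blast
  qed
  then show "W \<in> X0 \<rightarrow>\<^sub>E X0" by (auto simp: W_def)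
  fix k c assume k: "k \<in> carrier K" and c: "c \<in> X0"
  have "k <#\<^bsub>K\<^esub> c \<in> X0" unfolding X0_def by (rule K.lcosets_translate[OF subgroup_Z0 k c[unfolded X0_def]])
  moreover have "(k <#\<^bsub>K\<^esub> c) #>\<^bsub>K\<^esub> w0 = k <#\<^bsub>K\<^esub> (c #>\<^bsub>K\<^esub> w0)"
  proof -
    have "k \<otimes>\<^bsub>K\<^esub> x \<otimes>\<^bsub>K\<^esub> w0 = k \<otimes>\<^bsub>K\<^esub> (x \<otimes>\<^bsub>K\<^esub> w0)" if "x \<in> c" for x
      using K.m_assoc[OF k _ w0_closed, of x] X0_sub[OF c] that by blast
    then show ?thesis unfolding l_coset_def r_coset_def by auto
  qed
  ultimately show "W (k <#\<^bsub>K\<^esub> c) = k <#\<^bsub>K\<^esub> W c" using c by (simp add: W_def)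
qed

lemma W_W: "Cmp O_cat X0 X0 X0 W W = Idt O_cat X0"
proof -
  have "W (W c) = c" if c: "c \<in> X0" for c
  proof -
    obtain k where k: "k \<in> carrier K" "c = k <#\<^bsub>K\<^esub> Z0" using c by (auto simp: X0_def LCOSETS_def)
    have kw: "k \<otimes>\<^bsub>K\<^esub> w0 \<in> carrier K" using K.m_closed[OF k(1) w0_closed] .
    have wc: "W c = (k \<otimes>\<^bsub>K\<^esub> w0) <#\<^bsub>K\<^esub> Z0" using c by (simp add: W_def k(2) coset_w0[OF k(1)])
    have "W c \<in> X0" unfolding wc X0_def LCOSETS_def using kw by blast
    then have "W (W c) = (k \<otimes>\<^bsub>K\<^esub> w0 \<otimes>\<^bsub>K\<^esub> w0) <#\<^bsub>K\<^esub> Z0"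
      using coset_w0[OF kw] by (simp only: W_apply wc)
    also have "\<dots> = k <#\<^bsub>K\<^esub> ((w0 \<otimes>\<^bsub>K\<^esub> w0) <#\<^bsub>K\<^esub> Z0)"
      using K.lcos_m_assoc[OF subgroup.subset[OF subgroup_Z0] k(1) K.m_closed[OF w0_closed w0_closed]]
        K.m_assoc[OF k(1) w0_closed w0_closed] by simp
    also have "(w0 \<otimes>\<^bsub>K\<^esub> w0) <#\<^bsub>K\<^esub> Z0 = Z0"
    proof -
      have "(w0 \<otimes>\<^bsub>K\<^esub> w0) <#\<^bsub>K\<^esub> Z0 = Z0 #>\<^bsub>K\<^esub> (w0 \<otimes>\<^bsub>K\<^esub> w0)"
        unfolding l_coset_def r_coset_def using Z0_central[OF K.m_closed[OF w0_closed w0_closed]] by auto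
      also have "\<dots> = Z0" by (rule K.coset_join2[OF K.m_closed[OF w0_closed w0_closed] subgroup_Z0 w0_square])
      finally show ?thesis .
    qed
    finally show ?thesis using k(2) by simp
  qed
  then show ?thesis unfolding op_cat_simps orbit_cat_simps compose_def by (simp cong: restrict_cong)
qed

text \<open>A \<open>K\<close>-map from \<open>K/\<langle>(1, b\<^sup>2)\<rangle>\<close> to \<open>K/H\<close> that absorbs the involution gives a coset of \<open>H\<close> fixed by
  \<open>(a, b)\<close>, which would put \<open>(a, b)\<close> into a conjugate of \<open>H\<close>.\<close>

lemma W_free:
  assumes z: "z \<in> Ob O_cat" and f: "f \<in> Hom O_cat z X0"
  shows "Cmp O_cat z X0 X0 W f \<noteq> f"
proof
  assume "Cmp O_cat z X0 X0 W f = f"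
  then have fw: "compose X0 f W = f" by (simp add: orbit_cat_simps)
  have f': "f \<in> X0 \<rightarrow>\<^sub>E z" "\<And>k c. k \<in> carrier K \<Longrightarrow> c \<in> X0 \<Longrightarrow> f (k <#\<^bsub>K\<^esub> c) = k <#\<^bsub>K\<^esub> f c"
    using f by (auto simp: orbit_cat_simps)
  obtain H where H: "z = lcosets\<^bsub>K\<^esub> H" "H \<in> \<F>" using z by (auto simp: orbit_cat_simps)
  have Hs: "subgroup H K" by (rule subgroup_family[OF H(2)])
  have Z1: "\<one>\<^bsub>K\<^esub> <#\<^bsub>K\<^esub> Z0 = Z0" by (rule K.lcos_mult_one[OF subgroup.subset[OF subgroup_Z0]])
  have ZX: "Z0 \<in> X0" unfolding X0_def LCOSETS_def using Z1 K.one_closed by blast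
  have "W Z0 = w0 <#\<^bsub>K\<^esub> Z0"
    using coset_w0[OF K.one_closed] ZX by (simp only: W_def restrict_apply' Z1 K.l_one[OF w0_closed])
  then have fixed: "w0 <#\<^bsub>K\<^esub> f Z0 = f Z0"
    using fun_cong[OF fw, of Z0] ZX f'(2)[OF w0_closed ZX] by (simp add: compose_def)
  have "f Z0 \<in> z" using f'(1) ZX by (rule PiE_mem)
  then obtain k where k: "k \<in> carrier K" "f Z0 = k <#\<^bsub>K\<^esub> H" by (auto simp: H(1) LCOSETS_def)
  have "k \<in> k <#\<^bsub>K\<^esub> H" by (rule K.lcos_self[OF k(1) Hs])
  then have "w0 \<otimes>\<^bsub>K\<^esub> k \<in> w0 <#\<^bsub>K\<^esub> (k <#\<^bsub>K\<^esub> H)" unfolding l_coset_def by blast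
  then have "w0 \<otimes>\<^bsub>K\<^esub> k \<in> k <#\<^bsub>K\<^esub> H" using fixed k(2) by simp
  then obtain h where h: "h \<in> H" "w0 \<otimes>\<^bsub>K\<^esub> k = k \<otimes>\<^bsub>K\<^esub> h" by (auto simp: l_coset_def)
  obtain g where g: "g \<in> carrier K" "H \<subseteq> g <#\<^bsub>K\<^esub> L #>\<^bsub>K\<^esub> inv\<^bsub>K\<^esub> g" using H(2) by (auto simp: subconjugate_family_def)
  then obtain l where l: "l \<in> L" "h = g \<otimes>\<^bsub>K\<^esub> l \<otimes>\<^bsub>K\<^esub> inv\<^bsub>K\<^esub> g" using h(1) by (auto simp: l_coset_def r_coset_def)
  have lK: "l \<in> carrier K" by (rule subgroup.mem_carrier[OF subgroup_L l(1)])
  have "w0 \<otimes>\<^bsub>K\<^esub> (k \<otimes>\<^bsub>K\<^esub> g) = k \<otimes>\<^bsub>K\<^esub> h \<otimes>\<^bsub>K\<^esub> g" using K.m_assoc[OF w0_closed k(1) g(1)] h(2) by simp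
  also have "\<dots> = k \<otimes>\<^bsub>K\<^esub> (h \<otimes>\<^bsub>K\<^esub> g)" using K.m_assoc[OF k(1) subgroup.mem_carrier[OF Hs h(1)] g(1)] .
  also have "h \<otimes>\<^bsub>K\<^esub> g = g \<otimes>\<^bsub>K\<^esub> l"
    unfolding l(2) using K.m_assoc[OF K.m_closed[OF g(1) lK] K.inv_closed[OF g(1)] g(1)] K.l_inv[OF g(1)] K.r_one[OF K.m_closed[OF g(1) lK]] by simp
  also have "k \<otimes>\<^bsub>K\<^esub> (g \<otimes>\<^bsub>K\<^esub> l) = k \<otimes>\<^bsub>K\<^esub> g \<otimes>\<^bsub>K\<^esub> l" using K.m_assoc[OF k(1) g(1) lK] by simp
  finally show False using w0_not_conjugate[OF K.m_closed[OF k(1) g(1)] l(1)] by simp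
qed

theorem bredon_cd_klein: "bredon_cd TYPE('u) K \<F> = \<infinity>"
proof (rule ccontr)
  let ?S = "{enat n | n. \<exists>M :: (('g \<times> 'g) set set, ('g \<times> 'g) set \<Rightarrow> ('g \<times> 'g) set, 'u) cat_module.
      cat_module O_cat M \<and> \<not> trivial_group (bredon_cohomology K \<F> M n)}"
  assume "bredon_cd TYPE('u) K \<F> \<noteq> \<infinity>"
  then obtain n where n: "Sup ?S = enat n" by (auto simp: bredon_cd_def)
  have "X0 \<in> Ob O_cat" using Z0_family by (auto simp: X0_def orbit_cat_simps)
  from O.constant_Z_Ext_nontrivial[OF this W_Hom W_W W_free, of n]
  have "enat (Suc n) \<in> ?S" unfolding bredon_cohomology_def by blast
  then have "enat (Suc n) \<le> Sup ?S" by (rule Sup_upper)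
  then show False using n by simp
qed

end

section \<open>A covering of the Klein bottle by the plane\<close>

text \<open>The Klein bottle group acts on the plane by \<open>a (s, t) = (s, t + 1)\<close> and \<open>b (s, t) = (s + 1, - t)\<close>.\<close>

definition deck :: "int \<times> int \<Rightarrow> real \<times> real \<Rightarrow> real \<times> real" where
  "deck = (\<lambda>(m, n) (s, t). (s + of_int n, of_int (sg n) * t + of_int m))"

text \<open>A map whose fibres are the orbits, so that its image is a model of the Klein bottle in a Euclidean
  space. The factor \<open>cis (pi * s)\<close> changes its sign when \<open>s\<close> grows by one, as does \<open>sin (2 * pi * t)\<close>
  when \<open>t\<close> is replaced by \<open>- t\<close>.\<close>

definition wrap :: "real \<times> real \<Rightarrow> complex \<times> real \<times> complex" where
  "wrap = (\<lambda>(s, t). (cis (2 * pi * s), cos (2 * pi * t), cis (pi * s) * of_real (sin (2 * pi * t))))"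

lemma deck_deck: "deck (m, n) (deck (m', n') z) = deck (m + sg n * m', n + n') z"
  by (cases z) (simp add: deck_def sg_add algebra_simps)

lemma deck_zero [simp]: "deck (0, 0) z = z"
  by (cases z) (simp add: deck_def)

lemma deck_inverse: "deck (- (sg n * m), - n) (deck (m, n) z) = z" "deck (m, n) (deck (- (sg n * m), - n) z) = z"
  by (simp_all add: deck_deck)

lemma deck_eq_iff: "deck v z = deck w z \<longleftrightarrow> v = w"
  by (cases v; cases w; cases z) (auto simp: deck_def)

lemma cis_of_int_pi: "cis (pi * of_int n) = of_int (sg n)"
  using cos_int_2pin sin_npi_int by (auto simp: complex_eq_iff sg_def cos_npi_int sin_npi_int mult.commute)

lemma trig_sg: "cos (2 * pi * (of_int (sg n) * t)) = cos (2 * pi * t)" "sin (2 * pi * (of_int (sg n) * t)) = of_int (sg n) * sin (2 * pi * t)"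
  by (auto simp: sg_def)

lemma trig_add_int: "cos (2 * pi * (t + of_int m)) = cos (2 * pi * t)" "sin (2 * pi * (t + of_int m)) = sin (2 * pi * t)"
  using sin_cos_eq_iff[of "2 * pi * (t + of_int m)" "2 * pi * t"] by (auto simp: distrib_left)

lemma cis_eq_iff: "cis x = cis y \<longleftrightarrow> (\<exists>n::int. x = y + 2 * pi * n)"
  using sin_cos_eq_iff[of x y] by (auto simp: complex_eq_iff)

lemma wrap_deck [simp]: "wrap (deck v z) = wrap z"
proof -
  obtain m n s t where vz: "v = (m, n)" "z = (s, t)" by (metis surj_pair)
  have "cis (2 * pi * (s + of_int n)) = cis (2 * pi * s)" by (auto simp: cis_eq_iff distrib_left)
  moreover have "cis (pi * (s + of_int n)) = cis (pi * s) * of_int (sg n)"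
    by (simp add: distrib_left cis_of_int_pi flip: cis_mult)
  ultimately show ?thesis
    by (simp add: vz deck_def wrap_def trig_add_int trig_sg) (auto simp: sg_def)
qed

lemma wrap_eq_iff: "wrap z = wrap z' \<longleftrightarrow> (\<exists>v. z' = deck v z)"
proof
  assume eq: "wrap z = wrap z'"
  obtain s t s' t' where z: "z = (s, t)" "z' = (s', t')" by (metis surj_pair)
  have 1: "cis (2 * pi * s') = cis (2 * pi * s)" "cos (2 * pi * t') = cos (2 * pi * t)"
    "cis (pi * s') * of_real (sin (2 * pi * t')) = cis (pi * s) * of_real (sin (2 * pi * t))"
    using eq by (simp_all add: z wrap_def)
  obtain n :: int where "2 * pi * s' = 2 * pi * s + 2 * pi * n" using 1(1) by (auto simp: cis_eq_iff)
  then have n: "s' = s + of_int n" by (simp flip: distrib_left)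
  have "cis (pi * s') = cis (pi * s) * of_int (sg n)"
    by (simp add: n distrib_left cis_of_int_pi flip: cis_mult)
  then have "cis (pi * s) * (of_int (sg n) * of_real (sin (2 * pi * t'))) = cis (pi * s) * of_real (sin (2 * pi * t))"
    using 1(3) by simp
  then have "of_int (sg n) * of_real (sin (2 * pi * t')) = (of_real (sin (2 * pi * t)) :: complex)" by simp
  then have "of_real (of_int (sg n) * sin (2 * pi * t')) = (of_real (sin (2 * pi * t)) :: complex)" by simp
  then have "of_int (sg n) * sin (2 * pi * t') = sin (2 * pi * t)" by (simp only: of_real_eq_iff)
  then have "sin (2 * pi * (of_int (sg n) * t')) = sin (2 * pi * t) \<and> cos (2 * pi * (of_int (sg n) * t')) = cos (2 * pi * t)"
    using 1(2) by (simp add: trig_sg)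
  then obtain k :: int where "2 * pi * (of_int (sg n) * t') = 2 * pi * t + 2 * pi * k" by (auto simp: sin_cos_eq_iff)
  then have "of_int (sg n) * t' = t + of_int k" by (simp flip: distrib_left)
  then have "t' = of_int (sg n) * t + of_int (sg n * k)" by (auto simp: sg_def split: if_splits)
  then have "z' = deck (sg n * k, n) z" by (simp add: z n deck_def)
  then show "\<exists>v. z' = deck v z" by blast
qed auto

lemma continuous_wrap: "continuous_on X wrap"
  unfolding wrap_def case_prod_unfold by (intro continuous_intros)

lemma continuous_deck: "continuous_on X (deck v)"
  unfolding deck_def case_prod_unfold by (intro continuous_intros)

lemma open_deck_image:
  assumes "open U" shows "open (deck v ` U)"
proof -
  obtain m n where v: "v = (m, n)" by (metis surj_pair)
  have "deck v ` U = deck (- (sg n * m), - n) -` U"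
  proof (rule Set.set_eqI)
    fix x
    have "x = deck v y \<longleftrightarrow> y = deck (- (sg n * m), - n) x" for y
      unfolding v using deck_inverse[of n m y] deck_inverse[where m = m and n = n and z = x] by metis
    then show "x \<in> deck v ` U \<longleftrightarrow> x \<in> deck (- (sg n * m), - n) -` U" by (simp add: image_iff)
  qed
  then show ?thesis using open_vimage[OF assms continuous_deck] by simp
qed

lemma wrap_vimage_image: "wrap -` (wrap ` U) = (\<Union>v. deck v ` U)"
proof (rule Set.set_eqI)
  fix z
  have "z \<in> wrap -` (wrap ` U) \<longleftrightarrow> (\<exists>u\<in>U. wrap u = wrap z)" unfolding vimage_eq image_iff by metis
  also have "\<dots> \<longleftrightarrow> z \<in> (\<Union>v. deck v ` U)" unfolding wrap_eq_iff by blast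
  finally show "z \<in> wrap -` (wrap ` U) \<longleftrightarrow> z \<in> (\<Union>v. deck v ` U)" .
qed

lemma deck_into_square: "\<exists>v. deck v z \<in> unit_square"
proof -
  obtain s t where z: "z = (s, t)" by (metis surj_pair)
  define n where "n = - \<lfloor>s\<rfloor>"
  define m where "m = - \<lfloor>of_int (sg n) * t\<rfloor>"
  have "s + of_int n \<in> {0..1}" "of_int (sg n) * t + of_int m \<in> {0..1}"
    unfolding n_def m_def by (simp_all, linarith+)
  then show ?thesis by (intro exI[of _ "(m, n)"]) (simp add: z deck_def unit_square_def)
qed

lemma wrap_image_square: "wrap ` (unit_square - wrap -` T) = range wrap - T"
proof
  show "range wrap - T \<subseteq> wrap ` (unit_square - wrap -` T)"
  proof
    fix y assume "y \<in> range wrap - T"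
    then obtain z where z: "y = wrap z" "y \<notin> T" by blast
    obtain v where "deck v z \<in> unit_square" using deck_into_square by blast
    then show "y \<in> wrap ` (unit_square - wrap -` T)" using z by (intro image_eqI[of _ _ "deck v z"]) auto
  qed
qed auto

lemma compact_unit_square: "compact unit_square"
  unfolding unit_square_def by (intro compact_Times compact_Icc)

text \<open>The unit square meets all orbits, hence the complement of the image of an open set is the image
  of the compact set of points of the square outside all translates.\<close>

lemma wrap_open:
  assumes "open U" shows "openin (top_of_set (range wrap)) (wrap ` U)"
proof -
  have "open (wrap -` (wrap ` U))" unfolding wrap_vimage_image using open_deck_image[OF assms] by blast
  then have "compact (unit_square - wrap -` (wrap ` U))" using compact_unit_square by (rule compact_diff[rotated])
  then have "compact (range wrap - wrap ` U)"
    using compact_continuous_image[OF continuous_wrap] wrap_image_square by metis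
  then have "closedin (top_of_set (range wrap)) (range wrap - wrap ` U)"
    by (intro closed_subset compact_imp_closed) auto
  then show ?thesis by (simp add: openin_closedin_eq image_mono)
qed

text \<open>The coordinates of two points of the ball differ by less than \<open>1 / 2\<close>, too little for a non-zero
  integer.\<close>

lemma deck_ball_disjoint:
  assumes "deck v a = deck w b" "a \<in> ball z (1/4)" "b \<in> ball z (1/4)"
  shows "v = w"
proof -
  have "dist a b < 1/2"
    using assms(2,3) dist_triangle3[of a b z] by simp
  then have d: "\<bar>fst a - fst b\<bar> < 1/2" "\<bar>snd a - snd b\<bar> < 1/2"
    using dist_fst_le[of a b] dist_snd_le[of a b] by (simp_all add: dist_real_def)
  obtain m n m' n' where v: "v = (m, n)" "w = (m', n')" by (metis surj_pair)
  have e: "fst a + of_int n = fst b + of_int n'" "of_int (sg n) * snd a + of_int m = of_int (sg n') * snd b + of_int m'"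
    using assms(1) by (auto simp: v deck_def case_prod_unfold)
  have "of_int (n' - n) = fst a - fst b" using e(1) by simp
  then have "\<bar>of_int (n' - n) :: real\<bar> < 1/2" using d(1) by simp
  then have n: "n = n'" by linarith
  have "of_int (m' - m) = of_int (sg n) * (snd a - snd b)" using e(2) by (simp add: n algebra_simps)
  then have "\<bar>of_int (m' - m) :: real\<bar> < 1/2" using d(2) by (auto simp: sg_def abs_minus_commute split: if_splits)
  then have "m = m'" by linarith
  then show ?thesis using n by (simp add: v)
qed

lemma covering_wrap: "covering_space UNIV wrap (range wrap)"
proof (rule covering_spaceI)
  fix y assume "y \<in> range wrap"
  then obtain z where z: "y = wrap z" by blast
  let ?B = "ball z (1/4)"
  let ?T = "wrap ` ?B"
  have "\<exists>q. homeomorphism u ?T wrap q" if u: "u \<in> (\<lambda>v. deck v ` ?B) ` UNIV" for u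
  proof -
    obtain v where v: "u = deck v ` ?B" using u by blast
    have im: "wrap ` u = ?T" by (auto simp: v image_image)
    have "inj_on wrap u"
    proof (rule inj_onI)
      fix a b assume ab: "a \<in> u" "b \<in> u" "wrap a = wrap b"
      obtain a' b' where a': "a = deck v a'" "a' \<in> ?B" "b = deck v b'" "b' \<in> ?B" using ab by (auto simp: v)
      then have "wrap a' = wrap b'" using ab(3) by simp
      then obtain w where w: "b' = deck w a'" by (auto simp: wrap_eq_iff)
      have "deck (0, 0) b' = deck w a'" using w by simp
      from deck_ball_disjoint[OF this a'(4,2)] have "w = (0, 0)" by simp
      then show "a = b" using w a' by simp
    qed
    moreover have "openin (top_of_set ?T) (wrap ` V)" if V: "openin (top_of_set u) V" for V
    proof -
      have "open u" unfolding v by (rule open_deck_image) simp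
      then have oV: "open V" and Vu: "V \<subseteq> u" using V by (auto simp: openin_open_eq)
      have "wrap ` V \<subseteq> ?T" unfolding im[symmetric] using Vu by (rule image_mono)
      then show ?thesis by (rule openin_subset_trans[OF wrap_open[OF oV]]) (rule image_mono[OF subset_UNIV])
    qed
    ultimately show ?thesis using homeomorphism_injective_open_map[OF continuous_wrap im] by metis
  qed
  moreover have "pairwise disjnt ((\<lambda>v. deck v ` ?B) ` UNIV)"
  proof (rule pairwiseI)
    fix X Y assume "X \<in> (\<lambda>v. deck v ` ?B) ` UNIV" "Y \<in> (\<lambda>v. deck v ` ?B) ` UNIV" and ne: "X \<noteq> Y"
    then obtain v w where vw: "X = deck v ` ?B" "Y = deck w ` ?B" by blast
    have "v \<noteq> w" using ne vw by blast
    then show "disjnt X Y" unfolding vw disjnt_def using deck_ball_disjoint[of v _ w _ z] by blast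
  qed
  ultimately show "\<exists>T. y \<in> T \<and> openin (top_of_set (range wrap)) T \<and>
     (\<exists>V. \<Union>V = UNIV \<inter> wrap -` T \<and> (\<forall>u\<in>V. openin (top_of_set UNIV) u) \<and> pairwise disjnt V \<and> (\<forall>u\<in>V. \<exists>q. homeomorphism u T wrap q))"
    using z wrap_open[of ?B] open_deck_image[of ?B]
    by (intro exI[of _ ?T] exI[of _ "(\<lambda>v. deck v ` ?B) ` UNIV"] conjI) (auto simp: wrap_vimage_image)
qed (auto intro: continuous_wrap)

text \<open>Two points of the square in the same orbit differ by at most one step in each direction, so that
  one identification of vertical edges and one of horizontal edges connect them.\<close>

lemma klein_glue_wrap:
  assumes a: "a \<in> unit_square" and b: "b \<in> unit_square"
  shows "(a, b) \<in> (klein_glue \<union> klein_glue\<inverse>)\<^sup>* \<longleftrightarrow> wrap a = wrap b"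
proof
  have step: "wrap x = wrap y" if xy: "(x, y) \<in> klein_glue" for x y
  proof -
    consider s where "x = (s, 0)" "y = (s, 1)" | t where "x = (0, t)" "y = (1, 1 - t)"
      using xy by (auto simp: klein_glue_def)
    then show ?thesis
    proof cases
      case 1
      then have "y = deck (1, 0) x" by (simp add: deck_def)
      then show ?thesis by simp
    next
      case 2
      then have "y = deck (1, 1) x" by (simp add: deck_def)
      then show ?thesis by simp
    qed
  qed
  show "wrap a = wrap b" if "(a, b) \<in> (klein_glue \<union> klein_glue\<inverse>)\<^sup>*"
    using that by (induction rule: rtrancl_induct) (auto dest: step)
next
  let ?R = "klein_glue \<union> klein_glue\<inverse>"
  have v: "((s, 0), (s, 1)) \<in> ?R" "((s, 1), (s, 0)) \<in> ?R" if "0 \<le> s" "s \<le> 1" for s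
    using that by (auto simp: klein_glue_def)
  have h: "((0, t), (1, 1 - t)) \<in> ?R" "((1, 1 - t), (0, t)) \<in> ?R" if "0 \<le> t" "t \<le> 1" for t
    using that by (auto simp: klein_glue_def)
  have sym: "(y, x) \<in> ?R\<^sup>*" if "(x, y) \<in> ?R\<^sup>*" for x y
  proof -
    have "sym ?R" by (auto simp: sym_def)
    then show ?thesis using that by (metis symD sym_rtrancl)
  qed
  \<comment> \<open>vertical translation inside the square\<close>
  have V: "((s, t), (s, t + of_int m)) \<in> ?R\<^sup>*" if "0 \<le> s" "s \<le> 1" "0 \<le> t" "t \<le> 1" "0 \<le> t + of_int m" "t + of_int m \<le> 1" for s t and m :: int
  proof -
    have "\<bar>m\<bar> \<le> 1" using that by linarith
    then consider "m = 0" | "m = 1" | "m = - 1" by linarith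
    then show ?thesis
    proof cases
      case 2
      then have "t = 0" using that by simp
      then show ?thesis using v(1)[OF that(1,2)] 2 by auto
    next
      case 3
      then have "t = 1" using that by simp
      then show ?thesis using v(2)[OF that(1,2)] 3 by auto
    qed simp
  qed
  \<comment> \<open>a pair of points related by a translation to the right\<close>
  have H: "(x, y) \<in> ?R\<^sup>*" if xy: "x \<in> unit_square" "y \<in> unit_square" "y = deck (m, n) x" "0 \<le> n" for x y m n
  proof -
    obtain s t where x: "x = (s, t)" by (metis surj_pair)
    have y: "y = (s + of_int n, of_int (sg n) * t + of_int m)" using xy(3) by (simp add: x deck_def)
    have st: "0 \<le> s" "s \<le> 1" "0 \<le> t" "t \<le> 1" using xy(1) by (auto simp: x unit_square_def)
    have y01: "s + of_int n \<le> 1" "0 \<le> of_int (sg n) * t + of_int m" "of_int (sg n) * t + of_int m \<le> 1"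
      using xy(2) by (auto simp: y unit_square_def)
    have "n \<le> 1" using st y01(1) by linarith
    then consider "n = 0" | "n = 1" using xy(4) by linarith
    then show ?thesis
    proof cases
      case 1
      then show ?thesis using V[OF st, of m] y01 by (simp add: x y)
    next
      case 2
      then have s0: "s = 0" using st y01 by simp
      have "((0, t), (1, 1 - t)) \<in> ?R\<^sup>*" using h(1)[OF st(3,4)] by blast
      moreover have "((1, 1 - t), (1, (1 - t) + of_int (m - 1))) \<in> ?R\<^sup>*"
        by (rule V) (use st y01 2 in auto)
      ultimately have "((0, t), (1, (1 - t) + of_int (m - 1))) \<in> ?R\<^sup>*" by (rule rtrancl_trans)
      then show ?thesis using 2 by (simp add: x y s0)
    qed
  qed
  assume "wrap a = wrap b"
  then obtain m n where e: "b = deck (m, n) a" by (auto simp: wrap_eq_iff)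
  show "(a, b) \<in> ?R\<^sup>*"
  proof (cases "0 \<le> n")
    case True
    then show ?thesis using H[OF a b e] by simp
  next
    case False
    have "a = deck (- (sg n * m), - n) b" unfolding e by (simp only: deck_inverse)
    from H[OF b a this] show ?thesis using False sym by simp
  qed
qed

text \<open>Both spaces are quotients of the square by the same relation; for \<open>wrap\<close> this holds because the
  square is compact and the image is a Hausdorff space.\<close>

lemma klein_bottle_homeomorphism:
  assumes "klein_bottle S"
  obtains h k where "homeomorphism S (range wrap) h k"
proof -
  obtain q where q: "quotient_map (top_of_set unit_square) (top_of_set S) q"
    and glue: "\<And>a b. a \<in> unit_square \<Longrightarrow> b \<in> unit_square \<Longrightarrow> q a = q b \<longleftrightarrow> (a, b) \<in> (klein_glue \<union> klein_glue\<inverse>)\<^sup>*"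
    using assms unfolding klein_bottle_def by blast
  have qS: "q ` unit_square = S" using quotient_imp_surjective_map[OF q] by simp
  have eq: "q a = q b \<longleftrightarrow> wrap a = wrap b" if "a \<in> unit_square" "b \<in> unit_square" for a b
    using glue[OF that] klein_glue_wrap[OF that] by simp
  have wsq: "wrap ` unit_square = range wrap" using wrap_image_square[of "{}"] by simp
  define h where "h = (\<lambda>x. wrap (inv_into unit_square q x))"
  define k where "k = (\<lambda>y. q (inv_into unit_square wrap y))"
  have hq: "h (q a) = wrap a" if a: "a \<in> unit_square" for a
  proof -
    have qa: "q a \<in> q ` unit_square" using a by (rule imageI)
    have "q (inv_into unit_square q (q a)) = q a" using qa by (rule f_inv_into_f)
    then show ?thesis unfolding h_def eq[OF inv_into_into[OF qa] a] .
  qed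
  have kw: "k (wrap a) = q a" if a: "a \<in> unit_square" for a
  proof -
    have wa: "wrap a \<in> wrap ` unit_square" using a by (rule imageI)
    have "wrap (inv_into unit_square wrap (wrap a)) = wrap a" using wa by (rule f_inv_into_f)
    then show ?thesis unfolding k_def eq[OF inv_into_into[OF wa] a] .
  qed
  have w: "continuous_map (top_of_set unit_square) (top_of_set (range wrap)) wrap"
    using continuous_wrap by (auto simp: continuous_map_subtopology_eu)
  have wq: "quotient_map (top_of_set unit_square) (top_of_set (range wrap)) wrap"
  proof (rule T1_Spaces.continuous_imp_quotient_map[OF w])
    show "compact_space (top_of_set unit_square)" using compact_unit_square by (simp add: compact_space_subtopology)
    show "Hausdorff_space (top_of_set (range wrap))" by (simp add: Hausdorff_space_subtopology)
  qed (simp add: wsq)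
  have "continuous_map (top_of_set S) (top_of_set (range wrap)) h"
    by (rule continuous_compose_quotient_map[OF q], rule continuous_map_eq[OF w]) (simp add: hq)
  then have ch: "continuous_on S h" "h ` S \<subseteq> range wrap" by (simp_all add: continuous_map_subtopology_eu image_subset_iff_funcset)
  have "continuous_map (top_of_set (range wrap)) (top_of_set S) k"
    by (rule continuous_compose_quotient_map[OF wq], rule continuous_map_eq[OF quotient_imp_continuous_map[OF q]]) (simp add: kw)
  then have ck: "continuous_on (range wrap) k" "k ` range wrap \<subseteq> S" by (simp_all add: continuous_map_subtopology_eu image_subset_iff_funcset)
  have "homeomorphism S (range wrap) h k"
  proof (rule homeomorphismI[OF ch(1) ck(1)])
    show "h ` S \<subseteq> range wrap" "k ` range wrap \<subseteq> S" using ch(2) ck(2) by auto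
    show "k (h x) = x" if "x \<in> S" for x using that unfolding qS[symmetric] by (auto simp: hq kw)
    show "h (k y) = y" if "y \<in> range wrap" for y using that unfolding wsq[symmetric] by (auto simp: hq kw)
  qed
  then show thesis by (rule that)
qed

section \<open>The fundamental group of the Klein bottle\<close>

text \<open>The base point is \<open>k (wrap z0)\<close>, and \<open>z0\<close> is the point of the plane at which lifted loops
  start.\<close>

locale pointed_klein_bottle =
  fixes S :: "'a::topological_space set" and x0 :: 'a and h k and z0
  assumes hk: "homeomorphism S (range wrap) h k" and z0: "k (wrap z0) = x0"
begin

definition proj :: "real \<times> real \<Rightarrow> 'a" where "proj z = k (wrap z)"

lemma proj_deck [simp]: "proj (deck v z) = proj z"
  by (simp add: proj_def)

lemma h_proj: "h (proj z) = wrap z"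
  unfolding proj_def by (rule homeomorphism_apply2[OF hk rangeI])

lemma proj_S: "proj z \<in> S"
  unfolding proj_def using homeomorphism_image2[OF hk] by blast

lemma proj_eq: "proj z = proj z' \<Longrightarrow> \<exists>v. z' = deck v z"
  using h_proj wrap_eq_iff by metis

lemma continuous_proj: "continuous_on UNIV proj"
proof -
  have "continuous_on UNIV (k \<circ> wrap)"
    by (rule continuous_on_compose[OF continuous_wrap]) (use hk in \<open>simp add: homeomorphism_def\<close>)
  then show ?thesis by (simp add: proj_def[abs_def] comp_def)
qed

lemma path_lift:
  assumes g: "g \<in> loops S x0"
  obtains p where "path p" "pathstart p = z0" "\<And>t. t \<in> {0..1} \<Longrightarrow> proj (p t) = g t"
proof -
  have gp: "path g" "path_image g \<subseteq> S" "pathstart g = x0" using g by (auto simp: loops_def)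
  have ch: "continuous_on S h" "h ` S = range wrap" using hk by (auto simp: homeomorphism_def)
  have "path (h \<circ> g)" using gp ch by (intro path_continuous_image) (auto intro: continuous_on_subset)
  moreover have "path_image (h \<circ> g) \<subseteq> range wrap" using gp ch by (auto simp: path_image_compose)
  moreover have "pathstart (h \<circ> g) = wrap z0" using gp h_proj[of z0] z0 by (simp add: pathstart_compose proj_def)
  ultimately obtain p where p: "path p" "pathstart p = z0" "\<And>t. t \<in> {0..1} \<Longrightarrow> wrap (p t) = (h \<circ> g) t"
    using covering_space_lift_path_strong[OF covering_wrap UNIV_I] by metis
  have "proj (p t) = g t" if t: "t \<in> {0..1}" for t
  proof -
    have "g t \<in> S" using gp(2) t by (auto simp: path_image_def)
    then show ?thesis using p(3)[OF t] hk by (simp add: proj_def homeomorphism_def)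
  qed
  then show thesis using that p by blast
qed

lemma lift_end_unique:
  assumes hom: "homotopic_paths S (proj \<circ> p) (proj \<circ> p')" and p: "path p" "path p'" "pathstart p = pathstart p'"
  shows "pathfinish p = pathfinish p'"
proof -
  have ch: "continuous_on S h" "h \<in> S \<rightarrow> range wrap" using hk by (auto simp: homeomorphism_def)
  have "homotopic_paths (range wrap) (h \<circ> (proj \<circ> p)) (h \<circ> (proj \<circ> p'))"
    by (rule homotopic_paths_continuous_image[OF hom ch])
  moreover have "h \<circ> (proj \<circ> r) = wrap \<circ> r" for r :: "real \<Rightarrow> real \<times> real" by (simp add: comp_def h_proj)
  ultimately have hw: "homotopic_paths (range wrap) (wrap \<circ> p) (wrap \<circ> p')" by simp
  have pw: "path (wrap \<circ> r)" if "path r" for r by (rule path_continuous_image[OF that continuous_wrap])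
  have iw: "path_image (wrap \<circ> r) \<subseteq> range wrap" for r :: "real \<Rightarrow> real \<times> real" by (auto simp: path_image_def)
  show ?thesis
    by (rule covering_space_monodromy[OF covering_wrap pw[OF p(1)] iw pw[OF p(2)] iw hw p(1) _ _ p(2) _ _ p(3)]) auto
qed

lemma proj_path: "path p \<Longrightarrow> path (proj \<circ> p)" "path_image (proj \<circ> p) \<subseteq> S"
proof -
  show "path p \<Longrightarrow> path (proj \<circ> p)"
    by (rule path_continuous_image) (auto intro: continuous_on_subset[OF continuous_proj])
  show "path_image (proj \<circ> p) \<subseteq> S" by (auto simp: path_image_def proj_S)
qed

lemma proj_loop: "path p \<Longrightarrow> pathstart p = z0 \<Longrightarrow> pathfinish p = deck v z0 \<Longrightarrow> proj \<circ> p \<in> loops S x0"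
  using z0 proj_path[of p] by (simp add: loops_def pathstart_compose pathfinish_compose) (simp add: proj_def)

lemma proj_homotopic:
  assumes "path p" "path p'" "pathstart p' = pathstart p" "pathfinish p' = pathfinish p"
  shows "homotopic_paths S (proj \<circ> p) (proj \<circ> p')"
proof (rule homotopic_paths_continuous_image)
  show "homotopic_paths UNIV p p'" by (rule homotopic_paths_linear) (use assms in auto)
  show "proj \<in> UNIV \<rightarrow> S" using proj_S by blast
qed (rule continuous_proj)

definition cls where "cls g = loop_homotopy S x0 `` {g}"

lemma cls_mem: "g' \<in> cls g \<longleftrightarrow> g \<in> loops S x0 \<and> g' \<in> loops S x0 \<and> homotopic_paths S g g'"
  by (auto simp: cls_def loop_homotopy_def)

lemma cls_eq: "g \<in> loops S x0 \<Longrightarrow> g' \<in> loops S x0 \<Longrightarrow> homotopic_paths S g g' \<Longrightarrow> cls g = cls g'"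
  by (auto simp: set_eq_iff cls_mem intro: homotopic_paths_trans homotopic_paths_sym)

definition line where "line v = proj \<circ> linepath z0 (deck v z0)"

text \<open>Every loop lifts to a path from \<open>z0\<close> to a translate \<open>deck v z0\<close>. The translate depends only on the
  homotopy class, by monodromy, and determines it, because the plane is simply connected. Thus \<open>\<Psi>\<close>
  is a bijection from the deck transformations to the classes.\<close>

definition \<Psi> where "\<Psi> v = cls (line v)"

lemma line_loop: "line v \<in> loops S x0"
  unfolding line_def by (rule proj_loop[of _ v]) auto

lemma cls_proj: "path p \<Longrightarrow> pathstart p = z0 \<Longrightarrow> pathfinish p = deck v z0 \<Longrightarrow> cls (proj \<circ> p) = \<Psi> v"
  unfolding \<Psi>_def line_def
  by (intro cls_eq proj_loop[of _ v] proj_homotopic) auto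

lemma range_\<Psi>: "range \<Psi> = carrier (fundamental_group S x0)"
proof -
  have car: "carrier (fundamental_group S x0) = cls ` loops S x0"
    by (auto simp: fundamental_group_def quotient_def cls_def)
  show ?thesis
    unfolding car
  proof
    show "range \<Psi> \<subseteq> cls ` loops S x0" using line_loop by (auto simp: \<Psi>_def)
    show "cls ` loops S x0 \<subseteq> range \<Psi>"
    proof
      fix X assume "X \<in> cls ` loops S x0"
      then obtain g where g: "g \<in> loops S x0" "X = cls g" by blast
      obtain p where p: "path p" "pathstart p = z0" "\<And>t. t \<in> {0..1} \<Longrightarrow> proj (p t) = g t" by (rule path_lift[OF g(1)]) (rule that)
      have "proj (pathfinish p) = x0" using p(3)[of 1] g(1) by (simp add: pathfinish_def loops_def)
      then obtain v where v: "pathfinish p = deck v z0" using proj_eq[of z0 "pathfinish p"] z0 by (auto simp: proj_def)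
      have pl: "proj \<circ> p \<in> loops S x0" by (rule proj_loop[OF p(1,2) v])
      have "homotopic_paths S g (proj \<circ> p)"
        by (rule homotopic_paths_eq) (use g(1) p(3) in \<open>auto simp: loops_def\<close>)
      then have "X = cls (proj \<circ> p)" using g pl cls_eq by simp
      then show "X \<in> range \<Psi>" using cls_proj[OF p(1,2) v] by blast
    qed
  qed
qed

lemma inj_\<Psi>: "inj \<Psi>"
proof (rule injI)
  fix v w assume "\<Psi> v = \<Psi> w"
  moreover have "line w \<in> \<Psi> w" using line_loop by (auto simp: \<Psi>_def cls_mem loops_def)
  ultimately have "homotopic_paths S (line v) (line w)" by (metis \<Psi>_def cls_mem)
  then have "deck v z0 = deck w z0"
    unfolding line_def using lift_end_unique[of "linepath z0 (deck v z0)" "linepath z0 (deck w z0)"] by simp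
  then show "v = w" by (simp add: deck_eq_iff)
qed

text \<open>The product of two loops lifts to a segment from \<open>z0\<close> followed by the translate, under the first
  deck transformation, of the second segment.\<close>

lemma \<Psi>_mult: "\<Psi> (m, n) \<otimes>\<^bsub>fundamental_group S x0\<^esub> \<Psi> (m', n') = \<Psi> (m + sg n * m', n + n')"
proof -
  let ?v = "(m, n)" and ?w = "(m', n')" and ?u = "(m + sg n * m', n + n')"
  let ?A = "linepath z0 (deck ?v z0)" and ?B = "deck ?v \<circ> linepath z0 (deck ?w z0)"
  have B: "path ?B" by (rule path_continuous_image[OF path_linepath continuous_deck])
  have AB: "path (?A +++ ?B)" "pathstart (?A +++ ?B) = z0" "pathfinish (?A +++ ?B) = deck ?u z0"
    using B by (simp_all add: pathstart_compose pathfinish_compose deck_deck)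
  have pB: "proj \<circ> ?B = line ?w" by (simp add: line_def comp_def)
  have join: "line ?v +++ line ?w = proj \<circ> (?A +++ ?B)" unfolding path_compose_join pB by (simp add: line_def)
  have cu: "cls (line ?v +++ line ?w) = \<Psi> ?u" unfolding join by (rule cls_proj[OF AB])
  have lj: "line ?v +++ line ?w \<in> loops S x0" unfolding join by (rule proj_loop[OF AB])
  have "cls (g +++ g') = \<Psi> ?u" if g: "g \<in> \<Psi> ?v" "g' \<in> \<Psi> ?w" for g g'
  proof -
    have hg: "homotopic_paths S (line ?v) g" "homotopic_paths S (line ?w) g'" and gl: "g \<in> loops S x0" "g' \<in> loops S x0"
      using g by (auto simp: \<Psi>_def cls_mem)
    have "homotopic_paths S (line ?v +++ line ?w) (g +++ g')"
      using homotopic_paths_join[OF hg] line_loop[of ?v] line_loop[of ?w] by (simp add: loops_def)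
    moreover have "g +++ g' \<in> loops S x0" using gl by (auto simp: loops_def path_image_join)
    ultimately show ?thesis using cls_eq[OF lj] cu by simp
  qed
  moreover have "line ?v \<in> \<Psi> ?v" "line ?w \<in> \<Psi> ?w" using line_loop by (auto simp: \<Psi>_def cls_mem loops_def)
  moreover have "\<Psi> ?v \<otimes>\<^bsub>fundamental_group S x0\<^esub> \<Psi> ?w = (\<Union>g\<in>\<Psi> ?v. \<Union>g'\<in>\<Psi> ?w. cls (g +++ g'))"
    by (simp add: fundamental_group_def cls_def)
  ultimately show ?thesis by auto
qed

lemma \<Psi>_one: "\<one>\<^bsub>fundamental_group S x0\<^esub> = \<Psi> (0, 0)"
proof -
  have "line (0, 0) = (\<lambda>_. x0)" using z0 by (simp add: line_def comp_def linepath_refl proj_def fun_eq_iff)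
  then show ?thesis by (simp add: fundamental_group_def \<Psi>_def cls_def)
qed

lemma klein_group_fundamental_group: "klein_group (fundamental_group S x0) \<Psi>"
proof -
  have \<Psi>c: "\<Psi> v \<in> carrier (fundamental_group S x0)" for v using range_\<Psi> by blast
  have ex: "\<exists>m n. g = \<Psi> (m, n)" if "g \<in> carrier (fundamental_group S x0)" for g
    using that unfolding range_\<Psi>[symmetric] by auto
  have grp: "group (fundamental_group S x0)"
  proof (rule groupI)
    show "\<one>\<^bsub>fundamental_group S x0\<^esub> \<in> carrier (fundamental_group S x0)" unfolding \<Psi>_one by (rule \<Psi>c)
    fix g assume "g \<in> carrier (fundamental_group S x0)"
    then obtain m n where g: "g = \<Psi> (m, n)" using ex by blast
    show "\<one>\<^bsub>fundamental_group S x0\<^esub> \<otimes>\<^bsub>fundamental_group S x0\<^esub> g = g" unfolding g \<Psi>_one \<Psi>_mult by simp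
    have "\<Psi> (- (sg n * m), - n) \<otimes>\<^bsub>fundamental_group S x0\<^esub> g = \<one>\<^bsub>fundamental_group S x0\<^esub>"
      unfolding g \<Psi>_one \<Psi>_mult by simp
    then show "\<exists>g'\<in>carrier (fundamental_group S x0). g' \<otimes>\<^bsub>fundamental_group S x0\<^esub> g = \<one>\<^bsub>fundamental_group S x0\<^esub>"
      using \<Psi>c by blast
    fix g' assume "g' \<in> carrier (fundamental_group S x0)"
    then obtain m' n' where g': "g' = \<Psi> (m', n')" using ex by blast
    show "g \<otimes>\<^bsub>fundamental_group S x0\<^esub> g' \<in> carrier (fundamental_group S x0)" unfolding g g' \<Psi>_mult by (rule \<Psi>c)
    fix g'' assume "g'' \<in> carrier (fundamental_group S x0)"
    then obtain m'' n'' where g'': "g'' = \<Psi> (m'', n'')" using ex by blast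
    show "g \<otimes>\<^bsub>fundamental_group S x0\<^esub> g' \<otimes>\<^bsub>fundamental_group S x0\<^esub> g'' = g \<otimes>\<^bsub>fundamental_group S x0\<^esub> (g' \<otimes>\<^bsub>fundamental_group S x0\<^esub> g'')"
      unfolding g g' g'' \<Psi>_mult by (simp add: sg_add algebra_simps)
  qed
  show ?thesis
    by (rule klein_group.intro[OF grp klein_group_axioms.intro])
      (use inj_\<Psi> range_\<Psi> \<Psi>_mult in \<open>simp_all add: bij_betw_def\<close>)
qed

end

theorem proposition1p4:
  fixes S :: "'a::topological_space set" and x0 :: 'a
  assumes "klein_bottle S" and "x0 \<in> S"
    and "infinite (UNIV :: 'u set)"
  shows "let G = fundamental_group S x0;
             K = semidirect G G (conj_action G);
             L = acting_factor G G
         in takasu_cd TYPE('u) K L = 4 \<and>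
            bredon_cd TYPE('u) K (subconjugate_family K L) = \<infinity>"
proof -
  obtain h k where hk: "homeomorphism S (range wrap) h k" by (rule klein_bottle_homeomorphism[OF assms(1)])
  have "x0 \<in> k ` range wrap" using hk assms(2) by (simp add: homeomorphism_def)
  then obtain z0 where z0: "k (wrap z0) = x0" by blast
  interpret pointed_klein_bottle S x0 h k z0 using hk z0 by unfold_locales
  interpret klein_universe "fundamental_group S x0" \<Psi> "TYPE('u)"
    by (rule klein_universe.intro[OF klein_group_fundamental_group klein_universe_axioms.intro[OF assms(3)]])
  show ?thesis using takasu_cd_klein bredon_cd_klein by (simp add: Let_def)
qed

end
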